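(* For every fixed integer $\ell\ge 2$ there is a constant $C_\ell>0$ such that for every integer $g\ge 0$, every $n$-vertex graph $G$ of Euler genus at most $g$ (with $n$ sufficiently large) satisfies $\chi_\ell(G)\le C_\ell\cdot (g+1)\cdot\log n/\log^{(3)} n$.
   Context: A colouring $\varphi:V(G)\to\mathbb{N}$ of a graph $G$ is an $\ell$-ranking if for every non-trivial path $u_0,\ldots,u_p$ in $G$ of length $p\le \ell$, either $\varphi(u_0)\neq\varphi(u_p)$ or $\varphi(u_0)<\max\{\varphi(u_0),\ldots,\varphi(u_p)\}$; $\chi_\ell(G)$ is the minimum $k$ such that $G$ has an $\ell$-ranking with colours in $\{1,\ldots,k\}$. $\log$ is the natural logarithm, $\log^{(0)}x=x$, $\log^{(i)}x=\log(\log^{(i-1)}x)$. *)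

theory Defs
  imports Complex_Main "Graph_Theory.Graph_Theory"
    "HOL-Combinatorics.Permutations" "HOL-Combinatorics.Orbits"
begin

text \<open>
  Finite simple undirected graphs are the symmetric loop-free pair digraphs
  (locale \<^locale>\<open>pair_graph\<close>); an edge \<open>uv\<close> is the pair of arcs \<open>(u, v)\<close> and \<open>(v, u)\<close>.
\<close>

definition is_ranking :: "nat \<Rightarrow> 'a pair_pre_digraph \<Rightarrow> ('a \<Rightarrow> nat) \<Rightarrow> bool" where
  "is_ranking l G \<phi> \<longleftrightarrow>
     (\<forall>p. vpath p (with_proj G) \<and> 1 \<le> vwalk_length p \<and> vwalk_length p \<le> l \<longrightarrow>
        \<phi> (hd p) \<noteq> \<phi> (last p) \<or> \<phi> (hd p) < Max (\<phi> ` set p))"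

definition ranking_number :: "nat \<Rightarrow> 'a pair_pre_digraph \<Rightarrow> nat" where
  "ranking_number l G = (LEAST k. \<exists>\<phi>. is_ranking l G \<phi> \<and> \<phi> ` pverts G \<subseteq> {1..k})"

text \<open>
  Euler genus, through the combinatorial description of cellular embeddings of graphs in closed
  surfaces, orientable or not (embedding schemes, also called generalised rotation systems; see
  Mohar and Thomassen, Graphs on Surfaces). The permutation \<open>\<pi>\<close> of the arcs gives the cyclic
  order of the edges around each vertex, and \<open>\<sigma>\<close> is the signature: \<open>\<sigma> (u, v)\<close> is true
  iff the edge \<open>uv\<close> is untwisted, i.e. the local orientations chosen at \<open>u\<close> and \<open>v\<close>
  agree along it.
\<close>

definition embedding_scheme ::
  "'a pair_pre_digraph \<Rightarrow> ('a \<times> 'a \<Rightarrow> 'a \<times> 'a) \<Rightarrow> ('a \<times> 'a \<Rightarrow> bool) \<Rightarrow> bool" where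
  "embedding_scheme G \<pi> \<sigma> \<longleftrightarrow>
     \<pi> permutes parcs G \<and>
     (\<forall>v \<in> pverts G. out_arcs (with_proj G) v \<noteq> {} \<longrightarrow> cyclic_on \<pi> (out_arcs (with_proj G) v)) \<and>
     (\<forall>(u, v) \<in> parcs G. \<sigma> (v, u) = \<sigma> (u, v))"

text \<open>
  One step of face tracing. In the state \<open>((u, v), s)\<close> we are about to traverse the edge \<open>uv\<close>
  from \<open>u\<close> to \<open>v\<close>, reading rotations clockwise if \<open>s\<close> holds and anticlockwise otherwise;
  a twisted edge switches the sense.
\<close>

fun face_step ::
  "('a \<times> 'a \<Rightarrow> 'a \<times> 'a) \<Rightarrow> ('a \<times> 'a \<Rightarrow> bool) \<Rightarrow> ('a \<times> 'a) \<times> bool \<Rightarrow> ('a \<times> 'a) \<times> bool" where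
  "face_step \<pi> \<sigma> ((u, v), s) =
     (let s' = (s = \<sigma> (u, v)) in (if s' then \<pi> (v, u) else inv \<pi> (v, u), s'))"

text \<open>
  Every face bounded by at least one edge is traced by exactly two orbits, one for each direction of
  its boundary walk. An isolated vertex is drawn on a sphere of its own, with one face, which has no
  orbit and is added separately.
\<close>

definition num_faces ::
  "'a pair_pre_digraph \<Rightarrow> ('a \<times> 'a \<Rightarrow> 'a \<times> 'a) \<Rightarrow> ('a \<times> 'a \<Rightarrow> bool) \<Rightarrow> nat" where
  "num_faces G \<pi> \<sigma> =
     card (orbit (face_step \<pi> \<sigma>) ` (parcs G \<times> UNIV)) div 2
     + card {v \<in> pverts G. out_arcs (with_proj G) v = {}}"

text \<open>
  The sum over the components of \<open>G\<close> of the Euler genus \<open>2 - (V - E + F)\<close> of the surface that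
  carries the component. Strongly connected components of a symmetric digraph are the components
  of the graph.
\<close>

definition scheme_euler_genus ::
  "'a pair_pre_digraph \<Rightarrow> ('a \<times> 'a \<Rightarrow> 'a \<times> 'a) \<Rightarrow> ('a \<times> 'a \<Rightarrow> bool) \<Rightarrow> int" where
  "scheme_euler_genus G \<pi> \<sigma> =
     2 * int (card (pre_digraph.sccs_verts (with_proj G)))
     - (int (card (pverts G)) - int (card (parcs G) div 2) + int (num_faces G \<pi> \<sigma>))"

text \<open>
  The least Euler genus of a surface in which \<open>G\<close> embeds. For disconnected \<open>G\<close> this uses that
  the connected sum of surfaces adds Euler genera, so that the Euler genus of a graph is the sum of
  those of its components.
\<close>

definition euler_genus :: "'a pair_pre_digraph \<Rightarrow> nat" where
  "euler_genus G =
     (LEAST g. \<exists>\<pi> \<sigma>. embedding_scheme G \<pi> \<sigma> \<and> scheme_euler_genus G \<pi> \<sigma> \<le> int g)"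

definition iter_log :: "nat \<Rightarrow> real \<Rightarrow> real" where
  "iter_log i x = (ln ^^ i) x"

end

theory Submission
  imports Defs "HOL-Library.Sublist" "HOL-Real_Asymp.Real_Asymp"
begin

text \<open>
  Take a breadth-first spanning forest. Delete non-tree edges of an embedding as long as they separate
  two faces; by Euler's formula only \<open>O(g)\<close> other non-tree edges remain at the end, and every component
  has a single face. Let \<open>Z\<close> consist of the tree paths from the ends of these remaining edges to the roots;
  it is ranked with \<open>O(l (g + 1))\<close> colours of its own, because the vertices of one such path are told
  apart by their depth modulo \<open>l + 1\<close>.

  Outside \<open>Z\<close>, the boundary of the single face lists the corners of the tree so that the descendants of a
  vertex form an interval and the deleted edges are non-crossing chords. Repeated trisection of this
  polygon by three vertical tree paths, maps the vertices to words over
  three letters, such that edges go to equal words or to words adjacent in the sense of \<open>wadj\<close>, and each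
  fibre is covered by three vertical paths. Pulling back a ranking of the word graph and adding the depth
  modulo \<open>l + 1\<close> and the number of the vertical path yields a ranking.

  Finally, \<open>n\<close> words over three letters have an \<open>l\<close>-ranking with \<open>O(log n / log log log n)\<close> colours. The words
  over \<open>t\<close> letters are layered by the number of blocks, a block being a shortest stretch that uses all
  \<open>t\<close> letters; within a layer one letter less is in play. The weight beyond a region of a layer,
  on a logarithmic scale with base \<open>d\<close>, is its level. Along stretches of constant level, every
  \<open>l + 1\<close>-st attaching clique goes to a greedily coloured top palette of size \<open>O(d)\<close>, and all
  other vertices combine their level with a recursive ranking of their layer; choosing \<open>d\<close> at both
  steps of the recursion balances the two costs.
\<close>

text \<open>The third logarithm comes from the recursion over letters. If gaining a factor d costs
  f(d) colours with t letters, then gaining d^q costs O(q f(d) + d) with one letter more. One letter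
  costs O(1), so two letters cost O(log d / log log d). For three letters the log d in q = log n /
  log d cancels and log n / log log d + d remains; with d near sqrt(log n) this is the bound.

  Two obstacles shape the definitions. A set inside a layer must be judged by all that hangs beyond
  it, so the recursion runs over arbitrary superadditive weights instead of cardinalities. And a
  short walk between two vertices of a layer may leave it. Detours away from the root are cut short
  through the attaching clique. Towards the root a larger colour must be met, which follows at once
  where the level drops; where the level stays, a position modulo \<open>l + 1\<close> takes over,
  and it fails only where it wraps.

  Since the surface may be non-orientable, faces are orbits of flags that come in mirrored pairs,
  and two faces count as different only if they are not mirror images.\<close>

lemma choice2: "\<forall>x. \<exists>a b. P x a b \<Longrightarrow> \<exists>f g. \<forall>x. P x (f x) (g x)"
  by metis

section \<open>Rankings through separators\<close>

text \<open>Reflexivity of the adjacency makes a walk stay a walk under projections that may identify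
  neighbours.\<close>

locale lazy_graph =
  fixes E :: "'a \<Rightarrow> 'a \<Rightarrow> bool"
  assumes E_refl [simp]: "E x x"
    and E_sym: "E x y \<Longrightarrow> E y x"
begin

definition walk :: "'a set \<Rightarrow> 'a list \<Rightarrow> bool" where
  "walk S p \<longleftrightarrow> p \<noteq> [] \<and> set p \<subseteq> S \<and> successively E p"

definition reach :: "'a set \<Rightarrow> 'a \<Rightarrow> 'a \<Rightarrow> bool" where
  "reach S x y \<longleftrightarrow> (\<exists>p. walk S p \<and> hd p = x \<and> last p = y)"

definition conn :: "'a set \<Rightarrow> bool" where
  "conn T \<longleftrightarrow> (\<forall>x\<in>T. \<forall>y\<in>T. reach T x y)"

text \<open>Superadditivity is asked only for sets without edges between them, because adjacent
  vertices of a layer may carry the same things beyond them; see \<open>hang\<close>.\<close>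

definition weight :: "'a set \<Rightarrow> ('a set \<Rightarrow> nat) \<Rightarrow> bool" where
  "weight V w \<longleftrightarrow> (\<forall>A B. A \<subseteq> B \<and> B \<subseteq> V \<longrightarrow> w A \<le> w B) \<and>
     (\<forall>A B. A \<subseteq> V \<and> B \<subseteq> V \<and> (\<forall>a\<in>A. \<forall>b\<in>B. \<not> E a b) \<longrightarrow> w A + w B \<le> w (A \<union> B))"

text \<open>The walks use all of \<open>V\<close>, but their ends and the witness lie in
  \<open>X\<close>, so that the colourings of successive separators can be stacked.\<close>

definition ranks :: "nat \<Rightarrow> 'a set \<Rightarrow> 'a set \<Rightarrow> ('a \<Rightarrow> nat) \<Rightarrow> bool" where
  "ranks l V X \<phi> \<longleftrightarrow> (\<forall>p. walk V p \<and> length p \<le> Suc l \<and> hd p \<in> X \<and> last p \<in> X \<and> hd p \<noteq> last p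
      \<and> \<phi> (hd p) = \<phi> (last p) \<longrightarrow> (\<exists>z\<in>set p. z \<in> X \<and> \<phi> (hd p) < \<phi> z))"

text \<open>\<open>k\<close> colours rank a set \<open>X\<close> whose removal divides the weight of the components by \<open>D\<close>; iterating this
  \<open>q\<close> times ranks every set of weight less than \<open>D ^ q\<close>.\<close>

definition splits :: "nat \<Rightarrow> nat \<Rightarrow> nat \<Rightarrow> 'a set \<Rightarrow> ('a set \<Rightarrow> nat) \<Rightarrow> nat \<Rightarrow> bool" where
  "splits l D k S w b \<longleftrightarrow> (\<exists>X \<phi>. X \<subseteq> S \<and> (\<forall>x. \<phi> x < k) \<and> ranks l S X \<phi> \<and>
      (\<forall>T. T \<subseteq> S - X \<and> conn T \<longrightarrow> w T * D \<le> b))"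

text \<open>Quantifying over all subsets and all weights makes the property hereditary, so it can be
  applied again to what a separator leaves over.\<close>

definition good :: "nat \<Rightarrow> nat \<Rightarrow> nat \<Rightarrow> 'a set \<Rightarrow> bool" where
  "good l D k V \<longleftrightarrow> (\<forall>S w b. S \<subseteq> V \<and> weight S w \<and> w S \<le> b \<longrightarrow> splits l D k S w b)"

lemma good_subset: "good l D k V \<Longrightarrow> S \<subseteq> V \<Longrightarrow> good l D k S"
  unfolding good_def by blast

lemma weight_subset: "weight V w \<Longrightarrow> S \<subseteq> V \<Longrightarrow> weight S w"
  unfolding weight_def by (meson order_trans)

lemma weight_mono: "weight V w \<Longrightarrow> A \<subseteq> B \<Longrightarrow> B \<subseteq> V \<Longrightarrow> w A \<le> w B"
  unfolding weight_def by blast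

lemma weight_empty: "weight V w \<Longrightarrow> w {} = 0"
proof -
  assume "weight V w"
  then have "w {} + w {} \<le> w ({} \<union> {})"
    unfolding weight_def by blast
  then show ?thesis by simp
qed

lemma weight_super:
  "weight V w \<Longrightarrow> A \<subseteq> V \<Longrightarrow> B \<subseteq> V \<Longrightarrow> (\<And>a b. a \<in> A \<Longrightarrow> b \<in> B \<Longrightarrow> \<not> E a b) \<Longrightarrow> w A + w B \<le> w (A \<union> B)"
  unfolding weight_def by (elim conjE allE[of _ A] allE[of _ B]) simp

lemma weight_sum:
  assumes "weight V w" "finite I" "\<And>i. i \<in> I \<Longrightarrow> F i \<subseteq> V"
    "\<And>i j a b. i \<in> I \<Longrightarrow> j \<in> I \<Longrightarrow> i \<noteq> j \<Longrightarrow> a \<in> F i \<Longrightarrow> b \<in> F j \<Longrightarrow> \<not> E a b"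
  shows "(\<Sum>i\<in>I. w (F i)) \<le> w (\<Union>i\<in>I. F i)"
  using assms(2-)
proof (induction I rule: finite_induct)
  case empty
  then show ?case by simp
next
  case (insert x I)
  have "w (F x) + w (\<Union>i\<in>I. F i) \<le> w (F x \<union> (\<Union>i\<in>I. F i))"
  proof (rule weight_super[OF assms(1)])
    show "F x \<subseteq> V" using insert.prems by blast
    show "(\<Union>i\<in>I. F i) \<subseteq> V" using insert.prems by blast
    fix a b assume "a \<in> F x" "b \<in> (\<Union>i\<in>I. F i)"
    then obtain i where "i \<in> I" "b \<in> F i" by blast
    then show "\<not> E a b" using insert.prems(2)[of x i a b] insert.hyps \<open>a \<in> F x\<close> by auto
  qed
  moreover have "(\<Sum>i\<in>I. w (F i)) \<le> w (\<Union>i\<in>I. F i)"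
  proof (rule insert.IH)
    show "F i \<subseteq> V" if "i \<in> I" for i using that insert.prems(1) by simp
    show "\<not> E a b" if "i \<in> I" "j \<in> I" "i \<noteq> j" "a \<in> F i" "b \<in> F j" for i j a b
      using that insert.prems(2)[of i j a b] by simp
  qed
  ultimately show ?case using insert.hyps by simp
qed

lemma weight_card: "finite V \<Longrightarrow> weight V card"
  unfolding weight_def
proof (intro conjI allI impI)
  fix A B assume "finite V" "A \<subseteq> B \<and> B \<subseteq> V"
  then show "card A \<le> card B" by (meson card_mono finite_subset)
next
  fix A B assume "finite V" and AB: "A \<subseteq> V \<and> B \<subseteq> V \<and> (\<forall>a\<in>A. \<forall>b\<in>B. \<not> E a b)"
  have "A \<inter> B = {}" using AB E_refl by blast
  then show "card A + card B \<le> card (A \<union> B)"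
    using AB \<open>finite V\<close> by (metis card_Un_disjoint finite_subset order_refl)
qed

lemma walk_mono: "walk S p \<Longrightarrow> S \<subseteq> S' \<Longrightarrow> walk S' p"
  unfolding walk_def by blast

lemma walk_append: "walk S p \<Longrightarrow> walk S q \<Longrightarrow> E (last p) (hd q) \<Longrightarrow> walk S (p @ q)"
  unfolding walk_def by (auto simp: successively_append_iff)

lemma walk_Cons: "E x (hd p) \<Longrightarrow> x \<in> S \<Longrightarrow> walk S p \<Longrightarrow> walk S (x # p)"
  unfolding walk_def by (cases p) (auto simp: successively_Cons)

lemma walk_single: "x \<in> S \<Longrightarrow> walk S [x]"
  unfolding walk_def by auto

lemma walk_rev: "walk S p \<Longrightarrow> walk S (rev p)"
proof -
  assume "walk S p"
  moreover have "(\<lambda>x y. E y x) = E" using E_sym by blast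
  ultimately show ?thesis unfolding walk_def by (metis rev_is_Nil_conv set_rev successively_rev)
qed

lemma walk_prefix:
  assumes "walk S p" "y \<in> set p"
  shows "\<exists>q. walk S q \<and> hd q = hd p \<and> last q = y \<and> set q \<subseteq> set p"
proof -
  obtain us vs where p: "p = us @ y # vs" using assms(2) by (meson split_list)
  have "walk S (us @ [y])" using assms(1) unfolding p walk_def
    by (auto simp: successively_append_iff successively_Cons)
  then show ?thesis unfolding p by (intro exI[of _ "us @ [y]"]) (cases us; auto)
qed

lemma reach_refl: "x \<in> S \<Longrightarrow> reach S x x"
  unfolding reach_def by (intro exI[of _ "[x]"]) (auto simp: walk_single)

lemma reach_in: "reach S x y \<Longrightarrow> x \<in> S \<and> y \<in> S"
  unfolding reach_def walk_def by (metis hd_in_set last_in_set subsetD)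

lemma reach_sym: "reach S x y \<Longrightarrow> reach S y x"
  unfolding reach_def by (metis walk_rev hd_rev last_rev walk_def)

lemma reach_trans:
  assumes "reach S x y" "reach S y z" shows "reach S x z"
proof -
  obtain p q where "walk S p" "hd p = x" "last p = y" "walk S q" "hd q = y" "last q = z"
    using assms unfolding reach_def by blast
  then have "walk S (p @ q)" "hd (p @ q) = x" "last (p @ q) = z"
    by (simp add: walk_append, simp_all add: walk_def)
  then show ?thesis unfolding reach_def by blast
qed

lemma conn_component: "conn {y. reach S x y}"
proof -
  have from_x: "reach {y. reach S x y} x y" if y: "reach S x y" for y
  proof -
    obtain p where p: "walk S p" "hd p = x" "last p = y" using y unfolding reach_def by blast
    have "set p \<subseteq> {y. reach S x y}"
      using walk_prefix[OF p(1)] p(2) unfolding reach_def by blast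
    then have "walk {y. reach S x y} p" using p(1) unfolding walk_def by blast
    then show ?thesis using p unfolding reach_def by blast
  qed
  show ?thesis unfolding conn_def
    using from_x reach_sym reach_trans by (metis mem_Collect_eq)
qed

text \<open>A walk never leaves its component, so colourings chosen for the components separately
  fit together; hence only the components, not the whole of \<open>S\<close>, must weigh at most
  \<open>b\<close>.\<close>

lemma good_components:
  assumes g: "good l D k V" and S: "S \<subseteq> V" and w: "weight S w"
    and b: "\<And>T. T \<subseteq> S \<Longrightarrow> conn T \<Longrightarrow> w T \<le> b"
  shows "splits l D k S w b"
proof (cases "S = {}")
  case True
  then show ?thesis using g w b[of "{}"] unfolding good_def
    by (metis conn_def empty_iff empty_subsetI)
next
  case False
  define K where "K x = {y. reach S x y}" for x
  have KS: "K x \<subseteq> S" for x unfolding K_def using reach_in by blast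
  have "\<forall>x. \<exists>X \<phi>. X \<subseteq> K x \<and> (\<forall>x. \<phi> x < k) \<and> ranks l (K x) X \<phi> \<and>
      (\<forall>T. T \<subseteq> K x - X \<and> conn T \<longrightarrow> w T * D \<le> b)"
  proof
    fix x
    have "splits l D k (K x) w b"
      using g KS S w b conn_component unfolding good_def K_def
      by (metis order_trans weight_subset)
    then show "\<exists>X \<phi>. X \<subseteq> K x \<and> (\<forall>x. \<phi> x < k) \<and> ranks l (K x) X \<phi> \<and>
      (\<forall>T. T \<subseteq> K x - X \<and> conn T \<longrightarrow> w T * D \<le> b)" unfolding splits_def .
  qed
  then obtain XX ph where "\<forall>x. XX x \<subseteq> K x \<and> (\<forall>y. ph x y < k) \<and>
      ranks l (K x) (XX x) (ph x) \<and> (\<forall>T. T \<subseteq> K x - XX x \<and> conn T \<longrightarrow> w T * D \<le> b)"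
    by (elim exE[OF choice2] exE)
  note * = this[rule_format]
  \<comment> \<open>All vertices of a component must use the same separator and the same colouring,
    hence a representative.\<close>
  define rep where "rep x = (SOME y. K y = K x)" for x
  have Krep: "K (rep x) = K x" for x unfolding rep_def by (rule someI[of _ x]) simp
  have repeq: "rep x = rep y" if "K x = K y" for x y unfolding rep_def that ..
  define X where "X = {x \<in> S. x \<in> XX (rep x)}"
  define \<phi> where "\<phi> x = ph (rep x) x" for x
  have Keq: "K y = K x" if "y \<in> K x" for x y
    using that unfolding K_def by (metis Collect_cong mem_Collect_eq reach_sym reach_trans)
  have wK: "set p \<subseteq> K (hd p)" if "walk S p" for p
    using walk_prefix[OF that] unfolding K_def reach_def by blast
  have "ranks l S X \<phi>"
    unfolding ranks_def
  proof (intro allI impI)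
    fix p assume p: "walk S p \<and> length p \<le> Suc l \<and> hd p \<in> X \<and> last p \<in> X \<and> hd p \<noteq> last p
      \<and> \<phi> (hd p) = \<phi> (last p)"
    let ?r = "rep (hd p)"
    have sp: "set p \<subseteq> K (hd p)" using wK p by blast
    have same: "rep y = ?r" if "y \<in> set p" for y using that Keq sp repeq by blast
    have ne: "p \<noteq> []" using p unfolding walk_def by blast
    have "walk (K ?r) p" using p sp Krep unfolding walk_def by blast
    moreover have "hd p \<in> XX ?r" "last p \<in> XX ?r"
      using p same[of "last p"] ne unfolding X_def by auto
    moreover have "ph ?r (hd p) = ph ?r (last p)"
      using p same[of "last p"] ne unfolding \<phi>_def by auto
    ultimately obtain z where z: "z \<in> set p" "z \<in> XX ?r" "ph ?r (hd p) < ph ?r z"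
      using *[of ?r] p unfolding ranks_def by blast
    then have "z \<in> X" "\<phi> (hd p) < \<phi> z"
      using same[OF z(1)] p unfolding X_def \<phi>_def walk_def by auto
    then show "\<exists>z\<in>set p. z \<in> X \<and> \<phi> (hd p) < \<phi> z" using z by blast
  qed
  moreover have "w T * D \<le> b" if T: "T \<subseteq> S - X" "conn T" for T
  proof (cases "T = {}")
    case True
    then show ?thesis using weight_empty[OF w] by simp
  next
    case False
    then obtain x where x: "x \<in> T" by blast
    have "T \<subseteq> K x"
    proof
      fix y assume "y \<in> T"
      then have "reach T x y" using T x unfolding conn_def by blast
      then show "y \<in> K x" using T(1) unfolding K_def reach_def by (auto intro: walk_mono)
    qed
    have "z \<notin> XX (rep x)" if "z \<in> T" for z
    proof -
      have "rep z = rep x" using repeq[OF Keq] \<open>T \<subseteq> K x\<close> that by blast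
      then show ?thesis using that T(1) unfolding X_def by auto
    qed
    then have "T \<subseteq> K (rep x) - XX (rep x)" using \<open>T \<subseteq> K x\<close> Krep by blast
    then show ?thesis using *[of "rep x"] T(2) by blast
  qed
  moreover have "\<forall>x. \<phi> x < k" using * unfolding \<phi>_def by blast
  moreover have "X \<subseteq> S" unfolding X_def by blast
  ultimately show ?thesis unfolding splits_def by (intro exI[of _ X] exI[of _ \<phi>]) simp
qed

text \<open>Separators are removed one after another: round \<open>m\<close> removes the vertices of
  level \<open>m\<close>, and level \<open>q\<close> marks what survives all rounds. A vertex
  removed earlier separates those removed later, so a smaller level beats a larger one and
  \<open>\<phi>\<close> decides within a level. The start \<open>lam\<close> is the level that the
  components have already reached.\<close>

lemma good_levels:
  assumes "good l d k C" "weight C w" "d \<ge> 1" "lam \<le> q"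
    and "\<And>T. T \<subseteq> C \<Longrightarrow> conn T \<Longrightarrow> w T * d ^ lam \<le> b"
  shows "\<exists>lev \<phi>. (\<forall>x\<in>C. lam \<le> lev x \<and> lev x \<le> q) \<and> (\<forall>x. \<phi> x < k) \<and>
    (\<forall>p. walk C p \<and> length p \<le> Suc l \<and> hd p \<noteq> last p \<and> lev (hd p) = lev (last p) \<and> lev (hd p) < q \<and>
        \<phi> (hd p) = \<phi> (last p) \<longrightarrow> (\<exists>z\<in>set p. lev z < lev (hd p) \<or> (lev z = lev (hd p) \<and> \<phi> (hd p) < \<phi> z))) \<and>
    (\<forall>m T. m \<le> q \<and> T \<subseteq> C \<and> conn T \<and> (\<forall>x\<in>T. m \<le> lev x) \<longrightarrow> w T * d ^ m \<le> b)"
  using assms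
proof (induction "q - lam" arbitrary: lam C)
  case 0
  then have q: "lam = q" by simp
  have "splits l d k C w (w C)"
    by (rule good_components[OF 0(2) order_refl 0(3)]) (rule weight_mono[OF 0(3)], auto)
  then obtain \<phi> :: "'a \<Rightarrow> nat" where "\<forall>x. \<phi> x < k"
    unfolding splits_def by blast
  moreover have "w T * d ^ m \<le> b" if "m \<le> q" "T \<subseteq> C" "conn T" for T m
  proof -
    have "w T * d ^ m \<le> w T * d ^ lam"
      using that 0(4) q by (simp add: power_increasing)
    then show ?thesis using 0(6)[OF that(2,3)] by linarith
  qed
  ultimately show ?case using q by (intro exI[of _ "\<lambda>_. q"] exI[of _ \<phi>]) auto
next
  case (Suc n)
  have dpos: "d ^ lam > 0" using Suc by simp
  have bd: "w T \<le> b div d ^ lam" if "T \<subseteq> C" "conn T" for T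
    using Suc(7)[OF that] dpos by (simp add: less_eq_div_iff_mult_less_eq)
  \<comment> \<open>In round \<open>lam\<close> the components weigh at most
    \<open>b div d ^ lam\<close>; one more separator gains another factor \<open>d\<close>.\<close>
  have "splits l d k C w (b div d ^ lam)"
    by (rule good_components[OF Suc(3) order_refl Suc(4) bd])
  then obtain X \<phi>0 where X': "X \<subseteq> C \<and> (\<forall>x. \<phi>0 x < k) \<and> ranks l C X \<phi>0 \<and>
    (\<forall>T. T \<subseteq> C - X \<and> conn T \<longrightarrow> w T * d \<le> b div d ^ lam)"
    unfolding splits_def by (elim exE)
  then have X: "X \<subseteq> C" "\<forall>x. \<phi>0 x < k" "ranks l C X \<phi>0"
    "\<And>T. T \<subseteq> C - X \<Longrightarrow> conn T \<Longrightarrow> w T * d \<le> b div d ^ lam" by auto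
  have next_bd: "w T * d ^ Suc lam \<le> b" if "T \<subseteq> C - X" "conn T" for T
    using X(4)[OF that] dpos by (simp add: less_eq_div_iff_mult_less_eq mult.assoc)
  have "\<exists>lev \<phi>. (\<forall>x\<in>C-X. Suc lam \<le> lev x \<and> lev x \<le> q) \<and> (\<forall>x. \<phi> x < k) \<and>
    (\<forall>p. walk (C-X) p \<and> length p \<le> Suc l \<and> hd p \<noteq> last p \<and> lev (hd p) = lev (last p) \<and> lev (hd p) < q \<and>
        \<phi> (hd p) = \<phi> (last p) \<longrightarrow> (\<exists>z\<in>set p. lev z < lev (hd p) \<or> (lev z = lev (hd p) \<and> \<phi> (hd p) < \<phi> z))) \<and>
    (\<forall>m T. m \<le> q \<and> T \<subseteq> C-X \<and> conn T \<and> (\<forall>x\<in>T. m \<le> lev x) \<longrightarrow> w T * d ^ m \<le> b)"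
  proof (rule Suc(1))
    show "n = q - Suc lam" using Suc(2) by linarith
    show "good l d k (C - X)" using Suc(3) good_subset by blast
    show "weight (C - X) w" using Suc(4) weight_subset by blast
    show "1 \<le> d" "Suc lam \<le> q" using Suc by auto
  qed (use next_bd in blast)
  then obtain lev \<phi> where L': "(\<forall>x\<in>C-X. Suc lam \<le> lev x \<and> lev x \<le> q) \<and> (\<forall>x. \<phi> x < k) \<and>
    (\<forall>p. walk (C-X) p \<and> length p \<le> Suc l \<and> hd p \<noteq> last p \<and> lev (hd p) = lev (last p) \<and> lev (hd p) < q \<and>
        \<phi> (hd p) = \<phi> (last p) \<longrightarrow> (\<exists>z\<in>set p. lev z < lev (hd p) \<or> (lev z = lev (hd p) \<and> \<phi> (hd p) < \<phi> z))) \<and>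
    (\<forall>m T. m \<le> q \<and> T \<subseteq> C-X \<and> conn T \<and> (\<forall>x\<in>T. m \<le> lev x) \<longrightarrow> w T * d ^ m \<le> b)"
    by (elim exE)
  then have L: "\<And>x. x \<in> C - X \<Longrightarrow> Suc lam \<le> lev x \<and> lev x \<le> q" "\<forall>x. \<phi> x < k"
    "\<And>p. walk (C-X) p \<Longrightarrow> length p \<le> Suc l \<Longrightarrow> hd p \<noteq> last p \<Longrightarrow> lev (hd p) = lev (last p) \<Longrightarrow> lev (hd p) < q \<Longrightarrow>
        \<phi> (hd p) = \<phi> (last p) \<Longrightarrow> (\<exists>z\<in>set p. lev z < lev (hd p) \<or> (lev z = lev (hd p) \<and> \<phi> (hd p) < \<phi> z))"
    "\<And>m T. m \<le> q \<Longrightarrow> T \<subseteq> C-X \<Longrightarrow> conn T \<Longrightarrow> (\<forall>x\<in>T. m \<le> lev x) \<Longrightarrow> w T * d ^ m \<le> b"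
    by blast+
  define lev' where "lev' x = (if x \<in> X then lam else lev x)" for x
  define \<phi>' where "\<phi>' x = (if x \<in> X then \<phi>0 x else \<phi> x)" for x
  have "\<forall>x\<in>C. lam \<le> lev' x \<and> lev' x \<le> q"
    using L(1) Suc unfolding lev'_def by (auto dest: Suc_leD)
  moreover have "\<forall>x. \<phi>' x < k" using L(2) X(2) unfolding \<phi>'_def by simp
  moreover have "\<exists>z\<in>set p. lev' z < lev' (hd p) \<or> (lev' z = lev' (hd p) \<and> \<phi>' (hd p) < \<phi>' z)"
    if p: "walk C p" "length p \<le> Suc l" "hd p \<noteq> last p" "lev' (hd p) = lev' (last p)" "lev' (hd p) < q"
      "\<phi>' (hd p) = \<phi>' (last p)" for p
  proof -
    have hl: "hd p \<in> C" "last p \<in> C" "set p \<subseteq> C" using p(1) unfolding walk_def by auto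
    have lv: "lev' y = lam \<longleftrightarrow> y \<in> X" "lev' y \<ge> lam" if "y \<in> C" for y
      using L(1)[of y] that unfolding lev'_def by auto
    show ?thesis
    proof (cases "lev' (hd p) = lam")
      case True
      then have "hd p \<in> X" "last p \<in> X" using lv hl p(4) by auto
      then obtain z where "z \<in> set p" "z \<in> X" "\<phi>0 (hd p) < \<phi>0 z"
        using X(3) p unfolding ranks_def \<phi>'_def by auto
      then show ?thesis using \<open>hd p \<in> X\<close> unfolding lev'_def \<phi>'_def by force
    next
      case False
      then have big: "lev' (hd p) > lam" "hd p \<notin> X" "last p \<notin> X"
        using lv[of "hd p"] lv[of "last p"] hl p(4) by auto
      show ?thesis
      proof (cases "set p \<inter> X = {}")
        case True
        then have "walk (C - X) p" using p(1) unfolding walk_def by blast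
        then obtain z where "z \<in> set p" "lev z < lev (hd p) \<or> (lev z = lev (hd p) \<and> \<phi> (hd p) < \<phi> z)"
          using L(3)[of p] p big unfolding lev'_def \<phi>'_def by auto
        moreover have "z \<notin> X" using True calculation by blast
        ultimately show ?thesis using big unfolding lev'_def \<phi>'_def by auto
      next
        case False
        then show ?thesis using big unfolding lev'_def by force
      qed
    qed
  qed
  moreover have "w T * d ^ m \<le> b" if "m \<le> q" "T \<subseteq> C" "conn T" "\<forall>x\<in>T. m \<le> lev' x" for m T
  proof (cases "m \<le> lam")
    case True
    have "w T * d ^ m \<le> w T * d ^ lam" using True Suc by (simp add: power_increasing)
    then show ?thesis using Suc(7)[OF that(2,3)] by linarith
  next
    case False
    then have "T \<subseteq> C - X" using that unfolding lev'_def by force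
    moreover have "\<forall>x\<in>T. m \<le> lev x"
      using that(4) calculation unfolding lev'_def by (auto split: if_splits)
    ultimately show ?thesis using L(4)[OF that(1) _ that(3)] by blast
  qed
  ultimately show ?case by (intro exI[of _ lev'] exI[of _ \<phi>']) simp
qed

text \<open>Excursions out of \<open>C\<close> can be cut out: as long as a walk stays outside
  \<open>C\<close>, \<open>tg\<close> is constant, so the vertices of \<open>C\<close> where it
  leaves and returns belong to one clique and are adjacent. For the induction a walk may start
  outside \<open>C\<close>; its projection then starts in the clique.\<close>

lemma walk_project:
  assumes tg: "\<And>u v. u \<in> V - C \<Longrightarrow> v \<in> V - C \<Longrightarrow> E u v \<Longrightarrow> tg u = tg v"
    and N: "\<And>u v. u \<in> C \<Longrightarrow> v \<in> V - C \<Longrightarrow> E u v \<Longrightarrow> u \<in> N (tg v)"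
    and clique: "\<And>i u v. u \<in> N i \<Longrightarrow> v \<in> N i \<Longrightarrow> E u v"
    and p: "walk V p" "last p \<in> C"
  shows "\<exists>p'. walk C p' \<and> set p' \<subseteq> set p \<and> length p' \<le> length p \<and> last p' = last p \<and>
    (if hd p \<in> C then hd p' = hd p else hd p' \<in> N (tg (hd p)))"
  using p
proof (induction p)
  case Nil
  then show ?case by (simp add: walk_def)
next
  case (Cons x p)
  show ?case
  proof (cases "p = []")
    case True
    then show ?thesis using Cons by (intro exI[of _ "[x]"]) (auto simp: walk_single)
  next
    case False
    have p: "walk V p" "x \<in> V" "E x (hd p)" "hd p \<in> V"
      using Cons.prems False unfolding walk_def by (cases p; auto simp: successively_Cons)+
    then obtain p' where p': "walk C p'" "set p' \<subseteq> set p" "length p' \<le> length p" "last p' = last p"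
      "if hd p \<in> C then hd p' = hd p else hd p' \<in> N (tg (hd p))"
      using Cons False by auto
    have ne: "p' \<noteq> []" "hd p' \<in> C" using p'(1) unfolding walk_def by auto
    show ?thesis
    proof (cases "x \<in> C")
      case True
      have "E x (hd p')"
      proof (cases "hd p \<in> C")
        case True
        then show ?thesis using p' p by simp
      next
        case False
        then show ?thesis using p' p N[OF True, of "hd p"] clique by auto
      qed
      then have "walk C (x # p')" using walk_Cons True p'(1) by blast
      then show ?thesis using p' True False ne by (intro exI[of _ "x # p'"]) auto
    next
      case xC: False
      have "hd p' \<in> N (tg x)"
      proof (cases "hd p \<in> C")
        case True
        then show ?thesis using N[OF True, of x] p p' xC E_sym by auto
      next
        case False
        then show ?thesis using p' p xC tg[of x "hd p"] by simp
      qed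
      then show ?thesis using p' xC False ne by (intro exI[of _ p']) auto
    qed
  qed
qed

lemma walk_exit:
  assumes "walk V p" "hd p \<in> A" "u \<in> set p" "u \<notin> A"
  shows "\<exists>y z. y \<in> set p \<and> z \<in> set p \<and> y \<in> A \<and> z \<notin> A \<and> E y z"
  using assms
proof (induction p)
  case Nil
  then show ?case by simp
next
  case (Cons x p)
  then have "u \<in> set p" "p \<noteq> []" by auto
  then have p: "walk V p" "E x (hd p)" "hd p \<in> set p"
    using Cons.prems unfolding walk_def by (cases p; auto simp: successively_Cons)+
  show ?case
  proof (cases "hd p \<in> A")
    case True
    then show ?thesis using Cons.IH[OF p(1) True \<open>u \<in> set p\<close> Cons.prems(4)] by auto
  next
    case False
    then show ?thesis using p Cons.prems by auto
  qed
qed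

end

lemma greedy_colouring:
  assumes "finite B" "\<And>u v. c u v \<Longrightarrow> c v u"
    and "\<And>v. v \<in> B \<Longrightarrow> card {u \<in> B. c v u} \<le> m"
  shows "\<exists>f. (\<forall>v. f v \<le> m) \<and> (\<forall>u\<in>B. \<forall>v\<in>B. u \<noteq> v \<and> c u v \<longrightarrow> f u \<noteq> (f v :: nat))"
  using assms(1,3)
proof (induction B rule: finite_induct)
  case empty
  then show ?case by (intro exI[of _ "\<lambda>_. 0"]) auto
next
  case (insert x B)
  have "card {u \<in> B. c v u} \<le> m" if "v \<in> B" for v
  proof -
    have "card {u \<in> B. c v u} \<le> card {u \<in> insert x B. c v u}"
      using insert.hyps by (intro card_mono) auto
    then show ?thesis using insert.prems[of v] that by auto
  qed
  then obtain f where f: "\<forall>v. f v \<le> m" "\<forall>u\<in>B. \<forall>v\<in>B. u \<noteq> v \<and> c u v \<longrightarrow> f u \<noteq> (f v :: nat)"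
    using insert.IH by blast
  have "card (f ` {u \<in> B. c x u}) \<le> card {u \<in> B. c x u}"
    using insert.hyps by (intro card_image_le) auto
  also have "\<dots> \<le> card {u \<in> insert x B. c x u}"
    using insert.hyps by (intro card_mono) auto
  also have "\<dots> \<le> m" using insert.prems by blast
  finally have "card (f ` {u \<in> B. c x u}) < card {..m}" by simp
  then obtain a where a: "a \<le> m" "a \<notin> f ` {u \<in> B. c x u}"
    by (metis (no_types, lifting) card_mono finite_imageI finite_subset insert.hyps(1) leD
        mem_Collect_eq subsetI atMost_iff)
  show ?case
    using f a insert.hyps assms(2)
    by (intro exI[of _ "f(x := a)"]) (auto simp: image_iff; blast)
qed

section \<open>Layered graphs\<close>

definition (in lazy_graph) attach ::
  "'a set \<Rightarrow> ('a \<Rightarrow> nat) \<Rightarrow> ('a \<Rightarrow> nat \<Rightarrow> 'r) \<Rightarrow> nat \<Rightarrow> 'r \<Rightarrow> 'a set" where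
  "attach V lay rg j r = {u \<in> V. Suc (lay u) = j \<and> (\<exists>v\<in>V. lay v = j \<and> rg v j = r \<and> E u v)}"

text \<open>The vertices of layer \<open>j\<close> fall into regions; \<open>rg v j\<close> is the region of layer \<open>j\<close> in or beyond which \<open>v\<close>
  lies (meaningful for \<open>j \<le> lay v\<close> only), and the regions form a tree in which each is attached to its
  parent along a clique of at most \<open>t\<close> vertices.\<close>

locale layering = lazy_graph E for E :: "'a \<Rightarrow> 'a \<Rightarrow> bool" +
  fixes V :: "'a set" and lay :: "'a \<Rightarrow> nat" and rg :: "'a \<Rightarrow> nat \<Rightarrow> 'r" and t :: nat
  assumes finV: "finite V"
    and lay_adj: "u \<in> V \<Longrightarrow> v \<in> V \<Longrightarrow> E u v \<Longrightarrow> lay u \<le> Suc (lay v)"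
    and rg_adj: "u \<in> V \<Longrightarrow> v \<in> V \<Longrightarrow> E u v \<Longrightarrow> j \<le> lay u \<Longrightarrow> j \<le> lay v \<Longrightarrow> rg u j = rg v j"
    and rg_tree: "u \<in> V \<Longrightarrow> v \<in> V \<Longrightarrow> j \<le> lay u \<Longrightarrow> j \<le> lay v \<Longrightarrow> rg u j = rg v j \<Longrightarrow> i \<le> j \<Longrightarrow> rg u i = rg v i"
    and attach_clique: "u \<in> attach V lay rg j r \<Longrightarrow> v \<in> attach V lay rg j r \<Longrightarrow> E u v"
    and attach_card: "card (attach V lay rg j r) \<le> t"
begin

abbreviation "N \<equiv> attach V lay rg"

definition ter :: "nat \<Rightarrow> 'r \<Rightarrow> 'a set" where
  "ter j r = {v \<in> V. j \<le> lay v \<and> rg v j = r}"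

definition lay_reg :: "nat \<Rightarrow> 'r \<Rightarrow> 'a set" where
  "lay_reg j r = {v \<in> V. lay v = j \<and> rg v j = r}"

text \<open>The part of the territory that hangs on \<open>S\<close>. Its weight is what counts as
  the weight of \<open>S\<close> when levels are assigned within the layer.\<close>

definition hang :: "nat \<Rightarrow> 'a set \<Rightarrow> 'a set" where
  "hang j S = S \<union> {v \<in> V. j < lay v \<and> N (Suc j) (rg v (Suc j)) \<inter> S \<noteq> {}}"

lemma ter_sub: "ter j r \<subseteq> V" unfolding ter_def by blast

lemma ter_anc: "v \<in> V \<Longrightarrow> i \<le> j \<Longrightarrow> j \<le> lay v \<Longrightarrow> ter j (rg v j) \<subseteq> ter i (rg v i)"
  unfolding ter_def
proof
  fix u assume a: "v \<in> V" "i \<le> j" "j \<le> lay v" "u \<in> {u \<in> V. j \<le> lay u \<and> rg u j = rg v j}"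
  then have "rg u i = rg v i" using rg_tree[of u v j i] by simp
  then show "u \<in> {u \<in> V. i \<le> lay u \<and> rg u i = rg v i}" using a by simp
qed

lemma hang_sub_ter:
  assumes "S \<subseteq> lay_reg j r" shows "hang j S \<subseteq> ter j r"
proof
  fix v assume "v \<in> hang j S"
  then consider "v \<in> S" | "v \<in> V" "j < lay v" "N (Suc j) (rg v (Suc j)) \<inter> S \<noteq> {}"
    unfolding hang_def by blast
  then show "v \<in> ter j r"
  proof cases
    case 1 then show ?thesis using assms unfolding lay_reg_def ter_def by auto
  next
    case 2
    then obtain s y where s: "s \<in> S" "y \<in> V" "lay y = Suc j" "rg y (Suc j) = rg v (Suc j)" "E s y"
      unfolding attach_def by auto
    then have sC: "s \<in> V" "lay s = j" "rg s j = r" using assms unfolding lay_reg_def by auto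
    have "rg y j = rg v j" using rg_tree[of y v "Suc j" j] s 2 by auto
    moreover have "rg s j = rg y j" using rg_adj[of s y j] s sC by auto
    ultimately show ?thesis using 2 sC unfolding ter_def by auto
  qed
qed

lemma hang_sub_V: "S \<subseteq> lay_reg j r \<Longrightarrow> hang j S \<subseteq> V"
  using hang_sub_ter[of S j r] ter_sub[of j r] by (rule order_trans)

text \<open>Adjacent vertices beyond layer \<open>j\<close> lie in one region of layer
  \<open>Suc j\<close>, whose attaching set is a clique; if it met both \<open>S1\<close> and
  \<open>S2\<close>, these would be adjacent. This makes \<open>w (hang j S)\<close> a
  weight.\<close>

lemma hang_nonadjacent:
  assumes S: "S1 \<subseteq> lay_reg j r" "S2 \<subseteq> lay_reg j r" and ne: "\<And>a b. a \<in> S1 \<Longrightarrow> b \<in> S2 \<Longrightarrow> \<not> E a b"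
    and a: "a \<in> hang j S1" and b: "b \<in> hang j S2"
  shows "\<not> E a b"
proof
  assume ab: "E a b"
  have V: "a \<in> V" "b \<in> V" using a b hang_sub_V[OF S(1)] hang_sub_V[OF S(2)] by auto
  have L: "lay x = j" if "x \<in> S1 \<union> S2" for x using that S unfolding lay_reg_def by auto
  have key: False if "x \<in> S1" "y \<in> S2" "x \<in> N (Suc j) i" "y \<in> N (Suc j) i" for x y i
    using that attach_clique ne by blast
  consider "a \<in> S1" "b \<in> S2" | "a \<in> S1" "b \<notin> S2" | "a \<notin> S1" "b \<in> S2" | "a \<notin> S1" "b \<notin> S2" by blast
  then show False
  proof cases
    case 1 then show ?thesis using ne ab by blast
  next
    case 2
    then obtain y where y: "j < lay b" "y \<in> N (Suc j) (rg b (Suc j))" "y \<in> S2"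
      using b unfolding hang_def by blast
    have "lay b = Suc j" using lay_adj[of b a] V E_sym[OF ab] L[of a] 2 y by auto
    then have "a \<in> N (Suc j) (rg b (Suc j))" using V ab L[of a] 2 unfolding attach_def by auto
    then show ?thesis using key 2 y by blast
  next
    case 3
    then obtain y where y: "j < lay a" "y \<in> N (Suc j) (rg a (Suc j))" "y \<in> S1"
      using a unfolding hang_def by blast
    have "lay a = Suc j" using lay_adj[of a b] V ab L[of b] 3 y by auto
    then have "b \<in> N (Suc j) (rg a (Suc j))" using V E_sym[OF ab] L[of b] 3 unfolding attach_def by auto
    then show ?thesis using key 3 y by blast
  next
    case 4
    then obtain x y where "j < lay a" "x \<in> N (Suc j) (rg a (Suc j))" "x \<in> S1"
      "j < lay b" "y \<in> N (Suc j) (rg b (Suc j))" "y \<in> S2"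
      using a b unfolding hang_def by blast
    moreover from this have "rg a (Suc j) = rg b (Suc j)" using rg_adj[OF V ab] by auto
    ultimately show ?thesis using key by metis
  qed
qed

lemma walk_lay:
  "walk V p \<Longrightarrow> x \<in> set p \<Longrightarrow> y \<in> set p \<Longrightarrow> lay x \<le> lay y + (length p - 1)"
proof (induction p arbitrary: x y)
  case Nil then show ?case by simp
next
  case (Cons a p)
  show ?case
  proof (cases "p = []")
    case True then show ?thesis using Cons by auto
  next
    case False
    then have p: "walk V p" "E a (hd p)" "a \<in> V" "hd p \<in> V" "hd p \<in> set p"
      using Cons.prems unfolding walk_def by (cases p; auto simp: successively_Cons)+
    have s: "lay a \<le> Suc (lay (hd p))" "lay (hd p) \<le> Suc (lay a)"
      using lay_adj p E_sym by blast+
    have len: "length p \<ge> 1" using False by (cases p) auto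
    consider "x = a" "y = a" | "x = a" "y \<in> set p" | "x \<in> set p" "y = a" | "x \<in> set p" "y \<in> set p"
      using Cons.prems by auto
    then show ?thesis
    proof cases
      case 2 then show ?thesis using Cons.IH[OF p(1,5), of y] s len by simp
    next
      case 3 then show ?thesis using Cons.IH[OF p(1) _ p(5), of x] s len by simp
    next
      case 4 then show ?thesis using Cons.IH[OF p(1), of x y] by simp
    qed simp
  qed
qed

lemma walk_in_ter:
  assumes "walk V p" "\<And>x. x \<in> set p \<Longrightarrow> j \<le> lay x" "x \<in> set p" "y \<in> set p"
  shows "rg x j = rg y j"
proof -
  have "rg z j = rg (hd p) j" if z: "z \<in> set p" for z
  proof (rule ccontr)
    assume "rg z j \<noteq> rg (hd p) j"
    then obtain u v where "u \<in> set p" "v \<in> set p" "rg u j = rg (hd p) j" "rg v j \<noteq> rg (hd p) j" "E u v"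
      using walk_exit[OF assms(1), of "{u. rg u j = rg (hd p) j}" z] z by auto
    then show False using rg_adj[of u v j] assms(1,2) unfolding walk_def by auto
  qed
  then show ?thesis using assms by metis
qed

lemma ter_walk_project:
  assumes p: "walk (ter j r) p" "hd p \<in> lay_reg j r" "last p \<in> lay_reg j r"
  shows "\<exists>p'. walk (lay_reg j r) p' \<and> set p' \<subseteq> set p \<and> length p' \<le> length p \<and> last p' = last p \<and> hd p' = hd p"
proof -
  have "\<exists>p'. walk (lay_reg j r) p' \<and> set p' \<subseteq> set p \<and> length p' \<le> length p \<and> last p' = last p \<and>
    (if hd p \<in> lay_reg j r then hd p' = hd p else hd p' \<in> N (Suc j) (rg (hd p) (Suc j)))"
  proof (rule walk_project[of "ter j r" _ "\<lambda>v. rg v (Suc j)" "N (Suc j)"])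
    show "rg u (Suc j) = rg v (Suc j)"
      if "u \<in> ter j r - lay_reg j r" "v \<in> ter j r - lay_reg j r" "E u v" for u v
      using that rg_adj[of u v "Suc j"] unfolding ter_def lay_reg_def by force
    show "u \<in> N (Suc j) (rg v (Suc j))"
      if "u \<in> lay_reg j r" "v \<in> ter j r - lay_reg j r" "E u v" for u v
    proof -
      have "lay v \<le> Suc (lay u)" using that lay_adj[of v u] E_sym unfolding ter_def lay_reg_def by blast
      then show ?thesis using that unfolding ter_def lay_reg_def attach_def by force
    qed
    show "E u v" if "u \<in> N (Suc j) i" "v \<in> N (Suc j) i" for i u v using that attach_clique by blast
  qed (use p in auto)
  then show ?thesis using p(2) by auto
qed

end

section \<open>Colouring a layered graph: levels, stretches and the top palette\<close>

locale layered_weight = layering E V lay rg t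
  for E :: "'a \<Rightarrow> 'a \<Rightarrow> bool" and V :: "'a set" and lay :: "'a \<Rightarrow> nat" and rg :: "'a \<Rightarrow> nat \<Rightarrow> 'r" and t +
  fixes w :: "'a set \<Rightarrow> nat" and b d q l k :: nat
  assumes w: "weight V w" and wV: "w V \<le> b" and d: "d \<ge> 1"
    and good_reg: "good l d k (lay_reg j r)"
begin

text \<open>Baseline level of a territory: roughly the base-\<open>d\<close> logarithm of
  \<open>b / w (ter j r)\<close>, rounded down and cut off at \<open>q\<close>. It never decreases
  away from the root (\<open>LL_mono\<close>).\<close>

definition Lam :: "nat \<Rightarrow> 'r \<Rightarrow> nat" where
  "Lam j r = Max {m. m \<le> q \<and> w (ter j r) * d ^ m \<le> b}"

lemma Lam_set: "finite {m. m \<le> q \<and> w (ter j r) * d ^ m \<le> b}" "0 \<in> {m. m \<le> q \<and> w (ter j r) * d ^ m \<le> b}"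
  using weight_mono[OF w ter_sub order_refl, of j r] wV by auto

lemma Lam_le: "Lam j r \<le> q" and Lam_bd: "w (ter j r) * d ^ Lam j r \<le> b"
  using Max_in[OF Lam_set(1)[of j r]] Lam_set(2)[of j r] unfolding Lam_def by blast+

lemma Lam_ge: "m \<le> q \<Longrightarrow> w (ter j r) * d ^ m \<le> b \<Longrightarrow> m \<le> Lam j r"
  using Max_ge[OF Lam_set(1)[of j r], of m] unfolding Lam_def by blast

text \<open>The conclusion of \<open>good_levels\<close> for one region, started at its baseline
  level and with \<open>w (hang j S)\<close> as the weight.\<close>

definition LP :: "nat \<Rightarrow> 'r \<Rightarrow> ('a \<Rightarrow> nat) \<Rightarrow> ('a \<Rightarrow> nat) \<Rightarrow> bool" where
  "LP j r lev \<phi> \<longleftrightarrow> (\<forall>x\<in>lay_reg j r. Lam j r \<le> lev x \<and> lev x \<le> q) \<and> (\<forall>x. \<phi> x < k) \<and>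
    (\<forall>p. walk (lay_reg j r) p \<and> length p \<le> Suc l \<and> hd p \<noteq> last p \<and> lev (hd p) = lev (last p) \<and> lev (hd p) < q \<and>
        \<phi> (hd p) = \<phi> (last p) \<longrightarrow> (\<exists>z\<in>set p. lev z < lev (hd p) \<or> (lev z = lev (hd p) \<and> \<phi> (hd p) < \<phi> z))) \<and>
    (\<forall>m T. m \<le> q \<and> T \<subseteq> lay_reg j r \<and> conn T \<and> (\<forall>x\<in>T. m \<le> lev x) \<longrightarrow> w (hang j T) * d ^ m \<le> b)"

lemma LP_ex: "\<exists>lev \<phi>. LP j r lev \<phi>"
  unfolding LP_def
proof (rule good_levels)
  show "good l d k (lay_reg j r)" by (rule good_reg)
  show "weight (lay_reg j r) (\<lambda>S. w (hang j S))"
    unfolding weight_def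
  proof (intro conjI allI impI)
    fix A B assume "A \<subseteq> B \<and> B \<subseteq> lay_reg j r"
    moreover from this have "hang j A \<subseteq> hang j B" unfolding hang_def by blast
    ultimately show "w (hang j A) \<le> w (hang j B)"
      using weight_mono[OF w _ hang_sub_V] by blast
  next
    fix A B assume AB: "A \<subseteq> lay_reg j r \<and> B \<subseteq> lay_reg j r \<and> (\<forall>a\<in>A. \<forall>b\<in>B. \<not> E a b)"
    have "w (hang j A) + w (hang j B) \<le> w (hang j A \<union> hang j B)"
    proof (rule weight_super[OF w])
      show "hang j A \<subseteq> V" "hang j B \<subseteq> V" using AB hang_sub_V by auto
      show "\<not> E a b" if "a \<in> hang j A" "b \<in> hang j B" for a b
        using hang_nonadjacent[of A j r B a b] AB that by blast
    qed
    moreover have "hang j A \<union> hang j B = hang j (A \<union> B)" unfolding hang_def by blast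
    ultimately show "w (hang j A) + w (hang j B) \<le> w (hang j (A \<union> B))" by simp
  qed
  show "w (hang j T) * d ^ Lam j r \<le> b" if "T \<subseteq> lay_reg j r" for T
  proof -
    have "w (hang j T) \<le> w (ter j r)"
      using weight_mono[OF w hang_sub_ter[OF that] ter_sub] .
    then have "w (hang j T) * d ^ Lam j r \<le> w (ter j r) * d ^ Lam j r" by (rule mult_le_mono1)
    then show ?thesis using Lam_bd order_trans by blast
  qed
qed (use d Lam_le in auto)

definition levels :: "nat \<Rightarrow> 'r \<Rightarrow> ('a \<Rightarrow> nat) \<times> ('a \<Rightarrow> nat)" where
  "levels j r = (SOME p. LP j r (fst p) (snd p))"

lemma LP_levels: "LP j r (fst (levels j r)) (snd (levels j r))"
proof -
  obtain lev \<phi> where "LP j r lev \<phi>" using LP_ex by blast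
  then have "LP j r (fst (lev, \<phi>)) (snd (lev, \<phi>))" by simp
  then show ?thesis unfolding levels_def by (rule someI)
qed

definition lev :: "'a \<Rightarrow> nat" where "lev v = fst (levels (lay v) (rg v (lay v))) v"
definition ph :: "'a \<Rightarrow> nat" where "ph v = snd (levels (lay v) (rg v (lay v))) v"
definition LL :: "'a \<Rightarrow> nat \<Rightarrow> nat" where "LL v j = Lam j (rg v j)"
text \<open>Number of layers before \<open>j\<close> on which, coming from the root towards
  \<open>v\<close>, the baseline level already had the value that it has at
  \<open>j\<close>.\<close>

definition slack :: "'a \<Rightarrow> nat \<Rightarrow> nat" where
  "slack v j = j - (LEAST i. i \<le> j \<and> LL v i = LL v j)"

lemma lev_reg: "x \<in> lay_reg j r \<Longrightarrow> lev x = fst (levels j r) x \<and> ph x = snd (levels j r) x"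
  unfolding lev_def ph_def lay_reg_def by auto

lemma in_own_reg: "v \<in> V \<Longrightarrow> v \<in> lay_reg (lay v) (rg v (lay v))"
  unfolding lay_reg_def by auto

lemma lev_bounds: "v \<in> V \<Longrightarrow> LL v (lay v) \<le> lev v \<and> lev v \<le> q"
  using LP_levels[of "lay v" "rg v (lay v)"] in_own_reg[of v]
  unfolding LP_def lev_def LL_def by blast

lemma ph_less: "ph v < k"
  using LP_levels[of "lay v" "rg v (lay v)"] unfolding LP_def ph_def by blast

lemma lev_walk:
  assumes "walk (lay_reg j r) p" "length p \<le> Suc l" "hd p \<noteq> last p" "lev (hd p) = lev (last p)"
    "lev (hd p) < q" "ph (hd p) = ph (last p)"
  shows "\<exists>z\<in>set p. lev z < lev (hd p) \<or> (lev z = lev (hd p) \<and> ph (hd p) < ph z)"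
proof -
  have s: "set p \<subseteq> lay_reg j r" "hd p \<in> lay_reg j r" "last p \<in> lay_reg j r" using assms(1) unfolding walk_def by auto
  let ?l = "fst (levels j r)" and ?f = "snd (levels j r)"
  have "\<forall>p. walk (lay_reg j r) p \<and> length p \<le> Suc l \<and> hd p \<noteq> last p \<and> ?l (hd p) = ?l (last p) \<and> ?l (hd p) < q \<and>
        ?f (hd p) = ?f (last p) \<longrightarrow> (\<exists>z\<in>set p. ?l z < ?l (hd p) \<or> (?l z = ?l (hd p) \<and> ?f (hd p) < ?f z))"
    using LP_levels[of j r] unfolding LP_def by (elim conjE)
  from this[rule_format, of p] obtain z where z: "z \<in> set p" "?l z < ?l (hd p) \<or> (?l z = ?l (hd p) \<and> ?f (hd p) < ?f z)"
    using assms lev_reg[OF s(2)] lev_reg[OF s(3)] by auto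
  have "z \<in> lay_reg j r" using z s by blast
  then show ?thesis using z lev_reg[OF s(2)] lev_reg[of z j r] by (intro bexI[of _ z]) auto
qed

lemma lev_weight:
  assumes "m \<le> q" "T \<subseteq> lay_reg j r" "conn T" "\<And>x. x \<in> T \<Longrightarrow> m \<le> lev x"
  shows "w (hang j T) * d ^ m \<le> b"
proof -
  have "\<forall>x\<in>T. m \<le> fst (levels j r) x"
  proof
    fix x assume "x \<in> T"
    then show "m \<le> fst (levels j r) x" using assms(2) assms(4)[of x] lev_reg[of x j r] by auto
  qed
  moreover have "\<forall>m T. m \<le> q \<and> T \<subseteq> lay_reg j r \<and> conn T \<and> (\<forall>x\<in>T. m \<le> fst (levels j r) x) \<longrightarrow> w (hang j T) * d ^ m \<le> b"
    using LP_levels[of j r] unfolding LP_def by (elim conjE)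
  ultimately show ?thesis using assms(1-3) by simp
qed

lemma LL_mono: "v \<in> V \<Longrightarrow> i \<le> j \<Longrightarrow> j \<le> lay v \<Longrightarrow> LL v i \<le> LL v j"
  unfolding LL_def
proof (rule Lam_ge)
  assume a: "v \<in> V" "i \<le> j" "j \<le> lay v"
  show "Lam i (rg v i) \<le> q" by (rule Lam_le)
  have "w (ter j (rg v j)) \<le> w (ter i (rg v i))" using weight_mono[OF w ter_anc[OF a] ter_sub] .
  then have "w (ter j (rg v j)) * d ^ Lam i (rg v i) \<le> w (ter i (rg v i)) * d ^ Lam i (rg v i)"
    by (rule mult_le_mono1)
  then show "w (ter j (rg v j)) * d ^ Lam i (rg v i) \<le> b" using Lam_bd order_trans by blast
qed

lemma LL_cong: "u \<in> V \<Longrightarrow> v \<in> V \<Longrightarrow> j \<le> lay u \<Longrightarrow> j \<le> lay v \<Longrightarrow> rg u j = rg v j \<Longrightarrow> i \<le> j \<Longrightarrow> LL u i = LL v i"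
  unfolding LL_def using rg_tree by metis

lemma slack_cong: "u \<in> V \<Longrightarrow> v \<in> V \<Longrightarrow> j \<le> lay u \<Longrightarrow> j \<le> lay v \<Longrightarrow> rg u j = rg v j \<Longrightarrow> slack u j = slack v j"
proof -
  assume a: "u \<in> V" "v \<in> V" "j \<le> lay u" "j \<le> lay v" "rg u j = rg v j"
  have "(i \<le> j \<and> LL u i = LL u j) = (i \<le> j \<and> LL v i = LL v j)" for i
    using LL_cong[OF a, of i] LL_cong[OF a, of j] by auto
  then show ?thesis unfolding slack_def by simp
qed

lemma slack_LL:
  assumes "v \<in> V" "j \<le> lay v" "i \<le> j" "j \<le> i + slack v j" shows "LL v i = LL v j"
proof -
  let ?b = "LEAST i. i \<le> j \<and> LL v i = LL v j"
  have B: "?b \<le> j \<and> LL v ?b = LL v j" by (rule LeastI[of _ j]) simp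
  then have "?b \<le> i" using assms unfolding slack_def by linarith
  then have "LL v ?b \<le> LL v i" using LL_mono assms by simp
  moreover have "LL v i \<le> LL v j" using LL_mono assms by simp
  ultimately show ?thesis using B by simp
qed

lemma slack_Suc:
  assumes "LL v (Suc j) = LL v j" shows "slack v (Suc j) = Suc (slack v j)"
proof -
  let ?b = "LEAST i. i \<le> j \<and> LL v i = LL v j"
  have B: "?b \<le> j \<and> LL v ?b = LL v j" by (rule LeastI[of _ j]) simp
  have "(LEAST i. i \<le> Suc j \<and> LL v i = LL v (Suc j)) = ?b"
  proof (rule Least_equality)
    show "?b \<le> Suc j \<and> LL v ?b = LL v (Suc j)" using B assms by auto
    fix y assume y: "y \<le> Suc j \<and> LL v y = LL v (Suc j)"
    show "?b \<le> y"
    proof (cases "y \<le> j")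
      case True then show ?thesis using y assms by (intro Least_le) auto
    next
      case False then show ?thesis using B by linarith
    qed
  qed
  then show ?thesis using B unfolding slack_def by (simp add: Suc_diff_le)
qed

text \<open>These vertices belong to the attaching cliques at which the counter in
  \<open>sig\<close> starts over. There the colour could not grow towards the root, so they take
  their colours from a separate palette above all others.\<close>

definition top :: "'a \<Rightarrow> bool" where
  "top v \<longleftrightarrow> v \<in> V \<and> lev v < q \<and> (\<exists>y\<in>V. lay y = Suc (lay v) \<and> v \<in> N (Suc (lay v)) (rg y (Suc (lay v))) \<and>
     LL y (Suc (lay v)) = LL v (lay v) \<and> lev v = LL v (lay v) \<and> slack y (Suc (lay v)) mod Suc l = 0)"

text \<open>Breaks ties of level: within a stretch of constant baseline the value grows by one with
  each layer towards the root, until the residue wraps. Vertices above their own baseline get the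
  largest value; for what is attached to them with equal level a new stretch begins.\<close>

definition sig :: "'a \<Rightarrow> nat" where
  "sig v = (if lev v > LL v (lay v) then Suc l else l - slack v (lay v) mod Suc l)"

definition key :: "'a \<Rightarrow> nat" where "key v = (q - 1 - lev v) * (l + 2) + sig v"

text \<open>What two vertices joined by a walk of length at most \<open>l\<close> satisfy, with
  \<open>j\<close> the least layer on the walk.\<close>

definition confl :: "'a \<Rightarrow> 'a \<Rightarrow> bool" where
  "confl u v \<longleftrightarrow> (\<exists>j. j \<le> lay u \<and> j \<le> lay v \<and> lay u \<le> j + l \<and> lay v \<le> j + l \<and> rg u j = rg v j)"

lemma sig_le: "sig v \<le> Suc l" unfolding sig_def by auto

lemma key_less: "lev z < lev v \<Longrightarrow> lev v < q \<Longrightarrow> key v < key z"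
proof -
  assume a: "lev z < lev v" "lev v < q"
  then have "q - 1 - lev z \<ge> Suc (q - 1 - lev v)" by linarith
  then have "(q - 1 - lev z) * (l + 2) \<ge> Suc (q - 1 - lev v) * (l + 2)" by (rule mult_le_mono1)
  then have "(q - 1 - lev z) * (l + 2) \<ge> (q - 1 - lev v) * (l + 2) + (l + 2)" unfolding mult_Suc by linarith
  then show ?thesis using sig_le[of v] unfolding key_def by linarith
qed

lemma key_bd: "lev v < q \<Longrightarrow> key v < q * (l + 2)"
proof -
  assume "lev v < q"
  then have "Suc (q - 1 - lev v) * (l + 2) \<le> q * (l + 2)" by (intro mult_le_mono1) linarith
  then have "(q - 1 - lev v) * (l + 2) + (l + 2) \<le> q * (l + 2)" unfolding mult_Suc by linarith
  then show ?thesis using sig_le[of v] unfolding key_def by linarith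
qed

text \<open>A single vertex \<open>u\<close> is a connected set, so the level bound applies to
  \<open>hang (lay u) {u}\<close>, which contains the whole territory attached at
  \<open>u\<close>.\<close>

lemma attach_lev:
  assumes "u \<in> N j (rg v j)" "v \<in> V" "j \<le> lay v"
  shows "lev u \<le> LL v j"
  unfolding LL_def
proof (rule Lam_ge)
  have u: "u \<in> V" "Suc (lay u) = j" using assms unfolding attach_def by auto
  show "lev u \<le> q" using lev_bounds u by blast
  have "ter j (rg v j) \<subseteq> hang (lay u) {u}"
    using assms u unfolding ter_def hang_def by auto
  then have "w (ter j (rg v j)) \<le> w (hang (lay u) {u})"
    using weight_mono[OF w] hang_sub_ter[of "{u}" "lay u" "rg u (lay u)"] in_own_reg[OF u(1)] ter_sub
    by (meson empty_subsetI insert_subset order_trans)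
  moreover have "w (hang (lay u) {u}) * d ^ lev u \<le> b"
  proof (rule lev_weight)
    show "lev u \<le> q" by fact
    show "{u} \<subseteq> lay_reg (lay u) (rg u (lay u))" using in_own_reg[OF u(1)] by simp
    show "conn {u}" unfolding conn_def using reach_refl by simp
  qed simp
  ultimately show "w (ter j (rg v j)) * d ^ lev u \<le> b"
    by (meson mult_le_mono1 order_trans)
qed

text \<open>Leaving the territory of \<open>v\<close> towards the root means passing an attaching
  vertex \<open>u\<close>, which must beat \<open>v\<close>. Its level is at most that of
  \<open>v\<close>, and if it is smaller, \<open>u\<close> wins. If it is equal, both levels are the
  baseline at \<open>v\<close> and \<open>sig\<close> decides: either \<open>u\<close> is above its
  own baseline, or the slack grows by one from \<open>u\<close> to \<open>v\<close>, which lowers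
  \<open>sig\<close> unless the residue wraps, and then \<open>u\<close> is top.\<close>

lemma attach_dominates:
  assumes v: "v \<in> V" "lev v < q" and u: "u \<in> N (lay v) (rg v (lay v))"
  shows "lev u < q \<and> (top u \<or> key v < key u)"
proof -
  let ?j = "lay v"
  have uV: "u \<in> V" "Suc (lay u) = ?j" using u unfolding attach_def by auto
  obtain y where y: "y \<in> V" "lay y = ?j" "rg y ?j = rg v ?j" "E u y" using u unfolding attach_def by auto
  have le: "lev u \<le> LL v ?j" using attach_lev[OF u v(1)] by simp
  have le2: "LL v ?j \<le> lev v" using lev_bounds v by blast
  have "rg u (lay u) = rg y (lay u)" using rg_adj[of u y] uV y by auto
  also have "\<dots> = rg v (lay u)" using rg_tree[of y v ?j "lay u"] y v uV by auto
  finally have ruv: "rg u (lay u) = rg v (lay u)" .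
  have LLu: "LL u (lay u) = LL v (lay u)" using ruv unfolding LL_def by simp
  have sluv: "slack u (lay u) = slack v (lay u)" using slack_cong[of u v "lay u"] ruv uV v by auto
  have luq: "lev u < q" using le le2 v by linarith
  show ?thesis
  proof (cases "lev u < lev v")
    case True
    then show ?thesis using key_less v luq by blast
  next
    case False
    then have eq: "lev u = lev v" "LL v ?j = lev v" using le le2 by auto
    show ?thesis
    proof (cases "LL u (lay u) = lev u")
      case False
      then have "LL u (lay u) < lev u" using lev_bounds uV by (meson le_neq_implies_less)
      then have "sig u = Suc l" unfolding sig_def by simp
      moreover have "sig v \<le> l" using eq unfolding sig_def by auto
      ultimately have "key v < key u" unfolding key_def eq(1) by simp
      then show ?thesis using luq by blast
    next
      case True
      then have same: "LL v (Suc (lay u)) = LL v (lay u)" using LLu eq uV by simp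
      have sl: "slack v ?j = Suc (slack u (lay u))" using slack_Suc[OF same] sluv uV by simp
      show ?thesis
      proof (cases "slack v ?j mod Suc l = 0")
        case z: True
        have "LL y ?j = LL v ?j" "slack y ?j = slack v ?j"
          using y v LL_cong[of y v ?j ?j] slack_cong[of y v ?j] by auto
        then have "top u" unfolding top_def using uV luq y u True eq z by (auto intro!: bexI[of _ y])
        then show ?thesis using luq by blast
      next
        case nz: False
        have "Suc (slack u (lay u)) mod Suc l = Suc (slack u (lay u) mod Suc l)"
          using nz sl by (simp add: mod_Suc split: if_splits)
        moreover have "Suc (slack u (lay u)) mod Suc l \<le> l" by (metis less_Suc_eq_le mod_less_divisor zero_less_Suc)
        ultimately have "l - slack v ?j mod Suc l < l - slack u (lay u) mod Suc l" using sl by simp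
        then have "sig v < sig u" unfolding sig_def using eq True by simp
        then have "key v < key u" unfolding key_def eq(1) by linarith
        then show ?thesis using luq by blast
      qed
    qed
  qed
qed

lemma walk_leaves_ter:
  assumes "walk V p" "hd p \<in> V" "lev (hd p) < q" "x \<in> set p" "x \<notin> ter (lay (hd p)) (rg (hd p) (lay (hd p)))"
  shows "\<exists>u\<in>set p. lev u < q \<and> (top u \<or> key (hd p) < key u)"
proof -
  let ?v = "hd p" let ?j = "lay ?v"
  have "?v \<in> ter ?j (rg ?v ?j)" using assms unfolding ter_def by auto
  then obtain y u where yu: "y \<in> set p" "u \<in> set p" "y \<in> ter ?j (rg ?v ?j)" "u \<notin> ter ?j (rg ?v ?j)" "E y u"
    using walk_exit[OF assms(1) _ assms(4,5)] by blast
  have V: "y \<in> V" "u \<in> V" using yu assms(1) unfolding walk_def by auto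
  have "lay u < ?j"
    using rg_adj[OF V yu(5), of ?j] yu(3,4) V unfolding ter_def by force
  moreover have "lay y \<le> Suc (lay u)" "?j \<le> lay y" using lay_adj V yu unfolding ter_def by auto
  ultimately have "Suc (lay u) = ?j" "lay y = ?j" by linarith+
  then have "u \<in> N ?j (rg ?v ?j)" using V yu(3) E_sym[OF yu(5)] unfolding ter_def attach_def by blast
  then show ?thesis using attach_dominates[OF assms(2,3)] yu(2) by blast
qed

text \<open>The slack one layer after a top vertex is a positive multiple of \<open>Suc l\<close>,
  so at the vertex itself the baseline has been constant over the last \<open>l\<close> layers. This
  confines the conflicts of a top vertex to one baseline level.\<close>

lemma top_below:
  assumes "top v"
  obtains y where "y \<in> V" "lay y = Suc (lay v)" "v \<in> N (Suc (lay v)) (rg y (Suc (lay v)))"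
    "LL y (Suc (lay v)) = LL v (lay v)" "rg y (lay v) = rg v (lay v)" "l \<le> slack v (lay v)"
proof -
  let ?j = "lay v"
  obtain y where y: "v \<in> V" "y \<in> V" "lay y = Suc ?j" "v \<in> N (Suc ?j) (rg y (Suc ?j))"
    "LL y (Suc ?j) = LL v ?j" "slack y (Suc ?j) mod Suc l = 0"
    using assms unfolding top_def by (elim conjE bexE) simp
  obtain x where x: "x \<in> V" "lay x = Suc ?j" "rg x (Suc ?j) = rg y (Suc ?j)" "E v x"
    using y(4) unfolding attach_def by blast
  have "rg v ?j = rg x ?j" using rg_adj[of v x ?j] x y by simp
  also have "\<dots> = rg y ?j" using rg_tree[of x y "Suc ?j" ?j] x y by simp
  finally have r: "rg y ?j = rg v ?j" by simp
  then have "LL y ?j = LL v ?j" unfolding LL_def by simp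
  then have "slack y (Suc ?j) = Suc (slack y ?j)" using slack_Suc y(5) by simp
  also have "slack y ?j = slack v ?j" using slack_cong[of y v ?j] r y by simp
  finally have "Suc l dvd Suc (slack v ?j)" using y(6) by (metis mod_eq_0_iff_dvd)
  then have "l \<le> slack v ?j" by (metis Suc_le_mono dvd_imp_le zero_less_Suc)
  then show ?thesis using that y r by blast
qed

text \<open>Territories of different regions of one layer are non-adjacent, so their weights add up
  to at most \<open>w (ter j r)\<close>, hence to at most \<open>b / d ^ m\<close>. A baseline of
  exactly \<open>m < q\<close> means that each of them weighs more than
  \<open>b / d ^ Suc m\<close>.\<close>

lemma card_regions:
  assumes "m < q" "I = {rg y i | y. y \<in> V \<and> i \<le> lay y \<and> rg y j = r \<and> LL y i = m}" "j \<le> i"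
    and bd: "w (ter j r) * d ^ m \<le> b"
  shows "card I \<le> d"
proof -
  have fin: "finite I" using finV unfolding assms(2) by simp
  have heavy: "Suc b \<le> w (ter i r') * d ^ Suc m" if "r' \<in> I" for r'
  proof (rule ccontr)
    assume "\<not> ?thesis"
    then have "Suc m \<le> Lam i r'" using assms(1) by (intro Lam_ge) auto
    then show False using that unfolding assms(2) LL_def by auto
  qed
  have sub: "ter i r' \<subseteq> ter j r" if "r' \<in> I" for r'
    using that assms(3) ter_anc[of _ j i] unfolding assms(2) by auto
  have "(\<Sum>r'\<in>I. w (ter i r')) \<le> w (\<Union>r'\<in>I. ter i r')"
  proof (rule weight_sum[OF w fin ter_sub])
    fix r1 r2 x y assume "r1 \<noteq> r2" "x \<in> ter i r1" "y \<in> ter i r2"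
    then show "\<not> E x y" using rg_adj[of x y i] unfolding ter_def by auto
  qed
  also have "\<dots> \<le> w (ter j r)" using sub ter_sub by (intro weight_mono[OF w]) auto
  finally have s: "(\<Sum>r'\<in>I. w (ter i r')) \<le> w (ter j r)" .
  have "card I * Suc b \<le> (\<Sum>r'\<in>I. w (ter i r') * d ^ Suc m)"
    using sum_bounded_below[of I "Suc b" "\<lambda>r'. w (ter i r') * d ^ Suc m"] heavy by simp
  also have "\<dots> = (\<Sum>r'\<in>I. w (ter i r')) * d ^ Suc m" by (simp add: sum_distrib_right)
  also have "\<dots> \<le> w (ter j r) * d ^ Suc m" using s by (rule mult_le_mono1)
  also have "\<dots> = w (ter j r) * d ^ m * d" by simp
  also have "\<dots> \<le> b * d" using bd by (rule mult_le_mono1)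
  finally have le: "card I * Suc b \<le> b * d" .
  show ?thesis
  proof (rule ccontr)
    assume "\<not> ?thesis"
    then have "d * Suc b \<le> card I * Suc b" by (intro mult_le_mono1) simp
    then have "d * Suc b \<le> b * d" using le by linarith
    then show False using d by simp
  qed
qed

text \<open>All conflicting top vertices lie in one territory of layer \<open>lay v - l\<close> and
  have the same baseline \<open>m\<close>. Each belongs to the clique attached to a region of one of
  \<open>2 * l + 1\<close> layers; a layer has at most \<open>d\<close> such regions by
  \<open>card_regions\<close>, and a clique at most \<open>t\<close> vertices.\<close>

lemma confl_degree:
  assumes v: "top v"
  shows "card {u. top u \<and> confl v u} \<le> (2 * l + 1) * d * t"
proof -
  define j where "j = lay v - l"
  define m where "m = LL v (lay v)"
  have vV: "v \<in> V" and mq: "m < q" using v unfolding top_def m_def by auto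
  have sl: "l \<le> slack v (lay v)" using top_below[OF v] by blast
  then have jl: "lay v = j + l" unfolding j_def slack_def by linarith
  have LLm: "LL v i = m" if "j \<le> i" "i \<le> lay v" for i
    using slack_LL[of v "lay v" i] that sl vV jl unfolding m_def by simp
  define I where "I i = {rg y i | y. y \<in> V \<and> i \<le> lay y \<and> rg y j = rg v j \<and> LL y i = m}" for i
  have finI: "finite (I i)" for i using finV unfolding I_def by simp
  have "w (ter j (rg v j)) * d ^ m \<le> b"
    using Lam_bd[of j "rg v j"] LLm[of j] jl unfolding LL_def by simp
  then have cI: "card (I i) \<le> d" if "j \<le> i" for i
    using card_regions[OF mq _ that, of "I i" "rg v j"] unfolding I_def by simp
  \<comment> \<open>\<open>u\<close> is charged to the region that is attached at \<open>u\<close>,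
    one layer further out, because it is the attaching cliques whose size is bounded; hence the
    layers \<open>Suc j\<close> to \<open>j + 2 * l + 1\<close>.\<close>
  have "{u. top u \<and> confl v u} \<subseteq> (\<Union>i\<in>{Suc j..j + 2 * l + 1}. \<Union>r\<in>I i. N i r)"
  proof
    fix u assume "u \<in> {u. top u \<and> confl v u}"
    then have u: "top u" "confl v u" by auto
    then have uV: "u \<in> V" unfolding top_def by blast
    obtain i where i: "i \<le> lay v" "i \<le> lay u" "lay v \<le> i + l" "lay u \<le> i + l" "rg v i = rg u i"
      using u(2) unfolding confl_def by blast
    obtain y where y: "y \<in> V" "lay y = Suc (lay u)" "u \<in> N (Suc (lay u)) (rg y (Suc (lay u)))"
      "LL y (Suc (lay u)) = LL u (lay u)" "rg y (lay u) = rg u (lay u)" "l \<le> slack u (lay u)"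
      using top_below[OF u(1)] by blast
    have ji: "j \<le> i" using i jl by linarith
    have "LL u (lay u) = LL u i" using slack_LL[of u "lay u" i] uV i y by simp
    also have "\<dots> = LL v i" using i unfolding LL_def by simp
    also have "\<dots> = m" using LLm ji i by simp
    finally have Lu: "LL y (Suc (lay u)) = m" using y by simp
    have "rg y j = rg u j" using rg_tree[of y u "lay u" j] y uV ji i by simp
    also have "\<dots> = rg v j" using rg_tree[of u v i j] uV vV i ji by simp
    finally have "rg y (Suc (lay u)) \<in> I (Suc (lay u))" using y Lu unfolding I_def by auto
    moreover have "Suc (lay u) \<in> {Suc j..j + 2 * l + 1}" using i ji jl by simp
    ultimately show "u \<in> (\<Union>i\<in>{Suc j..j + 2 * l + 1}. \<Union>r\<in>I i. N i r)" using y(3) by blast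
  qed
  moreover have "finite (\<Union>i\<in>{Suc j..j + 2 * l + 1}. \<Union>r\<in>I i. N i r)"
    using finI finV unfolding attach_def by auto
  ultimately have "card {u. top u \<and> confl v u} \<le> card (\<Union>i\<in>{Suc j..j + 2 * l + 1}. \<Union>r\<in>I i. N i r)"
    by (intro card_mono)
  also have "\<dots> \<le> (\<Sum>i\<in>{Suc j..j + 2 * l + 1}. card (\<Union>r\<in>I i. N i r))"
    by (rule card_UN_le) simp
  also have "\<dots> \<le> (\<Sum>i\<in>{Suc j..j + 2 * l + 1}. d * t)"
  proof (rule sum_mono)
    fix i assume i: "i \<in> {Suc j..j + 2 * l + 1}"
    have "card (\<Union>r\<in>I i. N i r) \<le> (\<Sum>r\<in>I i. card (N i r))" by (rule card_UN_le[OF finI])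
    also have "\<dots> \<le> (\<Sum>r\<in>I i. t)" using attach_card by (intro sum_mono)
    also have "\<dots> \<le> d * t" using cI[of i] i by simp
    finally show "card (\<Union>r\<in>I i. N i r) \<le> d * t" .
  qed
  also have "\<dots> = (2 * l + 1) * d * t" by (simp add: algebra_simps)
  finally show ?thesis .
qed

text \<open>Let \<open>S\<close> be the trace of \<open>T\<close> on the layer of \<open>T\<close>
  closest to the root. Projection shows that \<open>S\<close> is connected, and all of
  \<open>T\<close> hangs on \<open>S\<close>, so the level bound for \<open>S\<close> covers
  \<open>T\<close>.\<close>

lemma conn_light:
  assumes T: "T \<subseteq> {v \<in> V. q \<le> lev v}" "conn T"
  shows "w T * d ^ q \<le> b"
proof (cases "T = {}")
  case True
  then show ?thesis using weight_empty[OF w] by simp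
next
  case False
  have TV: "T \<subseteq> V" using T by blast
  then have finT: "finite T" using finV finite_subset by blast
  define j where "j = Min (lay ` T)"
  have "j \<in> lay ` T" unfolding j_def using finT False by (intro Min_in) auto
  then obtain x where x: "x \<in> T" "lay x = j" by blast
  have jmin: "j \<le> lay y" if "y \<in> T" for y unfolding j_def using finT that by (intro Min_le) auto
  define r where "r = rg x j"
  have wk: "\<exists>p. walk T p \<and> hd p = a \<and> last p = c" if "a \<in> T" "c \<in> T" for a c
    using T(2) that unfolding conn_def reach_def by blast
  have wV': "walk V p" if "walk T p" for p using that TV walk_mono by blast
  have Tter: "T \<subseteq> ter j r"
  proof
    fix y assume y: "y \<in> T"
    then obtain p where p: "walk T p" "hd p = x" "last p = y" using wk[OF x(1) y] by blast
    have "rg y j = rg x j"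
    proof (rule walk_in_ter[OF wV'[OF p(1)]])
      show "j \<le> lay z" if "z \<in> set p" for z using that p jmin unfolding walk_def by blast
      show "y \<in> set p" "x \<in> set p" using p unfolding walk_def by auto
    qed
    then show "y \<in> ter j r" using y TV jmin unfolding ter_def r_def by auto
  qed
  define S where "S = T \<inter> lay_reg j r"
  have "conn S"
    unfolding conn_def
  proof (intro ballI)
    fix a c assume ac: "a \<in> S" "c \<in> S"
    then obtain p where p: "walk T p" "hd p = a" "last p = c" using wk[of a c] unfolding S_def by blast
    obtain p' where "walk (lay_reg j r) p'" "set p' \<subseteq> set p" "last p' = last p" "hd p' = hd p"
      using ter_walk_project[OF walk_mono[OF p(1) Tter]] ac p unfolding S_def by blast
    moreover from this have "walk S p'" using p(1) unfolding walk_def S_def by blast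
    ultimately show "reach S a c" using p unfolding reach_def by blast
  qed
  have "T \<subseteq> hang j S"
  proof
    fix y assume y: "y \<in> T"
    show "y \<in> hang j S"
    proof (cases "lay y = j")
      case True
      then show ?thesis using y Tter unfolding hang_def S_def lay_reg_def ter_def by auto
    next
      case False
      let ?A = "{u. j < lay u \<and> rg u (Suc j) = rg y (Suc j)}"
      obtain p where p: "walk T p" "hd p = y" "last p = x" using wk[OF y x(1)] by blast
      have "x \<in> set p" "x \<notin> ?A" "hd p \<in> ?A" using p x jmin[OF y] False unfolding walk_def by auto
      from walk_exit[OF p(1) this(3,1,2)]
      obtain a u where au: "a \<in> set p" "u \<in> set p" "a \<in> ?A" "u \<notin> ?A" "E a u"
        by blast
      have aT: "a \<in> T" "u \<in> T" using au p unfolding walk_def by auto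
      then have aV: "a \<in> V" "u \<in> V" using TV by auto
      have "\<not> j < lay u"
      proof
        assume "j < lay u"
        then show False using rg_adj[OF aV au(5), of "Suc j"] au(3,4) by simp
      qed
      then have lu: "lay u = j" using jmin[OF aT(2)] by simp
      then have la: "lay a = Suc j" using lay_adj[OF aV au(5)] au(3) by simp
      have "u \<in> N (Suc j) (rg y (Suc j))"
        using aV lu la au(3) E_sym[OF au(5)] unfolding attach_def by auto
      moreover have "u \<in> S" using aT lu Tter unfolding S_def lay_reg_def ter_def by auto
      ultimately show ?thesis using y TV jmin[OF y] False unfolding hang_def by auto
    qed
  qed
  then have "w T \<le> w (hang j S)"
    using weight_mono[OF w _ hang_sub_V[of S j r]] unfolding S_def by blast
  moreover have "w (hang j S) * d ^ q \<le> b"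
    using lev_weight[of q S j r] \<open>conn S\<close> T(1) unfolding S_def by blast
  ultimately show ?thesis by (meson mult_le_mono1 order_trans)
qed

text \<open>Non-top vertices get the pair of \<open>key\<close> and \<open>ph\<close>, encoded as a
  number, and the top palette lies above these. Two top vertices on a short walk are in conflict, so
  their colours differ. For other ends of equal colour, a walk leaving the territory of either end
  meets a larger colour; otherwise the territories coincide, the walk projects to their common
  region, and the levels of that region apply.\<close>

theorem splits_layered:
  assumes D: "D \<le> d ^ q"
  shows "splits l D (q * (l + 2) * k + (2 * l + 1) * d * t + 1) V w b"
proof -
  have "finite {v. top v}" using finV unfolding top_def by (auto intro: rev_finite_subset)
  moreover have "confl v u" if "confl u v" for u v using that unfolding confl_def by metis
  moreover have "card {u \<in> {v. top v}. confl v u} \<le> (2 * l + 1) * d * t" if "v \<in> {v. top v}" for v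
    using confl_degree[of v] that by simp
  ultimately have "\<exists>\<delta>. (\<forall>v. \<delta> v \<le> (2 * l + 1) * d * t) \<and>
    (\<forall>u\<in>{v. top v}. \<forall>v\<in>{v. top v}. u \<noteq> v \<and> confl u v \<longrightarrow> \<delta> u \<noteq> (\<delta> v :: nat))"
    by (rule greedy_colouring)
  then obtain \<delta> where \<delta>: "\<And>v. \<delta> v \<le> (2 * l + 1) * d * t"
    "\<And>u v. top u \<Longrightarrow> top v \<Longrightarrow> u \<noteq> v \<Longrightarrow> confl u v \<Longrightarrow> \<delta> u \<noteq> \<delta> v" by auto
  define X where "X = {v \<in> V. lev v < q}"
  define col where "col v = (if v \<notin> X then 0 else if top v then q * (l + 2) * k + \<delta> v else key v * k + ph v)" for v
  have lowcol: "key v * k + ph v < q * (l + 2) * k" if "lev v < q" for v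
  proof -
    have "Suc (key v) * k \<le> q * (l + 2) * k" using key_bd[OF that] by (intro mult_le_mono1) simp
    then show ?thesis using ph_less[of v] by simp
  qed
  have dom: "col v < col u" if "v \<in> X" "\<not> top v" "u \<in> X" "top u \<or> key v < key u" for u v
  proof (cases "top u")
    case True
    then show ?thesis using that lowcol[of v] unfolding col_def X_def by auto
  next
    case False
    then have "Suc (key v) * k \<le> key u * k" using that by (intro mult_le_mono1) simp
    then show ?thesis using that False ph_less[of v] unfolding col_def by simp
  qed
  have "ranks l V X col"
    unfolding ranks_def
  proof (intro allI impI)
    fix p assume p: "walk V p \<and> length p \<le> Suc l \<and> hd p \<in> X \<and> last p \<in> X \<and> hd p \<noteq> last p \<and> col (hd p) = col (last p)"
    let ?v = "hd p" and ?v' = "last p"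
    have p1: "walk V p" "length p \<le> Suc l" "?v \<in> X" "?v' \<in> X" "?v \<noteq> ?v'" "col ?v = col ?v'" using p by auto
    have ne: "p \<noteq> []" and pV: "set p \<subseteq> V" using p unfolding walk_def by auto
    have vs: "?v \<in> set p" "?v' \<in> set p" using ne by auto
    have vX: "?v \<in> V" "lev ?v < q" "?v' \<in> V" "lev ?v' < q" using p unfolding X_def by auto
    have sametop: "top ?v \<longleftrightarrow> top ?v'"
      using p lowcol[OF vX(2)] lowcol[OF vX(4)] unfolding col_def by (auto split: if_splits)
    show "\<exists>z\<in>set p. z \<in> X \<and> col ?v < col z"
    proof (cases "top ?v")
      case True
      then have "\<delta> ?v = \<delta> ?v'" using p1(3,4,6) sametop unfolding col_def by simp
      then have nc: "\<not> confl ?v ?v'" using \<delta>(2) True sametop p by blast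
      define j where "j = Min (lay ` set p)"
      have "j \<in> lay ` set p" unfolding j_def using ne by (intro Min_in) auto
      then obtain x where x: "x \<in> set p" "lay x = j" by blast
      have jm: "j \<le> lay y" if "y \<in> set p" for y unfolding j_def using that by (intro Min_le) auto
      have "lay ?v \<le> j + l" "lay ?v' \<le> j + l"
        using walk_lay[of p _ x] p x vs by fastforce+
      moreover have "rg ?v j = rg ?v' j" using walk_in_ter[of p j ?v ?v'] p jm vs by blast
      ultimately have "confl ?v ?v'" using jm vs unfolding confl_def by blast
      then show ?thesis using nc by blast
    next
      case False
      then have nt: "\<not> top ?v" "\<not> top ?v'" using sametop by auto
      have leave: ?thesis if x: "x \<in> set p" "x \<notin> ter (lay ?v) (rg ?v (lay ?v))" for x
      proof -
        obtain u where "u \<in> set p" "lev u < q" "top u \<or> key ?v < key u"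
          using walk_leaves_ter[OF p1(1) vX(1,2) x] by blast
        then show ?thesis using dom[of ?v u] p nt pV unfolding X_def by blast
      qed
      have leave': ?thesis if x: "x \<in> set p" "x \<notin> ter (lay ?v') (rg ?v' (lay ?v'))" for x
      proof -
        have h: "hd (rev p) = ?v'" "walk V (rev p)" using ne p walk_rev by (auto simp: hd_rev)
        obtain u where "u \<in> set p" "lev u < q" "top u \<or> key ?v' < key u"
          using walk_leaves_ter[of "rev p" x] h vX x by auto
        then have "u \<in> set p" "u \<in> X" "col ?v' < col u"
          using dom[of ?v' u] p nt pV unfolding X_def by auto
        then show ?thesis using p by auto
      qed
      show ?thesis
      proof (cases "set p \<subseteq> ter (lay ?v) (rg ?v (lay ?v)) \<and> set p \<subseteq> ter (lay ?v') (rg ?v' (lay ?v'))")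
        case False
        then show ?thesis using leave leave' by blast
      next
        case True
        then have "?v' \<in> ter (lay ?v) (rg ?v (lay ?v))" "?v \<in> ter (lay ?v') (rg ?v' (lay ?v'))" using vs by auto
        \<comment> \<open>Each end lies in the territory of the other, so neither is in a deeper
          layer.\<close>
        then have same: "lay ?v' = lay ?v" "rg ?v' (lay ?v) = rg ?v (lay ?v)" unfolding ter_def by auto
        let ?j = "lay ?v" let ?r = "rg ?v ?j"
        have reg: "?v \<in> lay_reg ?j ?r" "?v' \<in> lay_reg ?j ?r" using vX same unfolding lay_reg_def by auto
        have "walk (ter ?j ?r) p" using p True unfolding walk_def by blast
        then obtain p' where p': "walk (lay_reg ?j ?r) p'" "set p' \<subseteq> set p" "length p' \<le> length p"
          "last p' = ?v'" "hd p' = ?v" using ter_walk_project[OF _ reg] by blast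
        have kp: "key ?v * k + ph ?v = key ?v' * k + ph ?v'"
          using p1(3,4,6) nt unfolding col_def by simp
        have k0: "k > 0" using ph_less[of ?v] by simp
        have phe: "ph ?v = ph ?v'" using arg_cong[OF kp, of "\<lambda>x. x mod k"] ph_less[of ?v] ph_less[of ?v'] by simp
        have "key ?v = key ?v'" using kp phe k0 by simp
        then have "key ?v div (l + 2) = key ?v' div (l + 2)" by simp
        moreover have "key x div (l + 2) = q - 1 - lev x" for x
        proof -
          have "sig x < l + 2" using sig_le[of x] by simp
          then have "sig x div (l + 2) = 0" by (rule div_less)
          then have "(sig x + (q - 1 - lev x) * (l + 2)) div (l + 2) = (q - 1 - lev x)"
            by (subst div_mult_self1) auto
          then show ?thesis unfolding key_def by (simp only: add.commute)
        qed
        ultimately have "lev ?v = lev ?v'" using vX by simp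
        then have "\<exists>z\<in>set p'. lev z < lev ?v \<or> (lev z = lev ?v \<and> ph ?v < ph z)"
          using lev_walk[OF p'(1)] p' p vX phe by auto
        then obtain z where z: "z \<in> set p'" "lev z < lev ?v \<or> (lev z = lev ?v \<and> ph ?v < ph z)" by blast
        have zp: "z \<in> set p" "z \<in> lay_reg ?j ?r" using z p' unfolding walk_def by auto
        then have zX: "z \<in> X" using z vX unfolding X_def lay_reg_def by auto
        have "col ?v < col z"
        proof (cases "top z \<or> lev z < lev ?v")
          case True
          then show ?thesis using dom[of ?v z] key_less[of z ?v] vX p nt zX by blast
        next
          case False
          then have zz: "\<not> top z" "lev z = lev ?v" "ph ?v < ph z" using z by auto
          \<comment> \<open>Within one region baseline and slack agree, so equal levels give equal
            keys and only \<open>ph\<close> differs.\<close>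
          have "sig z = sig ?v"
            using zp(2) zz vX slack_cong[of z ?v ?j] unfolding sig_def lay_reg_def LL_def by auto
          then have "key z = key ?v" unfolding key_def using zz by simp
          then show ?thesis using zz zX p nt unfolding col_def by simp
        qed
        then show ?thesis using zp zX by blast
      qed
    qed
  qed
  moreover have "\<forall>v. col v < q * (l + 2) * k + (2 * l + 1) * d * t + 1"
  proof
    fix v
    show "col v < q * (l + 2) * k + (2 * l + 1) * d * t + 1"
      using \<delta>(1)[of v] lowcol[of v] unfolding col_def X_def by auto
  qed
  moreover have "w T * D \<le> b" if T: "T \<subseteq> V - X" "conn T" for T
  proof -
    have "T \<subseteq> {v \<in> V. q \<le> lev v}" using T unfolding X_def by auto
    then have "w T * d ^ q \<le> b" using conn_light T by blast
    then show ?thesis using D by (meson mult_le_mono2 order_trans)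
  qed
  moreover have "X \<subseteq> V" unfolding X_def by blast
  ultimately show ?thesis unfolding splits_def by (intro exI[of _ X] exI[of _ col]) simp
qed

end

section \<open>Graphs on words\<close>

text \<open>A word records successive trisections of a region, each letter naming the side that is replaced. After
  \<open>k # s\<close> the region named \<open>x\<close> is still on the boundary iff side \<open>k\<close> has not been replaced again.\<close>

definition wadj :: "'c list \<Rightarrow> 'c list \<Rightarrow> bool" where
  "wadj x y \<longleftrightarrow> x = y \<or> (\<exists>k s. y = x @ k # s \<and> k \<notin> set s) \<or> (\<exists>k s. x = y @ k # s \<and> k \<notin> set s)"

interpretation W: lazy_graph wadj
  by unfold_locales (auto simp: wadj_def)

lemma wadj_append [simp]: "wadj (r @ x) (r @ y) \<longleftrightarrow> wadj x y"
  unfolding wadj_def by auto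

text \<open>Length of the first block: with at most \<open>Suc t\<close> letters in play, the
  shortest prefix that uses all of them. The value is meaningful only if more than \<open>t\<close>
  letters occur.\<close>

definition blen :: "nat \<Rightarrow> 'c list \<Rightarrow> nat" where
  "blen t s = (LEAST n. t < card (set (take n s)))"

lemma blen_props:
  assumes "t < card (set s)"
  shows "t < card (set (take (blen t s) s))" "blen t s \<le> length s" "blen t s > 0"
proof -
  have *: "t < card (set (take (length s) s))" using assms by simp
  show 1: "t < card (set (take (blen t s) s))" unfolding blen_def by (rule LeastI[of _ "length s"]) (rule *)
  show "blen t s \<le> length s" unfolding blen_def by (rule Least_le) (rule *)
  show "blen t s > 0" using 1 by (cases "blen t s") auto
qed

lemma blen_append:
  assumes "t < card (set x)" shows "blen t (x @ y) = blen t x"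
  unfolding blen_def[of t "x @ y"]
proof (rule Least_equality)
  show "t < card (set (take (blen t x) (x @ y)))" using blen_props[OF assms] by simp
  fix n assume n: "t < card (set (take n (x @ y)))"
  show "blen t x \<le> n"
  proof (cases "n \<le> length x")
    case True
    then show ?thesis using n unfolding blen_def by (intro Least_le) simp
  next
    case False
    then show ?thesis using blen_props[OF assms] by simp
  qed
qed

function wlay :: "nat \<Rightarrow> 'c list \<Rightarrow> nat" where
  "wlay t s = (if card (set s) \<le> t then 0 else Suc (wlay t (drop (blen t s) s)))"
  by pat_completeness auto
termination
proof (relation "measure (\<lambda>(t, s). length s)")
  fix t :: nat and s :: "'c list" assume "\<not> card (set s) \<le> t"
  then have "blen t s > 0" "s \<noteq> []" using blen_props[of t s] by auto
  then show "((t, drop (blen t s) s), t, s) \<in> measure (\<lambda>(t, s). length s)" by simp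
qed simp

declare wlay.simps [simp del]

text \<open>The prefix of \<open>j\<close> blocks names the region. After its last block a word uses
  at most \<open>t\<close> letters, which is where a letter is saved.\<close>

fun wrg :: "nat \<Rightarrow> 'c list \<Rightarrow> nat \<Rightarrow> 'c list" where
  "wrg t s 0 = []"
| "wrg t s (Suc j) = take (blen t s) s @ wrg t (drop (blen t s) s) j"

lemma wlay_Suc: "Suc j \<le> wlay t s \<Longrightarrow> t < card (set s) \<and> j \<le> wlay t (drop (blen t s) s)"
  by (subst (asm) wlay.simps) (auto split: if_splits)

lemma wlay_append: "wlay t x \<le> wlay t (x @ y)"
proof (induction t x rule: wlay.induct)
  case (1 t s)
  show ?case
  proof (cases "card (set s) \<le> t")
    case True
    then show ?thesis by (simp add: wlay.simps[of t s])
  next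
    case False
    then have l: "t < card (set s)" by simp
    have "card (set s) \<le> card (set (s @ y))" by (intro card_mono) auto
    then have l': "t < card (set (s @ y))" using l by simp
    have "drop (blen t (s @ y)) (s @ y) = drop (blen t s) s @ y"
      using blen_append[OF l] blen_props[OF l] by simp
    then show ?thesis using 1[OF False] l l' by (simp add: wlay.simps[of t s] wlay.simps[of t "s @ y"])
  qed
qed

lemma wrg_append: "j \<le> wlay t x \<Longrightarrow> wrg t (x @ y) j = wrg t x j"
proof (induction j arbitrary: x)
  case (Suc j)
  have l: "t < card (set x)" "j \<le> wlay t (drop (blen t x) x)" using wlay_Suc[OF Suc.prems] by auto
  then show ?case using blen_append[OF l(1)] blen_props[OF l(1)] Suc.IH[OF l(2)] by simp
qed simp

lemma wrg_prefix: "j \<le> wlay t s \<Longrightarrow> \<exists>u. s = wrg t s j @ u \<and> (wlay t s = j \<longrightarrow> card (set u) \<le> t)"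
proof (induction j arbitrary: s)
  case 0
  then show ?case by (subst wlay.simps) auto
next
  case (Suc j)
  have l: "t < card (set s)" "j \<le> wlay t (drop (blen t s) s)" using wlay_Suc[OF Suc.prems] by auto
  obtain u where u: "drop (blen t s) s = wrg t (drop (blen t s) s) j @ u"
    "wlay t (drop (blen t s) s) = j \<longrightarrow> card (set u) \<le> t" using Suc.IH[OF l(2)] by blast
  have "s = take (blen t s) s @ wrg t (drop (blen t s) s) j @ u" using u(1) by (metis append_take_drop_id)
  moreover have "wlay t s = Suc j \<longrightarrow> card (set u) \<le> t"
    using u(2) l(1) by (subst wlay.simps) auto
  ultimately show ?case by auto
qed

lemma wlay_wrg: "j \<le> wlay t s \<Longrightarrow> wlay t (wrg t s j) = j"
proof (induction j arbitrary: s)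
  case 0
  then show ?case by (simp add: wlay.simps)
next
  case (Suc j)
  have l: "t < card (set s)" "j \<le> wlay t (drop (blen t s) s)" using wlay_Suc[OF Suc.prems] by auto
  let ?B = "take (blen t s) s" and ?z = "wrg t (drop (blen t s) s) j"
  have B: "t < card (set ?B)" using blen_props[OF l(1)] by simp
  have lB: "length ?B = blen t s" using blen_props[OF l(1)] by simp
  have "blen t (?B @ drop (blen t s) s) = blen t ?B" by (rule blen_append[OF B])
  then have "blen t ?B = length ?B" using lB by simp
  then have b: "blen t (?B @ ?z) = length ?B" using blen_append[OF B] by simp
  have "card (set ?B) \<le> card (set (?B @ ?z))" by (intro card_mono) auto
  then have "t < card (set (?B @ ?z))" using B by simp
  then have "wlay t (?B @ ?z) = Suc (wlay t (drop (length ?B) (?B @ ?z)))"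
    using b by (subst wlay.simps) simp
  then show ?case using Suc.IH[OF l(2)] by simp
qed

lemma wrg_wrg:
  assumes "i \<le> j" "j \<le> wlay t s" shows "wrg t (wrg t s j) i = wrg t s i"
proof -
  obtain u where "s = wrg t s j @ u" using wrg_prefix[OF assms(2)] by blast
  then show ?thesis using wrg_append[of i t "wrg t s j" u] wlay_wrg[OF assms(2)] assms(1) by simp
qed

text \<open>The first block that ends inside \<open>k # s\<close> ends at \<open>k\<close> or later,
  and from there on \<open>k\<close> does not occur; so at most \<open>t\<close> letters remain and
  no second block can be completed.\<close>

lemma wlay_adj:
  "k \<notin> set s \<Longrightarrow> card (set (x @ k # s)) \<le> Suc t \<Longrightarrow> wlay t (x @ k # s) \<le> Suc (wlay t x)"
proof (induction t x rule: wlay.induct)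
  case (1 t x)
  let ?y = "x @ k # s"
  show ?case
  proof (cases "card (set x) \<le> t")
    case True
    show ?thesis
    proof (cases "card (set ?y) \<le> t")
      case True
      then show ?thesis by (simp add: wlay.simps[of t ?y])
    next
      case False
      then have l: "t < card (set ?y)" by simp
      let ?z = "drop (blen t ?y) ?y"
      have "blen t ?y > length x"
      proof (rule ccontr)
        assume "\<not> ?thesis"
        then have "take (blen t ?y) ?y = take (blen t ?y) x" by simp
        then have "card (set (take (blen t ?y) ?y)) \<le> card (set x)"
          by (simp add: card_mono set_take_subset)
        then show False using blen_props(1)[OF l] True by simp
      qed
      then have "?z = drop (blen t ?y - Suc (length x)) s"
        by (simp add: drop_Cons' )
      then have "set ?z \<subseteq> set ?y - {k}" using 1(2) set_drop_subset by fastforce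
      then have "card (set ?z) \<le> card (set ?y - {k})" by (intro card_mono) auto
      also have "\<dots> \<le> t" using 1(3) by (subst card_Diff_singleton) auto
      finally have "wlay t ?z = 0" by (simp add: wlay.simps)
      then show ?thesis using l by (simp add: wlay.simps[of t ?y])
    qed
  next
    case False
    then have l: "t < card (set x)" by simp
    have d: "drop (blen t ?y) ?y = drop (blen t x) x @ k # s"
      using blen_append[OF l] blen_props[OF l] by simp
    have "card (set x) \<le> card (set ?y)" by (intro card_mono) auto
    then have l': "t < card (set ?y)" using l by simp
    have "card (set (drop (blen t x) x @ k # s)) \<le> card (set ?y)"
      using set_drop_subset[of "blen t x" x] by (intro card_mono) auto
    then have "wlay t (drop (blen t x) x @ k # s) \<le> Suc (wlay t (drop (blen t x) x))"
      using 1 False by simp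
    then show ?thesis using d l l' by (simp add: wlay.simps[of t x] wlay.simps[of t ?y])
  qed
qed

text \<open>\<open>u\<close> is \<open>\<rho>\<close> cut before the last occurrence of some letter,
  so there is exactly one such \<open>u\<close> for each letter of \<open>\<rho>\<close>.\<close>

definition last_before :: "'c list \<Rightarrow> 'c list \<Rightarrow> bool" where
  "last_before \<rho> u \<longleftrightarrow> (\<exists>k s. \<rho> = u @ k # s \<and> k \<notin> set s)"

text \<open>The letter at which the shorter prefix is cut does not occur again, so the longer prefix
  extends it as in \<open>wadj\<close> and is cut at another letter.\<close>

lemma last_before_cases:
  assumes "last_before \<rho> u" "last_before \<rho> u'" "length u \<le> length u'"
  shows "u = u' \<or> (\<exists>k s. u' = u @ k # s \<and> k \<notin> set s \<and> \<rho> ! length u = k \<and> \<rho> ! length u' \<noteq> k)"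
proof -
  obtain k s k' s' where *: "\<rho> = u @ k # s" "k \<notin> set s" "\<rho> = u' @ k' # s'" using assms unfolding last_before_def by blast
  then have "u @ k # s = u' @ k' # s'" by simp
  then obtain us where us: "u' = u @ us" "k # s = us @ k' # s'"
    using assms(3) by (auto simp: append_eq_append_conv2)
  show ?thesis
  proof (cases us)
    case Nil then show ?thesis using us by simp
  next
    case (Cons a v)
    then have "a = k" "s = v @ k' # s'" using us by auto
    then show ?thesis using * us Cons by (auto simp: nth_append)
  qed
qed

lemma last_before_wadj: "last_before \<rho> u \<Longrightarrow> last_before \<rho> u' \<Longrightarrow> wadj u u'"
  using last_before_cases[of \<rho> u u'] last_before_cases[of \<rho> u' u] unfolding wadj_def
  by (metis nat_le_linear)

lemma last_before_card:
  assumes "A \<subseteq> {r @ u | u. last_before \<rho> u}"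
  shows "card A \<le> card (set \<rho>)"
proof -
  let ?f = "\<lambda>w. \<rho> ! (length w - length r)"
  have "inj_on ?f A"
  proof (rule inj_onI)
    fix x y assume "x \<in> A" "y \<in> A" and eq: "?f x = ?f y"
    then obtain u v where uv: "x = r @ u" "y = r @ v" "last_before \<rho> u" "last_before \<rho> v" using assms by blast
    then show "x = y" using last_before_cases[of \<rho> u v] last_before_cases[of \<rho> v u] eq
      by (cases "length u \<le> length v") auto
  qed
  moreover have "?f ` A \<subseteq> set \<rho>" using assms unfolding last_before_def by auto
  ultimately show ?thesis by (metis card_inj_on_le List.finite_set)
qed

text \<open>A word attached to the region \<open>\<rho>\<close> has one block fewer, so it is a
  proper prefix of a word of that region, cut before a letter that does not recur. The cut falls
  inside \<open>\<rho>\<close>, so the attaching set consists of prefixes as in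
  \<open>last_before\<close>; these form a clique with at most one vertex for each letter.\<close>

lemma layering_words:
  assumes fin: "finite V" and V: "V \<subseteq> {r @ s | s. card (set s) \<le> Suc t}"
  shows "layering wadj V (\<lambda>v. wlay t (drop (length r) v)) (\<lambda>v. wrg t (drop (length r) v)) (Suc t)"
proof -
  let ?lay = "\<lambda>v. wlay t (drop (length r) v)" and ?rg = "\<lambda>v. wrg t (drop (length r) v)"
  have tail: "\<exists>s. v = r @ s \<and> card (set s) \<le> Suc t" if "v \<in> V" for v using V that by blast
  have att: "\<exists>u. w = r @ u \<and> last_before \<rho> u \<and> card (set \<rho>) \<le> Suc t"
    if w: "w \<in> W.attach V ?lay ?rg j \<rho>" for w j \<rho>
  proof -
    obtain v where v: "w \<in> V" "v \<in> V" "Suc (?lay w) = j" "?lay v = j" "?rg v j = \<rho>" "wadj w v"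
      using w unfolding W.attach_def by blast
    obtain u where u: "w = r @ u" using tail[OF v(1)] by blast
    obtain s where s: "v = r @ s" "card (set s) \<le> Suc t" using tail[OF v(2)] by blast
    note us = u s
    have a: "wadj u s" "Suc (wlay t u) = j" "wlay t s = j" "wrg t s j = \<rho>" using v us by auto
    \<comment> \<open>An extension of \<open>s\<close> has at least as many blocks as
      \<open>s\<close>, so \<open>u\<close> must be the shorter word.\<close>
    have "u \<noteq> s @ y" for y using wlay_append[of t s y] a(2,3) by auto
    then have "u \<noteq> s" "\<And>k z. u \<noteq> s @ k # z" by (metis append_Nil2, blast)
    then obtain k z where kz: "s = u @ k # z" "k \<notin> set z" using a(1) unfolding wadj_def by blast
    obtain y where y: "s = \<rho> @ y" using wrg_prefix[of j t s] a by auto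
    have l\<rho>: "wlay t \<rho> = j" using wlay_wrg[of j t s] a by auto
    have "length u < length \<rho>"
    proof (rule ccontr)
      assume "\<not> ?thesis"
      then obtain y' where "u = \<rho> @ y'" using kz y by (auto simp: append_eq_append_conv2)
      then have "j \<le> wlay t u" using wlay_append[of t \<rho> y'] l\<rho> by simp
      then show False using a by simp
    qed
    then obtain y' where y': "\<rho> = u @ k # y'" "z = y' @ y"
      using kz y by (auto simp: append_eq_append_conv2 append_eq_Cons_conv)
    have "card (set \<rho>) \<le> card (set s)" using y by (intro card_mono) auto
    then show ?thesis using us y' kz unfolding last_before_def by auto
  qed
  show ?thesis
  proof
    show "finite V" by fact
  next
    fix u v assume uv: "u \<in> V" "v \<in> V" "wadj u v"
    obtain a where a: "u = r @ a" "card (set a) \<le> Suc t" using tail[OF uv(1)] by blast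
    obtain c where c: "v = r @ c" using tail[OF uv(2)] by blast
    have "wadj a c" using uv a c by simp
    then show "?lay u \<le> Suc (?lay v)"
      unfolding wadj_def a c
    proof (elim disjE exE conjE)
      fix k s assume "c = a @ k # s"
      then show "?lay (r @ a) \<le> Suc (?lay (r @ c))" using wlay_append[of t a "k # s"] by simp
    next
      fix k s assume "a = c @ k # s" "k \<notin> set s"
      then show "?lay (r @ a) \<le> Suc (?lay (r @ c))" using wlay_adj[of k s c t] a by simp
    qed simp
  next
    fix u v j assume uv: "u \<in> V" "v \<in> V" "wadj u v" "j \<le> ?lay u" "j \<le> ?lay v"
    obtain a where a: "u = r @ a" using tail[OF uv(1)] by blast
    obtain c where c: "v = r @ c" using tail[OF uv(2)] by blast
    have "wadj a c" "j \<le> wlay t a" "j \<le> wlay t c" using uv a c by auto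
    then have "wrg t a j = wrg t c j" using wrg_append[of j t] unfolding wadj_def by metis
    then show "?rg u j = ?rg v j" using a c by simp
  next
    fix u v i j assume "j \<le> ?lay u" "j \<le> ?lay v" "?rg u j = ?rg v j" "i \<le> j"
    then show "?rg u i = ?rg v i"
      using wrg_wrg[of i j t "drop (length r) u"] wrg_wrg[of i j t "drop (length r) v"] by simp
  next
    fix u v j \<rho> assume "u \<in> W.attach V ?lay ?rg j \<rho>" "v \<in> W.attach V ?lay ?rg j \<rho>"
    then obtain a c where "u = r @ a" "v = r @ c" "last_before \<rho> a" "last_before \<rho> c" using att by blast
    then show "wadj u v" using last_before_wadj[of \<rho> a c] by simp
  next
    fix j \<rho>
    show "card (W.attach V ?lay ?rg j \<rho>) \<le> Suc t"
    proof (cases "W.attach V ?lay ?rg j \<rho> = {}")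
      case False
      then obtain w where "w \<in> W.attach V ?lay ?rg j \<rho>" by blast
      then have "card (set \<rho>) \<le> Suc t" using att by blast
      moreover have "card (W.attach V ?lay ?rg j \<rho>) \<le> card (set \<rho>)"
        by (rule last_before_card[of _ r]) (use att in blast)
      ultimately show ?thesis by simp
    qed simp
  qed
qed

text \<open>In one region all words start with \<open>r @ \<rho>\<close> and continue with at most
  \<open>t\<close> letters, so the hypothesis for \<open>t\<close> letters serves as
  \<open>good_reg\<close>. The fixed prefix \<open>r\<close> is carried along for this
  purpose.\<close>

lemma words_step:
  fixes V :: "'c list set" and r :: "'c list"
  assumes IH: "\<And>(r :: 'c list) V. finite V \<Longrightarrow> V \<subseteq> {r @ s | s. card (set s) \<le> t} \<Longrightarrow> W.good l d k V"
    and d: "d \<ge> 1" and D: "D \<le> d ^ q"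
    and V: "finite V" "V \<subseteq> {r @ s | s. card (set s) \<le> Suc t}"
  shows "W.good l D (q * (l + 2) * k + (2 * l + 1) * d * Suc t + 1) V"
  unfolding W.good_def
proof (intro allI impI, elim conjE)
  fix S w b assume S: "S \<subseteq> V" "W.weight S w" "w S \<le> b"
  have fin: "finite S" "S \<subseteq> {r @ s | s. card (set s) \<le> Suc t}" using S V finite_subset by auto
  let ?lay = "\<lambda>v. wlay t (drop (length r) v)" and ?rg = "\<lambda>v. wrg t (drop (length r) v)"
  interpret L: layering wadj S ?lay ?rg "Suc t" by (rule layering_words[OF fin])
  interpret L: layered_weight wadj S ?lay ?rg "Suc t" w b d q l k
  proof
    show "W.weight S w" "w S \<le> b" "1 \<le> d" using S d by auto
    fix j \<rho>
    show "W.good l d k (L.lay_reg j \<rho>)"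
    proof (rule IH[of _ "r @ \<rho>"])
      show "finite (L.lay_reg j \<rho>)" using fin unfolding L.lay_reg_def by simp
      show "L.lay_reg j \<rho> \<subseteq> {(r @ \<rho>) @ s | s. card (set s) \<le> t}"
      proof
        fix v assume "v \<in> L.lay_reg j \<rho>"
        then have v: "v \<in> S" "?lay v = j" "?rg v j = \<rho>" unfolding L.lay_reg_def by auto
        then obtain s where s: "v = r @ s" using fin by blast
        then obtain u where "s = \<rho> @ u" "card (set u) \<le> t" using wrg_prefix[of j t s] v by auto
        then show "v \<in> {(r @ \<rho>) @ s | s. card (set s) \<le> t}" using s by auto
      qed
    qed
  qed
  show "W.splits l D (q * (l + 2) * k + (2 * l + 1) * d * Suc t + 1) S w b" by (rule L.splits_layered[OF D])
qed

lemma one_letter: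
  assumes "card (set s) \<le> 1" "a \<in> set s" shows "set s = {a}"
proof -
  have "{a} = set s" using assms by (intro card_seteq) auto
  then show ?thesis by simp
qed

lemma one_letter_eq:
  assumes "card (set s) \<le> 1" "card (set s') \<le> 1" "a \<in> set s" "a \<in> set s'" "length s = length s'" shows "s = s'"
proof -
  have "set s = {a}" "set s' = {a}" using one_letter[OF assms(1,3)] one_letter[OF assms(2,4)] by auto
  then have "s = replicate (length s) a" "s' = replicate (length s) a"
    using assms(5) by (auto intro!: replicate_eqI)
  then show ?thesis by (rule trans[OF _ sym])
qed

lemma one_letter_adj:
  assumes "card (set s) \<le> 1" "card (set s') \<le> 1" "wadj s s'" "a \<in> set s" "s' \<noteq> []"
  shows "a \<in> set s' \<and> length s \<le> Suc (length s') \<and> length s' \<le> Suc (length s)"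
proof -
  have key: "length y = Suc (length x)" if "y = x @ k # z" "k \<notin> set z" "card (set y) \<le> 1" for x y :: "'a list" and k z
  proof -
    have "set y = {k}" using that one_letter[of y k] by auto
    then have "z = []" using that by (cases z) auto
    then show ?thesis using that by simp
  qed
  have "a \<in> set s'"
    using assms(3) unfolding wadj_def
  proof (elim disjE exE conjE)
    fix k z assume "s = s' @ k # z" "k \<notin> set z"
    then show ?thesis using one_letter[OF assms(1,4)] assms(5) by (cases s') auto
  qed (use assms(4) in auto)
  moreover have "length s \<le> Suc (length s') \<and> length s' \<le> Suc (length s)"
    using assms(3) unfolding wadj_def
  proof (elim disjE exE conjE)
    fix k z assume "s = s' @ k # z" "k \<notin> set z"
    then show ?thesis using key[of s s' k z] assms by simp
  next
    fix k z assume "s' = s @ k # z" "k \<notin> set z"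
    then show ?thesis using key[of s' s k z] assms by simp
  qed simp
  ultimately show ?thesis by blast
qed

text \<open>Words over at most one letter form paths that meet in \<open>r\<close>. That centre gets
  the largest colour \<open>l + 1\<close>, the paths are coloured by length modulo
  \<open>l + 1\<close>, which makes \<open>l + 2\<close> colours. Nothing is left over, so
  \<open>D\<close> is arbitrary.\<close>

lemma words_base:
  assumes "V \<subseteq> {r @ s | s. card (set s) \<le> 1}"
  shows "W.good l D (l + 2) V"
  unfolding W.good_def
proof (intro allI impI, elim conjE)
  fix S w b assume S: "S \<subseteq> V" "W.weight S w" "w S \<le> b"
  define \<phi> where "\<phi> x = (if x = r then l + 1 else (length x - length r) mod (l + 1))" for x :: "'a list"
  have sm: "\<phi> x \<le> l" if "x \<noteq> r" for x using that unfolding \<phi>_def by (simp add: less_Suc_eq_le)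
  have SV: "\<exists>s. x = r @ s \<and> card (set s) \<le> 1" if "x \<in> S" for x using that S assms by blast
  \<comment> \<open>A walk that avoids the centre stays on the path of one letter \<open>a\<close>,
    and the length of its words changes by at most one in each step.\<close>
  have leg: "\<forall>y\<in>set p. a \<in> set (drop (length r) y) \<and> length y < length (hd p) + length p \<and> length (hd p) < length y + length p"
    if "W.walk S p" "r \<notin> set p" "a \<in> set (drop (length r) (hd p))" for p a
    using that
  proof (induction p)
    case Nil then show ?case by simp
  next
    case (Cons x p)
    show ?case
    proof (cases "p = []")
      case True then show ?thesis using Cons by simp
    next
      case False
      then have p: "W.walk S p" "wadj x (hd p)" "x \<in> S" "hd p \<in> S" "hd p \<noteq> r"
        using Cons.prems unfolding W.walk_def by (cases p; auto simp: successively_Cons)+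
      obtain s s' where s: "x = r @ s" "hd p = r @ s'" "card (set s) \<le> 1" "card (set s') \<le> 1"
        using SV[OF p(3)] SV[OF p(4)] by blast
      have "a \<in> set s' \<and> length s \<le> Suc (length s') \<and> length s' \<le> Suc (length s)"
        using one_letter_adj[of s s' a] s p Cons.prems by auto
      then show ?thesis using Cons.IH[OF p(1)] Cons.prems s by fastforce
    qed
  qed
  have "W.ranks l S S \<phi>"
    unfolding W.ranks_def
  proof (intro allI impI)
    fix p assume p: "W.walk S p \<and> length p \<le> Suc l \<and> hd p \<in> S \<and> last p \<in> S \<and> hd p \<noteq> last p \<and> \<phi> (hd p) = \<phi> (last p)"
    have ne: "p \<noteq> []" using p unfolding W.walk_def by blast
    show "\<exists>z\<in>set p. z \<in> S \<and> \<phi> (hd p) < \<phi> z"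
    proof (cases "r \<in> set p")
      case True
      have "hd p \<noteq> r \<or> last p \<noteq> r" using p by auto
      then have "\<phi> (hd p) \<le> l" using sm p by metis
      then show ?thesis using True p unfolding W.walk_def \<phi>_def by (intro bexI[of _ r]) auto
    next
      case False
      then have hl: "hd p \<noteq> r" "last p \<noteq> r" using ne by auto
      obtain s s' where s: "hd p = r @ s" "last p = r @ s'" "card (set s) \<le> 1" "card (set s') \<le> 1"
        using SV[of "hd p"] SV[of "last p"] p by blast
      then obtain a where a: "a \<in> set s" using hl by (cases s) auto
      have "a \<in> set s' \<and> length (last p) < length (hd p) + length p \<and> length (hd p) < length (last p) + length p"
        using bspec[OF leg[of p a], of "last p"] p False a s last_in_set[OF ne] by auto
      then have len: "a \<in> set s'" "length s' \<le> length s + l" "length s \<le> length s' + l" using s p by auto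
      have "length s mod (l + 1) = length s' mod (l + 1)" using p hl s unfolding \<phi>_def by auto
      then have "length s = length s'"
      proof (cases "length s \<le> length s'")
        case True
        then have "(l + 1) dvd (length s' - length s)"
          using \<open>length s mod (l + 1) = length s' mod (l + 1)\<close> by (metis mod_eq_dvd_iff_nat)
        then have "length s' - length s = 0" using len by (metis One_nat_def add.commute dvd_imp_le le_diff_conv less_Suc_eq_le not_gr0 not_less plus_1_eq_Suc)
        then show ?thesis using True by simp
      next
        case False
        then have "(l + 1) dvd (length s - length s')"
          using \<open>length s mod (l + 1) = length s' mod (l + 1)\<close> by (metis mod_eq_dvd_iff_nat nat_le_linear)
        then have "length s - length s' = 0" using len by (metis One_nat_def add.commute dvd_imp_le le_diff_conv less_Suc_eq_le not_gr0 not_less plus_1_eq_Suc)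
        then show ?thesis using False by simp
      qed
      then have "s = s'" using one_letter_eq s a len by metis
      then show ?thesis using p s by auto
    qed
  qed
  moreover have "\<forall>x. \<phi> x < l + 2"
  proof
    fix x show "\<phi> x < l + 2"
    proof (cases "x = r")
      case False then show ?thesis using sm[of x] by simp
    qed (simp add: \<phi>_def)
  qed
  moreover have "w T * D \<le> b" if "T \<subseteq> S - S" for T
    using that W.weight_empty[OF S(2)] by simp
  ultimately show "W.splits l D (l + 2) S w b" unfolding W.splits_def by (intro exI[of _ S] exI[of _ \<phi>]) simp
qed

theorem words_ranking:
  fixes V :: "'a list set" and d1 q1 d2 q2 l :: nat
  assumes V: "finite V" "V \<subseteq> {s. card (set s) \<le> 3}"
    and d: "d1 \<ge> 1" "d2 \<ge> 1" and q: "card V < d1 ^ q1" "d1 \<le> d2 ^ q2"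
  defines "k2 \<equiv> q2 * (l + 2) * (l + 2) + (2 * l + 1) * d2 * 2 + 1"
  defines "k3 \<equiv> q1 * (l + 2) * k2 + (2 * l + 1) * d1 * 3 + 1"
  shows "\<exists>\<phi>. (\<forall>x. \<phi> x < k3) \<and> W.ranks l V V \<phi>"
proof -
  have g2: "W.good l d1 k2 U" if "finite U" "U \<subseteq> {r @ s | s. card (set s) \<le> 2}" for U :: "'a list set" and r
  proof -
    have "W.good l d1 (q2 * (l + 2) * (l + 2) + (2 * l + 1) * d2 * Suc 1 + 1) U"
    proof (rule words_step[of 1 l d2 "l + 2" d1 q2 U r])
      show "\<And>(r :: 'a list) V. finite V \<Longrightarrow> V \<subseteq> {r @ s | s. card (set s) \<le> 1} \<Longrightarrow> W.good l d2 (l + 2) V"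
        by (rule words_base)
    qed (use that d q in \<open>auto simp: numeral_2_eq_2\<close>)
    moreover have "Suc 1 = (2 :: nat)" by simp
    ultimately show ?thesis unfolding k2_def by metis
  qed
  \<comment> \<open>With \<open>D = Suc (card V)\<close> and cardinality as weight, a non-empty
    connected remainder would be too heavy, so the separator must be all of
    \<open>V\<close>.\<close>
  have "W.good l (Suc (card V)) (q1 * (l + 2) * k2 + (2 * l + 1) * d1 * Suc 2 + 1) V"
  proof (rule words_step[of 2 l d1 k2 _ _ V "[]"])
    show "\<And>(r :: 'a list) U. finite U \<Longrightarrow> U \<subseteq> {r @ s | s. card (set s) \<le> 2} \<Longrightarrow> W.good l d1 k2 U" by (rule g2)
    show "V \<subseteq> {[] @ s | s. card (set s) \<le> Suc 2}" using V(2) by auto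
  qed (use V(1) d(1) q(1) in auto)
  moreover have "Suc 2 = (3 :: nat)" by simp
  ultimately have "W.good l (Suc (card V)) k3 V" unfolding k3_def by metis
  then have "W.splits l (Suc (card V)) k3 V card (card V)"
    using W.weight_card[OF V(1)] unfolding W.good_def by blast
  then obtain X \<phi> where X: "X \<subseteq> V" "\<forall>x. \<phi> x < k3" "W.ranks l V X \<phi>"
    "\<forall>T. T \<subseteq> V - X \<and> W.conn T \<longrightarrow> card T * Suc (card V) \<le> card V"
    unfolding W.splits_def by (elim exE conjE)
  have "X = V"
  proof (rule ccontr)
    assume "X \<noteq> V"
    then obtain x where "x \<in> V - X" using X(1) by blast
    moreover have "W.conn {x}" unfolding W.conn_def using W.reach_refl[of x "{x}"] by simp
    ultimately show False using X(4)[rule_format, of "{x}"] by simp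
  qed
  then show ?thesis using X by blast
qed

section \<open>Choice of the parameters\<close>

text \<open>The square root keeps \<open>d\<close> far below \<open>ln m / ln (ln m)\<close>, while
  \<open>ln d\<close> is still at least half of \<open>ln (ln m)\<close>. The number of factors is
  then about \<open>2 * ln m / ln (ln m)\<close>, and 3 absorbs the rounding.\<close>

lemma pick_base:
  "eventually (\<lambda>m::nat. \<exists>d q. 2 \<le> d \<and> m \<le> d ^ q \<and> real q \<le> 3 * ln m / ln (ln m) \<and>
     sqrt (ln m) \<le> real d \<and> real d \<le> 2 * sqrt (ln m)) sequentially"
proof -
  have "eventually (\<lambda>m::nat. sqrt (ln m) \<ge> 2 \<and> ln (ln m) > 0 \<and> 1 \<le> ln m / ln (ln m) \<and> ln m > 0 \<and> m > 0) sequentially"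
    by (intro eventually_conj; real_asymp)
  then show ?thesis
  proof eventually_elim
    case (elim m)
    define d where "d = nat \<lceil>sqrt (ln m)\<rceil>"
    define q where "q = nat \<lceil>ln m / ln d\<rceil>"
    have d1: "sqrt (ln m) \<le> real d" unfolding d_def by linarith
    have d2: "real d \<le> 2 * sqrt (ln m)" unfolding d_def using elim by linarith
    have d3: "2 \<le> d" using d1 elim by linarith
    have "ln (sqrt (ln m)) \<le> ln (real d)" using d1 elim by (intro ln_mono) auto
    then have ld: "ln (ln m) / 2 \<le> ln d" using elim by (simp add: ln_sqrt)
    have ld0: "ln (real d) > 0" using d3 by simp
    have "real q \<le> ln m / ln d + 1"
      unfolding q_def using elim ld0 by (simp add: of_nat_nat)
    also have "ln m / ln d \<le> ln m / (ln (ln m) / 2)"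
      using ld elim by (intro divide_left_mono) auto
    finally have "real q \<le> 2 * (ln m / ln (ln m)) + 1" by (simp add: mult.commute)
    then have q1: "real q \<le> 3 * ln m / ln (ln m)" using elim by simp
    have "ln m / ln d \<le> real q" unfolding q_def by linarith
    then have "ln m \<le> q * ln d" using ld0 by (simp add: field_simps)
    then have "exp (ln m) \<le> exp (q * ln d)" by simp
    also have "exp (q * ln d) = real d ^ q" using d3 by (simp add: exp_of_nat_mult)
    finally have "real m \<le> real (d ^ q)" using elim by simp
    then have "m \<le> d ^ q" by linarith
    then show ?case using d1 d2 d3 q1 by blast
  qed
qed

lemma pick_two_letter:
  fixes l :: nat
  shows "\<exists>C>0. eventually (\<lambda>m::nat. \<exists>d q. 1 \<le> d \<and> m \<le> d ^ q \<and>
     real (q * (l + 2) * (l + 2) + (2 * l + 1) * d * 2 + 1) \<le> C * ln m / ln (ln m)) sequentially"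
proof -
  define C where "C = 3 * real (l + 2) * real (l + 2) + 4 * real (2 * l + 1) + 1"
  have "eventually (\<lambda>m::nat. sqrt (ln m) \<le> ln m / ln (ln m) \<and> 1 \<le> ln m / ln (ln m)) sequentially"
    by (intro eventually_conj; real_asymp)
  with pick_base have "eventually (\<lambda>m::nat. \<exists>d q. 1 \<le> d \<and> m \<le> d ^ q \<and>
     real (q * (l + 2) * (l + 2) + (2 * l + 1) * d * 2 + 1) \<le> C * ln m / ln (ln m)) sequentially"
  proof eventually_elim
    case (elim m)
    then obtain d q where dq: "2 \<le> d" "m \<le> d ^ q" "real q \<le> 3 * ln m / ln (ln m)" "real d \<le> 2 * sqrt (ln m)" by blast
    define x where "x = ln (real m) / ln (ln (real m))"
    have qx: "real q \<le> 3 * x" "real d \<le> 2 * x" "1 \<le> x" using dq elim unfolding x_def by auto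
    have "real (q * (l + 2) * (l + 2) + (2 * l + 1) * d * 2 + 1)
        = real q * (real (l + 2) * real (l + 2)) + real d * (2 * real (2 * l + 1)) + 1"
      by (simp add: algebra_simps)
    also have "\<dots> \<le> (3 * x) * (real (l + 2) * real (l + 2)) + (2 * x) * (2 * real (2 * l + 1)) + x"
      using qx by (intro add_mono mult_right_mono) auto
    also have "\<dots> = C * x" unfolding C_def by (simp add: algebra_simps)
    finally show ?case using dq unfolding x_def by (intro exI[of _ d] exI[of _ q]) auto
  qed
  moreover have "C > 0" unfolding C_def by (simp add: add_pos_nonneg)
  ultimately show ?thesis by blast
qed

text \<open>The base \<open>d1\<close> of the three-letter step is the number \<open>m\<close> of
  the two-letter step. So the cost of the latter is of order \<open>ln d1 / ln (ln d1)\<close> with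
  \<open>ln d1\<close> at most \<open>ln (ln (Suc n))\<close>, and this factor cancels against
  \<open>q1\<close>. Starting from \<open>Suc n\<close> gives the strict
  \<open>n < d1 ^ q1\<close>.\<close>

lemma pick_three_letter:
  fixes l :: nat
  shows "\<exists>C>0. eventually (\<lambda>n::nat. \<exists>d1 q1 d2 q2. 1 \<le> d1 \<and> 1 \<le> d2 \<and> n < d1 ^ q1 \<and> d1 \<le> d2 ^ q2 \<and>
     real (q1 * (l + 2) * (q2 * (l + 2) * (l + 2) + (2 * l + 1) * d2 * 2 + 1) + (2 * l + 1) * d1 * 3 + 1)
       \<le> C * ln n / ln (ln (ln n))) sequentially"
proof -
  obtain C2 M where C2: "C2 > 0" and M: "\<And>m::nat. m \<ge> M \<Longrightarrow> \<exists>d q. 1 \<le> d \<and> m \<le> d ^ q \<and>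
     real (q * (l + 2) * (l + 2) + (2 * l + 1) * d * 2 + 1) \<le> C2 * ln m / ln (ln m)"
    using pick_two_letter[of l] unfolding eventually_sequentially by blast
  define C where "C = 12 * C2 * real (l + 2) + 6 * real (2 * l + 1) + 1"
  have "eventually (\<lambda>n::nat. \<exists>d q. 2 \<le> d \<and> Suc n \<le> d ^ q \<and> real q \<le> 3 * ln (Suc n) / ln (ln (Suc n)) \<and>
     sqrt (ln (Suc n)) \<le> real d \<and> real d \<le> 2 * sqrt (ln (Suc n))) sequentially"
    using pick_base by (subst eventually_sequentially_Suc)
  moreover have "eventually (\<lambda>n::nat. sqrt (ln (Suc n)) \<ge> M \<and> 2 * sqrt (ln (Suc n)) \<le> ln (Suc n) \<and>
      ln (ln (Suc n)) > 0 \<and> ln (ln (ln n)) > 0 \<and> ln (ln (Suc n)) > 2 \<and>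
      ln (ln (Suc n) / 2) \<ge> ln (ln (ln n)) / 2 \<and> ln (Suc n) \<le> 2 * ln n \<and> 2 * sqrt (ln (Suc n)) \<le> 2 * ln n / ln (ln (ln n)) \<and>
      1 \<le> ln n / ln (ln (ln n)) \<and> ln n > 0 \<and>
      sqrt (ln (Suc n)) > 1 \<and> ln (sqrt (ln (Suc n))) > 1 \<and> ln (ln (sqrt (ln (Suc n)))) \<ge> ln (ln (ln n)) / 2) sequentially"
    by (intro eventually_conj; real_asymp)
  ultimately have "eventually (\<lambda>n::nat. \<exists>d1 q1 d2 q2. 1 \<le> d1 \<and> 1 \<le> d2 \<and> n < d1 ^ q1 \<and> d1 \<le> d2 ^ q2 \<and>
     real (q1 * (l + 2) * (q2 * (l + 2) * (l + 2) + (2 * l + 1) * d2 * 2 + 1) + (2 * l + 1) * d1 * 3 + 1)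
       \<le> C * ln n / ln (ln (ln n))) sequentially"
  proof eventually_elim
    case (elim n)
    then obtain d1 q1 where d1: "2 \<le> d1" "Suc n \<le> d1 ^ q1" "real q1 \<le> 3 * ln (Suc n) / ln (ln (Suc n))"
      "sqrt (ln (Suc n)) \<le> real d1" "real d1 \<le> 2 * sqrt (ln (Suc n))" by blast
    let ?L = "ln (real (Suc n))" and ?y = "ln (ln (ln (real n)))"
    note e = elim(2)
    have "M \<le> d1" using e d1 by linarith
    then obtain d2 q2 where d2: "1 \<le> d2" "d1 \<le> d2 ^ q2"
      "real (q2 * (l + 2) * (l + 2) + (2 * l + 1) * d2 * 2 + 1) \<le> C2 * ln d1 / ln (ln d1)" using M by blast
    define k2 where "k2 = q2 * (l + 2) * (l + 2) + (2 * l + 1) * d2 * 2 + 1"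
    have "real d1 \<le> ?L" "0 < real d1" using d1(1,5) e by linarith+
    then have ld: "ln (real d1) \<le> ln ?L" by (rule ln_mono)
    have s1: "1 < sqrt ?L" "1 < ln (sqrt ?L)" using e by blast+
    then have lge: "ln (sqrt ?L) \<le> ln (real d1)" using d1(4) by (intro ln_mono) linarith+
    moreover have "0 < ln (sqrt ?L)" using s1 by linarith
    ultimately have "ln (ln (sqrt ?L)) \<le> ln (ln (real d1))" by (rule ln_mono)
    then have lld: "?y / 2 \<le> ln (ln (real d1))" using e by linarith
    have l1: "0 \<le> ln (real d1)" using lge s1 by linarith
    have "C2 * ln d1 / ln (ln d1) \<le> C2 * ln ?L / (?y / 2)"
      using ld lld C2 e l1 by (intro frac_le mult_left_mono mult_nonneg_nonneg) linarith+
    then have k2: "real k2 \<le> C2 * ln ?L / (?y / 2)" using d2 unfolding k2_def by linarith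
    have "real q1 * real k2 \<le> (3 * ?L / ln ?L) * (C2 * ln ?L / (?y / 2))"
      using d1(3) k2 e by (intro mult_mono) auto
    \<comment> \<open>The two occurrences of \<open>ln ?L\<close> cancel, and only the third
      logarithm remains in the denominator.\<close>
    also have "\<dots> = 6 * C2 * (?L / ?y)" using e by (simp add: field_simps)
    also have "\<dots> \<le> 6 * C2 * (2 * ln n / ?y)"
      using e C2 by (intro mult_left_mono divide_right_mono) auto
    finally have qk0: "real q1 * real k2 \<le> 12 * C2 * (ln n / ?y)" by simp
    define z where "z = ln n / ?y"
    have qk: "real q1 * real k2 \<le> 12 * C2 * z" "real d1 \<le> 2 * z" "1 \<le> z"
      using qk0 d1(5) e unfolding z_def by auto
    have "real (q1 * (l + 2) * k2 + (2 * l + 1) * d1 * 3 + 1)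
       = (real q1 * real k2) * real (l + 2) + real d1 * (3 * real (2 * l + 1)) + 1" by (simp add: algebra_simps)
    also have "\<dots> \<le> (12 * C2 * z) * real (l + 2) + (2 * z) * (3 * real (2 * l + 1)) + z"
      using qk by (intro add_mono mult_right_mono) auto
    also have "\<dots> = C * z" unfolding C_def by (simp add: algebra_simps)
    finally show ?case using d1 d2 unfolding k2_def z_def
      by (intro exI[of _ d1] exI[of _ q1] exI[of _ d2] exI[of _ q2]) auto
  qed
  moreover have "C > 0" unfolding C_def using C2 by (simp add: add_pos_nonneg)
  ultimately show ?thesis by blast
qed

section \<open>Non-crossing chords\<close>

text \<open>A crossing needs four different positions; chords with a common end never cross.\<close>

definition nc :: "('p \<Rightarrow> 'p \<Rightarrow> bool) \<Rightarrow> 'p list \<Rightarrow> bool" where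
  "nc ch P \<longleftrightarrow> (\<forall>x y z w. subseq [x, y, z, w] P \<longrightarrow> \<not> (ch x z \<and> ch y w))"

lemma nc_subseq: "nc ch P \<Longrightarrow> subseq Q P \<Longrightarrow> nc ch Q"
  unfolding nc_def using subseq_order.order_trans by blast

text \<open>Crossing depends on the cyclic order only. The cases are how many of the four points lie
  in \<open>ys\<close>; rotating the four points keeps or exchanges the two chords.\<close>

lemma nc_rotate:
  assumes sym: "\<And>x y. ch x y \<Longrightarrow> ch y x" and nc: "nc ch (xs @ ys)"
  shows "nc ch (ys @ xs)"
  unfolding nc_def
proof (intro allI impI notI)
  fix x y z w assume "subseq [x, y, z, w] (ys @ xs)" and c: "ch x z \<and> ch y w"
  then obtain s1 s2 where s: "[x, y, z, w] = s1 @ s2" "subseq s1 ys" "subseq s2 xs"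
    by (meson subseq_appendE)
  have sub: "subseq (s2 @ s1) (xs @ ys)" using s by (simp add: list_emb_append_mono)
  have no: "\<not> (ch p r \<and> ch q t)" if "subseq [p, q, r, t] (xs @ ys)" for p q r t
    using nc that unfolding nc_def by blast
  have c': "ch x z" "ch y w" "ch z x" "ch w y" using c sym by auto
  show False
  proof (cases s1)
    case Nil
    then show ?thesis using no[of x y z w] sub s(1) c' by simp
  next
    case (Cons a t1)
    note s1 = Cons
    show ?thesis
    proof (cases t1)
      case Nil
      then show ?thesis using no[of y z w x] sub s(1) s1 c' by auto
    next
      case (Cons b t2)
      note t1 = Cons
      show ?thesis
      proof (cases t2)
        case Nil
        then show ?thesis using no[of z w x y] sub s(1) s1 t1 c' by auto
      next
        case (Cons d t3)
        note t2 = Cons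
        show ?thesis
        proof (cases t3)
          case Nil
          then show ?thesis using no[of w x y z] sub s(1) s1 t1 t2 c' by auto
        next
          case (Cons e t4)
          then have "t4 = []" "s2 = []" using s(1) s1 t1 t2 by auto
          then show ?thesis using no[of x y z w] sub s(1) s1 t1 t2 Cons c' by auto
        qed
      qed
    qed
  qed
qed

lemma subseq_nth_Cons:
  assumes "m \<le> i" "i < length P" "subseq xs (drop (Suc i) P)"
  shows "subseq (P ! i # xs) (drop m P)"
proof -
  have "drop m P = drop m (take i P) @ drop i P"
    using assms(1,2) append_take_drop_id[of i P] drop_append[of m "take i P" "drop i P"] by simp
  moreover have "drop i P = P ! i # drop (Suc i) P" using assms(2) by (simp add: Cons_nth_drop_Suc)
  ultimately show ?thesis using assms(3) by (simp add: subseq_drop_many)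
qed

lemma nc_nth:
  assumes "nc ch P" "i < j" "j < k" "k < l" "l < length P"
  shows "\<not> (ch (P ! i) (P ! k) \<and> ch (P ! j) (P ! l))"
proof -
  have "subseq [P ! l] (drop (Suc k) P)" using subseq_nth_Cons[of "Suc k" l P "[]"] assms by simp
  then have "subseq [P ! k, P ! l] (drop (Suc j) P)" using subseq_nth_Cons[of "Suc j" k P] assms by simp
  then have "subseq [P ! j, P ! k, P ! l] (drop (Suc i) P)" using subseq_nth_Cons[of "Suc i" j P] assms by simp
  then have "subseq [P ! i, P ! j, P ! k, P ! l] (drop 0 P)" using subseq_nth_Cons[of 0 i P] assms by simp
  then show ?thesis using assms(1) unfolding nc_def by simp
qed

text \<open>Every chord with two points of \<open>S\<close> strictly on different sides has its ends
  in \<open>S\<close>. Cutting \<open>S\<close> along such a chord then leaves two closed sets that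
  both contain its ends.\<close>

definition chord_closed :: "(nat \<Rightarrow> nat \<Rightarrow> bool) \<Rightarrow> nat set \<Rightarrow> bool" where
  "chord_closed c S \<longleftrightarrow> (\<forall>a\<in>S. \<forall>b\<in>S. \<forall>i j. c i j \<and> a < i \<and> i < b \<and> (j < a \<or> b < j) \<longrightarrow> i \<in> S \<and> j \<in> S)"

lemma chord_closed_inside:
  assumes S: "chord_closed c S" and nc: "\<And>i j. c i j \<Longrightarrow> lo < i \<Longrightarrow> i < hi \<Longrightarrow> lo \<le> j \<and> j \<le> hi"
  shows "chord_closed c {s \<in> S. lo \<le> s \<and> s \<le> hi}"
  unfolding chord_closed_def
proof (intro ballI allI impI)
  fix a b i j assume *: "a \<in> {s \<in> S. lo \<le> s \<and> s \<le> hi}" "b \<in> {s \<in> S. lo \<le> s \<and> s \<le> hi}"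
    "c i j \<and> a < i \<and> i < b \<and> (j < a \<or> b < j)"
  then have "i \<in> S \<and> j \<in> S" using S unfolding chord_closed_def by blast
  moreover have "lo < i" "i < hi" using * by auto
  ultimately show "i \<in> {s \<in> S. lo \<le> s \<and> s \<le> hi} \<and> j \<in> {s \<in> S. lo \<le> s \<and> s \<le> hi}"
    using nc[of i j] * by auto
qed

lemma chord_closed_outside:
  assumes S: "chord_closed c S" and nc: "\<And>i j. c i j \<Longrightarrow> lo < i \<Longrightarrow> i < hi \<Longrightarrow> lo \<le> j \<and> j \<le> hi"
    and sym: "\<And>i j. c i j \<Longrightarrow> c j i"
  shows "chord_closed c {s \<in> S. s \<le> lo \<or> hi \<le> s}"
  unfolding chord_closed_def
proof (intro ballI allI impI)
  fix a b i j assume *: "a \<in> {s \<in> S. s \<le> lo \<or> hi \<le> s}" "b \<in> {s \<in> S. s \<le> lo \<or> hi \<le> s}"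
    "c i j \<and> a < i \<and> i < b \<and> (j < a \<or> b < j)"
  have ij: "i \<in> S \<and> j \<in> S" using S * unfolding chord_closed_def by blast
  have n1: "lo < i \<and> i < hi \<longrightarrow> lo \<le> j \<and> j \<le> hi" using nc[of i j] * by blast
  have n2: "lo < j \<and> j < hi \<longrightarrow> lo \<le> i \<and> i \<le> hi" using nc[of j i] sym * by blast
  have "i \<le> lo \<or> hi \<le> i" using n1 * by auto
  moreover have "j \<le> lo \<or> hi \<le> j" using n2 * by auto
  ultimately show "i \<in> {s \<in> S. s \<le> lo \<or> hi \<le> s} \<and> j \<in> {s \<in> S. s \<le> lo \<or> hi \<le> s}" using ij by auto
qed

text \<open>A Sperner-type lemma: among the chord-closed sets meeting all three blocks, a smallest one is
  not separated by any chord, so any choice of one point per block works.\<close>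

lemma trisect_nat:
  fixes c :: "nat \<Rightarrow> nat \<Rightarrow> bool"
  assumes sym: "\<And>i j. c i j \<Longrightarrow> c j i"
    and nc: "\<And>i j k l. i < j \<Longrightarrow> j < k \<Longrightarrow> k < l \<Longrightarrow> l < n \<Longrightarrow> \<not> (c i k \<and> c j l)"
    and dom: "\<And>i j. c i j \<Longrightarrow> i < n \<and> j < n"
    and pq: "0 < p" "p < q" "q < n"
  shows "\<exists>x y z. x < p \<and> p \<le> y \<and> y < q \<and> q \<le> z \<and> z < n \<and>
    (\<forall>i j. c i j \<longrightarrow> (x < i \<and> i < y \<longrightarrow> x \<le> j \<and> j \<le> y) \<and> (y < i \<and> i < z \<longrightarrow> y \<le> j \<and> j \<le> z) \<and>
      (i < x \<or> z < i \<longrightarrow> j \<le> x \<or> z \<le> j))"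
proof -
  define ok where "ok S \<longleftrightarrow> S \<subseteq> {..<n} \<and> chord_closed c S \<and> (\<exists>x\<in>S. x < p) \<and> (\<exists>y\<in>S. p \<le> y \<and> y < q) \<and> (\<exists>z\<in>S. q \<le> z)" for S
  have "ok {..<n}" unfolding ok_def chord_closed_def using pq dom by (auto intro: bexI[of _ 0] bexI[of _ p] bexI[of _ q])
  then obtain S where S: "ok S" and min: "\<And>S'. ok S' \<Longrightarrow> card S \<le> card S'"
    using ex_has_least_nat[of ok "{..<n}" card] by blast
  have fin: "finite S" using S unfolding ok_def using finite_subset by blast
  have nosmaller: "\<not> ok S'" if "S' \<subset> S" for S' using min[of S'] psubset_card_mono[OF fin that] by linarith
  have free: "\<not> (c i j \<and> a < i \<and> i < b \<and> (j < a \<or> b < j))" if ab: "a \<in> S" "b \<in> S" for a b i j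
  proof
    assume *: "c i j \<and> a < i \<and> i < b \<and> (j < a \<or> b < j)"
    have ij: "i \<in> S" "j \<in> S" using S * ab unfolding ok_def chord_closed_def by blast+
    define lo hi where "lo = min i j" and "hi = max i j"
    have lh: "lo \<in> S" "hi \<in> S" "lo < hi" "c lo hi" using ij * sym unfolding lo_def hi_def
      by (auto simp: min_def max_def)
    have hn: "hi < n" using lh dom by blast
    have ncl: "lo \<le> v \<and> v \<le> hi" if uv: "c u v" "lo < u" "u < hi" for u v
    proof (rule ccontr)
      assume "\<not> (lo \<le> v \<and> v \<le> hi)"
      then consider "v < lo" | "hi < v" by linarith
      then show False
      proof cases
        case 1 then show ?thesis using nc[of v lo u hi] uv lh sym hn by blast
      next
        case 2 then show ?thesis using nc[of lo u hi v] uv lh dom[OF uv(1)] by blast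
      qed
    qed
    let ?S1 = "{s \<in> S. lo \<le> s \<and> s \<le> hi}" and ?S2 = "{s \<in> S. s \<le> lo \<or> hi \<le> s}"
    have Scl: "chord_closed c S" using S unfolding ok_def by blast
    have c12: "chord_closed c ?S1" "chord_closed c ?S2"
      by (rule chord_closed_inside[OF Scl ncl], assumption+)
        (rule chord_closed_outside[OF Scl ncl sym], assumption+)
    have "b \<notin> ?S1 \<or> a \<notin> ?S1" "b \<notin> ?S2 \<or> a \<notin> ?S2" using * unfolding lo_def hi_def by auto
    then have p12: "?S1 \<subset> S" "?S2 \<subset> S" using ab by blast+
    obtain x y z where xyz: "x \<in> S" "x < p" "y \<in> S" "p \<le> y" "y < q" "z \<in> S" "q \<le> z" using S unfolding ok_def by blast
    have sub: "?S1 \<subseteq> {..<n}" "?S2 \<subseteq> {..<n}" using S unfolding ok_def by auto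
    \<comment> \<open>Both pieces contain \<open>lo\<close> and \<open>hi\<close>. If these lie in
      different blocks, the piece containing a point of the third block meets all three; if they lie
      in one block, the outer piece keeps the points of the other two.\<close>
    have "((\<exists>x\<in>?S1. x < p) \<and> (\<exists>y\<in>?S1. p \<le> y \<and> y < q) \<and> (\<exists>z\<in>?S1. q \<le> z)) \<or>
      ((\<exists>x\<in>?S2. x < p) \<and> (\<exists>y\<in>?S2. p \<le> y \<and> y < q) \<and> (\<exists>z\<in>?S2. q \<le> z))"
    proof -
      have lo1: "lo \<in> ?S1" "hi \<in> ?S1" "lo \<in> ?S2" "hi \<in> ?S2" using lh by auto
      have in12: "s \<in> ?S1 \<or> s \<in> ?S2" if "s \<in> S" for s using that by auto
      consider "hi < p" | "lo < p" "p \<le> hi" "hi < q" | "lo < p" "q \<le> hi" | "p \<le> lo" "hi < q"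
        | "p \<le> lo" "lo < q" "q \<le> hi" | "q \<le> lo" using lh(3) by linarith
      then show ?thesis
      proof cases
        case 1
        then have "y \<in> ?S2" "z \<in> ?S2" using xyz by auto
        then show ?thesis using 1 lo1 xyz by blast
      next
        case 2
        then show ?thesis using lo1 xyz in12[of z] by blast
      next
        case 3
        then show ?thesis using lo1 xyz in12[of y] by blast
      next
        case 4
        then have "x \<in> ?S2" "z \<in> ?S2" "p \<le> hi" using xyz lh by auto
        then show ?thesis using 4 lo1 xyz by blast
      next
        case 5
        then show ?thesis using lo1 xyz in12[of x] by blast
      next
        case 6
        then have "x \<in> ?S2" "y \<in> ?S2" using xyz by auto
        then show ?thesis using 6 lo1 xyz by blast
      qed
    qed
    then show False using c12 p12 sub nosmaller unfolding ok_def by blast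
  qed
  obtain x y z where xyz: "x \<in> S" "x < p" "y \<in> S" "p \<le> y" "y < q" "z \<in> S" "q \<le> z" using S unfolding ok_def by blast
  have zn: "z < n" using xyz S unfolding ok_def by auto
  have "(x < i \<and> i < y \<longrightarrow> x \<le> j \<and> j \<le> y) \<and> (y < i \<and> i < z \<longrightarrow> y \<le> j \<and> j \<le> z) \<and>
      (i < x \<or> z < i \<longrightarrow> j \<le> x \<or> z \<le> j)" if cij: "c i j" for i j
  proof (intro conjI impI)
    show "x \<le> j" "j \<le> y" if "x < i \<and> i < y" using free[OF xyz(1,3), of i j] cij that by auto
    show "y \<le> j" "j \<le> z" if "y < i \<and> i < z" using free[OF xyz(3,6), of i j] cij that by auto
    show "j \<le> x \<or> z \<le> j" if "i < x \<or> z < i" using free[OF xyz(1,6), of j i] sym[OF cij] that by auto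
  qed
  then show ?thesis using xyz zn by blast
qed

lemma set_segment_nth:
  assumes "e \<in> set B" shows "\<exists>i. length A \<le> i \<and> i < length A + length B \<and> (A @ B @ C) ! i = e"
proof -
  obtain m where "m < length B" "B ! m = e" using assms by (auto simp: in_set_conv_nth)
  then show ?thesis by (intro exI[of _ "length A + m"]) (auto simp: nth_append)
qed

lemma nth_segment_set:
  assumes "length A \<le> i" "i < length A + length B" shows "(A @ B @ C) ! i \<in> set B"
  using assms by (auto simp: nth_append)

text \<open>This is \<open>trisect_nat\<close> with positions as points; the third arc runs over the
  end of the list into its beginning.\<close>

lemma trisect:
  assumes sym: "\<And>x y. ch x y \<Longrightarrow> ch y x" and nc: "nc ch (L0 @ L1 @ L2)"
    and ne: "L0 \<noteq> []" "L1 \<noteq> []" "L2 \<noteq> []"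
  obtains a0 x0 b0 a1 x1 b1 a2 x2 b2 where "L0 = a0 @ x0 # b0" "L1 = a1 @ x1 # b1" "L2 = a2 @ x2 # b2"
    "\<forall>i\<in>set (b0 @ a1). \<forall>j\<in>set (L0 @ L1 @ L2). ch i j \<longrightarrow> j \<in> set (x0 # b0 @ a1 @ [x1])"
    "\<forall>i\<in>set (b1 @ a2). \<forall>j\<in>set (L0 @ L1 @ L2). ch i j \<longrightarrow> j \<in> set (x1 # b1 @ a2 @ [x2])"
    "\<forall>i\<in>set (b2 @ a0). \<forall>j\<in>set (L0 @ L1 @ L2). ch i j \<longrightarrow> j \<in> set (x2 # b2 @ a0 @ [x0])"
proof -
  let ?L = "L0 @ L1 @ L2"
  define n where "n = length ?L"
  define c where "c i j \<longleftrightarrow> i < n \<and> j < n \<and> ch (?L ! i) (?L ! j)" for i j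
  let ?p = "length L0" and ?q = "length L0 + length L1"
  have "\<exists>x y z. x < ?p \<and> ?p \<le> y \<and> y < ?q \<and> ?q \<le> z \<and> z < n \<and>
    (\<forall>i j. c i j \<longrightarrow> (x < i \<and> i < y \<longrightarrow> x \<le> j \<and> j \<le> y) \<and> (y < i \<and> i < z \<longrightarrow> y \<le> j \<and> j \<le> z) \<and>
      (i < x \<or> z < i \<longrightarrow> j \<le> x \<or> z \<le> j))"
  proof (rule trisect_nat)
    show "c j i" if "c i j" for i j using that sym unfolding c_def by blast
    show "\<not> (c i k \<and> c j l)" if "i < j" "j < k" "k < l" "l < n" for i j k l
      using nc_nth[OF nc that(1-3)] that(4) unfolding c_def n_def by blast
    show "i < n \<and> j < n" if "c i j" for i j using that unfolding c_def by blast
    show "0 < ?p" "?p < ?q" "?q < n" using ne unfolding n_def by auto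
  qed
  then obtain x y z where xyz: "x < ?p" "?p \<le> y" "y < ?q" "?q \<le> z" "z < n"
    and cut: "\<And>i j. c i j \<Longrightarrow> (x < i \<and> i < y \<longrightarrow> x \<le> j \<and> j \<le> y) \<and> (y < i \<and> i < z \<longrightarrow> y \<le> j \<and> j \<le> z) \<and>
      (i < x \<or> z < i \<longrightarrow> j \<le> x \<or> z \<le> j)" by blast
  define a0 x0 b0 where "a0 = take x L0" and "x0 = L0 ! x" and "b0 = drop (Suc x) L0"
  define y' z' where "y' = y - ?p" and "z' = z - ?q"
  define a1 x1 b1 where "a1 = take y' L1" and "x1 = L1 ! y'" and "b1 = drop (Suc y') L1"
  define a2 x2 b2 where "a2 = take z' L2" and "x2 = L2 ! z'" and "b2 = drop (Suc z') L2"
  have L0: "L0 = a0 @ x0 # b0" and L1: "L1 = a1 @ x1 # b1" and L2: "L2 = a2 @ x2 # b2"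
    unfolding a0_def x0_def b0_def a1_def x1_def b1_def a2_def x2_def b2_def y'_def z'_def
    using xyz by (auto intro!: id_take_nth_drop simp: n_def)
  have len: "x = length a0" "y = length a0 + length b0 + length a1 + 1"
      "z = length a0 + length b0 + length a1 + length b1 + length a2 + 2"
      "n = length a0 + length b0 + length a1 + length b1 + length a2 + length b2 + 3"
    using xyz L0 L1 L2 unfolding a0_def a1_def a2_def b0_def b1_def b2_def y'_def z'_def n_def by auto
  have idx: "\<exists>j'<n. ?L ! j' = j" if "j \<in> set ?L" for j using that unfolding n_def in_set_conv_nth by blast
  show ?thesis
  proof (rule that[OF L0 L1 L2]; intro ballI impI)
    fix i j assume i: "i \<in> set (b0 @ a1)" and j: "j \<in> set ?L" and ch: "ch i j"
    have eq: "?L = (a0 @ [x0]) @ (b0 @ a1) @ (x1 # b1 @ L2)" unfolding L0 L1 by simp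
    obtain i' where i0: "length (a0 @ [x0]) \<le> i'" "i' < length (a0 @ [x0]) + length (b0 @ a1)" "?L ! i' = i"
      using set_segment_nth[OF i, of "a0 @ [x0]" "x1 # b1 @ L2"] unfolding eq by blast
    then have i': "x < i'" "i' < y" "?L ! i' = i" using len by auto
    obtain j' where j': "j' < n" "?L ! j' = j" using idx[OF j] by blast
    have "x \<le> j' \<and> j' \<le> y" using cut[of i' j'] i' j' ch xyz unfolding c_def by auto
    moreover have eq': "?L = a0 @ (x0 # b0 @ a1 @ [x1]) @ (b1 @ L2)" unfolding L0 L1 by simp
    ultimately show "j \<in> set (x0 # b0 @ a1 @ [x1])"
      using nth_segment_set[of a0 j' "x0 # b0 @ a1 @ [x1]" "b1 @ L2"] j' unfolding eq' len by auto
  next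
    fix i j assume i: "i \<in> set (b1 @ a2)" and j: "j \<in> set ?L" and ch: "ch i j"
    have eq: "?L = (L0 @ a1 @ [x1]) @ (b1 @ a2) @ (x2 # b2)" unfolding L1 L2 by simp
    obtain i' where i0: "length (L0 @ a1 @ [x1]) \<le> i'" "i' < length (L0 @ a1 @ [x1]) + length (b1 @ a2)" "?L ! i' = i"
      using set_segment_nth[OF i, of "L0 @ a1 @ [x1]" "x2 # b2"] unfolding eq by blast
    then have i': "y < i'" "i' < z" "?L ! i' = i" using len L0 by auto
    obtain j' where j': "j' < n" "?L ! j' = j" using idx[OF j] by blast
    have "y \<le> j' \<and> j' \<le> z" using cut[of i' j'] i' j' ch xyz unfolding c_def by auto
    moreover have eq': "?L = (L0 @ a1) @ (x1 # b1 @ a2 @ [x2]) @ b2" unfolding L1 L2 by simp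
    ultimately show "j \<in> set (x1 # b1 @ a2 @ [x2])"
      using nth_segment_set[of "L0 @ a1" j' "x1 # b1 @ a2 @ [x2]" b2] j' unfolding eq' len by (auto simp: L0)
  next
    fix i j assume i: "i \<in> set (b2 @ a0)" and j: "j \<in> set ?L" and ch: "ch i j"
    have eqa: "?L = [] @ a0 @ (x0 # b0 @ L1 @ L2)" unfolding L0 by simp
    have eqb: "?L = (L0 @ L1 @ a2 @ [x2]) @ b2 @ []" unfolding L2 by simp
    have "\<exists>i'<n. (i' < x \<or> z < i') \<and> ?L ! i' = i"
    proof (cases "i \<in> set a0")
      case True
      obtain i' where "i' < length ([] :: 'a list) + length a0" "?L ! i' = i"
        using set_segment_nth[OF True, of "[]" "x0 # b0 @ L1 @ L2"] unfolding eqa by blast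
      then show ?thesis using len by (intro exI[of _ i']) auto
    next
      case False
      then have "i \<in> set b2" using i by simp
      from set_segment_nth[OF this, of "L0 @ L1 @ a2 @ [x2]" "[]"]
      obtain i' where i0: "length (L0 @ L1 @ a2 @ [x2]) \<le> i'" "i' < length (L0 @ L1 @ a2 @ [x2]) + length b2" "?L ! i' = i"
        unfolding eqb by blast
      then show ?thesis using len L0 L1 by (intro exI[of _ i']) auto
    qed
    then obtain i' where i': "i' < n" "i' < x \<or> z < i'" "?L ! i' = i" by blast
    obtain j' where j': "j' < n" "?L ! j' = j" using idx[OF j] by blast
    have "j' \<le> x \<or> z \<le> j'" using cut[of i' j'] i' j' ch unfolding c_def by auto
    moreover have e1: "?L = [] @ (a0 @ [x0]) @ (b0 @ L1 @ L2)" unfolding L0 by simp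
    moreover have e2: "?L = (L0 @ L1 @ a2) @ (x2 # b2) @ []" unfolding L2 by simp
    ultimately show "j \<in> set (x2 # b2 @ a0 @ [x0])"
    proof (elim disjE)
      assume "j' \<le> x"
      then have "j \<in> set (a0 @ [x0])"
        using nth_segment_set[of "[]" j' "a0 @ [x0]" "b0 @ L1 @ L2"] j' unfolding e1 len by auto
      then show ?thesis by auto
    next
      assume "z \<le> j'"
      then have "j \<in> set (x2 # b2)"
        using nth_segment_set[of "L0 @ L1 @ a2" j' "x2 # b2" "[]"] j' unfolding e2 len by (auto simp: L0 L1)
      then show ?thesis by auto
    qed
  qed
qed

text \<open>The cut of a polygon with only two non-empty blocks: \<open>f\<close> and
  \<open>e\<close> are two of the three points, and \<open>y\<close> is the last inner point joined
  to \<open>f\<close>. A chord from before \<open>y\<close> to after \<open>y\<close> would cross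
  the chord from \<open>f\<close> to \<open>y\<close>, and no inner point after \<open>y\<close> is
  joined to \<open>f\<close>. If \<open>f\<close> has no such chord, the first inner point will
  do.\<close>

lemma apex:
  assumes sym: "\<And>x y. ch x y \<Longrightarrow> ch y x" and nc: "nc ch (f # M @ [e])" and M: "M \<noteq> []" and d: "distinct (f # M @ [e])"
  obtains m1 y m2 where "M = m1 @ y # m2"
    "\<And>i j. i \<in> set m1 \<Longrightarrow> j \<in> set (f # M @ [e]) \<Longrightarrow> ch i j \<Longrightarrow> j \<in> set (f # m1 @ [y])"
    "\<And>i j. i \<in> set m2 \<Longrightarrow> j \<in> set (f # M @ [e]) \<Longrightarrow> ch i j \<Longrightarrow> j \<in> set (y # m2 @ [e])"
proof (cases "\<exists>m\<in>set M. ch f m")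
  case True
  then obtain m1 y m2 where s: "M = m1 @ y # m2" "ch f y" "\<forall>z\<in>set m2. \<not> ch f z"
    using split_list_last_prop[of M "ch f"] by blast
  have x: False if i: "i \<in> set m1" and j: "j \<in> set (m2 @ [e])" and c: "ch i j" for i j
  proof -
    have "subseq [i] m1" "subseq [j] (m2 @ [e])" using i j by (simp_all only: subseq_singleton_left)
    then have "subseq ([f] @ [i] @ [y] @ [j]) ([f] @ m1 @ [y] @ (m2 @ [e]))"
      by (intro list_emb_append_mono) auto
    then have "subseq [f, i, y, j] (f # M @ [e])" unfolding s(1) by simp
    then show False using nc s(2) c unfolding nc_def by blast
  qed
  show ?thesis
  proof (rule that[OF s(1)])
    fix i j assume "i \<in> set m1" "j \<in> set (f # M @ [e])" "ch i j"
    then show "j \<in> set (f # m1 @ [y])" using x[of i j] unfolding s(1) by auto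
  next
    fix i j assume "i \<in> set m2" "j \<in> set (f # M @ [e])" "ch i j"
    then show "j \<in> set (y # m2 @ [e])" using x[of j i] s(3) sym unfolding s(1) by auto
  qed
next
  case False
  obtain y m2 where m: "M = [] @ y # m2" using M by (cases M) auto
  show ?thesis
  proof (rule that[OF m])
    fix i j assume "i \<in> set m2" "j \<in> set (f # M @ [e])" "ch i j"
    then show "j \<in> set (y # m2 @ [e])" using False sym unfolding m by auto
  qed auto
qed

section \<open>From contours to words\<close>

definition vis :: "nat \<Rightarrow> nat list \<Rightarrow> nat list \<Rightarrow> bool" where
  "vis k \<rho> \<pi> \<longleftrightarrow> (\<exists>\<tau>. \<pi> = \<rho> @ k # \<tau> \<and> k \<notin> set \<tau>)"

lemma vis_wadj: "vis k \<rho> \<pi> \<Longrightarrow> wadj \<pi> \<rho>"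
  unfolding vis_def wadj_def by blast

lemma vis_snoc: "vis k \<rho> \<pi> \<Longrightarrow> s \<noteq> k \<Longrightarrow> vis k \<rho> (\<pi> @ [s])"
  unfolding vis_def by auto

lemma vis_self: "vis k \<pi> (\<pi> @ [k])"
  unfolding vis_def by auto

text \<open>An end of \<open>P\<close> inside \<open>Lk\<close> is a point of \<open>X\<close>,
  which \<open>v\<close> avoids, so the contiguous \<open>v\<close> cannot reach across it.\<close>

lemma segment_inside:
  assumes P: "Lk = u @ P @ w" "u = [] \<or> hd P \<in> X" "w = [] \<or> last P \<in> X" "P \<noteq> []" "distinct Lk"
    and v: "Lk = a @ v @ c" "set v \<inter> X = {}" "set v \<inter> set P \<noteq> {}"
  shows "\<exists>a' c'. P = a' @ v @ c'"
proof -
  have hl: "hd P \<notin> set v \<or> u = []" "last P \<notin> set v \<or> w = []" using P v by auto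
  define ia where "ia = length a" define n where "n = length v"
  have vn: "v = take n (drop ia Lk)" unfolding v(1) ia_def n_def by simp
  obtain e where e: "e \<in> set v" "e \<in> set P" using v(3) by blast
  obtain m where m: "m < n" "v ! m = e" using e(1) unfolding n_def by (auto simp: in_set_conv_nth)
  obtain m' where m': "m' < length P" "P ! m' = e" using e(2) by (auto simp: in_set_conv_nth)
  have vi: "Lk ! (ia + i) = v ! i" if "i < n" for i using that unfolding v(1) ia_def n_def by (simp add: nth_append)
  have Pi: "Lk ! (length u + i) = P ! i" if "i < length P" for i using that unfolding P(1) by (simp add: nth_append)
  have bounds: "ia + n \<le> length Lk" unfolding v(1) ia_def n_def by simp
  have "ia + m = length u + m'"
    using nth_eq_iff_index_eq[OF P(5), of "ia + m" "length u + m'"] vi[OF m(1)] Pi[OF m'(1)] m m' bounds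
    unfolding P(1) by simp
  have lo: "length u \<le> ia"
  proof (rule ccontr)
    assume c: "\<not> length u \<le> ia"
    then have "length u - ia < n" using \<open>ia + m = length u + m'\<close> m by simp
    then have "v ! (length u - ia) = P ! 0" using vi[of "length u - ia"] Pi[of 0] c m' by (cases P) auto
    then have "hd P \<in> set v" using \<open>length u - ia < n\<close> P(4) unfolding n_def by (metis hd_conv_nth nth_mem)
    then show False using hl c by auto
  qed
  have hi: "ia + n \<le> length u + length P"
  proof (rule ccontr)
    assume c: "\<not> ia + n \<le> length u + length P"
    let ?i = "length u + length P - 1 - ia"
    have i: "?i < n" "ia + ?i = length u + (length P - 1)" using c \<open>ia + m = length u + m'\<close> m m' by auto
    then have "v ! ?i = P ! (length P - 1)" using vi[of ?i] Pi[of "length P - 1"] m' by simp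
    then have "last P \<in> set v" using i P(4) unfolding n_def by (metis last_conv_nth nth_mem)
    then have "w = []" using hl by blast
    then show False using c bounds unfolding P(1) by simp
  qed
  have "v = take n (drop (ia - length u) P)"
  proof (rule nth_equalityI)
    show "length v = length (take n (drop (ia - length u) P))" using lo hi unfolding n_def by simp
    fix i assume "i < length v"
    then have i: "i < n" unfolding n_def by simp
    have "v ! i = P ! (ia - length u + i)" using vi[OF i] Pi[of "ia - length u + i"] lo hi i by simp
    then show "v ! i = take n (drop (ia - length u) P) ! i" using i lo hi by simp
  qed
  then have "P = take (ia - length u) P @ v @ drop n (drop (ia - length u) P)"
    by (metis append_take_drop_id)
  then show ?thesis by blast
qed

text \<open>\<open>L\<close> lists the corners met when walking around a tree with parent function \<open>par\<close>, \<open>tl\<close> gives the vertex of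
  a corner, and the chords are the edges outside the tree. \<open>Z\<close> is an ancestor-closed set of vertices
  that are left out.\<close>

locale contour =
  fixes par :: "'v \<Rightarrow> 'v" and Z :: "'v set" and adj :: "'v \<Rightarrow> 'v \<Rightarrow> bool"
    and L :: "'p list" and tl :: "'p \<Rightarrow> 'v" and ch :: "'p \<Rightarrow> 'p \<Rightarrow> bool"
  assumes adj_sym: "adj u v \<Longrightarrow> adj v u"
    and Z_up: "v \<in> Z \<Longrightarrow> par v \<in> Z"
    and ch_sym: "ch x y \<Longrightarrow> ch y x"
    and L_distinct: "distinct L" and L_nc: "nc ch L"
    and L_seg: "t \<notin> Z \<Longrightarrow> \<exists>u v w. L = u @ v @ w \<and> set v = {i \<in> set L. \<exists>n. (par ^^ n) (tl i) = t}"
    and corner: "t \<notin> Z \<Longrightarrow> t \<in> tl ` set L"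
    and edge: "u \<notin> Z \<Longrightarrow> v \<notin> Z \<Longrightarrow> adj u v \<Longrightarrow>
      par u = v \<or> par v = u \<or> (\<exists>i\<in>set L. \<exists>j\<in>set L. tl i = u \<and> tl j = v \<and> ch i j)"
begin

definition anc :: "'v \<Rightarrow> 'v \<Rightarrow> bool" where "anc v t \<longleftrightarrow> (\<exists>n. (par ^^ n) v = t)"
definition pos :: "'v \<Rightarrow> 'p set" where "pos t = {i \<in> set L. anc (tl i) t}"
definition seg :: "'p list \<Rightarrow> 'v \<Rightarrow> bool" where "seg P t \<longleftrightarrow> (\<exists>u v w. P = u @ v @ w \<and> set v = pos t)"
text \<open>The first vertex of \<open>R\<close> on the way up from \<open>v\<close>; its word
  belongs to an earlier cut that still bounds the region at the corners of \<open>v\<close>.\<close>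

definition fstrm :: "'v set \<Rightarrow> 'v \<Rightarrow> 'v \<Rightarrow> bool" where
  "fstrm R v f \<longleftrightarrow> (\<exists>n. (par ^^ n) v = f \<and> f \<in> R \<and> (\<forall>m<n. (par ^^ m) v \<notin> R))"
text \<open>Vertices of \<open>Z\<close> carry no meaningful word and are exempt.\<close>

definition sees :: "'p list \<Rightarrow> nat \<Rightarrow> nat list \<Rightarrow> 'v set \<Rightarrow> ('v \<Rightarrow> nat list) \<Rightarrow> bool" where
  "sees P k \<pi> R h \<longleftrightarrow> (\<forall>i\<in>set P. \<forall>f. fstrm R (tl i) f \<and> f \<notin> Z \<longrightarrow> vis k (h f) \<pi>)"
definition edges_in :: "'p set \<Rightarrow> 'v set \<Rightarrow> bool" where
  "edges_in S R \<longleftrightarrow> (\<forall>u v. u \<notin> R \<and> v \<notin> Z \<and> adj u v \<and> pos u \<inter> S \<noteq> {} \<longrightarrow>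
     par u = v \<or> par v = u \<or> (\<exists>i\<in>S. \<exists>j\<in>S. tl i = u \<and> tl j = v \<and> ch i j))"
definition up_closed :: "'v set \<Rightarrow> bool" where "up_closed R \<longleftrightarrow> Z \<subseteq> R \<and> (\<forall>v\<in>R. par v \<in> R)"

text \<open>A region is a part of the contour bounded by at most three vertical tree paths, on which its three
  blocks of corners see the words of the neighbouring regions by the letters \<open>a\<close>, \<open>b\<close>, \<open>c\<close>.\<close>

definition region :: "'p list \<Rightarrow> 'p list \<Rightarrow> 'p list \<Rightarrow> nat \<Rightarrow> nat \<Rightarrow> nat \<Rightarrow> nat list \<Rightarrow> 'v set \<Rightarrow> ('v \<Rightarrow> nat list) \<Rightarrow> bool" where
  "region L0 L1 L2 a b c \<pi> R h \<longleftrightarrow>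
     distinct [a, b, c] \<and> {a, b, c} \<subseteq> {0, 1, 2} \<and> up_closed R \<and>
     distinct (L0 @ L1 @ L2) \<and> set (L0 @ L1 @ L2) \<subseteq> set L \<and> nc ch (L0 @ L1 @ L2) \<and>
     sees L0 a \<pi> R h \<and> sees L1 b \<pi> R h \<and> sees L2 c \<pi> R h \<and>
     (\<forall>t. t \<notin> R \<and> pos t \<inter> set (L0 @ L1 @ L2) \<noteq> {} \<longrightarrow> seg L0 t \<or> seg L1 t \<or> seg L2 t) \<and>
     edges_in (set (L0 @ L1 @ L2)) R"

text \<open>Adjacent words are required towards every neighbour outside \<open>Z\<close>, including
  those in \<open>R\<close> whose words were fixed earlier. The common prefix \<open>\<pi>\<close>
  keeps the fibres of different arcs apart.\<close>

definition solves :: "'p set \<Rightarrow> nat list \<Rightarrow> 'v set \<Rightarrow> ('v \<Rightarrow> nat list) \<Rightarrow> ('v \<Rightarrow> nat list) \<Rightarrow> bool" where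
  "solves S \<pi> R h h' \<longleftrightarrow> (\<forall>v\<in>R. h' v = h v) \<and>
     (\<forall>u. u \<notin> R \<and> pos u \<inter> S \<noteq> {} \<longrightarrow> (\<exists>\<tau>. h' u = \<pi> @ \<tau> \<and> set \<tau> \<subseteq> {0, 1, 2})) \<and>
     (\<forall>u v. u \<notin> R \<and> pos u \<inter> S \<noteq> {} \<and> v \<notin> Z \<and> adj u v \<longrightarrow> wadj (h' u) (h' v)) \<and>
     (\<forall>\<omega>. \<exists>x::nat \<Rightarrow> 'v. \<forall>u. u \<notin> R \<and> pos u \<inter> S \<noteq> {} \<and> h' u = \<omega> \<longrightarrow> (\<exists>j<3. anc (x j) u))"

lemma anc_refl [simp]: "anc v v" unfolding anc_def by (intro exI[of _ 0]) simp

lemma anc_trans: "anc u v \<Longrightarrow> anc v t \<Longrightarrow> anc u t"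
  unfolding anc_def by (metis funpow_add o_apply)

lemma anc_par [simp]: "anc v (par v)" unfolding anc_def by (intro exI[of _ 1]) simp

lemma anc_linear: "anc v s \<Longrightarrow> anc v t \<Longrightarrow> anc s t \<or> anc t s"
proof -
  assume "anc v s" "anc v t"
  then obtain m n where mn: "(par ^^ m) v = s" "(par ^^ n) v = t" unfolding anc_def by blast
  have "anc s t" if "m \<le> n"
    using mn that unfolding anc_def by (metis funpow_add le_add_diff_inverse2 o_apply)
  moreover have "anc t s" if "n \<le> m"
    using mn that unfolding anc_def by (metis funpow_add le_add_diff_inverse2 o_apply)
  ultimately show ?thesis by linarith
qed

lemma up_closed_anc: "up_closed R \<Longrightarrow> v \<in> R \<Longrightarrow> anc v t \<Longrightarrow> t \<in> R"
proof -
  assume R: "up_closed R" "v \<in> R" "anc v t"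
  have "(par ^^ n) v \<in> R" for n using R unfolding up_closed_def by (induction n) auto
  then show ?thesis using R unfolding anc_def by blast
qed

lemma pos_mono: "anc t s \<Longrightarrow> pos t \<subseteq> pos s"
  unfolding pos_def using anc_trans by blast

lemma pos_corner: "t \<notin> Z \<Longrightarrow> \<exists>i. i \<in> pos t \<and> tl i = t"
  using corner[of t] unfolding pos_def by auto

lemma region_pos_sub:
  assumes "region L0 L1 L2 a b c \<pi> R h" "t \<notin> R" "pos t \<inter> set (L0 @ L1 @ L2) \<noteq> {}"
  shows "pos t \<subseteq> set (L0 @ L1 @ L2)"
proof -
  have "seg L0 t \<or> seg L1 t \<or> seg L2 t" using assms unfolding region_def by blast
  then show ?thesis unfolding seg_def by auto
qed

lemma region_rotate:
  assumes "region L0 L1 L2 a b c \<pi> R h" shows "region L1 L2 L0 b c a \<pi> R h"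
proof -
  have s: "set (L1 @ L2 @ L0) = set (L0 @ L1 @ L2)" by auto
  have "nc ch ((L1 @ L2) @ L0)"
    by (rule nc_rotate[OF ch_sym]) (use assms in \<open>auto simp: region_def\<close>)
  then show ?thesis using assms unfolding region_def s by auto
qed

lemma region_nbr:
  assumes r: "region L0 L1 L2 a b c \<pi> R h" and uv: "u \<notin> R" "v \<notin> R" "adj u v" "pos u \<inter> set (L0 @ L1 @ L2) \<noteq> {}"
  shows "pos v \<inter> set (L0 @ L1 @ L2) \<noteq> {}"
proof -
  let ?S = "set (L0 @ L1 @ L2)"
  have vZ: "v \<notin> Z" "u \<notin> Z" using r uv unfolding region_def up_closed_def by auto
  have sub: "pos u \<subseteq> ?S" using region_pos_sub[OF r uv(1,4)] .
  have "par u = v \<or> par v = u \<or> (\<exists>i\<in>?S. \<exists>j\<in>?S. tl i = u \<and> tl j = v \<and> ch i j)"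
    using r uv vZ unfolding region_def edges_in_def by blast
  then show ?thesis
  proof (elim disjE bexE conjE)
    assume "par u = v"
    then have "pos u \<subseteq> pos v" using pos_mono[of u v] by auto
    then show ?thesis using uv by blast
  next
    assume "par v = u"
    then have "pos v \<subseteq> pos u" using pos_mono[of v u] by auto
    then show ?thesis using pos_corner[OF vZ(1)] sub by blast
  next
    fix i j assume "j \<in> ?S" "tl j = v"
    moreover have "?S \<subseteq> set L" using r unfolding region_def by blast
    ultimately have "j \<in> pos v" unfolding pos_def by auto
    then show ?thesis using \<open>j \<in> ?S\<close> by blast
  qed
qed

text \<open>The vertical paths of a cut, each followed upwards from its corner until it runs into
  \<open>R\<close>.\<close>

definition legs :: "'v set \<Rightarrow> 'p set \<Rightarrow> 'v set" where
  "legs R X = {v. v \<notin> R \<and> (\<exists>x\<in>X. anc (tl x) v)}"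

definition part :: "'p set \<Rightarrow> 'p list \<Rightarrow> 'p list \<Rightarrow> bool" where
  "part X Lk P \<longleftrightarrow> P = [] \<or> (\<exists>u w. Lk = u @ P @ w \<and> (u = [] \<or> hd P \<in> X) \<and> (w = [] \<or> last P \<in> X))"

lemma legs_up: "up_closed R \<Longrightarrow> up_closed (R \<union> legs R X)"
  unfolding up_closed_def legs_def using anc_trans anc_par by blast

lemma not_leg_pos: "t \<notin> R \<union> legs R X \<Longrightarrow> pos t \<inter> X = {}"
  unfolding legs_def pos_def by blast

text \<open>Corners below no leg still meet the same vertex of \<open>R\<close> first, and a new
  letter other than \<open>k\<close> leaves side \<open>k\<close> visible.\<close>

lemma sees_legs_off:
  assumes s: "sees P k \<pi> R h" and off: "\<And>i y. i \<in> set Q \<Longrightarrow> y \<in> legs R X \<Longrightarrow> i \<notin> pos y" "set Q \<subseteq> set P" "set P \<subseteq> set L" "n \<noteq> k"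
  shows "sees Q k (\<pi> @ [n]) (R \<union> legs R X) (\<lambda>v. if v \<in> legs R X then \<pi> else h v)"
  unfolding sees_def
proof (intro ballI allI impI)
  fix i f assume i: "i \<in> set Q" and f: "fstrm (R \<union> legs R X) (tl i) f \<and> f \<notin> Z"
  then have "anc (tl i) f" unfolding fstrm_def anc_def by blast
  then have "f \<notin> legs R X" using off i unfolding pos_def by blast
  then have "fstrm R (tl i) f" using f unfolding fstrm_def by blast
  then have "vis k (h f) \<pi>" using s i off f unfolding sees_def by blast
  then show "vis k ((\<lambda>v. if v \<in> legs R X then \<pi> else h v) f) (\<pi> @ [n])"
    using \<open>f \<notin> legs R X\<close> vis_snoc off by simp
qed

text \<open>Corners below a leg now meet a leg before \<open>R\<close>; its word
  \<open>\<pi>\<close> is seen through the new letter \<open>k\<close>.\<close>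

lemma sees_legs_on:
  assumes R: "up_closed R" and on: "\<And>i. i \<in> set Q \<Longrightarrow> \<exists>y\<in>legs R X. i \<in> pos y"
  shows "sees Q k (\<pi> @ [k]) (R \<union> legs R X) (\<lambda>v. if v \<in> legs R X then \<pi> else h v)"
  unfolding sees_def
proof (intro ballI allI impI)
  fix i f assume i: "i \<in> set Q" and f: "fstrm (R \<union> legs R X) (tl i) f \<and> f \<notin> Z"
  obtain y where y: "y \<in> legs R X" "anc (tl i) y" using on[OF i] unfolding pos_def by blast
  obtain n where n: "(par ^^ n) (tl i) = f" "f \<in> R \<union> legs R X" "\<forall>m<n. (par ^^ m) (tl i) \<notin> R \<union> legs R X"
    using f unfolding fstrm_def by blast
  obtain m where m: "(par ^^ m) (tl i) = y" using y unfolding anc_def by blast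
  have "n \<le> m" using n(3) m y(1) by (metis UnCI not_le)
  then have "anc f y" using n(1) m unfolding anc_def by (metis funpow_add le_add_diff_inverse2 o_apply)
  then have "f \<notin> R" using up_closed_anc[OF R] y(1) unfolding legs_def by blast
  then have "f \<in> legs R X" using n by blast
  then show "vis k ((\<lambda>v. if v \<in> legs R X then \<pi> else h v) f) (\<pi> @ [k])" using vis_self by simp
qed

text \<open>A vertex above \<open>y\<close> is on a leg or in \<open>R\<close>, so \<open>t\<close>
  must lie below \<open>y\<close>.\<close>

lemma leg_pos_dichotomy:
  assumes "t \<notin> R \<union> legs R X" "y \<in> legs R X" "i \<in> pos t" "i \<in> pos y"
  shows "pos t \<subseteq> pos y"
proof -
  have "anc t y \<or> anc y t" using assms(3,4) anc_linear unfolding pos_def by blast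
  moreover have "\<not> anc y t" using assms(1,2) anc_trans unfolding legs_def by blast
  ultimately show ?thesis using pos_mono by blast
qed

end

lemma nth_mem_segment:
  assumes "distinct (u @ v @ w)" "k < length (u @ v @ w)"
  shows "(u @ v @ w) ! k \<in> set v \<longleftrightarrow> length u \<le> k \<and> k < length u + length v"
proof
  assume "(u @ v @ w) ! k \<in> set v"
  then obtain i where i: "length u \<le> i" "i < length u + length v" "(u @ v @ w) ! i = (u @ v @ w) ! k"
    using set_segment_nth[of _ v u w] by blast
  then have "i = k" using nth_eq_iff_index_eq[OF assms(1), of i k] assms(2) by simp
  then show "length u \<le> k \<and> k < length u + length v" using i by simp
qed (use nth_segment_set[of u k v w] in simp)

lemma segment_convex:
  assumes d: "distinct (u @ v @ w)" and eq: "u @ v @ w = A @ e1 # B @ e2 # C"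
    and e: "e1 \<in> set v" "e2 \<in> set v"
  shows "set B \<subseteq> set v"
proof
  fix x assume "x \<in> set B"
  then obtain m where m: "m < length B" "B ! m = x" by (auto simp: in_set_conv_nth)
  let ?L = "u @ v @ w"
  have n: "?L ! length A = e1" "?L ! (length A + Suc (length B)) = e2" "?L ! (length A + Suc m) = x"
    unfolding eq using m by (auto simp: nth_append)
  have l: "length A + Suc (length B) < length ?L" unfolding eq by simp
  have "length u \<le> length A" using nth_mem_segment[OF d, of "length A"] n(1) e(1) l by auto
  moreover have "length A + Suc (length B) < length u + length v"
    using nth_mem_segment[OF d, of "length A + Suc (length B)"] n(2) e(2) l by auto
  ultimately have "?L ! (length A + Suc m) \<in> set v"
    using nth_mem_segment[OF d, of "length A + Suc m"] l m by auto
  then show "x \<in> set v" using n by simp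
qed

text \<open>If \<open>Pr\<close> spreads from each element to one of the two ends of the list, the
  elements violating it are contiguous. The last clause fixes the degenerate split, with everything
  in \<open>R1\<close>.\<close>

lemma prefix_suffix_filter:
  assumes "\<And>ys i zs. xs = ys @ i # zs \<Longrightarrow> Pr i \<Longrightarrow> (\<forall>y\<in>set ys. Pr y) \<or> (\<forall>z\<in>set zs. Pr z)"
  shows "\<exists>R1 R3. xs = R1 @ filter (\<lambda>x. \<not> Pr x) xs @ R3 \<and> (\<forall>x\<in>set R1. Pr x) \<and> (\<forall>x\<in>set R3. Pr x) \<and>
    (filter (\<lambda>x. \<not> Pr x) xs = [] \<longrightarrow> R3 = [])"
proof -
  define R1 where "R1 = takeWhile Pr xs"
  define r where "r = dropWhile Pr xs"
  define R2 where "R2 = takeWhile (\<lambda>x. \<not> Pr x) r"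
  define R3 where "R3 = dropWhile (\<lambda>x. \<not> Pr x) r"
  have xs: "xs = R1 @ R2 @ R3" unfolding R1_def R2_def R3_def r_def by simp
  have P1: "\<forall>x\<in>set R1. Pr x" unfolding R1_def by (auto dest: set_takeWhileD)
  have P2: "\<forall>x\<in>set R2. \<not> Pr x" unfolding R2_def by (auto dest: set_takeWhileD)
  have P3: "\<forall>x\<in>set R3. Pr x"
  proof (cases R3)
    case (Cons i zs)
    have i: "Pr i" using Cons unfolding R3_def by (metis dropWhile_eq_Cons_conv)
    have rne: "r \<noteq> []" using Cons unfolding R3_def by auto
    have "\<not> Pr (hd r)" using rne unfolding r_def by (rule hd_dropWhile)
    then have "hd r \<in> set R2" using rne unfolding R2_def by (cases r) auto
    then have "\<not> (\<forall>y\<in>set (R1 @ R2). Pr y)" using P2 by auto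
    moreover have "xs = (R1 @ R2) @ i # zs" using xs Cons by simp
    ultimately have "\<forall>z\<in>set zs. Pr z" using assms i by blast
    then show ?thesis using Cons i by simp
  qed simp
  have f: "filter (\<lambda>x. \<not> Pr x) xs = R2"
    unfolding xs using P1 P2 P3 by (simp add: filter_empty_conv filter_id_conv)
  have "R2 = [] \<longrightarrow> R3 = []"
  proof
    assume e: "R2 = []"
    show "R3 = []"
    proof (cases r)
      case (Cons a b)
      then have "\<not> Pr a" using hd_dropWhile[of Pr xs] unfolding r_def by auto
      then show ?thesis using e Cons unfolding R2_def by simp
    qed (simp add: R3_def)
  qed
  then show ?thesis using xs P1 P3 f by (intro exI[of _ R1] exI[of _ R3]) simp
qed

lemma segment_of_ends:
  assumes eq: "a @ v @ c = R1 @ F @ R3" and v: "v \<noteq> []" and F: "F \<noteq> []" "set v \<inter> set F = {}"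
  shows "(\<exists>a' c'. R1 = a' @ v @ c') \<or> (\<exists>a' c'. R3 = a' @ v @ c')"
proof (cases "length a + length v \<le> length R1")
  case True
  have "a @ v = take (length a + length v) (R1 @ F @ R3)" unfolding eq[symmetric] by simp
  also have "\<dots> = take (length a + length v) R1" using True by simp
  finally have "R1 = (a @ v) @ drop (length a + length v) R1" by (metis append_take_drop_id)
  then show ?thesis by (metis append.assoc)
next
  case False
  show ?thesis
  proof (cases "length R1 + length F \<le> length a")
    case True
    have "v @ c = drop (length a) (R1 @ F @ R3)" unfolding eq[symmetric] by simp
    also have "\<dots> = drop (length a - length R1 - length F) R3" using True by simp
    finally have "R3 = take (length a - length R1 - length F) R3 @ v @ c" by (metis append_take_drop_id)
    then show ?thesis by blast
  next
    case F': False
    define k where "k = max (length a) (length R1)"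
    have kv: "length a \<le> k" "k < length a + length v" "length R1 \<le> k" "k < length R1 + length F"
    proof -
      show "length a \<le> k" "length R1 \<le> k" unfolding k_def by auto
      show "k < length R1 + length F" using F' F(1) unfolding k_def by (cases F) auto
      show "k < length a + length v" using v False unfolding k_def by (cases v) auto
    qed
    have "(a @ v @ c) ! k \<in> set v" using nth_segment_set[of a k v c] kv by simp
    moreover have "(R1 @ F @ R3) ! k \<in> set F" using nth_segment_set[of R1 k F R3] kv by simp
    ultimately show ?thesis using eq F by auto
  qed
qed

section \<open>The arc between two cut points as a region\<close>

context contour
begin

text \<open>To be used with \<open>v\<close> the corners below a vertex of a leg, which contain a
  cut point \<open>x\<close>. Cut points occur in \<open>P\<close> only at its ends, so by convexity
  \<open>v\<close> covers \<open>P\<close> from \<open>i\<close> to an end that is itself a cut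
  point.\<close>

lemma block_ends:
  assumes R: "up_closed R" and Lk: "distinct Lk" and P: "part X Lk P" "i \<in> set P" "P = ys @ i # zs"
    and ends: "\<forall>A x C. P = A @ x # C \<and> x \<in> X \<longrightarrow> A = [] \<or> C = []"
    and seg: "Lk = u @ v @ w" "i \<in> set v" "x \<in> set v" "x \<in> X"
  shows "(hd P \<in> X \<and> set ys \<subseteq> set v) \<or> (last P \<in> X \<and> set zs \<subseteq> set v)"
proof -
  have ne: "P \<noteq> []" using P by auto
  obtain u' w' where p: "Lk = u' @ P @ w'" "u' = [] \<or> hd P \<in> X" "w' = [] \<or> last P \<in> X"
    using P ne unfolding part_def by blast
  have d: "distinct (u @ v @ w)" using Lk seg by simp
  have conv: "set B \<subseteq> set v" if "Lk = A @ e1 # B @ e2 # C" "e1 \<in> set v" "e2 \<in> set v" for A e1 B e2 C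
    using segment_convex[OF d, of A e1 B e2 C] that seg(1) by simp
  have hdP: "P = hd P # List.tl P" using ne by simp
  have laP: "P = butlast P @ [last P]" using ne by simp
  have claim: ?thesis if x: "x \<in> set v" "x \<in> X" "x \<in> set P" for x
  proof -
    obtain A C where AC: "P = A @ x # C" using x by (meson split_list)
    then consider "A = []" | "C = []" using ends x by blast
    then show ?thesis
    proof cases
      case 1
      then have hx: "hd P = x" using AC by simp
      have "set ys \<subseteq> set v"
      proof (cases ys)
        case (Cons y ys')
        then have "y = x" using AC 1 P(3) by simp
        then have "Lk = u' @ x # ys' @ i # (zs @ w')" using p(1) P(3) Cons by simp
        then have "set ys' \<subseteq> set v" using conv x seg by blast
        then show ?thesis using Cons \<open>y = x\<close> x by simp
      qed simp
      then show ?thesis using hx x by blast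
    next
      case 2
      then have lx: "last P = x" using AC by simp
      have "set zs \<subseteq> set v"
      proof (cases zs rule: rev_cases)
        case (snoc zs' z)
        then have "z = x" using AC 2 P(3) by simp
        then have "Lk = (u' @ ys) @ i # zs' @ x # w'" using p(1) P(3) snoc by simp
        then have "set zs' \<subseteq> set v" using conv x seg by blast
        then show ?thesis using snoc \<open>z = x\<close> x by simp
      qed simp
      then show ?thesis using lx x by blast
    qed
  qed
  have "x \<in> set u' \<or> x \<in> set P \<or> x \<in> set w'" using p(1) seg by (metis Un_iff set_append)
  then show ?thesis
  proof (elim disjE)
    assume "x \<in> set P"
    then show ?thesis using claim seg by blast
  next
    assume xu: "x \<in> set u'"
    then have hX: "hd P \<in> X" using p by auto
    obtain A C where AC: "u' = A @ x # C" using xu by (meson split_list)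
    have "hd P \<in> set v"
    proof (cases ys)
      case Nil
      then show ?thesis using P seg by simp
    next
      case (Cons y ys')
      then have "Lk = A @ x # (C @ y # ys') @ i # (zs @ w')" using p(1) P(3) AC by simp
      then have "set (C @ y # ys') \<subseteq> set v" using conv seg by blast
      then show ?thesis using P(3) Cons by simp
    qed
    then show ?thesis using claim hX ne by auto
  next
    assume xw: "x \<in> set w'"
    then have lX: "last P \<in> X" using p by auto
    obtain A C where AC: "w' = A @ x # C" using xw by (meson split_list)
    have "last P \<in> set v"
    proof (cases zs rule: rev_cases)
      case Nil
      then show ?thesis using P seg by simp
    next
      case (snoc zs' z)
      then have "Lk = (u' @ ys) @ i # (zs' @ z # A) @ x # C" using p(1) P(3) AC by simp
      then have "set (zs' @ z # A) \<subseteq> set v" using conv seg by blast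
      then show ?thesis using P(3) snoc by simp
    qed
    then show ?thesis using claim lX ne by auto
  qed
qed

text \<open>\<open>P\<close> and \<open>Q\<close> are the parts of two blocks between two cut
  points. The corners below legs form a beginning and an end of \<open>P @ Q\<close>; read
  cyclically they are one stretch, the new third block, which sees the legs through the third letter
  \<open>s\<close>. The remaining corners keep the letters \<open>p\<close> and
  \<open>q\<close>.\<close>

lemma arc_region:
  assumes r: "region L0 L1 L2 a b c \<pi> R h" and X: "X \<subseteq> set (L0 @ L1 @ L2)"
    and blocks: "(Lp, p) \<in> {(L0, a), (L1, b), (L2, c)}" "(Lq, q) \<in> {(L0, a), (L1, b), (L2, c)}"
      "part X Lp P" "part X Lq Q" "p \<noteq> q" "s \<in> {a, b, c}" "s \<noteq> p" "s \<noteq> q"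
    and nc: "nc ch (P @ Q)"
    and ends: "\<And>ys x zs. P @ Q = ys @ x # zs \<Longrightarrow> x \<in> X \<Longrightarrow> ys = [] \<or> zs = []"
    and cl: "\<And>i j. i \<in> set (P @ Q) - X \<Longrightarrow> j \<in> set (L0 @ L1 @ L2) \<Longrightarrow> ch i j \<Longrightarrow> j \<in> set (P @ Q)"
  shows "\<exists>M0 M1 M2. region M0 M1 M2 p q s (\<pi> @ [s]) (R \<union> legs R X) (\<lambda>v. if v \<in> legs R X then \<pi> else h v) \<and>
    set (M0 @ M1 @ M2) = set (P @ Q) \<and> length (M0 @ M1 @ M2) = length (P @ Q)"
proof -
  let ?S = "set (L0 @ L1 @ L2)"
  have R: "up_closed R" and dL: "distinct (L0 @ L1 @ L2)" and SL: "?S \<subseteq> set L"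
    and lett: "distinct [a, b, c]" "{a, b, c} \<subseteq> {0, 1, 2}" using r unfolding region_def by auto
  have segs: "seg L0 t \<or> seg L1 t \<or> seg L2 t" if "t \<notin> R" "pos t \<inter> ?S \<noteq> {}" for t
    using r that unfolding region_def by blast
  have sp: "sees Lp p \<pi> R h" "sees Lq q \<pi> R h" using r blocks(1,2) unfolding region_def by auto
  have subL: "set Lp \<subseteq> ?S" "set Lq \<subseteq> ?S" "distinct Lp" "distinct Lq" using blocks(1,2) dL by auto
  have disj: "set Lp \<inter> set Lq = {}" using blocks(1,2,5) dL lett by auto
  have PsubL: "set P \<subseteq> set Lp" "set Q \<subseteq> set Lq" using blocks(3,4) unfolding part_def by auto
  have dPQ: "distinct (P @ Q)"
    using blocks(3,4) subL disj PsubL unfolding part_def by auto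
  have same_block: "Lk = Lk'" if "Lk \<in> {L0, L1, L2}" "Lk' \<in> {L0, L1, L2}" "e \<in> set Lk" "e \<in> set Lk'" for e Lk Lk'
    using that dL by auto
  have LpB: "Lp \<in> {L0, L1, L2}" "Lq \<in> {L0, L1, L2}" using blocks by auto
  define PY where "PY i \<longleftrightarrow> (\<exists>y\<in>legs R X. i \<in> pos y)" for i
  have seg_block: "\<exists>u v w. Lk = u @ v @ w \<and> set v = pos t"
    if t: "t \<notin> R" "e \<in> pos t" "e \<in> set Lk" "Lk \<in> {L0, L1, L2}" for t e Lk
  proof -
    have "pos t \<inter> ?S \<noteq> {}" using t by auto
    then obtain Lk' where Lk': "Lk' \<in> {L0, L1, L2}" "seg Lk' t" using segs[OF t(1)] by blast
    then have "e \<in> set Lk'" using t unfolding seg_def by auto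
    then have "Lk' = Lk" using same_block Lk' t by blast
    then show ?thesis using Lk' unfolding seg_def by simp
  qed
  have block_claim: "(hd B \<in> X \<and> (\<forall>y\<in>set ys. PY y)) \<or> (last B \<in> X \<and> (\<forall>y\<in>set zs. PY y))"
    if B: "part X Lk B" "Lk \<in> {L0, L1, L2}" "distinct Lk" "B = ys @ i # zs" "PY i"
      and e: "\<forall>A x C. B = A @ x # C \<and> x \<in> X \<longrightarrow> A = [] \<or> C = []" for B Lk ys i zs
  proof -
    obtain y where y: "y \<in> legs R X" "i \<in> pos y" using B(5) unfolding PY_def by blast
    then obtain x where x: "x \<in> X" "anc (tl x) y" and yR: "y \<notin> R" unfolding legs_def by blast
    have xp: "x \<in> pos y" using x X SL unfolding pos_def by blast
    have "i \<in> set Lk" using B(1,4) unfolding part_def by auto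
    then obtain u v w where v: "Lk = u @ v @ w" "set v = pos y" using seg_block[OF yR y(2) _ B(2)] by blast
    have "(hd B \<in> X \<and> set ys \<subseteq> set v) \<or> (last B \<in> X \<and> set zs \<subseteq> set v)"
      by (rule block_ends[OF R B(3,1) _ B(4) e v(1), of x]) (use B(4) v(2) y(2) xp x(1) in auto)
    moreover have "PY z" if "z \<in> set v" for z using that v(2) y(1) unfolding PY_def by blast
    ultimately show ?thesis by blast
  qed
  \<comment> \<open>Within one part this is \<open>block_ends\<close>. At the seam of
    \<open>P\<close> and \<open>Q\<close> a cut point can stand only if one side of it is empty, by
    \<open>ends\<close>; then the claim is trivial or already proved.\<close>
  have pre_suf: "(\<forall>y\<in>set ys. PY y) \<or> (\<forall>z\<in>set zs. PY z)" if eq: "P @ Q = ys @ i # zs" and i: "PY i" for ys i zs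
  proof (cases "length ys < length P")
    case True
    have zs: "zs = drop (Suc (length ys)) (P @ Q)" "ys = take (length ys) (P @ Q)" "i = (P @ Q) ! length ys"
      unfolding eq by auto
    then have yP: "P = ys @ i # drop (Suc (length ys)) P"
      using True id_take_nth_drop[OF True] by (simp add: nth_append)
    define z0 where "z0 = drop (Suc (length ys)) P"
    have zz: "zs = z0 @ Q" using zs(1) True unfolding z0_def by simp
    have P: "P = ys @ i # z0" using yP unfolding z0_def .
    have e: "\<forall>A x C. P = A @ x # C \<and> x \<in> X \<longrightarrow> A = [] \<or> C = []"
    proof (intro allI impI)
      fix A x C assume "P = A @ x # C \<and> x \<in> X"
      then show "A = [] \<or> C = []" using ends[of A x "C @ Q"] by auto
    qed
    from block_claim[OF blocks(3) LpB(1) subL(3) P i e]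
    show ?thesis
    proof (elim disjE conjE)
      assume lX: "last P \<in> X" and z: "\<forall>y\<in>set z0. PY y"
      have ne: "P \<noteq> []" using P by simp
      have "P @ Q = butlast P @ last P # Q" using ne by simp
      then have "butlast P = [] \<or> Q = []" using ends lX by blast
      then show ?thesis
      proof
        assume "butlast P = []"
        then have "length P \<le> 1" by (metis One_nat_def diff_is_0_eq length_butlast list.size(3))
        then have "ys = []" unfolding P by simp
        then show ?thesis by simp
      next
        assume "Q = []"
        then show ?thesis using z zz by simp
      qed
    qed simp
  next
    case False
    have "ys @ i # zs = P @ Q" using eq by simp
    then obtain y0 where y0: "ys = P @ y0" "Q = y0 @ i # zs" using False by (auto simp: append_eq_append_conv2)
    have e: "\<forall>A x C. Q = A @ x # C \<and> x \<in> X \<longrightarrow> A = [] \<or> C = []"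
    proof (intro allI impI)
      fix A x C assume "Q = A @ x # C \<and> x \<in> X"
      then show "A = [] \<or> C = []" using ends[of "P @ A" x C] by auto
    qed
    from block_claim[OF blocks(4) LpB(2) subL(4) y0(2) i e]
    show ?thesis
    proof (elim disjE conjE)
      assume hX: "hd Q \<in> X" and z: "\<forall>y\<in>set y0. PY y"
      have "P @ Q = P @ hd Q # List.tl Q" using y0 by (cases Q) auto
      then have "P = [] \<or> List.tl Q = []" using ends hX by blast
      then show ?thesis
      proof
        assume "P = []"
        then show ?thesis using z y0 by simp
      next
        assume "List.tl Q = []"
        then have "zs = []" unfolding y0(2) by (cases y0) auto
        then show ?thesis by simp
      qed
    qed simp
  qed
  define F where "F = filter (\<lambda>x. \<not> PY x) (P @ Q)"
  obtain R1 R3 where R13: "P @ Q = R1 @ F @ R3" "\<forall>x\<in>set R1. PY x" "\<forall>x\<in>set R3. PY x" "F = [] \<longrightarrow> R3 = []"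
    using prefix_suffix_filter[of "P @ Q" PY] pre_suf unfolding F_def by blast
  \<comment> \<open>\<open>R3 @ R1\<close> is a single stretch in the cyclic order, from the end of
    the arc on to its beginning.\<close>
  define M0 M1 M2 where "M0 = filter (\<lambda>x. \<not> PY x) P" and "M1 = filter (\<lambda>x. \<not> PY x) Q" and "M2 = R3 @ R1"
  have F: "F = M0 @ M1" unfolding F_def M0_def M1_def by simp
  have len: "length (M0 @ M1 @ M2) = length (P @ Q)" unfolding R13(1) F M2_def by simp
  have st: "set (M0 @ M1 @ M2) = set (P @ Q)" unfolding R13(1) F M2_def by auto
  have SPQ: "set (P @ Q) \<subseteq> ?S" using PsubL subL by auto
  have "nc ch ((F @ R3) @ R1)"
    by (rule nc_rotate) (use ch_sym nc R13(1) in auto)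
  then have nc': "nc ch (M0 @ M1 @ M2)" unfolding F M2_def by simp
  have inner: "\<exists>a' v c'. set v = pos t \<and> v \<noteq> [] \<and> (P = a' @ v @ c' \<or> Q = a' @ v @ c')"
    if t: "t \<notin> R \<union> legs R X" "pos t \<inter> set (P @ Q) \<noteq> {}" for t
  proof -
    have tX: "pos t \<inter> X = {}" using not_leg_pos[OF t(1)] .
    obtain e where e: "e \<in> pos t" "e \<in> set (P @ Q)" using t by blast
    have go: "\<exists>a' v c'. set v = pos t \<and> v \<noteq> [] \<and> B = a' @ v @ c'"
      if B: "e \<in> set B" "part X Lk B" "Lk \<in> {L0, L1, L2}" "distinct Lk" for B Lk
    proof -
      obtain u' w' where p: "Lk = u' @ B @ w'" "u' = [] \<or> hd B \<in> X" "w' = [] \<or> last B \<in> X" "B \<noteq> []"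
        using B(1,2) unfolding part_def by (metis empty_iff empty_set)
      have "e \<in> set Lk" using p B by auto
      moreover have "t \<notin> R" using t by blast
      ultimately obtain u v w where v: "Lk = u @ v @ w" "set v = pos t" using seg_block e B(3) by blast
      obtain a' c' where "B = a' @ v @ c'"
        using segment_inside[OF p(1-4) B(4) v(1)] tX v(2) e B(1) by blast
      moreover have "v \<noteq> []" using v e by auto
      ultimately show ?thesis using v by blast
    qed
    show ?thesis
    proof (cases "e \<in> set P")
      case True
      then show ?thesis using go[OF True blocks(3) LpB(1) subL(3)] by blast
    next
      case False
      then have "e \<in> set Q" using e by simp
      then show ?thesis using go[OF _ blocks(4) LpB(2) subL(4)] by blast
    qed
  qed
  have seg': "seg M0 t \<or> seg M1 t \<or> seg M2 t" if t: "t \<notin> R \<union> legs R X" "pos t \<inter> set (P @ Q) \<noteq> {}" for t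
  proof -
    obtain a' v c' where v: "set v = pos t" "v \<noteq> []" "P = a' @ v @ c' \<or> Q = a' @ v @ c'" using inner[OF t] by blast
    show ?thesis
    proof (cases "\<exists>i\<in>set v. PY i")
      case False
      then have fv: "filter (\<lambda>x. \<not> PY x) v = v" by (simp add: filter_id_conv)
      show ?thesis using v(3)
      proof
        assume "P = a' @ v @ c'"
        then have "M0 = filter (\<lambda>x. \<not> PY x) a' @ v @ filter (\<lambda>x. \<not> PY x) c'" unfolding M0_def using fv by simp
        then show ?thesis using v(1) unfolding seg_def by blast
      next
        assume "Q = a' @ v @ c'"
        then have "M1 = filter (\<lambda>x. \<not> PY x) a' @ v @ filter (\<lambda>x. \<not> PY x) c'" unfolding M1_def using fv by simp
        then show ?thesis using v(1) unfolding seg_def by blast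
      qed
    next
      case True
      then obtain i y where i: "i \<in> pos t" "y \<in> legs R X" "i \<in> pos y" using v unfolding PY_def by blast
      then have "pos t \<subseteq> pos y" using leg_pos_dichotomy[OF t(1)] by blast
      then have allPY: "PY z" if "z \<in> set v" for z using that v(1) i unfolding PY_def by blast
      have "\<exists>a0 c0. P @ Q = a0 @ v @ c0" using v(3)
      proof
        assume "P = a' @ v @ c'" then show ?thesis by (intro exI[of _ a'] exI[of _ "c' @ Q"]) simp
      next
        assume "Q = a' @ v @ c'" then show ?thesis by (intro exI[of _ "P @ a'"] exI[of _ c']) simp
      qed
      then obtain a0 c0 where ac: "P @ Q = a0 @ v @ c0" by blast
      show ?thesis
      proof (cases "F = []")
        case True
        then have "M2 = a0 @ v @ c0" using R13 ac unfolding M2_def by simp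
        then show ?thesis using v(1) unfolding seg_def by blast
      next
        case False
        have "set v \<inter> set F = {}" using allPY unfolding F_def by auto
        then have "(\<exists>a' c'. R1 = a' @ v @ c') \<or> (\<exists>a' c'. R3 = a' @ v @ c')"
          using segment_of_ends[of a0 v c0 R1 F R3] ac R13(1) v(2) False by simp
        then show ?thesis
        proof (elim disjE exE)
          fix a1 c1 assume "R1 = a1 @ v @ c1"
          then have "M2 = (R3 @ a1) @ v @ c1" unfolding M2_def by simp
          then show ?thesis using v(1) unfolding seg_def by blast
        next
          fix a1 c1 assume "R3 = a1 @ v @ c1"
          then have "M2 = a1 @ v @ (c1 @ R1)" unfolding M2_def by simp
          then show ?thesis using v(1) unfolding seg_def by blast
        qed
      qed
    qed
  qed
  have edges': "edges_in (set (P @ Q)) (R \<union> legs R X)"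
    unfolding edges_in_def
  proof (intro allI impI)
    fix u v assume uv: "u \<notin> R \<union> legs R X \<and> v \<notin> Z \<and> adj u v \<and> pos u \<inter> set (P @ Q) \<noteq> {}"
    then have uS: "pos u \<inter> ?S \<noteq> {}" using SPQ by blast
    have pu: "pos u \<subseteq> set (P @ Q)" using inner[of u] uv by fastforce
    have "par u = v \<or> par v = u \<or> (\<exists>i\<in>?S. \<exists>j\<in>?S. tl i = u \<and> tl j = v \<and> ch i j)"
      using r uv uS unfolding region_def edges_in_def by blast
    then show "par u = v \<or> par v = u \<or> (\<exists>i\<in>set (P @ Q). \<exists>j\<in>set (P @ Q). tl i = u \<and> tl j = v \<and> ch i j)"
    proof (elim disjE bexE conjE)
      fix i j assume ij: "i \<in> ?S" "j \<in> ?S" "tl i = u" "tl j = v" "ch i j"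
      then have "i \<in> pos u" using SL unfolding pos_def by auto
      then have "i \<in> set (P @ Q) - X" using pu not_leg_pos[of u R X] uv by blast
      then have "j \<in> set (P @ Q)" using cl ij by blast
      then show ?thesis using ij \<open>i \<in> set (P @ Q) - X\<close> by blast
    qed auto
  qed
  have "sees M0 p (\<pi> @ [s]) (R \<union> legs R X) (\<lambda>v. if v \<in> legs R X then \<pi> else h v)"
    by (rule sees_legs_off[OF sp(1)]) (use PsubL subL SL blocks in \<open>auto simp: M0_def PY_def\<close>)
  moreover have "sees M1 q (\<pi> @ [s]) (R \<union> legs R X) (\<lambda>v. if v \<in> legs R X then \<pi> else h v)"
    by (rule sees_legs_off[OF sp(2)]) (use PsubL subL SL blocks in \<open>auto simp: M1_def PY_def\<close>)
  moreover have "sees M2 s (\<pi> @ [s]) (R \<union> legs R X) (\<lambda>v. if v \<in> legs R X then \<pi> else h v)"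
  proof (rule sees_legs_on[OF R])
    fix i assume "i \<in> set M2"
    then have "PY i" using R13(2,3) unfolding M2_def by auto
    then show "\<exists>y\<in>legs R X. i \<in> pos y" unfolding PY_def .
  qed
  moreover have "distinct (M0 @ M1 @ M2)"
    using dPQ len st by (metis card_distinct distinct_card)
  moreover have "distinct [p, q, s]" "{p, q, s} \<subseteq> {0, 1, 2}" using blocks lett by auto
  moreover have "set (M0 @ M1 @ M2) \<subseteq> set L" using st SPQ SL by blast
  ultimately have "region M0 M1 M2 p q s (\<pi> @ [s]) (R \<union> legs R X) (\<lambda>v. if v \<in> legs R X then \<pi> else h v)"
    unfolding region_def st using legs_up[OF R] nc' seg' edges' by blast
  then show ?thesis using st len by blast
qed

end

section \<open>Gluing the solutions of the arcs\<close>

context contour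
begin

text \<open>The region is kept beside its solution because gluing needs that the corners of an
  unremoved vertex stay within one arc.\<close>

definition settled :: "'p set \<Rightarrow> nat \<Rightarrow> nat list \<Rightarrow> 'v set \<Rightarrow> 'p set \<Rightarrow> ('v \<Rightarrow> nat list) \<Rightarrow> bool" where
  "settled K s \<pi> R X h \<longleftrightarrow>
     (\<exists>M0 M1 M2 p q. region M0 M1 M2 p q s (\<pi> @ [s]) (R \<union> legs R X) (\<lambda>v. if v \<in> legs R X then \<pi> else h v) \<and>
       set (M0 @ M1 @ M2) = K) \<and>
     (\<exists>h'. solves K (\<pi> @ [s]) (R \<union> legs R X) (\<lambda>v. if v \<in> legs R X then \<pi> else h v) h')"

lemma part_whole: "part X P P"
  unfolding part_def by (intro disjI2 exI[of _ "[]"]) simp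

lemma image_three: "{x, y, z} \<subseteq> (\<lambda>j::nat. if j = 0 then x else if j = 1 then y else z) ` {..<3}"
  by (auto simp: numeral_3_eq_3 lessThan_Suc)

text \<open>The legs get the word \<open>\<pi>\<close>, every other vertex the word from the arc
  that contains its corners. That arc is unique, because the corners avoid \<open>X\<close> and arcs
  overlap only there. Words of different arcs differ in the letter after \<open>\<pi>\<close>, so
  the fibre of \<open>\<pi>\<close> consists of the legs, at most three paths, and every other fibre
  lies within one arc.\<close>

lemma combine:
  fixes xf :: "nat \<Rightarrow> 'p"
  assumes r: "region L0 L1 L2 a b c \<pi> R h" and X: "X \<subseteq> set (L0 @ L1 @ L2)" and xf: "X \<subseteq> xf ` {..<3}"
    and settled: "\<And>s. s \<in> A \<Longrightarrow> settled (K s) s \<pi> R X h"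
    and cover: "set (L0 @ L1 @ L2) \<subseteq> X \<union> \<Union> (K ` A)"
    and disj: "\<And>s s'. s \<in> A \<Longrightarrow> s' \<in> A \<Longrightarrow> s \<noteq> s' \<Longrightarrow> K s \<inter> K s' \<subseteq> X"
    and A: "A \<subseteq> {0, 1, 2}"
  shows "\<exists>h'. solves (set (L0 @ L1 @ L2)) \<pi> R h h'"
proof -
  let ?S = "set (L0 @ L1 @ L2)" and ?R = "R \<union> legs R X"
  define h1 where h1: "h1 = (\<lambda>v. if v \<in> legs R X then \<pi> else h v)"
  have arcs: "\<exists>M0 M1 M2 p q. region M0 M1 M2 p q s (\<pi> @ [s]) (R \<union> legs R X) h1 \<and> set (M0 @ M1 @ M2) = K s"
    and sol: "\<exists>h'. solves (K s) (\<pi> @ [s]) (R \<union> legs R X) h1 h'" if "s \<in> A" for s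
    using settled[OF that] unfolding settled_def h1 by (rule conjunct1, rule conjunct2)
  have R: "up_closed R" and SL: "?S \<subseteq> set L" using r unfolding region_def by auto
  have "\<forall>s. \<exists>h'. s \<in> A \<longrightarrow> solves (K s) (\<pi> @ [s]) ?R h1 h'" using sol by blast
  then obtain hs where "\<forall>s. s \<in> A \<longrightarrow> solves (K s) (\<pi> @ [s]) ?R h1 (hs s)" by (rule choice[THEN exE])
  then have hs: "solves (K s) (\<pi> @ [s]) ?R h1 (hs s)" if "s \<in> A" for s using that by blast
  have hs1: "hs s v = h1 v" if "s \<in> A" "v \<in> ?R" for s v using hs[OF that(1)] that(2) unfolding solves_def by blast
  have hs2: "\<exists>\<tau>. hs s u = (\<pi> @ [s]) @ \<tau> \<and> set \<tau> \<subseteq> {0, 1, 2}" if "s \<in> A" "u \<notin> ?R" "pos u \<inter> K s \<noteq> {}" for s u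
    using hs[OF that(1)] that(2,3) unfolding solves_def by blast
  have hs3: "wadj (hs s u) (hs s v)" if "s \<in> A" "u \<notin> ?R" "pos u \<inter> K s \<noteq> {}" "v \<notin> Z" "adj u v" for s u v
    using hs[OF that(1)] that(2-) unfolding solves_def by blast
  have hs4: "\<exists>x::nat \<Rightarrow> 'v. \<forall>u. u \<notin> ?R \<and> pos u \<inter> K s \<noteq> {} \<and> hs s u = \<omega> \<longrightarrow> (\<exists>j<3. anc (x j) u)" if "s \<in> A" for s \<omega>
    using hs[OF that(1)] unfolding solves_def by blast
  have Ksub: "pos u \<subseteq> K s" if "s \<in> A" "u \<notin> ?R" "pos u \<inter> K s \<noteq> {}" for s u
  proof -
    obtain M0 M1 M2 p q where M: "region M0 M1 M2 p q s (\<pi> @ [s]) ?R h1" "set (M0 @ M1 @ M2) = K s"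
      using arcs[OF \<open>s \<in> A\<close>] by blast
    show ?thesis using region_pos_sub[OF M(1) that(2)] that(3) unfolding M(2) by blast
  qed
  have Knbr: "pos v \<inter> K s \<noteq> {}" if "s \<in> A" "u \<notin> ?R" "v \<notin> ?R" "adj u v" "pos u \<inter> K s \<noteq> {}" for s u v
  proof -
    obtain M0 M1 M2 p q where M: "region M0 M1 M2 p q s (\<pi> @ [s]) ?R h1" "set (M0 @ M1 @ M2) = K s"
      using arcs[OF \<open>s \<in> A\<close>] by blast
    show ?thesis using region_nbr[OF M(1) that(2-4)] that(5) unfolding M(2) by blast
  qed
  have uniq: "s = s'" if "s \<in> A" "s' \<in> A" "u \<notin> ?R" "pos u \<inter> K s \<noteq> {}" "pos u \<inter> K s' \<noteq> {}" for s s' u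
  proof (rule ccontr)
    assume "s \<noteq> s'"
    then have "pos u \<subseteq> X" using Ksub[OF that(1,3,4)] Ksub[OF that(2,3,5)] disj[OF that(1,2)] by blast
    then show False using not_leg_pos[OF that(3)] that(4) by blast
  qed
  define sel where "sel v = (SOME s. s \<in> A \<and> pos v \<inter> K s \<noteq> {})" for v
  have sel: "sel u = s" if "s \<in> A" "u \<notin> ?R" "pos u \<inter> K s \<noteq> {}" for s u
  proof -
    have "sel u \<in> A \<and> pos u \<inter> K (sel u) \<noteq> {}" unfolding sel_def by (rule someI[of _ s]) (use that in blast)
    then show ?thesis using uniq that by blast
  qed
  have exs: "\<exists>s\<in>A. pos u \<inter> K s \<noteq> {}" if "u \<notin> ?R" "pos u \<inter> ?S \<noteq> {}" for u
    using that cover not_leg_pos[OF that(1)] by blast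
  define h' where "h' v = (if v \<in> ?R then h1 v else hs (sel v) v)" for v
  have h'hs: "h' u = hs s u" if "s \<in> A" "u \<notin> ?R" "pos u \<inter> K s \<noteq> {}" for s u
    unfolding h'_def using sel[OF that] that(2) by simp
  have legS: "pos u \<inter> ?S \<noteq> {}" if "u \<in> legs R X" for u
    using that X SL unfolding legs_def pos_def by blast
  have Z: "Z \<subseteq> R" using R unfolding up_closed_def by blast
  \<comment> \<open>An edge into \<open>R\<close> leads to the parent or along a chord. Either way
    some corner of the region has \<open>v\<close> as its first vertex of \<open>R\<close>, so
    \<open>\<pi>\<close> still sees the word of \<open>v\<close>.\<close>
  have visR: "wadj \<pi> (h v)" if u: "u \<notin> R" "pos u \<inter> ?S \<noteq> {}" and v: "v \<in> R" "v \<notin> Z" "adj u v" for u v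
  proof -
    have usub: "pos u \<subseteq> ?S" by (rule region_pos_sub[OF r u])
    have ss: "sees L0 a \<pi> R h" "sees L1 b \<pi> R h" "sees L2 c \<pi> R h" using r unfolding region_def by simp_all
    have see: "\<exists>k. vis k (h v) \<pi>" if "i \<in> ?S" "fstrm R (tl i) v" for i
    proof -
      have "i \<in> set L0 \<or> i \<in> set L1 \<or> i \<in> set L2" using that(1) by simp
      then show ?thesis using ss that(2) v(2) unfolding sees_def by blast
    qed
    have "par u = v \<or> par v = u \<or> (\<exists>i\<in>?S. \<exists>j\<in>?S. tl i = u \<and> tl j = v \<and> ch i j)"
      using r u v unfolding region_def edges_in_def by blast
    then have "\<exists>k. vis k (h v) \<pi>"
    proof (elim disjE bexE conjE)
      assume pu: "par u = v"
      obtain i where i: "i \<in> pos u" "tl i = u" using pos_corner u Z by blast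
      have "fstrm R (tl i) v" unfolding fstrm_def by (rule exI[of _ 1]) (use pu u v i in auto)
      then show ?thesis using see usub i by blast
    next
      assume "par v = u"
      then show ?thesis using R v u unfolding up_closed_def by blast
    next
      fix i j assume j: "j \<in> ?S" "tl j = v"
      have "fstrm R (tl j) v" unfolding fstrm_def by (rule exI[of _ 0]) (use v j in auto)
      then show ?thesis using see j by blast
    qed
    then show ?thesis using vis_wadj by blast
  qed
  have "solves ?S \<pi> R h h'"
    unfolding solves_def
  proof (intro conjI allI impI ballI)
    fix v assume "v \<in> R"
    then show "h' v = h v" unfolding h'_def h1 legs_def by simp
  next
    fix u assume u: "u \<notin> R \<and> pos u \<inter> ?S \<noteq> {}"
    show "\<exists>\<tau>. h' u = \<pi> @ \<tau> \<and> set \<tau> \<subseteq> {0, 1, 2}"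
    proof (cases "u \<in> legs R X")
      case True
      then show ?thesis unfolding h'_def h1 by simp
    next
      case False
      then obtain s where s: "s \<in> A" "pos u \<inter> K s \<noteq> {}" using exs u by blast
      then obtain \<tau> where "hs s u = (\<pi> @ [s]) @ \<tau>" "set \<tau> \<subseteq> {0, 1, 2}" using hs2[of s u] False u by blast
      then show ?thesis using h'hs[of s u] s False u A by (intro exI[of _ "s # \<tau>"]) auto
    qed
  next
    fix u v assume uv: "u \<notin> R \<and> pos u \<inter> ?S \<noteq> {} \<and> v \<notin> Z \<and> adj u v"
    show "wadj (h' u) (h' v)"
    proof (cases "u \<in> legs R X")
      case True
      then have hu: "h' u = \<pi>" unfolding h'_def h1 by simp
      consider "v \<in> R" | "v \<in> legs R X" | "v \<notin> ?R" by blast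
      then show ?thesis
      proof cases
        case 1
        then have "h' v = h v" unfolding h'_def h1 legs_def by simp
        then show ?thesis using visR[of u v] uv 1 hu by simp
      next
        case 2
        then have "h' v = \<pi>" unfolding h'_def h1 by simp
        then show ?thesis using hu by simp
      next
        case 3
        have "pos v \<inter> ?S \<noteq> {}" using region_nbr[OF r, of u v] uv 3 by blast
        then obtain s where s: "s \<in> A" "pos v \<inter> K s \<noteq> {}" using exs 3 by blast
        have uZ: "u \<notin> Z" using uv Z by blast
        have "wadj (hs s v) (hs s u)" using hs3[OF s(1) 3 s(2) uZ] adj_sym uv by blast
        moreover have "hs s u = \<pi>" using hs1[OF s(1)] True unfolding h1 by simp
        moreover have "h' v = hs s v" using h'hs[OF s(1) 3 s(2)] .
        ultimately show ?thesis using hu W.E_sym by simp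
      qed
    next
      case False
      then have uR: "u \<notin> ?R" using uv by blast
      then obtain s where s: "s \<in> A" "pos u \<inter> K s \<noteq> {}" using exs uv by blast
      have "wadj (hs s u) (hs s v)" using hs3[OF s(1) uR s(2)] uv by blast
      moreover have "h' u = hs s u" using h'hs[OF s(1) uR s(2)] .
      moreover have "h' v = hs s v"
      proof (cases "v \<in> ?R")
        case True
        then show ?thesis using hs1[OF s(1) True] unfolding h'_def by simp
      next
        case vR: False
        have "pos v \<inter> K s \<noteq> {}" using Knbr[OF s(1) uR vR _ s(2)] uv by blast
        then show ?thesis using h'hs[OF s(1) vR] by blast
      qed
      ultimately show ?thesis by simp
    qed
  next
    fix \<omega>
    have word: "\<exists>\<tau>. h' u = \<pi> @ s # \<tau>" if "s \<in> A" "u \<notin> ?R" "pos u \<inter> K s \<noteq> {}" for s u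
      using hs2[OF that] h'hs[OF that] by auto
    show "\<exists>x::nat \<Rightarrow> 'v. \<forall>u. u \<notin> R \<and> pos u \<inter> ?S \<noteq> {} \<and> h' u = \<omega> \<longrightarrow> (\<exists>j<3. anc (x j) u)"
    proof (cases "\<exists>s\<in>A. \<exists>\<tau>. \<omega> = \<pi> @ s # \<tau>")
      case True
      then obtain s \<tau> where s: "s \<in> A" "\<omega> = \<pi> @ s # \<tau>" by blast
      obtain x :: "nat \<Rightarrow> 'v" where x: "\<And>u. u \<notin> ?R \<Longrightarrow> pos u \<inter> K s \<noteq> {} \<Longrightarrow> hs s u = \<omega> \<Longrightarrow> \<exists>j<3. anc (x j) u"
        using hs4[OF s(1), of \<omega>] by blast
      have "\<exists>j<3. anc (x j) u" if u: "u \<notin> R" "pos u \<inter> ?S \<noteq> {}" "h' u = \<omega>" for u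
      proof -
        have "u \<notin> legs R X" using u s unfolding h'_def h1 by auto
        then have uR: "u \<notin> ?R" using u by blast
        then obtain s' where s': "s' \<in> A" "pos u \<inter> K s' \<noteq> {}" using exs u by blast
        then have "s' = s" using word[OF s'(1) uR s'(2)] u s by auto
        then show ?thesis using x[OF uR] s' h'hs[OF s'(1) uR s'(2)] u by auto
      qed
      then show ?thesis by blast
    next
      case False
      have "\<exists>j<3. anc (tl (xf j)) u" if u: "u \<notin> R" "pos u \<inter> ?S \<noteq> {}" "h' u = \<omega>" for u
      proof -
        have "u \<in> legs R X"
        proof (rule ccontr)
          assume "u \<notin> legs R X"
          then have uR: "u \<notin> ?R" using u by blast
          then obtain s' where s': "s' \<in> A" "pos u \<inter> K s' \<noteq> {}" using exs u by blast
          then show False using word[OF s'(1) uR s'(2)] u False by blast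
        qed
        then obtain x where "x \<in> X" "anc (tl x) u" unfolding legs_def by blast
        then show ?thesis using xf by blast
      qed
      then show ?thesis by (intro exI[of _ "\<lambda>j. tl (xf j)"]) blast
    qed
  qed
  then show ?thesis by blast
qed

lemma interior_ends: "f # I @ [e] = ys @ x # zs \<Longrightarrow> set I \<inter> X = {} \<Longrightarrow> x \<in> X \<Longrightarrow> ys = [] \<or> zs = []"
  by (cases ys; cases zs rule: rev_cases) auto

lemma app_split:
  assumes "xs @ ys = as @ y # bs"
  obtains bs1 where "xs = as @ y # bs1" "bs = bs1 @ ys" | as2 where "as = xs @ as2" "ys = as2 @ y # bs"
  using assms by (auto simp: append_eq_append_conv2 Cons_eq_append_conv append_eq_Cons_conv)

text \<open>Induction on the number of corners, as every arc omits at least one. Three non-empty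
  blocks are cut by \<open>trisect\<close>, two by \<open>apex\<close>; with at most two corners all
  of them are cut points and no arc remains. An arc receives the letter of a block that it does not
  touch.\<close>

theorem region_solves:
  "region L0 L1 L2 a b c \<pi> R h \<Longrightarrow> \<exists>h'. solves (set (L0 @ L1 @ L2)) \<pi> R h h'"
proof (induction "length (L0 @ L1 @ L2)" arbitrary: L0 L1 L2 a b c \<pi> R h rule: less_induct)
  case less
  note r = less.prems
  have arc: "settled (set (P @ Q)) s \<pi> R X h"
    if r': "region K0 K1 K2 a' b' c' \<pi> R h" and n: "length (K0 @ K1 @ K2) = length (L0 @ L1 @ L2)"
      and X: "X \<subseteq> set (K0 @ K1 @ K2)"
      and bl: "(Lp, p) \<in> {(K0, a'), (K1, b'), (K2, c')}" "(Lq, q) \<in> {(K0, a'), (K1, b'), (K2, c')}"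
        "part X Lp P" "part X Lq Q" "p \<noteq> q" "s \<in> {a', b', c'}" "s \<noteq> p" "s \<noteq> q"
      and sub: "subseq (P @ Q) (K0 @ K1 @ K2) \<or> subseq (P @ Q) (K2 @ K0 @ K1)"
      and fe: "P @ Q = f # I @ [e]" "set I \<inter> X = {}" "f \<in> X" "e \<in> X"
      and cl: "\<And>i j. i \<in> set I \<Longrightarrow> j \<in> set (K0 @ K1 @ K2) \<Longrightarrow> ch i j \<Longrightarrow> j \<in> set (f # I @ [e])"
      and len: "length (P @ Q) < length (L0 @ L1 @ L2)"
    for K0 K1 K2 a' b' c' X Lp p Lq q P Q s f I e
  proof -
    have nK: "nc ch (K0 @ K1 @ K2)" using r' unfolding region_def by blast
    have "nc ch (K2 @ K0 @ K1)"
      using nc_rotate[of ch "K0 @ K1" K2] nK ch_sym by auto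
    then have nPQ: "nc ch (P @ Q)" using nK sub nc_subseq by blast
    have "\<exists>M0 M1 M2. region M0 M1 M2 p q s (\<pi> @ [s]) (R \<union> legs R X) (\<lambda>v. if v \<in> legs R X then \<pi> else h v) \<and>
      set (M0 @ M1 @ M2) = set (P @ Q) \<and> length (M0 @ M1 @ M2) = length (P @ Q)"
    proof (rule arc_region[OF r' X bl nPQ])
      fix ys x zs assume "P @ Q = ys @ x # zs" "x \<in> X"
      then show "ys = [] \<or> zs = []" using interior_ends fe by metis
    next
      fix i j assume "i \<in> set (P @ Q) - X" "j \<in> set (K0 @ K1 @ K2)" "ch i j"
      then show "j \<in> set (P @ Q)" using cl[of i j] fe by auto
    qed
    then obtain M0 M1 M2 where M: "region M0 M1 M2 p q s (\<pi> @ [s]) (R \<union> legs R X) (\<lambda>v. if v \<in> legs R X then \<pi> else h v)"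
      "set (M0 @ M1 @ M2) = set (P @ Q)" "length (M0 @ M1 @ M2) = length (P @ Q)" by blast
    have "\<exists>h'. solves (set (M0 @ M1 @ M2)) (\<pi> @ [s]) (R \<union> legs R X) (\<lambda>v. if v \<in> legs R X then \<pi> else h v) h'"
      by (rule less.hyps[OF _ M(1)]) (use M(3) len in simp)
    then have "\<exists>h'. solves (set (P @ Q)) (\<pi> @ [s]) (R \<union> legs R X) (\<lambda>v. if v \<in> legs R X then \<pi> else h v) h'"
      unfolding M(2) .
    moreover have "\<exists>M0 M1 M2 p q. region M0 M1 M2 p q s (\<pi> @ [s]) (R \<union> legs R X) (\<lambda>v. if v \<in> legs R X then \<pi> else h v) \<and>
       set (M0 @ M1 @ M2) = set (P @ Q)" using M(1,2) by blast
    ultimately show ?thesis unfolding settled_def by (rule conjI[rotated])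
  qed
  have two: "\<exists>h'. solves (set (K0 @ K1)) \<pi> R h h'"
    if r': "region K0 K1 [] a' b' c' \<pi> R h" and n: "length (K0 @ K1) = length (L0 @ L1 @ L2)" for K0 K1 a' b' c'
  proof -
    have lett: "distinct [a', b', c']" "{a', b', c'} \<subseteq> {0, 1, 2}" and dK: "distinct (K0 @ K1)" and nK: "nc ch (K0 @ K1)"
      using r' unfolding region_def by auto
    have ne: "a' \<noteq> b'" "a' \<noteq> c'" "b' \<noteq> c'" "b' \<noteq> a'" "c' \<noteq> a'" "c' \<noteq> b'" using lett(1) by auto
    have small: "\<exists>h'. solves (set (K0 @ K1)) \<pi> R h h'" if "set (K0 @ K1) \<subseteq> {x, y}" for x y
    proof -
      have "\<exists>h'. solves (set (K0 @ K1 @ [])) \<pi> R h h'"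
        by (rule combine[OF r', of "set (K0 @ K1)" "\<lambda>j. if j = 0 then x else if j = 1 then y else y" "{}"])
          (use that image_three[of x y y] in auto)
      then show ?thesis by simp
    qed
    show ?thesis
    proof (cases "length (K0 @ K1) \<le> 2")
      case True
      then consider "K0 @ K1 = []" | x where "K0 @ K1 = [x]" | x y where "K0 @ K1 = [x, y]"
        by (cases "K0 @ K1"; cases "List.tl (K0 @ K1)"; auto)
      then show ?thesis
      proof cases
        case 1 then show ?thesis using small by simp
      next
        case (2 x) then show ?thesis using small[of x x] by simp
      next
        case (3 x y) then show ?thesis using small[of x y] by simp
      qed
    next
      case False
      obtain f K' where K': "K0 @ K1 = f # K'" using False by (cases "K0 @ K1") auto
      obtain M e where Me: "K' = M @ [e]" using False K' by (cases K' rule: rev_cases) auto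
      have fMe: "K0 @ K1 = f # M @ [e]" using K' Me by simp
      have M: "M \<noteq> []" using False fMe by auto
      obtain m1 y m2 where m: "M = m1 @ y # m2"
        and cl1: "\<And>i j. i \<in> set m1 \<Longrightarrow> j \<in> set (f # M @ [e]) \<Longrightarrow> ch i j \<Longrightarrow> j \<in> set (f # m1 @ [y])"
        and cl2: "\<And>i j. i \<in> set m2 \<Longrightarrow> j \<in> set (f # M @ [e]) \<Longrightarrow> ch i j \<Longrightarrow> j \<in> set (y # m2 @ [e])"
        using apex[of ch f M e] ch_sym nK dK M unfolding fMe by metis
      define X where "X = {f, y, e}"
      have eqK: "K0 @ K1 = (f # m1) @ y # (m2 @ [e])" using fMe m by simp
      have dis: "distinct (f # m1 @ y # m2 @ [e])" using dK eqK by simp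
      have XS: "X \<subseteq> set (K0 @ K1 @ [])" unfolding X_def using eqK by auto
      have I12: "set m1 \<inter> X = {}" "set m2 \<inter> X = {}" using dis unfolding X_def by auto
      have n': "length (K0 @ K1 @ []) = length (L0 @ L1 @ L2)" using n by simp
      have nn: "length (L0 @ L1 @ L2) = length m1 + length m2 + 3" using n eqK by simp
      have sb: "subseq (f # m1 @ [y]) (K0 @ K1 @ [])" "subseq (y # m2 @ [e]) (K0 @ K1 @ [])"
      proof -
        have "subseq ((f # m1 @ [y]) @ []) ((f # m1 @ [y]) @ (m2 @ [e]))" by (intro list_emb_append_mono) auto
        then show "subseq (f # m1 @ [y]) (K0 @ K1 @ [])" using eqK by simp
        have "subseq (y # m2 @ [e]) ((f # m1) @ y # m2 @ [e])" by (rule subseq_drop_many) simp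
        then show "subseq (y # m2 @ [e]) (K0 @ K1 @ [])" using eqK by simp
      qed
      have c1: "j \<in> set (f # m1 @ [y])" if "i \<in> set m1" "j \<in> set (K0 @ K1 @ [])" "ch i j" for i j
        using cl1 that fMe by simp
      have c2: "j \<in> set (y # m2 @ [e])" if "i \<in> set m2" "j \<in> set (K0 @ K1 @ [])" "ch i j" for i j
        using cl2 that fMe by simp
      have fin: ?thesis
        if s12: "s1 \<noteq> s2" "s1 \<in> {0, 1, 2}" "s2 \<in> {0, 1, 2}"
          and a1: "settled (set (f # m1 @ [y])) s1 \<pi> R X h"
          and a2: "settled (set (y # m2 @ [e])) s2 \<pi> R X h"
        for s1 s2
      proof -
        let ?K = "\<lambda>s. if s = s1 then set (f # m1 @ [y]) else set (y # m2 @ [e])"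
        have "\<exists>h'. solves (set (K0 @ K1 @ [])) \<pi> R h h'"
        proof (rule combine[OF r' XS, of "\<lambda>j. if j = 0 then f else if j = 1 then y else e" "{s1, s2}" ?K])
          show "X \<subseteq> (\<lambda>j::nat. if j = 0 then f else if j = 1 then y else e) ` {..<3}"
            unfolding X_def by (rule image_three)
          fix s assume s: "s \<in> {s1, s2}"
          show "settled (?K s) s \<pi> R X h" using a1 a2 s s12(1) by (elim insertE emptyE) simp_all
        next
          show "set (K0 @ K1 @ []) \<subseteq> X \<union> \<Union> (?K ` {s1, s2})" using eqK s12 by auto
        next
          fix s s' assume "s \<in> {s1, s2}" "s' \<in> {s1, s2}" "s \<noteq> s'"
          then show "?K s \<inter> ?K s' \<subseteq> X" using dis s12 unfolding X_def by auto
        qed (use s12 in auto)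
        then show ?thesis by simp
      qed
      \<comment> \<open>The arc that lies within the block of \<open>y\<close> is paired with the
        empty block, so that the two arcs get different letters.\<close>
      from eqK show ?thesis
      proof (cases rule: app_split)
        case (1 b1)
        have "settled (set ((f # m1 @ [y]) @ [])) b' \<pi> R X h"
        proof (rule arc[OF r' n' XS, of K0 a' "[]" c' _ _ _ f m1 y])
          show "part X K0 (f # m1 @ [y])" unfolding part_def
            by (intro disjI2 exI[of _ "[]"] exI[of _ b1]) (use 1 in \<open>auto simp: X_def\<close>)
          show "subseq ((f # m1 @ [y]) @ []) (K0 @ K1 @ []) \<or> subseq ((f # m1 @ [y]) @ []) ([] @ K0 @ K1)" using sb by simp
          show "j \<in> set (f # m1 @ [y])" if "i \<in> set m1" "j \<in> set (K0 @ K1 @ [])" "ch i j" for i j using c1[OF that] .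
          show "part X [] []" by (rule part_whole)
        qed (use ne I12 nn in \<open>simp_all add: X_def\<close>)
        moreover have "settled (set ((y # b1) @ K1)) c' \<pi> R X h"
        proof (rule arc[OF r' n' XS, of K0 a' K1 b' _ _ _ y m2 e])
          show "part X K0 (y # b1)" unfolding part_def
            by (intro disjI2 exI[of _ "f # m1"] exI[of _ "[]"]) (use 1 in \<open>auto simp: X_def\<close>)
          show "part X K1 K1" by (rule part_whole)
          have eq: "(y # b1) @ K1 = y # m2 @ [e]" using 1(2) by simp
          show "(y # b1) @ K1 = y # m2 @ [e]" by (rule eq)
          show "subseq ((y # b1) @ K1) (K0 @ K1 @ []) \<or> subseq ((y # b1) @ K1) ([] @ K0 @ K1)" unfolding eq using sb by blast
          show "length ((y # b1) @ K1) < length (L0 @ L1 @ L2)" unfolding eq using nn by simp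
          show "j \<in> set (y # m2 @ [e])" if "i \<in> set m2" "j \<in> set (K0 @ K1 @ [])" "ch i j" for i j using c2[OF that] .
        qed (use ne I12 in \<open>simp_all add: X_def\<close>)
        moreover have "set ((y # b1) @ K1) = set (y # m2 @ [e])" using 1(2) by (metis Cons_eq_appendI)
        ultimately show ?thesis using fin[OF ne(3)] lett(2) by simp
      next
        case (2 a2)
        have "settled (set (K0 @ (a2 @ [y]))) c' \<pi> R X h"
        proof (rule arc[OF r' n' XS, of K0 a' K1 b' _ _ _ f m1 y])
          show "part X K0 K0" by (rule part_whole)
          show "part X K1 (a2 @ [y])" unfolding part_def
            by (intro disjI2 exI[of _ "[]"] exI[of _ "m2 @ [e]"]) (use 2 in \<open>auto simp: X_def\<close>)
          have eq: "K0 @ a2 @ [y] = f # m1 @ [y]" using 2(1) by (metis append.assoc append_Cons)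
          show "K0 @ a2 @ [y] = f # m1 @ [y]" by (rule eq)
          show "subseq (K0 @ a2 @ [y]) (K0 @ K1 @ []) \<or> subseq (K0 @ a2 @ [y]) ([] @ K0 @ K1)" unfolding eq using sb by blast
          show "length (K0 @ a2 @ [y]) < length (L0 @ L1 @ L2)" unfolding eq using nn by simp
          show "j \<in> set (f # m1 @ [y])" if "i \<in> set m1" "j \<in> set (K0 @ K1 @ [])" "ch i j" for i j using c1[OF that] .
        qed (use ne I12 in \<open>simp_all add: X_def\<close>)
        moreover have "set (K0 @ (a2 @ [y])) = set (f # m1 @ [y])" using 2(1) by (metis append.assoc append_Cons)
        moreover have "settled (set ((y # m2 @ [e]) @ [])) a' \<pi> R X h"
        proof (rule arc[OF r' n' XS, of K1 b' "[]" c' _ _ _ y m2 e])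
          show "part X K1 (y # m2 @ [e])" unfolding part_def
            by (intro disjI2 exI[of _ a2] exI[of _ "[]"]) (use 2 in \<open>auto simp: X_def\<close>)
          show "subseq ((y # m2 @ [e]) @ []) (K0 @ K1 @ []) \<or> subseq ((y # m2 @ [e]) @ []) ([] @ K0 @ K1)" using sb by simp
          show "j \<in> set (y # m2 @ [e])" if "i \<in> set m2" "j \<in> set (K0 @ K1 @ [])" "ch i j" for i j using c2[OF that] .
          show "part X [] []" by (rule part_whole)
        qed (use ne I12 nn in \<open>simp_all add: X_def\<close>)
        ultimately show ?thesis using fin[OF ne(5)] lett(2) by simp
      qed
    qed
  qed
  have rot1: "region L1 L2 L0 b c a \<pi> R h" by (rule region_rotate[OF r])
  have rot2: "region L2 L0 L1 c a b \<pi> R h" by (rule region_rotate[OF rot1])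
  show ?case
  proof (cases "L0 = [] \<or> L1 = [] \<or> L2 = []")
    case True
    then show ?thesis
    proof (elim disjE)
      assume "L0 = []"
      then show ?thesis using two[of L1 L2 b c a] rot1 by simp
    next
      assume "L1 = []"
      then have "\<exists>h'. solves (set (L2 @ L0)) \<pi> R h h'" using two[of L2 L0 c a b] rot2 by simp
      moreover have "set (L2 @ L0) = set (L0 @ L1 @ L2)" using \<open>L1 = []\<close> by auto
      ultimately show ?thesis by metis
    next
      assume "L2 = []"
      then show ?thesis using two[of L0 L1 a b c] r by simp
    qed
  next
    case False
    have nL: "nc ch (L0 @ L1 @ L2)" and dL: "distinct (L0 @ L1 @ L2)"
      and lett: "distinct [a, b, c]" "{a, b, c} \<subseteq> {0, 1, 2}" using r unfolding region_def by auto
    have ne3: "L0 \<noteq> []" "L1 \<noteq> []" "L2 \<noteq> []" using False by auto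
    obtain a0 x0 b0 a1 x1 b1 a2 x2 b2 where
      L: "L0 = a0 @ x0 # b0" "L1 = a1 @ x1 # b1" "L2 = a2 @ x2 # b2"
      and c01: "\<forall>i\<in>set (b0 @ a1). \<forall>j\<in>set (L0 @ L1 @ L2). ch i j \<longrightarrow> j \<in> set (x0 # b0 @ a1 @ [x1])"
      and c12: "\<forall>i\<in>set (b1 @ a2). \<forall>j\<in>set (L0 @ L1 @ L2). ch i j \<longrightarrow> j \<in> set (x1 # b1 @ a2 @ [x2])"
      and c20: "\<forall>i\<in>set (b2 @ a0). \<forall>j\<in>set (L0 @ L1 @ L2). ch i j \<longrightarrow> j \<in> set (x2 # b2 @ a0 @ [x0])"
      by (rule trisect[of ch L0 L1 L2]) (assumption | rule nL ne3 | erule ch_sym | erule that, assumption+)+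
    have ne: "a \<noteq> b" "a \<noteq> c" "b \<noteq> c" "b \<noteq> a" "c \<noteq> a" "c \<noteq> b" using lett(1) by auto
    define X where "X = {x0, x1, x2}"
    have XS: "X \<subseteq> set (L0 @ L1 @ L2)" unfolding X_def L by auto
    have dis: "distinct (a0 @ x0 # b0 @ a1 @ x1 # b1 @ a2 @ x2 # b2)" using dL unfolding L by simp
    have sfx: "subseq (x # zs) (ys @ x # zs)" for x and ys zs :: "'p list" by (rule subseq_drop_many) simp
    have pfx: "subseq (ys @ [x]) (ys @ x # zs)" for x and ys zs :: "'p list" by (simp add: subseq_append')
    have A: "settled (set ((x0 # b0) @ (a1 @ [x1]))) c \<pi> R X h"
    proof (rule arc[OF r refl XS, of L0 a L1 b _ _ _ x0 "b0 @ a1" x1])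
      show "part X L0 (x0 # b0)" unfolding part_def
        by (intro disjI2 exI[of _ a0] exI[of _ "[]"]) (auto simp: X_def L)
      show "part X L1 (a1 @ [x1])" unfolding part_def
        by (intro disjI2 exI[of _ "[]"] exI[of _ b1]) (auto simp: X_def L)
      have "subseq ((x0 # b0) @ (a1 @ [x1]) @ []) (L0 @ L1 @ L2)"
        unfolding L by (intro list_emb_append_mono sfx pfx) simp
      then show "subseq ((x0 # b0) @ a1 @ [x1]) (L0 @ L1 @ L2) \<or> subseq ((x0 # b0) @ a1 @ [x1]) (L2 @ L0 @ L1)" by simp
      show "j \<in> set (x0 # (b0 @ a1) @ [x1])" if "i \<in> set (b0 @ a1)" "j \<in> set (L0 @ L1 @ L2)" "ch i j" for i j
        using c01 that by simp
      show "set (b0 @ a1) \<inter> X = {}" using dis unfolding X_def by auto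
    qed (use ne in \<open>simp_all add: X_def L\<close>)
    have B: "settled (set ((x1 # b1) @ (a2 @ [x2]))) a \<pi> R X h"
    proof (rule arc[OF r refl XS, of L1 b L2 c _ _ _ x1 "b1 @ a2" x2])
      show "part X L1 (x1 # b1)" unfolding part_def
        by (intro disjI2 exI[of _ a1] exI[of _ "[]"]) (auto simp: X_def L)
      show "part X L2 (a2 @ [x2])" unfolding part_def
        by (intro disjI2 exI[of _ "[]"] exI[of _ b2]) (auto simp: X_def L)
      have "subseq ([] @ (x1 # b1) @ (a2 @ [x2])) (L0 @ L1 @ L2)"
        unfolding L by (intro list_emb_append_mono sfx pfx) simp
      then show "subseq ((x1 # b1) @ a2 @ [x2]) (L0 @ L1 @ L2) \<or> subseq ((x1 # b1) @ a2 @ [x2]) (L2 @ L0 @ L1)" by simp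
      show "j \<in> set (x1 # (b1 @ a2) @ [x2])" if "i \<in> set (b1 @ a2)" "j \<in> set (L0 @ L1 @ L2)" "ch i j" for i j
        using c12 that by simp
      show "set (b1 @ a2) \<inter> X = {}" using dis unfolding X_def by auto
    qed (use ne in \<open>simp_all add: X_def L\<close>)
    have C: "settled (set ((x2 # b2) @ (a0 @ [x0]))) b \<pi> R X h"
    proof (rule arc[OF r refl XS, of L2 c L0 a _ _ _ x2 "b2 @ a0" x0])
      show "part X L2 (x2 # b2)" unfolding part_def
        by (intro disjI2 exI[of _ a2] exI[of _ "[]"]) (auto simp: X_def L)
      show "part X L0 (a0 @ [x0])" unfolding part_def
        by (intro disjI2 exI[of _ "[]"] exI[of _ b0]) (auto simp: X_def L)
      have "subseq ((x2 # b2) @ (a0 @ [x0]) @ []) (L2 @ L0 @ L1)"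
        unfolding L by (intro list_emb_append_mono sfx pfx) simp
      then show "subseq ((x2 # b2) @ a0 @ [x0]) (L0 @ L1 @ L2) \<or> subseq ((x2 # b2) @ a0 @ [x0]) (L2 @ L0 @ L1)" by simp
      show "j \<in> set (x2 # (b2 @ a0) @ [x0])" if "i \<in> set (b2 @ a0)" "j \<in> set (L0 @ L1 @ L2)" "ch i j" for i j
        using c20 that by simp
      show "set (b2 @ a0) \<inter> X = {}" using dis unfolding X_def by auto
    qed (use ne in \<open>simp_all add: X_def L\<close>)
    let ?K = "\<lambda>s. if s = c then set ((x0 # b0) @ (a1 @ [x1])) else if s = a then set ((x1 # b1) @ (a2 @ [x2]))
      else set ((x2 # b2) @ (a0 @ [x0]))"
    have Kabc: "?K c = set ((x0 # b0) @ (a1 @ [x1]))" "?K a = set ((x1 # b1) @ (a2 @ [x2]))" "?K b = set ((x2 # b2) @ (a0 @ [x0]))"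
      using ne by simp_all
    show ?thesis
    proof (rule combine[OF r XS, of "\<lambda>j. if j = 0 then x0 else if j = 1 then x1 else x2" "{a, b, c}" ?K])
      show "X \<subseteq> (\<lambda>j::nat. if j = 0 then x0 else if j = 1 then x1 else x2) ` {..<3}"
        unfolding X_def by (rule image_three)
      fix s assume s: "s \<in> {a, b, c}"
      then show "settled (?K s) s \<pi> R X h"
      proof (elim insertE emptyE)
        assume "s = a" show ?thesis unfolding \<open>s = a\<close> Kabc(2) by (rule B)
      next
        assume "s = b" show ?thesis unfolding \<open>s = b\<close> Kabc(3) by (rule C)
      next
        assume "s = c" show ?thesis unfolding \<open>s = c\<close> Kabc(1) by (rule A)
      qed
    next
      show "set (L0 @ L1 @ L2) \<subseteq> X \<union> \<Union> (?K ` {a, b, c})" using ne unfolding L by auto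
    next
      fix s s' assume "s \<in> {a, b, c}" "s' \<in> {a, b, c}" "s \<noteq> s'"
      then show "?K s \<inter> ?K s' \<subseteq> X" using dis ne unfolding X_def by auto
    qed (rule lett(2))
  qed
qed

text \<open>The whole contour is a region with two empty blocks and \<open>R = Z\<close>. The first
  vertex of \<open>R\<close> above a corner is then always in \<open>Z\<close>, so the blocks see
  nothing yet and every choice of letters is allowed.\<close>

theorem contour_words:
  "\<exists>h :: 'v \<Rightarrow> nat list. (\<forall>u. u \<notin> Z \<longrightarrow> set (h u) \<subseteq> {0, 1, 2}) \<and>
     (\<forall>u v. u \<notin> Z \<and> v \<notin> Z \<and> adj u v \<longrightarrow> wadj (h u) (h v)) \<and>
     (\<forall>\<omega>. \<exists>x::nat \<Rightarrow> 'v. \<forall>u. u \<notin> Z \<and> h u = \<omega> \<longrightarrow> (\<exists>j<3. \<exists>n. (par ^^ n) (x j) = u))"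
proof -
  have "region L [] [] 0 1 2 [] Z (\<lambda>_. [])"
    unfolding region_def up_closed_def sees_def fstrm_def edges_in_def
    using Z_up L_distinct L_nc L_seg edge unfolding seg_def pos_def anc_def by auto
  then obtain h where h: "solves (set (L @ [] @ [])) [] Z (\<lambda>_. []) h" using region_solves by blast
  have p: "pos u \<inter> set (L @ [] @ []) \<noteq> {}" if "u \<notin> Z" for u
    using pos_corner[OF that] unfolding pos_def by auto
  show ?thesis
  proof (intro exI[of _ h] conjI allI impI)
    fix u assume "u \<notin> Z"
    then show "set (h u) \<subseteq> {0, 1, 2}" using h p unfolding solves_def by fastforce
  next
    fix u v assume "u \<notin> Z \<and> v \<notin> Z \<and> adj u v"
    then show "wadj (h u) (h v)" using h p unfolding solves_def by blast
  next
    fix \<omega>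
    obtain x :: "nat \<Rightarrow> 'v" where "\<forall>u. u \<notin> Z \<and> pos u \<inter> set (L @ [] @ []) \<noteq> {} \<and> h u = \<omega> \<longrightarrow> (\<exists>j<3. anc (x j) u)"
      using h unfolding solves_def by blast
    then show "\<exists>x::nat \<Rightarrow> 'v. \<forall>u. u \<notin> Z \<and> h u = \<omega> \<longrightarrow> (\<exists>j<3. \<exists>n. (par ^^ n) (x j) = u)"
      using p unfolding anc_def by (intro exI[of _ x]) blast
  qed
qed

end

section \<open>Cyclic lists\<close>

lemma nc_iff_nth:
  "nc ch P \<longleftrightarrow> (\<forall>i j k l. i < j \<and> j < k \<and> k < l \<and> l < length P \<longrightarrow> \<not> (ch (P ! i) (P ! k) \<and> ch (P ! j) (P ! l)))"
proof
  assume "nc ch P"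
  then show "\<forall>i j k l. i < j \<and> j < k \<and> k < l \<and> l < length P \<longrightarrow> \<not> (ch (P ! i) (P ! k) \<and> ch (P ! j) (P ! l))"
    using nc_nth by blast
next
  assume *: "\<forall>i j k l. i < j \<and> j < k \<and> k < l \<and> l < length P \<longrightarrow> \<not> (ch (P ! i) (P ! k) \<and> ch (P ! j) (P ! l))"
  show "nc ch P"
    unfolding nc_def
  proof (intro allI impI)
    fix x y z w assume "subseq [x, y, z, w] P"
    then obtain a b where 1: "P = a @ x # b" "subseq [y, z, w] b" by (blast dest: list_emb_ConsD)
    from 1(2) obtain c d where 2: "b = c @ y # d" "subseq [z, w] d" by (blast dest: list_emb_ConsD)
    from 2(2) obtain e f where 3: "d = e @ z # f" "subseq [w] f" by (blast dest: list_emb_ConsD)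
    from 3(2) obtain g h where 4: "f = g @ w # h" by (blast dest: list_emb_ConsD)
    define i j k l where "i = length a" and "j = Suc (i + length c)" and "k = Suc (j + length e)" and "l = Suc (k + length g)"
    have P: "P = a @ x # c @ y # e @ z # g @ w # h" using 1 2 3 4 by simp
    have ijk: "i < j" "j < k" "k < l" "l < length P" unfolding P i_def j_def k_def l_def by auto
    have n1: "P ! i = x" unfolding P i_def by simp
    have n2: "P ! j = y" using nth_append_length[of "a @ x # c" y "e @ z # g @ w # h"] unfolding P j_def i_def by simp
    have n3: "P ! k = z" using nth_append_length[of "a @ x # c @ y # e" z "g @ w # h"] unfolding P k_def j_def i_def by (simp add: add.assoc)
    have n4: "P ! l = w" using nth_append_length[of "a @ x # c @ y # e @ z # g" w h] unfolding P l_def k_def j_def i_def by (simp add: add.assoc)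
    show "\<not> (ch x z \<and> ch y w)" using *[rule_format, of i j k l] ijk n1 n2 n3 n4 by simp
  qed
qed

lemma subseq_set: "subseq xs ys \<Longrightarrow> set xs \<subseteq> set ys"
  by (induction rule: list_emb.induct) auto

lemma nc_mono:
  assumes "nc ch P" "\<And>x y. x \<in> set P \<Longrightarrow> y \<in> set P \<Longrightarrow> ch' x y \<Longrightarrow> ch x y"
  shows "nc ch' P"
  unfolding nc_def
proof (intro allI impI notI)
  fix x y z w assume s: "subseq [x, y, z, w] P" and c: "ch' x z \<and> ch' y w"
  have "set [x, y, z, w] \<subseteq> set P" by (rule subseq_set[OF s])
  then show False using assms(1) assms(2)[of x z] assms(2)[of y w] s c unfolding nc_def by auto
qed

lemma nc_append:
  assumes nc: "nc ch P" "nc ch Q" and sep: "\<And>x y. x \<in> set P \<Longrightarrow> y \<in> set Q \<Longrightarrow> \<not> ch x y"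
  shows "nc ch (P @ Q)"
  unfolding nc_def
proof (intro allI impI notI)
  fix x y z w assume "subseq [x, y, z, w] (P @ Q)" and c: "ch x z \<and> ch y w"
  then obtain s1 s2 where s: "[x, y, z, w] = s1 @ s2" "subseq s1 P" "subseq s2 Q"
    by (meson subseq_appendE)
  have sub: "set s1 \<subseteq> set P" "set s2 \<subseteq> set Q" using subseq_set[OF s(2)] subseq_set[OF s(3)] by auto
  show False
  proof (cases s1)
    case Nil
    then show ?thesis using s nc(2) c unfolding nc_def by auto
  next
    case (Cons a t1)
    note s1 = Cons
    show ?thesis
    proof (cases t1)
      case Nil
      then show ?thesis using s(1) s1 sub sep[of x z] c by auto
    next
      case (Cons b t2)
      note t1 = Cons
      show ?thesis
      proof (cases t2)
        case Nil
        then show ?thesis using s(1) s1 t1 sub sep[of x z] c by auto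
      next
        case (Cons d t3)
        note t2 = Cons
        show ?thesis
        proof (cases t3)
          case Nil
          then show ?thesis using s(1) s1 t1 t2 sub sep[of y w] c by auto
        next
          case (Cons e t4)
          then have "s1 = [x, y, z, w]" using s(1) s1 t1 t2 by auto
          then show ?thesis using s(2) nc(1) c unfolding nc_def by blast
        qed
      qed
    qed
  qed
qed

text \<open>Deleting an edge merges the faces \<open>z # \<alpha>\<close> and
  \<open>y # \<beta>\<close> into \<open>\<alpha> @ \<beta>\<close>. Chord ends at \<open>z\<close>
  move to \<open>hd \<beta>\<close>, those at \<open>y\<close> to \<open>hd \<alpha>\<close>, and
  the deleted edge becomes the chord between these two. The old polygons, read as
  \<open>\<alpha> @ [z]\<close> and \<open>y # \<beta>\<close>, are then the two sides of the new
  chord, so nothing crosses.\<close>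

lemma nc_merge:
  assumes sym: "\<And>x y. c x y \<Longrightarrow> c y x"
    and nc: "nc c (z # \<alpha>)" "nc c (y # \<beta>)" and ne: "\<alpha> \<noteq> []" "\<beta> \<noteq> []" and d: "distinct (z # \<alpha> @ y # \<beta>)"
    and c': "\<And>p q. p \<in> set (\<alpha> @ \<beta>) \<Longrightarrow> q \<in> set (\<alpha> @ \<beta>) \<Longrightarrow> c' p q \<Longrightarrow>
      (\<exists>p0\<in>set (z # \<alpha>). \<exists>q0\<in>set (z # \<alpha>). c p0 q0 \<and> p = (if p0 = z then hd \<beta> else p0) \<and> q = (if q0 = z then hd \<beta> else q0)) \<or>
      (\<exists>p0\<in>set (y # \<beta>). \<exists>q0\<in>set (y # \<beta>). c p0 q0 \<and> p = (if p0 = y then hd \<alpha> else p0) \<and> q = (if q0 = y then hd \<alpha> else q0)) \<or>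
      (p = hd \<alpha> \<and> q = hd \<beta>) \<or> (p = hd \<beta> \<and> q = hd \<alpha>)"
  shows "nc c' (\<alpha> @ \<beta>)"
proof -
  let ?M = "\<alpha> @ \<beta>" and ?p = "length \<alpha>"
  have ncz: "nc c (\<alpha> @ [z])" using nc_rotate[of c "[z]" \<alpha>] sym nc(1) by auto
  have dM: "distinct ?M" using d by auto
  \<comment> \<open>Position \<open>?p\<close> of the merged list, where \<open>hd \<beta>\<close>
    stands, plays the part of \<open>z\<close>.\<close>
  have pos1: "i \<le> ?p \<and> (\<alpha> @ [z]) ! i = p0"
    if i: "i < length ?M" and p0: "p0 \<in> set (z # \<alpha>)" "?M ! i = (if p0 = z then hd \<beta> else p0)" for i p0
  proof (cases "p0 = z")
    case True
    then have "?M ! i = ?M ! ?p" using p0 ne by (simp add: nth_append hd_conv_nth)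
    then have "i = ?p" using nth_eq_iff_index_eq[OF dM i, of ?p] ne by simp
    then show ?thesis using True by simp
  next
    case False
    then have "p0 \<in> set \<alpha>" using p0 by simp
    then obtain j where j: "j < ?p" "\<alpha> ! j = p0" by (auto simp: in_set_conv_nth)
    then have "?M ! i = ?M ! j" using p0 False by (simp add: nth_append)
    then have "i = j" using nth_eq_iff_index_eq[OF dM i, of j] j by simp
    then show ?thesis using j by (simp add: nth_append)
  qed
  \<comment> \<open>Position 0, where \<open>hd \<alpha>\<close> stands, plays the part of
    \<open>y\<close>; the elements of \<open>\<beta>\<close> come one place later in
    \<open>y # \<beta>\<close>, hence \<open>Suc (i - ?p)\<close>.\<close>
  have pos2: "(i = 0 \<or> ?p \<le> i) \<and> (y # \<beta>) ! (if i = 0 then 0 else Suc (i - ?p)) = p0"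
    if i: "i < length ?M" and p0: "p0 \<in> set (y # \<beta>)" "?M ! i = (if p0 = y then hd \<alpha> else p0)" for i p0
  proof (cases "p0 = y")
    case True
    then have "?M ! i = ?M ! 0" using p0 ne by (simp add: nth_append hd_conv_nth)
    then have "i = 0" using nth_eq_iff_index_eq[OF dM i, of 0] ne by simp
    then show ?thesis using True by simp
  next
    case False
    then have "p0 \<in> set \<beta>" using p0 by simp
    then obtain j where j: "j < length \<beta>" "\<beta> ! j = p0" by (auto simp: in_set_conv_nth)
    then have "?M ! i = ?M ! (?p + j)" using p0 False by (simp add: nth_append)
    then have "i = ?p + j" using nth_eq_iff_index_eq[OF dM i, of "?p + j"] j by simp
    then show ?thesis using j ne by auto
  qed
  have kinds: "(i \<le> ?p \<and> k \<le> ?p \<and> (c ((\<alpha> @ [z]) ! i) ((\<alpha> @ [z]) ! k) \<or> i = 0 \<and> k = ?p \<or> i = ?p \<and> k = 0)) \<or>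
      ((i = 0 \<or> ?p \<le> i) \<and> (k = 0 \<or> ?p \<le> k) \<and>
        c ((y # \<beta>) ! (if i = 0 then 0 else Suc (i - ?p))) ((y # \<beta>) ! (if k = 0 then 0 else Suc (k - ?p))))"
    if i: "i < length ?M" and k: "k < length ?M" and ch: "c' (?M ! i) (?M ! k)" for i k
  proof -
    have h: "hd \<alpha> = ?M ! 0" "hd \<beta> = ?M ! ?p" using ne by (simp_all add: nth_append hd_conv_nth)
    have eq: "i = j" if "?M ! i = ?M ! j" "i < length ?M" "j < length ?M" for i j
      using nth_eq_iff_index_eq[OF dM that(2,3)] that(1) by simp
    have l: "0 < length ?M" "?p < length ?M" using ne by auto
    from c'[OF nth_mem[OF i] nth_mem[OF k] ch] show ?thesis
    proof (elim disjE bexE conjE)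
      fix p0 q0 assume a: "p0 \<in> set (z # \<alpha>)" "q0 \<in> set (z # \<alpha>)" "c p0 q0"
        "?M ! i = (if p0 = z then hd \<beta> else p0)" "?M ! k = (if q0 = z then hd \<beta> else q0)"
      show ?thesis using pos1[OF i a(1,4)] pos1[OF k a(2,5)] a(3) by auto
    next
      fix p0 q0 assume a: "p0 \<in> set (y # \<beta>)" "q0 \<in> set (y # \<beta>)" "c p0 q0"
        "?M ! i = (if p0 = y then hd \<alpha> else p0)" "?M ! k = (if q0 = y then hd \<alpha> else q0)"
      show ?thesis using pos2[OF i a(1,4)] pos2[OF k a(2,5)] a(3) by auto
    next
      assume a: "?M ! i = hd \<alpha>" "?M ! k = hd \<beta>"
      then have "i = 0" "k = ?p" using eq[of i 0] eq[of k ?p] h i k l by auto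
      then show ?thesis by simp
    next
      assume a: "?M ! i = hd \<beta>" "?M ! k = hd \<alpha>"
      then have "i = ?p" "k = 0" using eq[of i ?p] eq[of k 0] h i k l by auto
      then show ?thesis by simp
    qed
  qed
  show ?thesis
    unfolding nc_iff_nth
  proof (intro allI impI notI)
    fix i j k l assume o: "i < j \<and> j < k \<and> k < l \<and> l < length ?M" and cc: "c' (?M ! i) (?M ! k) \<and> c' (?M ! j) (?M ! l)"
    have t1: "(k \<le> ?p \<and> (c ((\<alpha> @ [z]) ! i) ((\<alpha> @ [z]) ! k) \<or> i = 0 \<and> k = ?p)) \<or>
      ((i = 0 \<or> ?p \<le> i) \<and> ?p \<le> k \<and> c ((y # \<beta>) ! (if i = 0 then 0 else Suc (i - ?p))) ((y # \<beta>) ! Suc (k - ?p)))"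
      using kinds[of i k] o cc by auto
    have t2: "(l \<le> ?p \<and> c ((\<alpha> @ [z]) ! j) ((\<alpha> @ [z]) ! l)) \<or>
      (?p \<le> j \<and> c ((y # \<beta>) ! Suc (j - ?p)) ((y # \<beta>) ! Suc (l - ?p)))"
      using kinds[of j l] o cc by auto
    from t1 t2 show False
    proof (elim disjE)
      assume a: "k \<le> ?p \<and> (c ((\<alpha> @ [z]) ! i) ((\<alpha> @ [z]) ! k) \<or> i = 0 \<and> k = ?p)" "l \<le> ?p \<and> c ((\<alpha> @ [z]) ! j) ((\<alpha> @ [z]) ! l)"
      then have "c ((\<alpha> @ [z]) ! i) ((\<alpha> @ [z]) ! k)" using o by auto
      then show False using ncz[unfolded nc_iff_nth, rule_format, of i j k l] a o by auto
    next
      assume a: "(i = 0 \<or> ?p \<le> i) \<and> ?p \<le> k \<and> c ((y # \<beta>) ! (if i = 0 then 0 else Suc (i - ?p))) ((y # \<beta>) ! Suc (k - ?p))"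
        "?p \<le> j \<and> c ((y # \<beta>) ! Suc (j - ?p)) ((y # \<beta>) ! Suc (l - ?p))"
      have "(if i = 0 then 0 else Suc (i - ?p)) < Suc (j - ?p)" "Suc (j - ?p) < Suc (k - ?p)" "Suc (k - ?p) < Suc (l - ?p)"
        "Suc (l - ?p) < length (y # \<beta>)" using a o by auto
      then show False using nc(2)[unfolded nc_iff_nth, rule_format] a by blast
    qed (use o in auto)
  qed
qed

definition cyc :: "('x \<Rightarrow> 'x) \<Rightarrow> 'x list \<Rightarrow> bool" where
  "cyc F P \<longleftrightarrow> P \<noteq> [] \<and> distinct P \<and> successively (\<lambda>a b. F a = b) P \<and> F (last P) = hd P"

lemma cyc_rotate: "cyc F (xs @ ys) \<Longrightarrow> cyc F (ys @ xs)"
  unfolding cyc_def by (cases "xs = []"; cases "ys = []") (auto simp: successively_append_iff)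

lemma cyc_closed: "cyc F P \<Longrightarrow> x \<in> set P \<Longrightarrow> F x \<in> set P"
proof -
  assume c: "cyc F P" "x \<in> set P"
  then obtain a b where P: "P = a @ x # b" by (meson split_list)
  show ?thesis
  proof (cases b)
    case Nil
    then have "F x = hd P" using c P unfolding cyc_def by simp
    then show ?thesis using P by (metis hd_in_set append_is_Nil_conv list.distinct(1))
  next
    case (Cons y b')
    then have "F x = y" using c P unfolding cyc_def by (auto simp: successively_append_iff)
    then show ?thesis using P Cons by simp
  qed
qed

lemma cyc_orbit:
  assumes c: "cyc F P" and x: "x \<in> set P" shows "orbit F x = set P"
proof
  show "orbit F x \<subseteq> set P"
  proof
    fix y assume "y \<in> orbit F x"
    then show "y \<in> set P" by (induction rule: orbit.induct) (use x cyc_closed[OF c] in auto)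
  qed
  obtain a b where P: "P = a @ x # b" using x by (meson split_list)
  have c': "cyc F ((b @ a) @ [x])" using cyc_rotate[of F "a @ [x]" b] c P by simp
  have "set (b @ a @ [x]) \<subseteq> orbit F x"
  proof -
    have *: "set Q \<subseteq> orbit F x" if "successively (\<lambda>a b. F a = b) (x # Q)" for Q
    proof -
      have "set Q \<subseteq> orbit F x" if "successively (\<lambda>a b. F a = b) (u # Q)" "u = x \<or> u \<in> orbit F x" for u
        using that
      proof (induction Q arbitrary: u)
        case (Cons v Q)
        then have "F u = v" "successively (\<lambda>a b. F a = b) (v # Q)" by auto
        moreover from this have "v \<in> orbit F x" using Cons.prems by (auto intro: orbit.intros)
        ultimately show ?case using Cons.IH[of v] by auto
      qed simp
      then show ?thesis using that by blast
    qed
    show ?thesis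
    proof (rule *)
      have s: "successively (\<lambda>a b. F a = b) (b @ a @ [x])" "F x = hd (b @ a @ [x])" using c' unfolding cyc_def by auto
      then show "successively (\<lambda>a b. F a = b) (x # b @ a @ [x])" by (cases "b @ a @ [x]") auto
    qed
  qed
  then show "set P \<subseteq> orbit F x" using P by auto
qed

lemma cyc_exists:
  assumes fin: "finite X" and inj: "inj_on F X" and F: "\<And>x. x \<in> X \<Longrightarrow> F x \<in> X" and x: "x \<in> X"
  shows "\<exists>P. cyc F P \<and> x \<in> set P"
proof -
  have inX: "(F ^^ n) x \<in> X" for n using x F by (induction n) auto
  have cancel: "(F ^^ k) x = x" if "(F ^^ (i + k)) x = (F ^^ i) x" for i k
    using that
  proof (induction i)
    case (Suc i)
    then have "F ((F ^^ (i + k)) x) = F ((F ^^ i) x)" by simp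
    then show ?case using Suc.IH inj inX by (simp add: inj_on_eq_iff)
  qed simp
  have "\<not> inj_on (\<lambda>n. (F ^^ n) x) UNIV"
    using finite_imageD[of "\<lambda>n. (F ^^ n) x" UNIV] fin inX by (metis finite_subset image_subsetI infinite_UNIV_nat)
  then obtain i j where ij: "(F ^^ i) x = (F ^^ j) x" "i < j" unfolding inj_on_def by (metis linorder_neqE_nat)
  then have "(F ^^ (j - i)) x = x" using cancel[of i "j - i"] by simp
  then have ex: "\<exists>n. 0 < n \<and> (F ^^ n) x = x" using ij by (intro exI[of _ "j - i"]) simp
  define n where "n = (LEAST n. 0 < n \<and> (F ^^ n) x = x)"
  have n: "0 < n" "(F ^^ n) x = x" using LeastI_ex[OF ex] unfolding n_def by auto
  have nmin: "\<not> (0 < m \<and> (F ^^ m) x = x)" if "m < n" for m using not_less_Least that unfolding n_def by blast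
  define P where "P = map (\<lambda>i. (F ^^ i) x) [0..<n]"
  have ne: "(F ^^ i) x \<noteq> (F ^^ j) x" if "i < j" "j < n" for i j
    using cancel[of i "j - i"] nmin[of "j - i"] that by auto
  have "distinct P" unfolding P_def distinct_map
    by (auto intro!: inj_onI) (metis ne linorder_neqE_nat)
  moreover have "successively (\<lambda>a b. F a = b) P"
    unfolding P_def successively_conv_nth by auto
  moreover have "F (last P) = hd P"
  proof -
    have "hd P = x" using n(1) unfolding P_def by (simp add: hd_map)
    moreover have "last P = (F ^^ (n - 1)) x" using n(1) unfolding P_def by (simp add: last_map)
    moreover have "F ((F ^^ (n - 1)) x) = (F ^^ n) x" using n(1) by (cases n) auto
    ultimately show ?thesis using n(2) by simp
  qed
  moreover have "x \<in> set P" "P \<noteq> []" using n unfolding P_def by (auto simp: image_iff intro: bexI[of _ 0])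
  ultimately show ?thesis unfolding cyc_def by blast
qed

section \<open>Flags and facial walks\<close>

text \<open>A flag is a state of face tracing; \<open>opp\<close> moves to the other end of the edge, and \<open>rv\<close> reverses the
  direction of the walk.\<close>

type_synonym 'v flag = "('v \<times> 'v) \<times> bool"

fun opp :: "('v \<times> 'v \<Rightarrow> bool) \<Rightarrow> 'v flag \<Rightarrow> 'v flag" where
  "opp \<sigma> ((u, v), s) = ((v, u), s = \<sigma> (u, v))"

definition flip :: "'v flag \<Rightarrow> 'v flag" where "flip x = (fst x, \<not> snd x)"
definition rv :: "('v \<times> 'v \<Rightarrow> bool) \<Rightarrow> 'v flag \<Rightarrow> 'v flag" where "rv \<sigma> x = flip (opp \<sigma> x)"
abbreviation ftail :: "'v flag \<Rightarrow> 'v" where "ftail x \<equiv> fst (fst x)"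
abbreviation fhead :: "'v flag \<Rightarrow> 'v" where "fhead x \<equiv> snd (fst x)"
text \<open>A deleted edge is drawn between the corners in which its two ends now lie.\<close>

definition chord :: "('v \<times> 'v \<Rightarrow> bool) \<Rightarrow> ('v \<times> 'v) set \<Rightarrow> ('v \<times> 'v) set \<Rightarrow> ('v flag \<Rightarrow> 'v flag) \<Rightarrow> 'v flag \<Rightarrow> 'v flag \<Rightarrow> bool" where
  "chord \<sigma> A0 A \<kappa> x y \<longleftrightarrow> (\<exists>z\<in>(A0 - A) \<times> UNIV. x = \<kappa> z \<and> y = \<kappa> (opp \<sigma> z))"

lemma flip_flip [simp]: "flip (flip x) = x" unfolding flip_def by simp
lemma flip_fst [simp]: "fst (flip x) = fst x" "snd (flip x) = (\<not> snd x)" unfolding flip_def by simp_all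
lemma opp_flip: "opp \<sigma> (flip x) = flip (opp \<sigma> x)" by (cases x; cases "fst x") (auto simp: flip_def)
lemma opp_ends [simp]: "ftail (opp \<sigma> x) = fhead x" "fhead (opp \<sigma> x) = ftail x"
  by (cases x; cases "fst x"; auto)+
lemma fst_opp: "fst (opp \<sigma> x) = (fhead x, ftail x)" by (simp add: prod_eq_iff)

text \<open>The graph \<open>A0\<close> after some edges have been deleted, each of them merging two faces: \<open>A\<close> is the set of
  remaining arcs, \<open>\<rho>\<close> the rotation of their flags, and \<open>\<kappa>\<close> sends a flag of the original graph to the
  remaining corner in which it now lies. The deleted edges are non-crossing chords of the faces
  (\<open>poly\<close>).\<close>

locale flag_state =
  fixes \<sigma> :: "'v \<times> 'v \<Rightarrow> bool" and A0 A :: "('v \<times> 'v) set" and \<rho> \<kappa> :: "'v flag \<Rightarrow> 'v flag"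
  assumes finA0: "finite A0" and symA0: "(u, v) \<in> A0 \<Longrightarrow> (v, u) \<in> A0" and noloop: "(u, v) \<in> A0 \<Longrightarrow> u \<noteq> v"
    and sigma_sym: "(u, v) \<in> A0 \<Longrightarrow> \<sigma> (v, u) = \<sigma> (u, v)"
    and A_sub: "A \<subseteq> A0" and A_sym: "(u, v) \<in> A \<Longrightarrow> (v, u) \<in> A"
    and rho_in: "w \<in> A \<times> UNIV \<Longrightarrow> \<rho> w \<in> A \<times> UNIV" and rho_inj: "inj_on \<rho> (A \<times> UNIV)"
    and rho_tail: "w \<in> A \<times> UNIV \<Longrightarrow> ftail (\<rho> w) = ftail w" and rho_snd: "w \<in> A \<times> UNIV \<Longrightarrow> snd (\<rho> w) = snd w"
    and rho_flip: "w \<in> A \<times> UNIV \<Longrightarrow> \<rho> (flip (\<rho> w)) = flip w"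
    and rho_trans: "B \<noteq> {} \<Longrightarrow> B \<subseteq> {w \<in> A \<times> UNIV. ftail w = v \<and> snd w = s} \<Longrightarrow> \<rho> ` B \<subseteq> B \<Longrightarrow>
        B = {w \<in> A \<times> UNIV. ftail w = v \<and> snd w = s}"
    and kappa_in: "w \<in> A0 \<times> UNIV \<Longrightarrow> \<kappa> w \<in> A \<times> UNIV" and kappa_id: "w \<in> A \<times> UNIV \<Longrightarrow> \<kappa> w = w"
    and kappa_tail: "w \<in> A0 \<times> UNIV \<Longrightarrow> ftail (\<kappa> w) = ftail w"
    and kappa_opp: "w \<in> (A0 - A) \<times> UNIV \<Longrightarrow> orbit (\<rho> \<circ> opp \<sigma>) (\<kappa> (opp \<sigma> w)) = orbit (\<rho> \<circ> opp \<sigma>) (\<kappa> w)"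
    and kappa_flip: "w \<in> (A0 - A) \<times> UNIV \<Longrightarrow> orbit (\<rho> \<circ> opp \<sigma>) (\<kappa> (flip w)) = rv \<sigma> ` orbit (\<rho> \<circ> opp \<sigma>) (\<kappa> w)"
    and poly: "x \<in> A \<times> UNIV \<Longrightarrow> \<exists>P. cyc (\<rho> \<circ> opp \<sigma>) P \<and> x \<in> set P \<and> nc (chord \<sigma> A0 A \<kappa>) P"
begin

abbreviation "X \<equiv> A \<times> (UNIV :: bool set)"
abbreviation "X0 \<equiv> A0 \<times> (UNIV :: bool set)"
abbreviation "F \<equiv> \<rho> \<circ> opp \<sigma>"
abbreviation "R \<equiv> rv \<sigma>"
abbreviation "ch \<equiv> chord \<sigma> A0 A \<kappa>"
abbreviation "orb \<equiv> orbit F"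

lemma finX: "finite X" using finite_subset[OF A_sub finA0] by simp

lemma X_X0: "x \<in> X \<Longrightarrow> x \<in> X0" using A_sub by auto

lemma opp_opp: "x \<in> X0 \<Longrightarrow> opp \<sigma> (opp \<sigma> x) = x"
proof -
  assume "x \<in> X0"
  then obtain u v s where x: "x = ((u, v), s)" "(u, v) \<in> A0" by (metis SigmaE surj_pair)
  then show ?thesis using sigma_sym[of u v] by auto
qed

lemma opp_in: "x \<in> X \<Longrightarrow> opp \<sigma> x \<in> X" and opp_in0: "x \<in> X0 \<Longrightarrow> opp \<sigma> x \<in> X0"
  using A_sym symA0 by (auto simp: mem_Times_iff fst_opp)

lemma flip_in: "x \<in> X \<Longrightarrow> flip x \<in> X" and flip_in0: "x \<in> X0 \<Longrightarrow> flip x \<in> X0"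
  by (auto simp: mem_Times_iff)

lemma R_in: "x \<in> X \<Longrightarrow> R x \<in> X"
  unfolding rv_def using opp_in flip_in by blast

lemma R_R: "x \<in> X0 \<Longrightarrow> R (R x) = x"
  unfolding rv_def by (simp add: opp_flip opp_opp)

lemma R_opp: "x \<in> X0 \<Longrightarrow> R (opp \<sigma> x) = flip x" and opp_R: "x \<in> X0 \<Longrightarrow> opp \<sigma> (R x) = flip x"
  unfolding rv_def by (simp_all add: opp_flip opp_opp)

lemma R_tail: "ftail (R x) = fhead x" "fhead (R x) = ftail x"
  unfolding rv_def by simp_all

lemma F_in: "x \<in> X \<Longrightarrow> F x \<in> X" using opp_in rho_in by simp

lemma F_inj: "inj_on F X"
proof (rule inj_onI)
  fix x y assume xy: "x \<in> X" "y \<in> X" "F x = F y"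
  then have "opp \<sigma> x = opp \<sigma> y" using rho_inj opp_in by (auto simp: inj_on_eq_iff)
  then show "x = y" using opp_opp X_X0 xy by metis
qed

lemma F_tail: "x \<in> X \<Longrightarrow> ftail (F x) = fhead x"
  using rho_tail[OF opp_in] by simp

lemma F_opp: "x \<in> X \<Longrightarrow> F (opp \<sigma> x) = \<rho> x" using opp_opp X_X0 by simp

text \<open>\<open>R\<close> turns the facial permutation into its inverse; this is why facial walks
  come in mirrored pairs.\<close>

lemma F_R_F: "x \<in> X \<Longrightarrow> F (R (F x)) = R x"
proof -
  assume x: "x \<in> X"
  have "F (R (F x)) = \<rho> (flip (\<rho> (opp \<sigma> x)))" using opp_R[OF X_X0[OF F_in[OF x]]] by simp
  also have "\<dots> = flip (opp \<sigma> x)" using rho_flip[OF opp_in[OF x]] .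
  finally show ?thesis unfolding rv_def .
qed

lemma cyc_sub: "cyc F P \<Longrightarrow> x \<in> set P \<Longrightarrow> x \<in> X \<Longrightarrow> set P \<subseteq> X"
proof -
  assume c: "cyc F P" "x \<in> set P" "x \<in> X"
  have "y \<in> X" if "y \<in> orb x" for y using that
    by (induction rule: orbit.induct) (use c F_in in auto)
  then show ?thesis using cyc_orbit[OF c(1,2)] by blast
qed

lemma orb_list: "x \<in> X \<Longrightarrow> \<exists>P. cyc F P \<and> set P = orb x \<and> x \<in> set P \<and> set P \<subseteq> X \<and> nc ch P"
  using poly[of x] cyc_orbit[of F] cyc_sub[of _ x] by metis

lemma orb_sub: "x \<in> X \<Longrightarrow> orb x \<subseteq> X" and orb_self: "x \<in> X \<Longrightarrow> x \<in> orb x"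
  using orb_list by blast+

lemma orb_eq: "x \<in> X \<Longrightarrow> y \<in> orb x \<Longrightarrow> orb y = orb x"
  using orb_list[of x] cyc_orbit[of F] by metis

lemma orb_disjoint: "x \<in> X \<Longrightarrow> y \<in> X \<Longrightarrow> orb x \<noteq> orb y \<Longrightarrow> orb x \<inter> orb y = {}"
  using orb_eq by blast

lemma orb_F: "x \<in> X \<Longrightarrow> orb (F x) = orb x"
  using orb_eq[of x "F x"] orbit.base[of F x] by simp

lemma cyc_rev:
  assumes c: "cyc F P" and P: "set P \<subseteq> X" shows "cyc F (rev (map R P))"
  unfolding cyc_def
proof (intro conjI)
  have ne: "P \<noteq> []" using c unfolding cyc_def by blast
  show "rev (map R P) \<noteq> []" using ne by simp
  have "inj_on R (set P)" using R_R X_X0 P by (intro inj_on_inverseI[of _ R]) auto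
  then show "distinct (rev (map R P))" using c unfolding cyc_def by (simp add: distinct_map)
  have "successively (\<lambda>x y. F (R y) = R x) P"
    using c unfolding cyc_def
  proof (elim conjE)
    assume "successively (\<lambda>a b. F a = b) P"
    then show ?thesis
    proof (rule successively_mono)
      fix a b assume "a \<in> set P" "F a = b"
      then show "F (R b) = R a" using F_R_F[of a] P by (metis subsetD)
    qed
  qed
  then show "successively (\<lambda>a b. F a = b) (rev (map R P))"
    by (simp add: successively_rev successively_map)
  have "F (R (hd P)) = R (last P)" using c F_R_F[of "last P"] P ne unfolding cyc_def by (metis last_in_set subsetD)
  then show "F (last (rev (map R P))) = hd (rev (map R P))"
    using ne by (simp add: last_rev hd_rev hd_map last_map)
qed

lemma orb_R: "x \<in> X \<Longrightarrow> orb (R x) = R ` orb x"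
proof -
  assume x: "x \<in> X"
  then obtain P where P: "cyc F P" "set P = orb x" "x \<in> set P" "set P \<subseteq> X" using orb_list by blast
  then have "orb (R x) = set (rev (map R P))" by (intro cyc_orbit cyc_rev) auto
  then show ?thesis using P by simp
qed

text \<open>A facial walk containing \<open>y\<close> and its reversal would be its own mirror image, and the middle of the
  mirrored stretch would be a flag fixed by \<open>R\<close> or one on which \<open>R\<close> and \<open>F\<close> agree.\<close>

lemma orb_R_disjoint:
  assumes x: "x \<in> X" shows "orb x \<inter> R ` orb x = {}"
proof (rule ccontr)
  assume "\<not> ?thesis"
  then obtain y where y: "y \<in> orb x" "R y \<in> orb x" by blast
  then have yX: "y \<in> X" using orb_sub x by blast
  obtain P where P: "cyc F P" "set P = orb y" "y \<in> set P" "set P \<subseteq> X" using orb_list[OF yX] by blast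
  obtain a b where "P = a @ y # b" using P(3) by (meson split_list)
  then have c: "cyc F (y # b @ a)" and Ps: "set (y # b @ a) = orb y" using P cyc_rotate[of F a "y # b"] by auto
  define Q where "Q = y # b @ a"
  have QX: "set Q \<subseteq> X" using Ps P(2,4) unfolding Q_def by simp
  have idx: "Q ! j \<in> X" if "j < length Q" for j using QX nth_mem[OF that] by blast
  have nxt: "F (Q ! i) = Q ! Suc i" if "Suc i < length Q" for i
    using c that unfolding cyc_def Q_def[symmetric] by (simp add: successively_conv_nth)
  have "R y \<in> set Q" using y orb_eq[OF x y(1)] Ps unfolding Q_def by simp
  then obtain k where k: "k < length Q" "Q ! k = R y" by (auto simp: in_set_conv_nth)
  have mirror: "R (Q ! i) = Q ! (k - i)" if "i \<le> k" for i
    using that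
  proof (induction i)
    case 0
    then show ?case using k unfolding Q_def by simp
  next
    case (Suc i)
    have qi: "Q ! i \<in> X" "Q ! Suc i \<in> X" "Q ! (k - Suc i) \<in> X"
      by (rule idx, use k Suc in linarith)+
    have "F (R (Q ! Suc i)) = R (Q ! i)" using F_R_F[OF qi(1)] nxt[of i] Suc k by simp
    also have "\<dots> = Q ! (k - i)" using Suc by simp
    also have "\<dots> = F (Q ! (k - Suc i))" using nxt[of "k - Suc i"] Suc k by (simp add: Suc_diff_Suc)
    finally show ?case by (rule inj_onD[OF F_inj _ R_in[OF qi(2)] qi(3)])
  qed
  have Rne: "R w \<noteq> w" if "w \<in> X" for w
  proof
    assume "R w = w"
    then have "ftail w = fhead w" using R_tail[of w] by simp
    moreover have "(ftail w, fhead w) \<in> A0" using that A_sub by (auto simp: mem_Times_iff)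
    ultimately show False using noloop by metis
  qed
  have RneF: "R w \<noteq> F w" if "w \<in> X" for w
    using rho_snd[OF opp_in[OF that]] unfolding rv_def by (metis comp_apply flip_fst(2))
  show False
  proof (cases "even k")
    case True
    then obtain j where j: "k = 2 * j" by blast
    then have "R (Q ! j) = Q ! j" using mirror[of j] by simp
    then show False using Rne[OF idx[of j]] k j by simp
  next
    case False
    then obtain j where j: "k = 2 * j + 1" by (metis oddE)
    then have "R (Q ! j) = Q ! Suc j" using mirror[of j] by simp
    also have "\<dots> = F (Q ! j)" using nxt[of j] k j by simp
    finally show False using RneF[OF idx[of j]] k j by simp
  qed
qed

lemma chord_sym: "ch x y \<Longrightarrow> ch y x"
proof -
  assume "ch x y"
  then obtain z where z: "z \<in> (A0 - A) \<times> UNIV" "x = \<kappa> z" "y = \<kappa> (opp \<sigma> z)" unfolding chord_def by blast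
  have "(ftail z, fhead z) \<in> A0 - A" using z(1) by (simp add: mem_Times_iff)
  then have "(fhead z, ftail z) \<in> A0 - A" using symA0 A_sym by blast
  then have "opp \<sigma> z \<in> (A0 - A) \<times> UNIV" by (simp add: mem_Times_iff fst_opp)
  moreover have "opp \<sigma> (opp \<sigma> z) = z" using opp_opp z(1) by auto
  ultimately show ?thesis using z unfolding chord_def by metis
qed

end

section \<open>Deleting an edge between two faces\<close>

text \<open>The facial walks of \<open>z\<close> and \<open>opp \<sigma> z\<close> run along the two
  sides of the edge. The conditions say that they are neither equal nor mirror images, so that two
  different faces meet at the edge.\<close>

locale flag_delete = flag_state +
  fixes z :: "'a flag"
  assumes zX: "z \<in> X" and merge1: "orb (opp \<sigma> z) \<noteq> orb z" and merge2: "orb (opp \<sigma> z) \<noteq> R ` orb z"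
begin

definition A' :: "('a \<times> 'a) set" where "A' = A - {fst z, fst (opp \<sigma> z)}"
definition D :: "'a flag set" where "D = {z, opp \<sigma> z, R z, R (opp \<sigma> z)}"
text \<open>A single bypass suffices: by \<open>rho_D\<close>, no two flags of the deleted edge
  follow each other in the rotation.\<close>

definition \<rho>' :: "'a flag \<Rightarrow> 'a flag" where "\<rho>' w = (if \<rho> w \<in> D then \<rho> (\<rho> w) else \<rho> w)"
definition skip :: "'a flag \<Rightarrow> 'a flag" where "skip x = (if x \<in> D then \<rho> x else x)"
definition \<kappa>' :: "'a flag \<Rightarrow> 'a flag" where "\<kappa>' w = skip (\<kappa> w)"
abbreviation "F' \<equiv> \<rho>' \<circ> opp \<sigma>"
abbreviation "X' \<equiv> A' \<times> (UNIV :: bool set)"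

lemma z0: "z \<in> X0" "opp \<sigma> z \<in> X" "opp \<sigma> z \<in> X0" "R z \<in> X" "R (opp \<sigma> z) \<in> X"
  using zX X_X0 opp_in R_in by blast+

lemma D_sub: "D \<subseteq> X" unfolding D_def using zX z0 by blast

lemma D_fst: "x \<in> D \<longleftrightarrow> fst x \<in> {fst z, fst (opp \<sigma> z)}"
proof
  show "x \<in> D \<Longrightarrow> fst x \<in> {fst z, fst (opp \<sigma> z)}"
    unfolding D_def using R_opp[OF z0(1)] by (auto simp: rv_def)
  have two: "y = a \<or> y = flip a" if "fst y = fst a" for y a :: "'a flag"
    using that by (cases y; cases a) (auto simp: flip_def)
  assume "fst x \<in> {fst z, fst (opp \<sigma> z)}"
  then have "x = z \<or> x = flip z \<or> x = opp \<sigma> z \<or> x = flip (opp \<sigma> z)" using two by blast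
  then show "x \<in> D" unfolding D_def using R_opp[OF z0(1)] by (auto simp: rv_def)
qed

lemma X'_eq: "X' = X - D"
proof (rule set_eqI)
  fix x :: "'a flag"
  show "x \<in> X' \<longleftrightarrow> x \<in> X - D" using D_fst[of x] by (simp add: A'_def mem_Times_iff)
qed

lemma D_opp: "x \<in> D \<Longrightarrow> opp \<sigma> x \<in> D"
  using opp_opp[OF z0(1)] opp_opp[OF z0(3)] D_fst[of "opp \<sigma> x"] D_fst[of x] fst_opp[of \<sigma> x] fst_opp[of \<sigma> z] by auto

lemma D_flip: "x \<in> D \<Longrightarrow> flip x \<in> D" using D_fst by simp

lemma opp_D_iff: "x \<in> X0 \<Longrightarrow> opp \<sigma> x \<in> D \<longleftrightarrow> x \<in> D" using D_opp opp_opp by metis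

lemma flip_D_iff: "flip x \<in> D \<longleftrightarrow> x \<in> D" using D_flip flip_flip by metis

lemma R_D_iff: "x \<in> X0 \<Longrightarrow> R x \<in> D \<longleftrightarrow> x \<in> D" unfolding rv_def using opp_D_iff flip_D_iff by blast

lemma R_R_image: "S \<subseteq> X \<Longrightarrow> R ` R ` S = S"
proof -
  assume "S \<subseteq> X"
  then have "\<And>x. x \<in> S \<Longrightarrow> R (R x) = x" using R_R X_X0 by blast
  then show ?thesis by (simp add: image_image)
qed

definition "o1 = orb z" definition "o2 = orb (opp \<sigma> z)"

lemma o34: "orb (R z) = R ` o1" "orb (R (opp \<sigma> z)) = R ` o2"
  unfolding o1_def o2_def by (rule orb_R[OF zX], rule orb_R[OF z0(2)])

lemma o_sub: "o1 \<subseteq> X" "o2 \<subseteq> X"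
  unfolding o1_def o2_def by (rule orb_sub[OF zX], rule orb_sub[OF z0(2)])

lemma o_RR: "x \<in> o1 \<Longrightarrow> R (R x) = x" "x \<in> o2 \<Longrightarrow> R (R x) = x"
  by (rule R_R[OF X_X0[OF subsetD[OF o_sub(1)]]], assumption, rule R_R[OF X_X0[OF subsetD[OF o_sub(2)]]], assumption)

lemma o_disj: "o1 \<inter> o2 = {}" "o1 \<inter> R ` o1 = {}" "o1 \<inter> R ` o2 = {}" "o2 \<inter> R ` o1 = {}" "o2 \<inter> R ` o2 = {}" "R ` o1 \<inter> R ` o2 = {}"
proof -
  show 1: "o1 \<inter> o2 = {}" unfolding o1_def o2_def using orb_disjoint[OF zX z0(2) merge1[symmetric]] .
  show "o1 \<inter> R ` o1 = {}" unfolding o1_def by (rule orb_R_disjoint[OF zX])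
  show "o2 \<inter> R ` o2 = {}" unfolding o2_def by (rule orb_R_disjoint[OF z0(2)])
  have "orb (opp \<sigma> z) \<noteq> orb (R z)" using merge2 o34(1) unfolding o1_def by simp
  from orb_disjoint[OF z0(2) z0(4) this] show 2: "o2 \<inter> R ` o1 = {}" unfolding o34(1) o2_def .
  show "o1 \<inter> R ` o2 = {}"
  proof (rule ccontr)
    assume "\<not> ?thesis"
    then obtain y where y: "y \<in> o2" "R y \<in> o1" by blast
    then have "R (R y) \<in> R ` o1" by simp
    then have "y \<in> R ` o1" using o_RR(2)[OF y(1)] by simp
    then show False using equals0D[OF 2, of y] y(1) by simp
  qed
  show "R ` o1 \<inter> R ` o2 = {}"
  proof (rule ccontr)
    assume "\<not> ?thesis"
    then obtain x y where xy: "x \<in> o1" "y \<in> o2" "R x = R y" by blast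
    have "x = y" using o_RR(1)[OF xy(1)] o_RR(2)[OF xy(2)] xy(3) by metis
    then show False using equals0D[OF 1, of y] xy(1,2) by simp
  qed
qed

lemma o_self: "z \<in> o1" "opp \<sigma> z \<in> o2" "R z \<in> R ` o1" "R (opp \<sigma> z) \<in> R ` o2"
  unfolding o1_def o2_def using orb_self[OF zX] orb_self[OF z0(2)] by (simp_all add: imageI)

lemma D_orb_cases: "x \<in> D \<Longrightarrow> x = z \<and> x \<in> o1 \<or> x = opp \<sigma> z \<and> x \<in> o2 \<or> x = R z \<and> x \<in> R ` o1 \<or> x = R (opp \<sigma> z) \<and> x \<in> R ` o2"
  unfolding D_def using o_self by (elim insertE) (simp_all only: simp_thms empty_iff)

lemma D_o: "x \<in> D \<Longrightarrow> x \<in> o1 \<Longrightarrow> x = z" "x \<in> D \<Longrightarrow> x \<in> o2 \<Longrightarrow> x = opp \<sigma> z"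
  "x \<in> D \<Longrightarrow> x \<in> R ` o1 \<Longrightarrow> x = R z" "x \<in> D \<Longrightarrow> x \<in> R ` o2 \<Longrightarrow> x = R (opp \<sigma> z)"
proof -
  assume x: "x \<in> D"
  have d: "\<not> (x \<in> o1 \<and> x \<in> o2)" "\<not> (x \<in> o1 \<and> x \<in> R ` o1)" "\<not> (x \<in> o1 \<and> x \<in> R ` o2)" "\<not> (x \<in> o2 \<and> x \<in> R ` o1)"
    "\<not> (x \<in> o2 \<and> x \<in> R ` o2)" "\<not> (x \<in> R ` o1 \<and> x \<in> R ` o2)"
    using o_disj[THEN equals0D, of x] by (simp_all only: Int_iff simp_thms not_False_eq_True)
  show "x \<in> o1 \<Longrightarrow> x = z" "x \<in> o2 \<Longrightarrow> x = opp \<sigma> z" "x \<in> R ` o1 \<Longrightarrow> x = R z" "x \<in> R ` o2 \<Longrightarrow> x = R (opp \<sigma> z)"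
    using D_orb_cases[OF x] d by argo+
qed

lemma orb_D_opp: "d \<in> D \<Longrightarrow> y \<in> D \<Longrightarrow> y \<in> orb (opp \<sigma> d) \<Longrightarrow> y = opp \<sigma> d"
proof -
  assume d: "d \<in> D" "y \<in> D" "y \<in> orb (opp \<sigma> d)"
  have Rz: "opp \<sigma> (R z) = R (opp \<sigma> z)" "opp \<sigma> (R (opp \<sigma> z)) = R z" "opp \<sigma> (opp \<sigma> z) = z"
    using opp_R[OF z0(1)] R_opp[OF z0(1)] opp_R[OF z0(3)] opp_opp[OF z0(1)] unfolding rv_def by simp_all
  from d(1) consider "d = z" | "d = opp \<sigma> z" | "d = R z" | "d = R (opp \<sigma> z)" unfolding D_def by blast
  then show ?thesis
  proof cases
    case 1 then show ?thesis using D_o(2)[OF d(2)] d(3) unfolding o2_def by simp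
  next
    case 2 then show ?thesis using D_o(1)[OF d(2)] d(3) Rz unfolding o1_def by simp
  next
    case 3 then show ?thesis using D_o(4)[OF d(2)] d(3) Rz o34 by simp
  next
    case 4 then show ?thesis using D_o(3)[OF d(2)] d(3) Rz o34 by simp
  qed
qed

text \<open>An edge with an end of degree one has the same face on both sides. In terms of flags,
  \<open>\<rho> d\<close> lies on the facial walk of \<open>opp \<sigma> d\<close>, whose only flag
  in \<open>D\<close> is \<open>opp \<sigma> d\<close> itself, and that has another tail.\<close>

lemma rho_D: "d \<in> D \<Longrightarrow> \<rho> d \<notin> D"
proof
  assume d: "d \<in> D" "\<rho> d \<in> D"
  have dX: "d \<in> X" using d D_sub by blast
  have "\<rho> d = F (opp \<sigma> d)" using F_opp[OF dX] by simp
  then have "\<rho> d \<in> orb (opp \<sigma> d)" using orbit.base[of F "opp \<sigma> d"] by simp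
  then have "\<rho> d = opp \<sigma> d" using orb_D_opp d by blast
  then have "ftail d = fhead d" using rho_tail[OF dX] by simp
  moreover have "(ftail d, fhead d) \<in> A0" using dX A_sub by (auto simp: mem_Times_iff)
  ultimately show False using noloop by metis
qed

lemma skip_in: "x \<in> X \<Longrightarrow> skip x \<in> X'"
  unfolding skip_def X'_eq using rho_D rho_in D_sub by auto

text \<open>After the last flag of \<open>\<alpha>\<close> the old walk would return to
  \<open>y\<close>; the bypass continues with the successor of \<open>opp \<sigma> y\<close>
  instead, that is with \<open>\<beta>\<close>, and vice versa. It is stated for a flag
  \<open>y\<close> because it serves both \<open>z\<close> and its mirror image.\<close>

lemma merged_list:
  assumes y: "y \<in> X" "\<And>x. x \<in> D \<Longrightarrow> x \<in> orb y \<Longrightarrow> x = y" "\<And>x. x \<in> D \<Longrightarrow> x \<in> orb (opp \<sigma> y) \<Longrightarrow> x = opp \<sigma> y"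
    and yD: "y \<in> D" and dis: "orb y \<inter> orb (opp \<sigma> y) = {}"
  shows "\<exists>\<alpha> \<beta>. cyc F (y # \<alpha>) \<and> cyc F (opp \<sigma> y # \<beta>) \<and> nc ch (y # \<alpha>) \<and> nc ch (opp \<sigma> y # \<beta>) \<and> \<alpha> \<noteq> [] \<and> \<beta> \<noteq> [] \<and>
    set (y # \<alpha>) = orb y \<and> set (opp \<sigma> y # \<beta>) = orb (opp \<sigma> y) \<and> distinct (y # \<alpha> @ opp \<sigma> y # \<beta>) \<and>
    cyc F' (\<alpha> @ \<beta>) \<and> set (\<alpha> @ \<beta>) = (orb y \<union> orb (opp \<sigma> y)) - D \<and> F y = hd \<alpha> \<and> F (opp \<sigma> y) = hd \<beta>"
proof -
  have start: "\<exists>\<alpha>. cyc F (x # \<alpha>) \<and> nc ch (x # \<alpha>) \<and> set (x # \<alpha>) = orb x \<and> \<alpha> \<noteq> [] \<and> F x = hd \<alpha> \<and> F (last \<alpha>) = x" if x: "x \<in> X" for x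
  proof -
    obtain P where P: "cyc F P" "set P = orb x" "x \<in> set P" "nc ch P" using orb_list[OF x] by blast
    obtain a b where ab: "P = a @ x # b" using P(3) by (meson split_list)
    have c: "cyc F (x # b @ a)" using cyc_rotate[of F a "x # b"] P ab by simp
    have n: "nc ch (x # b @ a)" using nc_rotate[of ch a "x # b"] chord_sym P ab by auto
    have s: "set (x # b @ a) = orb x" using P ab by auto
    have "F x \<noteq> x"
    proof
      assume "F x = x"
      then have "ftail x = fhead x" using F_tail[OF x] by simp
      moreover have "(ftail x, fhead x) \<in> A0" using x A_sub by (auto simp: mem_Times_iff)
      ultimately show False using noloop by metis
    qed
    then have ne: "b @ a \<noteq> []" using c unfolding cyc_def by (cases "b @ a") auto
    have "F x = hd (b @ a)" "F (last (b @ a)) = x" using c ne unfolding cyc_def by (cases "b @ a"; auto)+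
    then show ?thesis using c n s ne by blast
  qed
  have oy: "opp \<sigma> y \<in> X" "opp \<sigma> y \<in> D" using opp_in y D_opp yD by auto
  obtain \<alpha> where a: "cyc F (y # \<alpha>)" "nc ch (y # \<alpha>)" "set (y # \<alpha>) = orb y" "\<alpha> \<noteq> []" "F y = hd \<alpha>" "F (last \<alpha>) = y"
    using start[OF y(1)] by blast
  obtain \<beta> where b: "cyc F (opp \<sigma> y # \<beta>)" "nc ch (opp \<sigma> y # \<beta>)" "set (opp \<sigma> y # \<beta>) = orb (opp \<sigma> y)" "\<beta> \<noteq> []"
    "F (opp \<sigma> y) = hd \<beta>" "F (last \<beta>) = opp \<sigma> y" using start[OF oy(1)] by blast
  have aX: "set \<alpha> \<subseteq> X" "set \<beta> \<subseteq> X"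
    using set_subset_Cons[of \<alpha> y] set_subset_Cons[of \<beta> "opp \<sigma> y"] orb_sub[OF y(1)] orb_sub[OF oy(1)] unfolding a(3) b(3)
    by - (erule (1) order_trans)+
  have da: "distinct (y # \<alpha>)" "distinct (opp \<sigma> y # \<beta>)" using a b unfolding cyc_def by auto
  have aD: "set \<alpha> \<inter> D = {}" "set \<beta> \<inter> D = {}"
  proof -
    have "x \<notin> D" if "x \<in> set \<alpha>" for x using y(2)[of x] a(3) da(1) that by (metis distinct.simps(2) set_subset_Cons subsetD)
    then show "set \<alpha> \<inter> D = {}" by (intro equals0I) (erule IntE, simp)
    have "x \<notin> D" if "x \<in> set \<beta>" for x using y(3)[of x] b(3) da(2) that by (metis distinct.simps(2) set_subset_Cons subsetD)
    then show "set \<beta> \<inter> D = {}" by (intro equals0I) (erule IntE, simp)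
  qed
  have dist: "distinct (y # \<alpha> @ opp \<sigma> y # \<beta>)" using da dis a(3) b(3) by auto
  have F'1: "F' x = F x" if "F x \<notin> D" for x using that unfolding \<rho>'_def by simp
  have F'2: "F' x = F (opp \<sigma> (F x))" if "x \<in> X" "F x \<in> D" for x
    using that F_opp[OF F_in[OF that(1)]] unfolding \<rho>'_def by simp
  have sa: "successively (\<lambda>a b. F' a = b) Q" if "successively (\<lambda>a b. F a = b) Q" "set Q \<inter> D = {}" for Q
    using that(1)
  proof (rule successively_mono)
    fix a b assume "b \<in> set Q" "F a = b"
    then show "F' a = b" using F'1[of a] that(2) by auto
  qed
  have sab: "successively (\<lambda>a b. F' a = b) \<alpha>" "successively (\<lambda>a b. F' a = b) \<beta>"
    using sa a(1) b(1) aD unfolding cyc_def by (auto simp: successively_Cons)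
  have "F' (last \<alpha>) = F (opp \<sigma> y)" using F'2[OF subsetD[OF aX(1) last_in_set[OF a(4)]]] a(6) yD by simp
  then have l1: "F' (last \<alpha>) = hd \<beta>" using b(5) by simp
  have "F' (last \<beta>) = F (opp \<sigma> (opp \<sigma> y))" using F'2[OF subsetD[OF aX(2) last_in_set[OF b(4)]]] b(6) oy by simp
  then have l2: "F' (last \<beta>) = hd \<alpha>" using a(5) opp_opp[OF X_X0[OF y(1)]] by simp
  have "cyc F' (\<alpha> @ \<beta>)" unfolding cyc_def
    using a(4) b(4) dist sab l1 l2 by (auto simp: successively_append_iff)
  moreover have "set (\<alpha> @ \<beta>) = (orb y \<union> orb (opp \<sigma> y)) - D" 
  proof -
    have gen: "U \<union> V = (S \<union> T) - D" if "insert p U = S" "insert q V = T" "U \<inter> D = {}" "V \<inter> D = {}" "p \<in> D" "q \<in> D" for U V S T p q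
      using that by blast
    show ?thesis unfolding set_append by (rule gen[OF _ _ aD yD oy(2)]) (use a(3) b(3) in simp_all)
  qed
  ultimately show ?thesis
    by (intro exI[of _ \<alpha>] exI[of _ \<beta>] conjI a b dist)
qed

lemma cyc_unaffected:
  assumes c: "cyc F P" and P: "set P \<inter> D = {}" shows "cyc F' P"
proof -
  have F'1: "F' x = F x" if "x \<in> set P" for x
    using cyc_closed[OF c that] P unfolding \<rho>'_def by auto
  have "successively (\<lambda>a b. F' a = b) P"
    using c unfolding cyc_def
  proof (elim conjE)
    assume "successively (\<lambda>a b. F a = b) P"
    then show ?thesis by (rule successively_mono) (use F'1 in auto)
  qed
  moreover have "F' (last P) = hd P" using F'1[of "last P"] c unfolding cyc_def by auto
  ultimately show ?thesis using c unfolding cyc_def by blast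
qed

definition "M1 = (o1 \<union> o2) - D"

lemma R_M1: "R ` M1 = (R ` o1 \<union> R ` o2) - D"
proof -
  have "\<And>x. x \<in> o1 \<union> o2 \<Longrightarrow> (R x \<in> D \<longleftrightarrow> x \<in> D)" using R_D_iff X_X0 o_sub by blast
  then show ?thesis unfolding M1_def by auto
qed

lemma merged_z: "\<exists>\<alpha> \<beta>. cyc F (z # \<alpha>) \<and> cyc F (opp \<sigma> z # \<beta>) \<and> nc ch (z # \<alpha>) \<and> nc ch (opp \<sigma> z # \<beta>) \<and> \<alpha> \<noteq> [] \<and> \<beta> \<noteq> [] \<and>
    set (z # \<alpha>) = o1 \<and> set (opp \<sigma> z # \<beta>) = o2 \<and> distinct (z # \<alpha> @ opp \<sigma> z # \<beta>) \<and>
    cyc F' (\<alpha> @ \<beta>) \<and> set (\<alpha> @ \<beta>) = M1 \<and> F z = hd \<alpha> \<and> F (opp \<sigma> z) = hd \<beta>"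
proof -
  have "z \<in> D" unfolding D_def by blast
  from merged_list[OF zX D_o(1)[unfolded o1_def] D_o(2)[unfolded o2_def] this o_disj(1)[unfolded o1_def o2_def]]
  show ?thesis unfolding o1_def o2_def M1_def .
qed

lemma merged_Rz: "\<exists>\<alpha> \<beta>. cyc F (R z # \<alpha>) \<and> cyc F (R (opp \<sigma> z) # \<beta>) \<and> nc ch (R z # \<alpha>) \<and> nc ch (R (opp \<sigma> z) # \<beta>) \<and> \<alpha> \<noteq> [] \<and> \<beta> \<noteq> [] \<and>
    set (R z # \<alpha>) = R ` o1 \<and> set (R (opp \<sigma> z) # \<beta>) = R ` o2 \<and> distinct (R z # \<alpha> @ R (opp \<sigma> z) # \<beta>) \<and>
    cyc F' (\<alpha> @ \<beta>) \<and> set (\<alpha> @ \<beta>) = R ` M1 \<and> F (R z) = hd \<alpha> \<and> F (R (opp \<sigma> z)) = hd \<beta>"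
proof -
  have e: "opp \<sigma> (R z) = R (opp \<sigma> z)" using opp_R[OF z0(1)] R_opp[OF z0(1)] by simp
  have "R z \<in> D" unfolding D_def by blast
  from merged_list[OF z0(4), unfolded e o34, OF D_o(3,4) this o_disj(6)]
  show ?thesis unfolding R_M1 .
qed

text \<open>Old orbits are of three kinds: the two that merge, their mirror images, and the rest,
  which the bypass does not touch. The conditions on \<open>\<kappa>'\<close>, the polygons and the
  orbit count are read off from this.\<close>

lemma orb'_cases:
  assumes x: "x \<in> X"
  shows "orb x \<in> {o1, o2} \<and> orbit F' (skip x) = M1 \<and> skip x \<in> M1 \<or>
    orb x \<in> {R ` o1, R ` o2} \<and> orbit F' (skip x) = R ` M1 \<and> skip x \<in> R ` M1 \<or>
    orb x \<notin> {o1, o2, R ` o1, R ` o2} \<and> x \<notin> D \<and> skip x = x \<and> orbit F' (skip x) = orb x \<and> orb x \<inter> (o1 \<union> o2 \<union> R ` o1 \<union> R ` o2) = {}"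
proof -
  obtain \<alpha> \<beta> where ab: "set (z # \<alpha>) = o1" "set (opp \<sigma> z # \<beta>) = o2" "cyc F' (\<alpha> @ \<beta>)" "set (\<alpha> @ \<beta>) = M1"
    "F z = hd \<alpha>" "F (opp \<sigma> z) = hd \<beta>" "\<alpha> \<noteq> []" "\<beta> \<noteq> []" using merged_z by blast
  obtain \<gamma> \<delta> where cd: "set (R z # \<gamma>) = R ` o1" "set (R (opp \<sigma> z) # \<delta>) = R ` o2" "cyc F' (\<gamma> @ \<delta>)" "set (\<gamma> @ \<delta>) = R ` M1"
    "F (R z) = hd \<gamma>" "F (R (opp \<sigma> z)) = hd \<delta>" "\<gamma> \<noteq> []" "\<delta> \<noteq> []" using merged_Rz by blast
  have rz: "\<rho> z = hd \<beta>" "\<rho> (opp \<sigma> z) = hd \<alpha>" using ab F_opp[OF zX] opp_opp[OF z0(1)] by auto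
  have e: "opp \<sigma> (R z) = R (opp \<sigma> z)" using opp_R[OF z0(1)] R_opp[OF z0(1)] by simp
  have "F (R z) = \<rho> (R (opp \<sigma> z))" using e by (simp only: comp_apply)
  then have rRz: "\<rho> (R z) = hd \<delta>" "\<rho> (R (opp \<sigma> z)) = hd \<gamma>" using F_opp[OF z0(4)] cd(5,6) unfolding e by (simp_all only:)
  have hds: "hd \<alpha> \<in> M1" "hd \<beta> \<in> M1" "hd \<gamma> \<in> R ` M1" "hd \<delta> \<in> R ` M1"
  proof -
    have h: "hd p \<in> set (p @ q)" "hd q \<in> set (p @ q)" if "p \<noteq> []" "q \<noteq> []" for p q :: "'a flag list" using that by simp_all
    show "hd \<alpha> \<in> M1" "hd \<beta> \<in> M1" "hd \<gamma> \<in> R ` M1" "hd \<delta> \<in> R ` M1"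
      using h[OF ab(7,8)] h[OF cd(7,8)] unfolding ab(4) cd(4) by (simp_all only:)
  qed
  have inM: "orbit F' y = M1" if "y \<in> M1" for y using cyc_orbit[OF ab(3)] ab(4) that by metis
  have inRM: "orbit F' y = R ` M1" if "y \<in> R ` M1" for y using cyc_orbit[OF cd(3)] cd(4) that by metis
  have s1: "skip x \<in> M1" if "x \<in> o1 \<or> x \<in> o2"
  proof (cases "x \<in> D")
    case True
    have "x = z \<or> x = opp \<sigma> z" using that D_o(1,2)[OF True] by argo
    then show ?thesis using True rz hds unfolding skip_def by auto
  next
    case False
    then show ?thesis using that unfolding skip_def M1_def by auto
  qed
  have s2: "skip x \<in> R ` M1" if "x \<in> R ` o1 \<or> x \<in> R ` o2"
  proof (cases "x \<in> D")
    case True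
    have "x = R z \<or> x = R (opp \<sigma> z)" using that D_o(3,4)[OF True] by argo
    then show ?thesis using True rRz hds unfolding skip_def by auto
  next
    case False
    then show ?thesis using that unfolding skip_def R_M1 by auto
  qed
  have xo: "x \<in> orb x" using orb_self x by blast
  show ?thesis
  proof (cases "orb x \<in> {o1, o2}")
    case True
    then have "x \<in> o1 \<or> x \<in> o2" using xo by blast
    then show ?thesis using True s1 inM by blast
  next
    case F1: False
    show ?thesis
    proof (cases "orb x \<in> {R ` o1, R ` o2}")
      case True
      then have "x \<in> R ` o1 \<or> x \<in> R ` o2" using xo by blast
      then show ?thesis using True s2 inRM by blast
    next
      case False
      have d1: "orb x \<inter> o1 = {}" using F1 orb_disjoint[OF x zX] unfolding o1_def by auto
      have d2: "orb x \<inter> o2 = {}" using F1 orb_disjoint[OF x z0(2)] unfolding o2_def by auto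
      have d3: "orb x \<inter> R ` o1 = {}" using False orb_disjoint[OF x z0(4)] o34 by auto
      have d4: "orb x \<inter> R ` o2 = {}" using False orb_disjoint[OF x z0(5)] o34 by auto
      have oD: "orb x \<inter> D = {}"
      proof (rule equals0I, erule IntE)
        fix y assume y: "y \<in> orb x" "y \<in> D"
        have "y \<notin> o1" "y \<notin> o2" "y \<notin> R ` o1" "y \<notin> R ` o2"
          using d1[THEN equals0D, of y] d2[THEN equals0D, of y] d3[THEN equals0D, of y] d4[THEN equals0D, of y] y(1)
          by (simp_all only: Int_iff simp_thms)
        then show False using D_orb_cases[OF y(2)] by argo
      qed
      then have xD: "x \<notin> D" using xo by (metis IntI empty_iff)
      obtain P where P: "cyc F P" "set P = orb x" "x \<in> set P" using orb_list[OF x] by blast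
      then have "cyc F' P" using cyc_unaffected oD by simp
      then have "orbit F' x = orb x" using cyc_orbit[of F' P x] P by simp
      moreover have sk: "skip x = x" unfolding skip_def using xD by (simp only: if_False)
      moreover have "orb x \<inter> (o1 \<union> o2 \<union> R ` o1 \<union> R ` o2) = {}" by (simp only: Int_Un_distrib d1 d2 d3 d4 Un_empty_left)
      moreover have "orb x \<notin> {o1, o2, R ` o1, R ` o2}" using F1 False by (simp only: insert_iff empty_iff simp_thms de_Morgan_disj)
      ultimately show ?thesis using xD by (simp only: simp_thms)
    qed
  qed
qed

lemma R_ne: "o1 \<noteq> R ` o1" "o1 \<noteq> R ` o2" "o2 \<noteq> R ` o1" "o2 \<noteq> R ` o2"
proof -
  have ne: "S \<noteq> T" if "S \<inter> T = {}" "y \<in> S" for S T :: "'a flag set" and y using that by blast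
  show "o1 \<noteq> R ` o1" "o1 \<noteq> R ` o2" "o2 \<noteq> R ` o1" "o2 \<noteq> R ` o2"
    by (rule ne[OF o_disj(2) o_self(1)], rule ne[OF o_disj(3) o_self(1)], rule ne[OF o_disj(4) o_self(2)], rule ne[OF o_disj(5) o_self(2)])
qed

lemma orb'_M:
  assumes x: "x \<in> X" "orb x \<in> {o1, o2}" shows "orbit F' (skip x) = M1" "skip x \<in> M1"
  using orb'_cases[OF x(1)] x(2) R_ne by (simp_all only: insert_iff empty_iff) metis+

lemma orb'_RM:
  assumes x: "x \<in> X" "orb x \<in> {R ` o1, R ` o2}" shows "orbit F' (skip x) = R ` M1" "skip x \<in> R ` M1"
  using orb'_cases[OF x(1)] x(2) R_ne by (simp_all only: insert_iff empty_iff) metis+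

lemma orb'_other:
  assumes x: "x \<in> X" "orb x \<notin> {o1, o2, R ` o1, R ` o2}"
  shows "orbit F' (skip x) = orb x" "skip x = x" "x \<notin> D" "orb x \<inter> (o1 \<union> o2 \<union> R ` o1 \<union> R ` o2) = {}"
  using orb'_cases[OF x(1)] x(2) by (simp_all only: insert_iff empty_iff) metis+

lemma orb'_cong: "x \<in> X \<Longrightarrow> y \<in> X \<Longrightarrow> orb x = orb y \<Longrightarrow> orbit F' (skip x) = orbit F' (skip y)"
proof -
  assume a: "x \<in> X" "y \<in> X" "orb x = orb y"
  consider "orb x \<in> {o1, o2}" | "orb x \<in> {R ` o1, R ` o2}" | "orb x \<notin> {o1, o2, R ` o1, R ` o2}" by blast
  then show ?thesis
  proof cases
    case 1 then show ?thesis using orb'_M(1)[OF a(1)] orb'_M(1)[OF a(2)] a(3) by metis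
  next
    case 2 then show ?thesis using orb'_RM(1)[OF a(1)] orb'_RM(1)[OF a(2)] a(3) by metis
  next
    case 3 then show ?thesis using orb'_other(1)[OF a(1)] orb'_other(1)[OF a(2)] a(3) by metis
  qed
qed

lemma R_image_RR: "R ` R ` o1 = o1" "R ` R ` o2 = o2" "R ` R ` M1 = M1" "x \<in> X \<Longrightarrow> R ` R ` orb x = orb x"
proof -
  have "M1 \<subseteq> X" unfolding M1_def using o_sub by (meson Diff_subset Un_least order_trans)
  then show "R ` R ` o1 = o1" "R ` R ` o2 = o2" "R ` R ` M1 = M1" "x \<in> X \<Longrightarrow> R ` R ` orb x = orb x"
    using R_R_image[OF o_sub(1)] R_R_image[OF o_sub(2)] R_R_image[of M1] R_R_image[OF orb_sub[of x]] by simp_all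
qed

lemma orb'_R: "x \<in> X \<Longrightarrow> y \<in> X \<Longrightarrow> orb y = R ` orb x \<Longrightarrow> orbit F' (skip y) = R ` orbit F' (skip x)"
proof -
  assume a: "x \<in> X" "y \<in> X" "orb y = R ` orb x"
  consider "orb x \<in> {o1, o2}" | "orb x \<in> {R ` o1, R ` o2}" | "orb x \<notin> {o1, o2, R ` o1, R ` o2}" by blast
  then show ?thesis
  proof cases
    case 1
    then have "orb y \<in> {R ` o1, R ` o2}" using a(3) by (simp only: insert_iff empty_iff) metis
    then show ?thesis using orb'_RM(1)[OF a(2)] orb'_M(1)[OF a(1) 1] by metis
  next
    case 2
    then have "orb y \<in> {o1, o2}" using a(3) R_image_RR(1,2) by (simp only: insert_iff empty_iff) metis
    then show ?thesis using orb'_M(1)[OF a(2)] orb'_RM(1)[OF a(1) 2] R_image_RR(3) by metis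
  next
    case 3
    have "orb y \<notin> {o1, o2, R ` o1, R ` o2}"
      using 3 a(3) R_image_RR(1,2) R_image_RR(4)[OF a(1)] by (simp only: insert_iff empty_iff) metis
    then show ?thesis using orb'_other(1)[OF a(2)] orb'_other(1)[OF a(1) 3] a(3) by metis
  qed
qed

lemma X'D: "w \<in> X' \<Longrightarrow> w \<in> X" "w \<in> X' \<Longrightarrow> w \<notin> D"
  unfolding X'_eq by simp_all

lemma X'I: "w \<in> X \<Longrightarrow> w \<notin> D \<Longrightarrow> w \<in> X'"
  unfolding X'_eq by simp

lemma card_A': "card A' + 2 = card A"
proof -
  have z: "fst z \<in> A" "fst (opp \<sigma> z) \<in> A" using zX z0(2) unfolding mem_Times_iff by simp_all
  have "ftail z \<noteq> fhead z" using noloop[of "ftail z" "fhead z"] z(1) A_sub by (metis prod.collapse subsetD)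
  then have ne: "fst z \<noteq> fst (opp \<sigma> z)" unfolding fst_opp by (metis fst_conv)
  have fin: "finite A" using finite_subset[OF A_sub finA0] .
  have "card {fst z, fst (opp \<sigma> z)} = 2" using ne by simp
  moreover have "card A' = card A - card {fst z, fst (opp \<sigma> z)}" unfolding A'_def using z by (intro card_Diff_subset) auto
  moreover have "card {fst z, fst (opp \<sigma> z)} \<le> card A" using z fin by (intro card_mono) auto
  ultimately show ?thesis by simp
qed

lemma rho'_D: "\<rho> w \<in> D \<Longrightarrow> \<rho>' w = \<rho> (\<rho> w)" and rho'_notD: "\<rho> w \<notin> D \<Longrightarrow> \<rho>' w = \<rho> w"
  unfolding \<rho>'_def by (simp_all only: if_True if_False)

lemma rho'_in: assumes w: "w \<in> X'" shows "\<rho>' w \<in> X'"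
proof -
  have r: "\<rho> w \<in> X" using rho_in[OF X'D(1)[OF w]] .
  show ?thesis
  proof (cases "\<rho> w \<in> D")
    case True then show ?thesis using X'I[OF rho_in[OF r] rho_D[OF True]] by (simp only: rho'_D)
  next
    case False then show ?thesis using X'I[OF r False] rho'_notD[OF False] by simp
  qed
qed

lemma rho'_inj: "inj_on \<rho>' X'"
proof (rule inj_onI)
  fix x y assume x: "x \<in> X'" and y: "y \<in> X'" and e: "\<rho>' x = \<rho>' y"
  note xX = X'D(1)[OF x] and yX = X'D(1)[OF y]
  show "x = y"
  proof (cases "\<rho> x \<in> D"; cases "\<rho> y \<in> D")
    assume D: "\<rho> x \<in> D" "\<rho> y \<in> D"
    then have "\<rho> x = \<rho> y" using e inj_onD[OF rho_inj _ rho_in[OF xX] rho_in[OF yX]] by (simp only: rho'_D)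
    then show ?thesis by (rule inj_onD[OF rho_inj _ xX yX])
  next
    assume D: "\<rho> x \<in> D" "\<rho> y \<notin> D"
    then have "\<rho> x = y" using e inj_onD[OF rho_inj _ rho_in[OF xX] yX] rho'_D rho'_notD by metis
    then show ?thesis using D(1) X'D(2)[OF y] by simp
  next
    assume D: "\<rho> x \<notin> D" "\<rho> y \<in> D"
    then have "x = \<rho> y" using e inj_onD[OF rho_inj _ xX rho_in[OF yX]] rho'_D rho'_notD by metis
    then show ?thesis using D(2) X'D(2)[OF x] by simp
  next
    assume D: "\<rho> x \<notin> D" "\<rho> y \<notin> D"
    then show ?thesis using e inj_onD[OF rho_inj _ xX yX] rho'_notD by metis
  qed
qed

lemma rho'_tail: "w \<in> X' \<Longrightarrow> ftail (\<rho>' w) = ftail w" and rho'_snd: "w \<in> X' \<Longrightarrow> snd (\<rho>' w) = snd w"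
proof -
  assume "w \<in> X'"
  then have w: "w \<in> X" by (rule X'D)
  show "ftail (\<rho>' w) = ftail w" "snd (\<rho>' w) = snd w"
    unfolding \<rho>'_def using rho_tail[OF w] rho_tail[OF rho_in[OF w]] rho_snd[OF w] rho_snd[OF rho_in[OF w]] by simp_all
qed

lemma rho'_flip: assumes w: "w \<in> X'" shows "\<rho>' (flip (\<rho>' w)) = flip w"
proof (cases "\<rho> w \<in> D")
  case True
  have r: "\<rho> w \<in> X" using rho_in[OF X'D(1)[OF w]] .
  have f: "\<rho> (flip (\<rho> (\<rho> w))) = flip (\<rho> w)" using rho_flip[OF r] .
  have "\<rho> (flip (\<rho> (\<rho> w))) \<in> D" unfolding f using True D_flip by (simp only:)
  then have "\<rho>' (flip (\<rho> (\<rho> w))) = \<rho> (flip (\<rho> w))" using f by (simp only: rho'_D)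
  then show ?thesis using rho'_D[OF True] rho_flip[OF X'D(1)[OF w]] by (simp only:)
next
  case False
  have f: "\<rho> (flip (\<rho> w)) = flip w" using rho_flip[OF X'D(1)[OF w]] .
  have "\<rho> (flip (\<rho> w)) \<notin> D" unfolding f flip_D_iff by (rule X'D(2)[OF w])
  then have "\<rho>' (flip (\<rho> w)) = \<rho> (flip (\<rho> w))" by (rule rho'_notD)
  then show ?thesis using rho'_notD[OF False] f by simp
qed

text \<open>A set closed under \<open>\<rho>'\<close> becomes closed under \<open>\<rho>\<close>
  once the bypassed flags are put back, so the transitivity of \<open>\<rho>\<close>
  applies.\<close>

lemma rho'_trans:
  assumes ne: "B \<noteq> {}" and B: "B \<subseteq> {w \<in> X'. ftail w = v \<and> snd w = s}" and cl: "\<rho>' ` B \<subseteq> B"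
  shows "B = {w \<in> X'. ftail w = v \<and> snd w = s}"
proof -
  define B2 where "B2 = B \<union> (\<rho> ` B \<inter> D)"
  have Bm: "w \<in> X \<and> w \<notin> D \<and> ftail w = v \<and> snd w = s" if "w \<in> B" for w
    using subsetD[OF B that] X'D[of w] by simp
  have cl2: "\<rho>' w \<in> B" if "w \<in> B" for w by (rule subsetD[OF cl imageI[OF that]])
  have "B2 = {w \<in> X. ftail w = v \<and> snd w = s}"
  proof (rule rho_trans)
    show "B2 \<noteq> {}" using ne unfolding B2_def by simp
    show "B2 \<subseteq> {w \<in> X. ftail w = v \<and> snd w = s}"
    proof
      fix y assume "y \<in> B2"
      then consider "y \<in> B" | w where "w \<in> B" "y = \<rho> w" unfolding B2_def by (elim UnE IntE imageE)
      then show "y \<in> {w \<in> X. ftail w = v \<and> snd w = s}"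
      proof cases
        case 1 then show ?thesis using Bm[of y] by simp
      next
        case 2 then show ?thesis using Bm[of w] rho_in[of w] rho_tail[of w] rho_snd[of w] by simp
      qed
    qed
    show "\<rho> ` B2 \<subseteq> B2"
    proof (rule image_subsetI)
      fix y assume "y \<in> B2"
      then consider "y \<in> B" | w where "w \<in> B" "y = \<rho> w" "y \<in> D" unfolding B2_def by (elim UnE IntE imageE)
      then show "\<rho> y \<in> B2"
      proof cases
        case 1
        show ?thesis
        proof (cases "\<rho> y \<in> D")
          case True then show ?thesis using 1 unfolding B2_def by simp
        next
          case False then show ?thesis using cl2[OF 1] unfolding B2_def rho'_notD[OF False] by simp
        qed
      next
        case 2
        have "\<rho> y = \<rho>' w" using rho'_D[of w] 2 by simp
        then show ?thesis using cl2[OF 2(1)] unfolding B2_def by simp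
      qed
    qed
  qed
  then have B2': "\<And>w. w \<in> B2 \<longleftrightarrow> w \<in> X \<and> ftail w = v \<and> snd w = s" by simp
  show ?thesis
  proof (rule subset_antisym[OF B], rule subsetI)
    fix w assume "w \<in> {w \<in> X'. ftail w = v \<and> snd w = s}"
    then have "w \<in> B2" "w \<notin> D" using B2'[of w] X'D[of w] by simp_all
    then show "w \<in> B" unfolding B2_def by simp
  qed
qed

lemma skip_tail: "x \<in> X \<Longrightarrow> ftail (skip x) = ftail x"
  unfolding skip_def using rho_tail[of x] by simp

lemma kappa'_id: "w \<in> X' \<Longrightarrow> \<kappa>' w = w"
  unfolding \<kappa>'_def skip_def using kappa_id[OF X'D(1)] X'D(2)[of w] by simp

lemma old_or_new: "w \<in> (A0 - A') \<times> UNIV \<Longrightarrow> w \<in> (A0 - A) \<times> UNIV \<or> w \<in> D"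
  unfolding D_fst A'_def mem_Times_iff by simp

lemma old_in: "w \<in> (A0 - A) \<times> UNIV \<Longrightarrow> w \<in> X0"
  unfolding mem_Times_iff by simp

lemma opp_D_swap: "opp \<sigma> (opp \<sigma> z) = z" "opp \<sigma> (R z) = R (opp \<sigma> z)" "opp \<sigma> (R (opp \<sigma> z)) = R z"
  "flip z = R (opp \<sigma> z)" "flip (opp \<sigma> z) = R z" "flip (R z) = opp \<sigma> z" "flip (R (opp \<sigma> z)) = z"
  using opp_opp[OF z0(1)] unfolding rv_def by (simp_all add: opp_flip)

lemma D_cases:
  assumes "w \<in> D"
  shows "w \<in> {z, opp \<sigma> z} \<and> opp \<sigma> w \<in> {z, opp \<sigma> z} \<and> flip w \<in> {R z, R (opp \<sigma> z)} \<or>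
    w \<in> {R z, R (opp \<sigma> z)} \<and> opp \<sigma> w \<in> {R z, R (opp \<sigma> z)} \<and> flip w \<in> {z, opp \<sigma> z}"
  using assms unfolding D_def
  by (elim insertE) (simp_all only: opp_D_swap insert_iff empty_iff simp_thms)

lemma kappa_D: "w \<in> D \<Longrightarrow> \<kappa> w = w" using kappa_id[of w] D_sub by (meson subsetD)

lemma kappa'_z: assumes "w \<in> {z, opp \<sigma> z}" shows "orbit F' (\<kappa>' w) = M1" "\<kappa>' w \<in> M1"
proof -
  have w: "w \<in> D" using assms unfolding D_def by (simp only: insert_iff empty_iff) metis
  have "orb w \<in> {o1, o2}" using assms unfolding o1_def o2_def by (simp only: insert_iff empty_iff) metis
  then show "orbit F' (\<kappa>' w) = M1" "\<kappa>' w \<in> M1"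
    unfolding \<kappa>'_def kappa_D[OF w] using orb'_M[of w] subsetD[OF D_sub w] by (simp_all only:)
qed

lemma kappa'_Rz: assumes "w \<in> {R z, R (opp \<sigma> z)}" shows "orbit F' (\<kappa>' w) = R ` M1" "\<kappa>' w \<in> R ` M1"
proof -
  have w: "w \<in> D" using assms unfolding D_def by (simp only: insert_iff empty_iff) metis
  have "orb w \<in> {R ` o1, R ` o2}" using assms o34 by (simp only: insert_iff empty_iff) metis
  then show "orbit F' (\<kappa>' w) = R ` M1" "\<kappa>' w \<in> R ` M1"
    unfolding \<kappa>'_def kappa_D[OF w] using orb'_RM[of w] subsetD[OF D_sub w] by (simp_all only:)
qed

lemma kappa'_opp: assumes w: "w \<in> (A0 - A') \<times> UNIV" shows "orbit F' (\<kappa>' (opp \<sigma> w)) = orbit F' (\<kappa>' w)"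
  using old_or_new[OF w]
proof
  assume w: "w \<in> (A0 - A) \<times> UNIV"
  note w0 = old_in[OF w]
  show ?thesis unfolding \<kappa>'_def by (rule orb'_cong[OF kappa_in[OF opp_in0[OF w0]] kappa_in[OF w0] kappa_opp[OF w]])
next
  assume w: "w \<in> D"
  from D_cases[OF w] show ?thesis
    by (elim disjE conjE) (simp_all only: kappa'_z(1) kappa'_Rz(1))
qed

lemma kappa'_flip: assumes w: "w \<in> (A0 - A') \<times> UNIV" shows "orbit F' (\<kappa>' (flip w)) = R ` orbit F' (\<kappa>' w)"
  using old_or_new[OF w]
proof
  assume w: "w \<in> (A0 - A) \<times> UNIV"
  note w0 = old_in[OF w]
  show ?thesis unfolding \<kappa>'_def by (rule orb'_R[OF kappa_in[OF w0] kappa_in[OF flip_in0[OF w0]] kappa_flip[OF w]])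
next
  assume w: "w \<in> D"
  from D_cases[OF w] show ?thesis
    by (elim disjE conjE) (simp_all only: kappa'_z(1) kappa'_Rz(1) R_image_RR(3))
qed

abbreviation "ch' \<equiv> chord \<sigma> A0 A' \<kappa>'"

text \<open>An instance of \<open>nc_merge\<close>: an old chord lies within one of the two faces by
  \<open>kappa_opp\<close>, \<open>skip\<close> moves its ends as required there, and the deleted
  edge gives the new chord.\<close>

lemma merged_nc:
  assumes lists: "nc ch (y # \<alpha>)" "nc ch (opp \<sigma> y # \<beta>)" "\<alpha> \<noteq> []" "\<beta> \<noteq> []" "set (y # \<alpha>) = O1" "set (opp \<sigma> y # \<beta>) = O2"
      "distinct (y # \<alpha> @ opp \<sigma> y # \<beta>)" "set (\<alpha> @ \<beta>) = M" "F y = hd \<alpha>" "F (opp \<sigma> y) = hd \<beta>"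
    and O: "O1 = orb y" "O2 = orb (opp \<sigma> y)" and y: "y \<in> X" "y \<in> D" "opp \<sigma> y \<in> D" "opp \<sigma> (opp \<sigma> y) = y"
    and only: "\<And>x. x \<in> D \<Longrightarrow> x \<in> O1 \<Longrightarrow> x = y" "\<And>x. x \<in> D \<Longrightarrow> x \<in> O2 \<Longrightarrow> x = opp \<sigma> y"
    and into: "\<And>a. a \<in> X \<Longrightarrow> skip a \<in> M \<Longrightarrow> orb a = O1 \<or> orb a = O2"
    and new: "\<And>w. w \<in> D \<Longrightarrow> \<kappa>' w \<in> M \<Longrightarrow> w = y \<or> w = opp \<sigma> y"
  shows "nc ch' (\<alpha> @ \<beta>)"
proof (rule nc_merge[OF _ lists(1,2,3,4,7)])
  have ry: "skip y = hd \<beta>" "skip (opp \<sigma> y) = hd \<alpha>"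
    unfolding skip_def using y(2,3) F_opp[OF y(1)] lists(9,10) by simp_all
  fix p q assume "p \<in> set (\<alpha> @ \<beta>)" "q \<in> set (\<alpha> @ \<beta>)" and c: "ch' p q"
  then have pq: "p \<in> M" "q \<in> M" unfolding lists(8) by simp_all
  from c obtain w where w: "w \<in> (A0 - A') \<times> UNIV" "p = \<kappa>' w" "q = \<kappa>' (opp \<sigma> w)" unfolding chord_def by (elim bexE conjE)
  from old_or_new[OF w(1)] show "(\<exists>p0\<in>set (y # \<alpha>). \<exists>q0\<in>set (y # \<alpha>). ch p0 q0 \<and> p = (if p0 = y then hd \<beta> else p0) \<and> q = (if q0 = y then hd \<beta> else q0)) \<or>
      (\<exists>p0\<in>set (opp \<sigma> y # \<beta>). \<exists>q0\<in>set (opp \<sigma> y # \<beta>). ch p0 q0 \<and> p = (if p0 = opp \<sigma> y then hd \<alpha> else p0) \<and> q = (if q0 = opp \<sigma> y then hd \<alpha> else q0)) \<or>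
      (p = hd \<alpha> \<and> q = hd \<beta>) \<or> (p = hd \<beta> \<and> q = hd \<alpha>)"
  proof
    assume wD: "w \<in> D"
    have k: "\<kappa>' y = hd \<beta>" "\<kappa>' (opp \<sigma> y) = hd \<alpha>" unfolding \<kappa>'_def using kappa_D y ry by simp_all
    from new[OF wD pq(1)[unfolded w(2)]] show ?thesis
    proof
      assume "w = y" then show ?thesis using k w by simp
    next
      assume "w = opp \<sigma> y" then show ?thesis using k w y(4) by simp
    qed
  next
    assume old: "w \<in> (A0 - A) \<times> UNIV"
    note w0 = old_in[OF old]
    have aX: "\<kappa> w \<in> X" "\<kappa> (opp \<sigma> w) \<in> X" by (rule kappa_in[OF w0], rule kappa_in[OF opp_in0[OF w0]])
    have chab: "ch (\<kappa> w) (\<kappa> (opp \<sigma> w))" unfolding chord_def by (rule bexI[OF _ old]) simp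
    have in_orb: "\<kappa> w \<in> orb (\<kappa> w)" "\<kappa> (opp \<sigma> w) \<in> orb (\<kappa> w)"
      using orb_self[OF aX(1)] orb_self[OF aX(2)] unfolding kappa_opp[OF old] by (simp_all only:)
    have sk1: "skip a = (if a = y then hd \<beta> else a)" if "a \<in> O1" for a
    proof (cases "a \<in> D")
      case True
      have "a = y" by (rule only(1)[OF True that])
      then show ?thesis using ry(1) by simp
    next
      case False
      then have "a \<noteq> y" using y(2) by metis
      then show ?thesis using False unfolding skip_def by (simp only: if_False)
    qed
    have sk2: "skip a = (if a = opp \<sigma> y then hd \<alpha> else a)" if "a \<in> O2" for a
    proof (cases "a \<in> D")
      case True
      have "a = opp \<sigma> y" by (rule only(2)[OF True that])
      then show ?thesis using ry(2) by simp
    next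
      case False
      then have "a \<noteq> opp \<sigma> y" using y(3) by metis
      then show ?thesis using False unfolding skip_def by (simp only: if_False)
    qed
    from into[OF aX(1) pq(1)[unfolded w(2) \<kappa>'_def]] show ?thesis
    proof
      assume "orb (\<kappa> w) = O1"
      then have i: "\<kappa> w \<in> O1" "\<kappa> (opp \<sigma> w) \<in> O1" using in_orb by (simp_all only:)
      show ?thesis unfolding lists(5) w(2,3) \<kappa>'_def
        by (rule disjI1, rule bexI[OF bexI[OF _ i(2)] i(1)], intro conjI chab sk1 i)
    next
      assume "orb (\<kappa> w) = O2"
      then have i: "\<kappa> w \<in> O2" "\<kappa> (opp \<sigma> w) \<in> O2" using in_orb by (simp_all only:)
      show ?thesis unfolding lists(6) w(2,3) \<kappa>'_def
        by (rule disjI2, rule disjI1, rule bexI[OF bexI[OF _ i(2)] i(1)], intro conjI chab sk2 i)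
    qed
  qed
qed (rule chord_sym)

lemma M_disj: "x \<in> M1 \<Longrightarrow> x \<notin> R ` M1" "x \<in> M1 \<Longrightarrow> x \<in> o1 \<or> x \<in> o2" "x \<in> R ` M1 \<Longrightarrow> x \<in> R ` o1 \<or> x \<in> R ` o2"
proof -
  show 1: "x \<in> M1 \<Longrightarrow> x \<in> o1 \<or> x \<in> o2" unfolding M1_def by simp
  show 2: "x \<in> R ` M1 \<Longrightarrow> x \<in> R ` o1 \<or> x \<in> R ` o2" unfolding R_M1 by (simp only: Diff_iff Un_iff)
  have d: "\<not> (x \<in> o1 \<and> x \<in> R ` o1)" "\<not> (x \<in> o1 \<and> x \<in> R ` o2)" "\<not> (x \<in> o2 \<and> x \<in> R ` o1)"
    "\<not> (x \<in> o2 \<and> x \<in> R ` o2)"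
    using o_disj(2-5)[THEN equals0D, of x] by (simp_all only: Int_iff simp_thms not_False_eq_True)
  show "x \<in> M1 \<Longrightarrow> x \<notin> R ` M1" using 1 2 d by argo
qed

lemma skip_in_M: assumes "a \<in> X" "skip a \<in> M1" shows "orb a = o1 \<or> orb a = o2"
proof (rule ccontr)
  assume n: "\<not> ?thesis"
  show False
  proof (cases "orb a \<in> {R ` o1, R ` o2}")
    case True
    then show False using orb'_RM(2)[OF assms(1) True] M_disj(1)[OF assms(2)] by simp
  next
    case False
    then have o: "orb a \<notin> {o1, o2, R ` o1, R ` o2}" using n by (simp only: insert_iff empty_iff simp_thms de_Morgan_disj)
    have "a \<in> o1 \<or> a \<in> o2" using M_disj(2)[OF assms(2)] orb'_other(2)[OF assms(1) o] by (simp only:)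
    then show False using orb'_other(4)[OF assms(1) o, THEN equals0D, of a] orb_self[OF assms(1)] by (simp only: Int_iff Un_iff simp_thms)
  qed
qed

lemma skip_in_RM: assumes "a \<in> X" "skip a \<in> R ` M1" shows "orb a = R ` o1 \<or> orb a = R ` o2"
proof (rule ccontr)
  assume n: "\<not> ?thesis"
  show False
  proof (cases "orb a \<in> {o1, o2}")
    case True
    then show False using M_disj(1)[OF orb'_M(2)[OF assms(1) True]] assms(2) by simp
  next
    case False
    then have o: "orb a \<notin> {o1, o2, R ` o1, R ` o2}" using n by (simp only: insert_iff empty_iff simp_thms de_Morgan_disj)
    have "a \<in> R ` o1 \<or> a \<in> R ` o2" using M_disj(3)[OF assms(2)] orb'_other(2)[OF assms(1) o] by (simp only:)
    then show False using orb'_other(4)[OF assms(1) o, THEN equals0D, of a] orb_self[OF assms(1)] by (simp only: Int_iff Un_iff simp_thms) argo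
  qed
qed

lemma in_D: "z \<in> D" "opp \<sigma> z \<in> D" "R z \<in> D" "R (opp \<sigma> z) \<in> D"
  unfolding D_def by simp_all

lemma poly': assumes x: "x \<in> X'" shows "\<exists>P. cyc F' P \<and> x \<in> set P \<and> nc ch' P"
proof -
  note xX = X'D(1)[OF x]
  have sx: "skip x = x" unfolding skip_def using X'D(2)[OF x] by (simp only: if_False)
  consider "orb x \<in> {o1, o2}" | "orb x \<in> {R ` o1, R ` o2}" | "orb x \<notin> {o1, o2, R ` o1, R ` o2}" by (simp only: insert_iff empty_iff) argo
  then show ?thesis
  proof cases
    case 1
    have xM: "x \<in> M1" using orb'_M(2)[OF xX 1] unfolding sx .
    obtain \<alpha> \<beta> where ab: "cyc F' (\<alpha> @ \<beta>)" "nc ch (z # \<alpha>)" "nc ch (opp \<sigma> z # \<beta>)" "\<alpha> \<noteq> []" "\<beta> \<noteq> []"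
      "set (z # \<alpha>) = o1" "set (opp \<sigma> z # \<beta>) = o2" "distinct (z # \<alpha> @ opp \<sigma> z # \<beta>)" "set (\<alpha> @ \<beta>) = M1"
      "F z = hd \<alpha>" "F (opp \<sigma> z) = hd \<beta>" using merged_z by (elim exE conjE)
    have "nc ch' (\<alpha> @ \<beta>)"
    proof (rule merged_nc[OF ab(2-11) o1_def o2_def zX in_D(1,2) opp_D_swap(1) D_o(1,2) skip_in_M])
      fix w assume w: "w \<in> D" "\<kappa>' w \<in> M1"
      from D_cases[OF w(1)] show "w = z \<or> w = opp \<sigma> z"
      proof (elim disjE conjE)
        assume "w \<in> {R z, R (opp \<sigma> z)}"
        from notE[OF M_disj(1)[OF w(2)] kappa'_Rz(2)[OF this]] show ?thesis .
      qed (simp only: insert_iff empty_iff simp_thms)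
    qed
    then show ?thesis using ab(1) xM unfolding ab(9)[symmetric] by (intro exI conjI)
  next
    case 2
    have xM: "x \<in> R ` M1" using orb'_RM(2)[OF xX 2] unfolding sx .
    note e = opp_D_swap(2)
    obtain \<alpha> \<beta> where ab: "cyc F' (\<alpha> @ \<beta>)" "nc ch (R z # \<alpha>)" "nc ch (R (opp \<sigma> z) # \<beta>)" "\<alpha> \<noteq> []" "\<beta> \<noteq> []"
      "set (R z # \<alpha>) = R ` o1" "set (R (opp \<sigma> z) # \<beta>) = R ` o2" "distinct (R z # \<alpha> @ R (opp \<sigma> z) # \<beta>)" "set (\<alpha> @ \<beta>) = R ` M1"
      "F (R z) = hd \<alpha>" "F (R (opp \<sigma> z)) = hd \<beta>" using merged_Rz by (elim exE conjE)
    have "nc ch' (\<alpha> @ \<beta>)"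
    proof (rule merged_nc[of "R z", unfolded e, OF ab(2-11) o34(1)[symmetric] o34(2)[symmetric] z0(4) in_D(3,4) opp_D_swap(3) D_o(3,4) skip_in_RM])
      fix w assume w: "w \<in> D" "\<kappa>' w \<in> R ` M1"
      from D_cases[OF w(1)] show "w = R z \<or> w = R (opp \<sigma> z)"
      proof (elim disjE conjE)
        assume "w \<in> {z, opp \<sigma> z}"
        from notE[OF M_disj(1)[OF kappa'_z(2)[OF this]] w(2)] show ?thesis .
      qed (simp only: insert_iff empty_iff simp_thms)
    qed
    then show ?thesis using ab(1) xM unfolding ab(9)[symmetric] by (intro exI conjI)
  next
    case 3
    obtain P where P: "cyc F P" "set P = orb x" "x \<in> set P" "nc ch P" using orb_list[OF xX] by (elim exE conjE)
    have out: "y \<notin> o1 \<and> y \<notin> o2 \<and> y \<notin> R ` o1 \<and> y \<notin> R ` o2" if "y \<in> set P" for y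
      using orb'_other(4)[OF xX 3, THEN equals0D, of y] that unfolding P(2) by (simp only: Int_iff Un_iff simp_thms de_Morgan_disj)
    have outM: "y \<notin> M1" "y \<notin> R ` M1" if "y \<in> set P" for y
      using out[OF that] M_disj(2,3)[of y] by metis+
    have oD: "set P \<inter> D = {}"
    proof (rule equals0I, erule IntE)
      fix y assume y: "y \<in> set P" "y \<in> D"
      show False using D_orb_cases[OF y(2)] out[OF y(1)] by argo
    qed
    have sk: "skip a = a" if "a \<in> X" "skip a \<in> set P" for a
    proof (rule orb'_other(2)[OF that(1)], rule notI)
      assume "orb a \<in> {o1, o2, R ` o1, R ` o2}"
      then consider "orb a \<in> {o1, o2}" | "orb a \<in> {R ` o1, R ` o2}" by (simp only: insert_iff empty_iff) argo
      then show False
      proof cases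
        case 1 then show ?thesis using orb'_M(2)[OF that(1) 1] outM(1)[OF that(2)] by (simp only:)
      next
        case 2 then show ?thesis using orb'_RM(2)[OF that(1) 2] outM(2)[OF that(2)] by (simp only:)
      qed
    qed
    have "nc ch' P" using P(4)
    proof (rule nc_mono)
      fix p q assume pq: "p \<in> set P" "q \<in> set P" "ch' p q"
      from pq(3) obtain w where w: "w \<in> (A0 - A') \<times> UNIV" "p = \<kappa>' w" "q = \<kappa>' (opp \<sigma> w)" unfolding chord_def by (elim bexE conjE)
      from old_or_new[OF w(1)] show "ch p q"
      proof
        assume wD: "w \<in> D"
        from D_cases[OF this] show ?thesis
        proof (elim disjE conjE)
          assume "w \<in> {z, opp \<sigma> z}"
          from notE[OF outM(1)[OF pq(1), unfolded w(2)] kappa'_z(2)[OF this]] show ?thesis .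
        next
          assume "w \<in> {R z, R (opp \<sigma> z)}"
          from notE[OF outM(2)[OF pq(1), unfolded w(2)] kappa'_Rz(2)[OF this]] show ?thesis .
        qed
      next
        assume old: "w \<in> (A0 - A) \<times> UNIV"
        note w0 = old_in[OF old]
        have aX: "\<kappa> w \<in> X" "\<kappa> (opp \<sigma> w) \<in> X" by (rule kappa_in[OF w0], rule kappa_in[OF opp_in0[OF w0]])
        have "p = \<kappa> w" using sk[OF aX(1)] pq(1) unfolding w(2) \<kappa>'_def by (simp only:)
        moreover have "q = \<kappa> (opp \<sigma> w)" using sk[OF aX(2)] pq(2) unfolding w(3) \<kappa>'_def by (simp only:)
        ultimately show ?thesis unfolding chord_def using old by (intro bexI[of _ w] conjI)
      qed
    qed
    then show ?thesis using cyc_unaffected[OF P(1) oD] P(3) by (intro exI conjI)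
  qed
qed

lemma deleted_state: "flag_state \<sigma> A0 A' \<rho>' \<kappa>'"
proof (rule flag_state.intro)
  show "A' \<subseteq> A0" unfolding A'_def using A_sub by (meson Diff_subset order_trans)
  fix u v assume uv: "(u, v) \<in> A'"
  then have "(v, u) \<in> A" unfolding A'_def using A_sym by (meson DiffD1)
  moreover have "(v, u) \<notin> {fst z, fst (opp \<sigma> z)}"
    using uv unfolding A'_def fst_opp by (auto simp: prod_eq_iff)
  ultimately show "(v, u) \<in> A'" unfolding A'_def by (rule DiffI)
next
  show "w \<in> X0 \<Longrightarrow> ftail (\<kappa>' w) = ftail w" for w
    unfolding \<kappa>'_def using skip_tail[OF kappa_in, of w] kappa_tail[of w] by (simp only:)
  show "w \<in> X0 \<Longrightarrow> \<kappa>' w \<in> X'" for w unfolding \<kappa>'_def by (rule skip_in[OF kappa_in])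
qed (fact finA0 symA0 noloop sigma_sym rho'_in rho'_inj rho'_tail rho'_snd rho'_flip rho'_trans kappa'_id kappa'_opp kappa'_flip poly')+

text \<open>The facial walks \<open>o1\<close>, \<open>o2\<close> and their mirror images become
  two, while two arcs disappear (\<open>card_A'\<close>). So the number of orbits minus the number
  of arcs does not drop.\<close>

lemma orbit_count: "card (orb ` X) \<le> card (orbit F' ` X') + 2"
proof -
  have M: "M1 \<in> orbit F' ` X'" "R ` M1 \<in> orbit F' ` X'"
    using orb'_M(1)[OF zX] orb'_RM(1)[OF z0(4)] skip_in[OF zX] skip_in[OF z0(4)] o34(1) unfolding o1_def
    by (metis image_eqI insertI1)+
  have ne: "M1 \<noteq> R ` M1" using M_disj(1) kappa'_z(2)[of z] by (metis insertI1)
  have fin: "finite (orbit F' ` X')" using finX unfolding X'_eq by simp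
  have "orb ` X \<subseteq> (orbit F' ` X' - {M1, R ` M1}) \<union> {o1, o2, R ` o1, R ` o2}"
  proof (rule image_subsetI)
    fix x assume x: "x \<in> X"
    show "orb x \<in> (orbit F' ` X' - {M1, R ` M1}) \<union> {o1, o2, R ` o1, R ` o2}"
    proof (cases "orb x \<in> {o1, o2, R ` o1, R ` o2}")
      case False
      note o = orb'_other[OF x False]
      have "x \<in> orb x" "orb x \<noteq> M1" "orb x \<noteq> R ` M1"
        using orb_self[OF x] M_disj(2,3)[of x] o(4)[THEN equals0D, of x] by auto
      moreover have "orb x \<in> orbit F' ` X'" using o(1,2) X'I[OF x o(3)] by (metis image_eqI)
      ultimately show ?thesis by (simp only: Un_iff Diff_iff insert_iff empty_iff simp_thms)
    qed (simp only: Un_iff simp_thms)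
  qed
  then have "card (orb ` X) \<le> card ((orbit F' ` X' - {M1, R ` M1}) \<union> {o1, o2, R ` o1, R ` o2})"
    using fin by (intro card_mono) simp_all
  also have "\<dots> \<le> card (orbit F' ` X' - {M1, R ` M1}) + card {o1, o2, R ` o1, R ` o2}" by (rule card_Un_le)
  also have "card {o1, o2, R ` o1, R ` o2} \<le> 4" by (simp add: card_insert_if)
  also have "card (orbit F' ` X' - {M1, R ` M1}) = card (orbit F' ` X') - 2"
    using M ne fin by (subst card_Diff_subset) auto
  finally have "card (orb ` X) \<le> card (orbit F' ` X') - 2 + 4" by (simp only: add_left_mono)
  moreover have "card {M1, R ` M1} \<le> card (orbit F' ` X')" using fin M by (intro card_mono) simp_all
  moreover have "card {M1, R ` M1} = 2" using ne by simp
  ultimately show ?thesis by linarith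
qed

end

section \<open>Spanning forests and minimal flag systems\<close>

text \<open>\<open>rt v\<close> names the component of \<open>v\<close> by its root; \<open>par\<close> fixes the roots and everything outside \<open>V\<close>.\<close>

locale bfs_forest =
  fixes V :: "'v set" and E :: "('v \<times> 'v) set" and par :: "'v \<Rightarrow> 'v" and lev :: "'v \<Rightarrow> nat" and Rt :: "'v set" and rt :: "'v \<Rightarrow> 'v"
  assumes finV: "finite V" and E_V: "(u, v) \<in> E \<Longrightarrow> u \<in> V" and E_sym: "(u, v) \<in> E \<Longrightarrow> (v, u) \<in> E"
    and Rt_V: "Rt \<subseteq> V" and par_Rt: "r \<in> Rt \<Longrightarrow> par r = r" and par_out: "v \<notin> V \<Longrightarrow> par v = v"
    and par_E: "v \<in> V \<Longrightarrow> v \<notin> Rt \<Longrightarrow> (v, par v) \<in> E" and lev_par_Suc: "v \<in> V \<Longrightarrow> v \<notin> Rt \<Longrightarrow> lev v = Suc (lev (par v))"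
    and lev_Rt: "r \<in> Rt \<Longrightarrow> lev r = 0" and lev_E: "(u, v) \<in> E \<Longrightarrow> lev v \<le> Suc (lev u)"
    and rt_Rt: "r \<in> Rt \<Longrightarrow> rt r = r" and rt_E: "(u, v) \<in> E \<Longrightarrow> rt u = rt v"
begin

definition T :: "('v \<times> 'v) set" where "T = (\<lambda>v. (v, par v)) ` (V - Rt) \<union> (\<lambda>v. (par v, v)) ` (V - Rt)"

lemma par_in: "v \<in> V \<Longrightarrow> par v \<in> V"
  using par_E[of v] E_sym E_V par_Rt by metis

lemma lev_par: "v \<in> V \<Longrightarrow> lev (par v) = lev v - 1"
  using lev_par_Suc[of v] par_Rt[of v] lev_Rt[of v] by (cases "v \<in> Rt") auto

lemma rt_par: "v \<in> V \<Longrightarrow> rt (par v) = rt v"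
  using rt_E[OF par_E, of v] par_Rt[of v] by (cases "v \<in> Rt") auto

lemma anc_in: "v \<in> V \<Longrightarrow> (par ^^ n) v \<in> V"
  by (induction n) (auto simp: par_in)

lemma anc_lev: "v \<in> V \<Longrightarrow> lev ((par ^^ n) v) = lev v - n"
  by (induction n) (auto simp: lev_par anc_in)

lemma anc_rt: "v \<in> V \<Longrightarrow> rt ((par ^^ n) v) = rt v"
  by (induction n) (auto simp: rt_par anc_in)

lemma lev_0: "v \<in> V \<Longrightarrow> lev v = 0 \<Longrightarrow> v \<in> Rt"
  using lev_par_Suc[of v] by auto

lemma anc_Rt: "r \<in> Rt \<Longrightarrow> (par ^^ n) r = r"
  by (induction n) (auto simp: par_Rt)

lemma anc_unique:
  assumes y: "y \<in> V" and e: "lev ((par ^^ i) y) = lev ((par ^^ j) y)" shows "(par ^^ i) y = (par ^^ j) y"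
proof -
  have gen: "(par ^^ j) y = (par ^^ i) y" if "i \<le> j" "lev ((par ^^ i) y) = lev ((par ^^ j) y)" for i j
  proof -
    define u where "u = (par ^^ i) y"
    have u: "u \<in> V" unfolding u_def by (rule anc_in[OF y])
    have v: "(par ^^ j) y = (par ^^ (j - i)) u"
      unfolding u_def using that(1) by (metis comp_apply funpow_add le_add_diff_inverse2)
    have "lev u = lev u - (j - i)" using anc_lev[OF u, of "j - i"] that(2) v u_def by simp
    \<comment> \<open>At a root \<open>par\<close> is constant, so there different exponents may
      give the same vertex.\<close>
    then have "j - i = 0 \<or> lev u = 0" by linarith
    then show ?thesis using v anc_Rt[OF lev_0[OF u]] u_def by auto
  qed
  show ?thesis using gen[of i j] gen[of j i] e by (metis linear)
qed

lemma T_cases: "(u, v) \<in> T \<Longrightarrow> u \<in> V - Rt \<and> v = par u \<or> v \<in> V - Rt \<and> u = par v"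
  unfolding T_def by auto

lemma T_par: "v \<in> V \<Longrightarrow> v \<notin> Rt \<Longrightarrow> (v, par v) \<in> T \<and> (par v, v) \<in> T"
  unfolding T_def by auto

lemma T_sym: "(u, v) \<in> T \<Longrightarrow> (v, u) \<in> T" unfolding T_def by auto

lemma T_E: "T \<subseteq> E" using par_E E_sym unfolding T_def by auto

lemma card_T: "card T = 2 * card (V - Rt)"
proof -
  have "(\<lambda>v. (v, par v)) ` (V - Rt) \<inter> (\<lambda>v. (par v, v)) ` (V - Rt) = {}"
  proof (rule ccontr)
    assume "\<not> ?thesis"
    then obtain p where "p \<in> (\<lambda>v. (v, par v)) ` (V - Rt)" "p \<in> (\<lambda>v. (par v, v)) ` (V - Rt)" by blast
    then obtain v w where vw: "v \<in> V - Rt" "w \<in> V - Rt" "(v, par v) = (par w, w)" by (elim imageE) metis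
    have e: "par v = w" "par w = v" using vw(3) by (metis prod.inject)+
    have "lev v = Suc (lev w)" "lev w = Suc (lev v)" using lev_par_Suc[of v] lev_par_Suc[of w] vw(1,2) unfolding e by simp_all
    then show False by linarith
  qed
  moreover have "card ((\<lambda>v. (v, par v)) ` (V - Rt)) = card (V - Rt)" "card ((\<lambda>v. (par v, v)) ` (V - Rt)) = card (V - Rt)"
    by (intro card_image inj_onI; simp)+
  ultimately show ?thesis unfolding T_def using finV by (simp add: card_Un_disjoint)
qed

end

section \<open>Minimal systems have one face in each component\<close>

context flag_state
begin

text \<open>A face without orientation: a facial walk together with its mirror image.\<close>

definition cls :: "'v flag \<Rightarrow> 'v flag set" where "cls x = orb x \<union> R ` orb x"

lemma orb_RR: "x \<in> X \<Longrightarrow> R ` R ` orb x = orb x"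
proof -
  assume x: "x \<in> X"
  have "R (R y) = y" if "y \<in> orb x" for y using R_R[OF X_X0[OF subsetD[OF orb_sub[OF x] that]]] .
  then show ?thesis by (simp add: image_image)
qed

lemma cls_self: "x \<in> X \<Longrightarrow> x \<in> cls x" unfolding cls_def using orb_self[of x] by simp

lemma cls_orb: "orb y = orb x \<Longrightarrow> cls y = cls x" unfolding cls_def by simp

lemma cls_orb_R: "x \<in> X \<Longrightarrow> orb y = R ` orb x \<Longrightarrow> cls y = cls x"
  unfolding cls_def using orb_RR[of x] by (simp only: Un_commute)

lemma cls_F: "x \<in> X \<Longrightarrow> cls (F x) = cls x" by (rule cls_orb[OF orb_F])

lemma cls_R: "x \<in> X \<Longrightarrow> cls (R x) = cls x" by (rule cls_orb_R[OF _ orb_R])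

lemma cls_rho: "x \<in> X \<Longrightarrow> cls (\<rho> x) = cls (opp \<sigma> x)"
  using cls_F[OF opp_in, of x] F_opp[of x] by simp

lemma cls_flip: "x \<in> X \<Longrightarrow> cls (flip x) = cls (opp \<sigma> x)"
  using cls_R[OF opp_in, of x] R_opp[OF X_X0, of x] by simp

lemma cls_mem: "x \<in> X \<Longrightarrow> y \<in> cls x \<Longrightarrow> orb y = orb x \<or> orb y = R ` orb x"
proof -
  assume x: "x \<in> X" and "y \<in> cls x"
  then consider "y \<in> orb x" | w where "w \<in> orb x" "y = R w" unfolding cls_def by (elim UnE imageE)
  then show ?thesis
  proof cases
    case 1 then show ?thesis using orb_eq[OF x] by simp
  next
    case 2 then show ?thesis using orb_R[OF subsetD[OF orb_sub[OF x] 2(1)]] orb_eq[OF x 2(1)] by simp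
  qed
qed

lemma flag_fst: "fst y = fst x \<Longrightarrow> y = x \<or> y = flip x" for x y :: "'v flag"
  unfolding flip_def by (cases y; cases x) auto

end

text \<open>Forest edges are never deleted, so the vertical paths survive; minimality says that no
  other kept edge separates two faces.\<close>

locale minimal_state = flag_state \<sigma> E A \<rho> \<kappa> + bfs_forest V E par lev Rt rt
  for \<sigma> :: "'v \<times> 'v \<Rightarrow> bool" and E A :: "('v \<times> 'v) set" and \<rho> \<kappa> :: "'v flag \<Rightarrow> 'v flag"
    and V :: "'v set" and par :: "'v \<Rightarrow> 'v" and lev :: "'v \<Rightarrow> nat" and Rt :: "'v set" and rt :: "'v \<Rightarrow> 'v" +
  assumes T_A: "T \<subseteq> A"
    and minimal: "z \<in> X \<Longrightarrow> fst z \<notin> T \<Longrightarrow> orb (opp \<sigma> z) = orb z \<or> orb (opp \<sigma> z) = R ` orb z"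
begin

lemma X_iff: "w \<in> X \<longleftrightarrow> (ftail w, fhead w) \<in> A" by (simp add: mem_Times_iff)

lemma ends: "w \<in> X \<Longrightarrow> (ftail w, fhead w) \<in> E" "w \<in> X \<Longrightarrow> ftail w \<in> V" "w \<in> X \<Longrightarrow> fhead w \<in> V"
proof -
  assume "w \<in> X"
  then show 1: "(ftail w, fhead w) \<in> E" using X_iff A_sub by (meson subsetD)
  show "ftail w \<in> V" "fhead w \<in> V" using E_V[OF 1] E_V[OF E_sym[OF 1]] by simp_all
qed

lemma cls_nonT: "z \<in> X \<Longrightarrow> fst z \<notin> T \<Longrightarrow> cls (opp \<sigma> z) = cls z"
  using minimal[of z] cls_orb[of "opp \<sigma> z" z] cls_orb_R[of z "opp \<sigma> z"] by argo

text \<open>Leaves first: going once around the corners of a vertex, every edge but the one to the parent is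
  already known to join corners of one class, so that the parent edge does as well.\<close>

lemma cls_up:
  assumes "v \<in> V" "v \<notin> Rt" "w \<in> X" "fst w = (v, par v)" shows "cls (opp \<sigma> w) = cls w"
  using assms
proof (induction "Max (lev ` V) - lev v" arbitrary: v w rule: less_induct)
  case less
  have le: "lev u \<le> Max (lev ` V)" if "u \<in> V" for u using finV that by simp
  have other: "cls (opp \<sigma> x) = cls x" if x: "x \<in> X" "ftail x = v" "fst x \<noteq> (v, par v)" for x
  proof (cases "fst x \<in> T")
    case False then show ?thesis by (rule cls_nonT[OF x(1)])
  next
    case True
    then have "(v, fhead x) \<in> T" using x(2) by (metis prod.collapse)
    from T_cases[OF this] have c: "fhead x \<in> V" "fhead x \<notin> Rt" "v = par (fhead x)" using x(2,3) by (auto simp: prod_eq_iff)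
    have ox: "opp \<sigma> x \<in> X" "fst (opp \<sigma> x) = (fhead x, par (fhead x))"
      using opp_in[OF x(1)] x(2) c(3) unfolding fst_opp by simp_all
    have "lev (fhead x) = Suc (lev v)" using lev_par_Suc[OF c(1,2)] c(3) by simp
    then have "Max (lev ` V) - lev (fhead x) < Max (lev ` V) - lev v" using le[OF c(1)] by linarith
    from less.hyps[OF this c(1,2) ox] show ?thesis using opp_opp[OF X_X0[OF x(1)]] by simp
  qed
  let ?S = "{x \<in> X. ftail x = v \<and> snd x = snd w}"
  define B where "B = {x \<in> ?S. cls x = cls (\<rho> w)}"
  have tw: "ftail w = v" using less.prems(4) by simp
  have rw: "\<rho> w \<in> B" unfolding B_def using rho_in[OF less.prems(3)] rho_tail[OF less.prems(3)] rho_snd[OF less.prems(3)] tw by simp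
  have "B = ?S"
  proof (rule rho_trans)
    show "B \<noteq> {}" using rw by (metis empty_iff)
    show "B \<subseteq> ?S" unfolding B_def by (rule Collect_restrict)
    show "\<rho> ` B \<subseteq> B"
    proof (rule image_subsetI)
      fix x assume xB: "x \<in> B"
      then have x: "x \<in> X" "ftail x = v" "snd x = snd w" "cls x = cls (\<rho> w)" unfolding B_def by simp_all
      show "\<rho> x \<in> B"
      proof (cases "x = w")
        case True then show ?thesis using rw by simp
      next
        case False
        then have "fst x \<noteq> (v, par v)" using less.prems(4) x(3) prod_eqI[of x w] by argo
        then have "cls (\<rho> x) = cls x" using cls_rho[OF x(1)] other[OF x(1,2)] by simp
        then show ?thesis unfolding B_def using rho_in[OF x(1)] rho_tail[OF x(1)] rho_snd[OF x(1)] x by simp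
      qed
    qed
  qed
  then have "w \<in> B" using less.prems(3) tw by simp
  then have "cls w = cls (\<rho> w)" unfolding B_def by simp
  then show ?case using cls_rho[OF less.prems(3)] by simp
qed

lemma cls_opp: assumes x: "x \<in> X" shows "cls (opp \<sigma> x) = cls x"
proof (cases "fst x \<in> T")
  case False then show ?thesis by (rule cls_nonT[OF x])
next
  case True
  then have "(ftail x, fhead x) \<in> T" by simp
  from T_cases[OF this] show ?thesis
  proof
    assume a: "ftail x \<in> V - Rt \<and> fhead x = par (ftail x)"
    show ?thesis by (rule cls_up[of "ftail x"]) (use a x in \<open>simp_all add: prod_eq_iff\<close>)
  next
    assume a: "fhead x \<in> V - Rt \<and> ftail x = par (fhead x)"
    have "cls (opp \<sigma> (opp \<sigma> x)) = cls (opp \<sigma> x)"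
      by (rule cls_up[of "fhead x"]) (use a opp_in[OF x] in \<open>simp_all add: fst_opp\<close>)
    then show ?thesis using opp_opp[OF X_X0[OF x]] by simp
  qed
qed

text \<open>Consecutive corners at a vertex are separated by one edge, which has the same face on
  both sides by \<open>cls_opp\<close>; \<open>flip\<close> covers the opposite sense.\<close>

lemma cls_tail: assumes x: "x \<in> X" and y: "y \<in> X" and e: "ftail x = ftail y" shows "cls x = cls y"
proof -
  have same: "cls b = cls a" if a: "a \<in> X" and b: "b \<in> X" "ftail a = ftail b" "snd a = snd b" for a b
  proof -
    let ?S = "{w \<in> X. ftail w = ftail a \<and> snd w = snd a}"
    define B where "B = {w \<in> ?S. cls w = cls a}"
    have "B = ?S"
    proof (rule rho_trans)
      have "a \<in> B" unfolding B_def using a by simp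
      then show "B \<noteq> {}" by (metis empty_iff)
      show "B \<subseteq> ?S" unfolding B_def by (rule Collect_restrict)
      show "\<rho> ` B \<subseteq> B"
      proof (rule image_subsetI)
        fix w assume "w \<in> B"
        then have w: "w \<in> X" "ftail w = ftail a" "snd w = snd a" "cls w = cls a" unfolding B_def by simp_all
        have "cls (\<rho> w) = cls w" using cls_rho[OF w(1)] cls_opp[OF w(1)] by simp
        then show "\<rho> w \<in> B" unfolding B_def using rho_in[OF w(1)] rho_tail[OF w(1)] rho_snd[OF w(1)] w by simp
      qed
    qed
    then have "b \<in> B" using b by simp
    then show ?thesis unfolding B_def by simp
  qed
  have f: "cls (flip x) = cls x" using cls_flip[OF x] cls_opp[OF x] by simp
  show ?thesis
  proof (cases "snd x = snd y")
    case True then show ?thesis using same[OF y x] e by simp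
  next
    case False then show ?thesis using same[OF y flip_in[OF x]] e f by simp
  qed
qed

text \<open>Roots of the components that have an edge; isolated vertices carry no flags and are
  counted separately.\<close>

definition NI :: "'v set" where "NI = {r \<in> Rt. \<exists>w\<in>X. ftail w = r}"
definition start :: "'v \<Rightarrow> 'v flag" where "start r = (SOME w. w \<in> X \<and> ftail w = r)"

lemma start: "r \<in> NI \<Longrightarrow> start r \<in> X" "r \<in> NI \<Longrightarrow> ftail (start r) = r"
proof -
  assume "r \<in> NI"
  then have "\<exists>w. w \<in> X \<and> ftail w = r" unfolding NI_def by (simp add: Bex_def)
  from someI_ex[OF this] show "start r \<in> X" "ftail (start r) = r" unfolding start_def by simp_all
qed

text \<open>Climbing to the root along forest edges never changes the class.\<close>

lemma cls_root: "x \<in> X \<Longrightarrow> rt (ftail x) \<in> NI \<and> cls x = cls (start (rt (ftail x)))"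
proof (induction "lev (ftail x)" arbitrary: x)
  case 0
  then have r: "ftail x \<in> Rt" using lev_0[OF ends(2)] by simp
  then have ni: "ftail x \<in> NI" unfolding NI_def using 0 by (intro CollectI conjI bexI[of _ x]) simp_all
  have "cls x = cls (start (ftail x))" by (rule cls_tail) (use start[OF ni] 0 in simp_all)
  then show ?case using ni rt_Rt[OF r] by simp
next
  case (Suc k)
  let ?v = "ftail x"
  have v: "?v \<in> V" "?v \<notin> Rt" using ends(2)[OF Suc.prems] lev_Rt[of ?v] Suc.hyps(2) by auto
  define y :: "'v flag" where "y = ((?v, par ?v), True)"
  have yX: "y \<in> X" unfolding X_iff y_def using T_par[OF v] T_A by auto
  have oy: "opp \<sigma> y \<in> X" "ftail (opp \<sigma> y) = par ?v" using opp_in[OF yX] unfolding y_def by simp_all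
  have "k = lev (ftail (opp \<sigma> y))" using Suc.hyps(2) lev_par_Suc[OF v] oy by simp
  from Suc.hyps(1)[OF this oy(1)] have "rt (par ?v) \<in> NI \<and> cls (opp \<sigma> y) = cls (start (rt (par ?v)))" unfolding oy(2) .
  moreover have "cls x = cls y" by (rule cls_tail[OF Suc.prems yX]) (simp add: y_def)
  ultimately show ?case using rt_par[OF v(1)] cls_opp[OF yX] by simp
qed

lemma orb_root: "x \<in> X \<Longrightarrow> orb x = orb (start (rt (ftail x))) \<or> orb x = R ` orb (start (rt (ftail x)))"
  using cls_root[of x] cls_self[of x] cls_mem[OF start(1), of "rt (ftail x)" x] by simp

lemma finNI: "finite NI"
  by (rule finite_subset[OF _ finV]) (use Rt_V in \<open>auto simp: NI_def\<close>)

lemma card_orbits: "card (orb ` X) \<le> 2 * card NI"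
proof -
  have "orb ` X \<subseteq> (\<lambda>r. orb (start r)) ` NI \<union> (\<lambda>r. R ` orb (start r)) ` NI"
  proof (rule image_subsetI)
    fix x assume x: "x \<in> X"
    show "orb x \<in> (\<lambda>r. orb (start r)) ` NI \<union> (\<lambda>r. R ` orb (start r)) ` NI"
      using orb_root[OF x] cls_root[OF x] by (metis UnI1 UnI2 image_eqI)
  qed
  then have "card (orb ` X) \<le> card ((\<lambda>r. orb (start r)) ` NI \<union> (\<lambda>r. R ` orb (start r)) ` NI)"
    using finNI by (intro card_mono) simp_all
  also have "\<dots> \<le> card ((\<lambda>r. orb (start r)) ` NI) + card ((\<lambda>r. R ` orb (start r)) ` NI)" by (rule card_Un_le)
  also have "\<dots> \<le> card NI + card NI" by (intro add_mono card_image_le finNI)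
  finally show ?thesis by simp
qed

lemma orb_rt: assumes x: "x \<in> X" and y: "y \<in> orb x" shows "rt (ftail y) = rt (ftail x)"
  using y
proof (induction rule: orbit.induct)
  case base
  then show ?case using F_tail[OF x] rt_E[OF ends(1)[OF x]] by simp
next
  case (step y)
  then have yX: "y \<in> X" using orb_sub[OF x] by (meson subsetD)
  show ?case using F_tail[OF yX] rt_E[OF ends(1)[OF yX]] step by simp
qed

text \<open>The vertices outside \<open>Z\<close> are those below which the kept edges form a tree.\<close>

definition Z :: "'v set" where "Z = - V \<union> Rt \<union> {v. \<exists>u\<in>fst ` (A - T). \<exists>n. (par ^^ n) u = v}"

lemma Z_up: "v \<in> Z \<Longrightarrow> par v \<in> Z"
proof -
  assume "v \<in> Z"
  then consider "v \<notin> V" | "v \<in> Rt" | u n where "u \<in> fst ` (A - T)" "(par ^^ n) u = v" unfolding Z_def by blast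
  then show ?thesis
  proof cases
    case 1 then show ?thesis using par_out unfolding Z_def by simp
  next
    case 2 then show ?thesis using par_Rt unfolding Z_def by simp
  next
    case 3
    then have "(par ^^ Suc n) u = par v" by simp
    then show ?thesis using 3(1) unfolding Z_def by blast
  qed
qed

definition desc :: "'v \<Rightarrow> 'v \<Rightarrow> bool" where "desc t u \<longleftrightarrow> (\<exists>n. (par ^^ n) u = t)"

lemma desc_par: "desc t (par u) \<Longrightarrow> desc t u"
  unfolding desc_def by (metis funpow_Suc_right comp_apply)

lemma desc_par_iff: "desc t u \<Longrightarrow> u \<noteq> t \<Longrightarrow> desc t (par u)"
  unfolding desc_def by (metis funpow_Suc_right comp_apply funpow_0 not0_implies_Suc)

text \<open>All ancestors of the ends of a kept non-forest edge are in \<open>Z\<close>, so such an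
  edge has no end below \<open>t\<close>. The only forest edge that leaves the subtree is the one
  from \<open>t\<close> to its parent.\<close>

lemma desc_A:
  assumes t: "t \<notin> Z" and x: "x \<in> X" and d: "desc t (ftail x) \<noteq> desc t (fhead x)"
  shows "fst x = (if desc t (ftail x) then (t, par t) else (par t, t))"
proof -
  have "fst x \<in> T"
  proof (rule ccontr)
    assume n: "fst x \<notin> T"
    then have "(ftail x, fhead x) \<in> A - T" using x X_iff by simp
    moreover from this have "(fhead x, ftail x) \<in> A - T" using A_sym T_sym by blast
    ultimately have "ftail x \<in> fst ` (A - T)" "fhead x \<in> fst ` (A - T)" by (metis fst_conv image_eqI)+
    then show False using d t unfolding Z_def desc_def by blast
  qed
  then have "(ftail x, fhead x) \<in> T" by simp
  from T_cases[OF this] show ?thesis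
  proof
    assume a: "ftail x \<in> V - Rt \<and> fhead x = par (ftail x)"
    then have "desc t (ftail x)" "ftail x = t" using d desc_par[of t "ftail x"] desc_par_iff[of t "ftail x"] by auto
    then show ?thesis using a by (simp add: prod_eq_iff)
  next
    assume a: "fhead x \<in> V - Rt \<and> ftail x = par (fhead x)"
    then have "\<not> desc t (ftail x)" "fhead x = t" using d desc_par[of t "fhead x"] desc_par_iff[of t "fhead x"] by auto
    then show ?thesis using a by (simp add: prod_eq_iff)
  qed
qed

lemma switch: "\<exists>e. a \<le> e \<and> e < b \<and> f e \<noteq> f (Suc e) \<and> f e = f a" if "a \<le> b" "f a \<noteq> f b" for a b :: nat and f :: "nat \<Rightarrow> bool"
  using that
proof (induction b rule: dec_induct)
  case base then show ?case by simp
next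
  case (step n)
  show ?case
  proof (cases "f a = f n")
    case True then show ?thesis using step by (intro exI[of _ n]) auto
  next
    case False then show ?thesis using step by (metis less_SucI)
  qed
qed

text \<open>A facial walk enters the descendants of \<open>t\<close> only along the tree edge into \<open>t\<close>. Entering twice it would use
  both flags of that arc, and then the flag by which it leaves in between is the reversal of one of
  them, although no facial walk contains a flag together with its reversal.\<close>

lemma no_reentry:
  assumes t: "t \<notin> Z" and c: "cyc F P" "set P = orb x" "x \<in> X" and h: "\<not> desc t (ftail (P ! 0))"
    and ijk: "i < j" "j < k" "k < length P" "desc t (ftail (P ! i))" "\<not> desc t (ftail (P ! j))" "desc t (ftail (P ! k))"
  shows False
proof -
  define f where "f n = desc t (ftail (P ! n))" for n
  have PX: "P ! n \<in> X" "P ! n \<in> orb x" if "n < length P" for n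
    using nth_mem[OF that] c(2) orb_sub[OF c(3)] by auto
  have nxt: "ftail (P ! Suc n) = fhead (P ! n)" if "Suc n < length P" for n
  proof -
    have "F (P ! n) = P ! Suc n" using c(1) that unfolding cyc_def by (simp add: successively_conv_nth)
    then show ?thesis using F_tail[OF PX(1)[of n]] that by simp
  qed
  have sw: "fst (P ! e) = (if f e then (t, par t) else (par t, t))" if "Suc e < length P" "f e \<noteq> f (Suc e)" for e
    using desc_A[OF t PX(1)[of e]] nxt[OF that(1)] that unfolding f_def by simp
  obtain e1 where e1: "e1 < i" "f e1 \<noteq> f (Suc e1)" "f e1 = f 0" using switch[of 0 i f] h ijk(4) unfolding f_def by auto
  obtain e2 where e2: "i \<le> e2" "e2 < j" "f e2 \<noteq> f (Suc e2)" "f e2 = f i" using switch[of i j f] ijk unfolding f_def by auto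
  obtain e3 where e3: "j \<le> e3" "e3 < k" "f e3 \<noteq> f (Suc e3)" "f e3 = f j" using switch[of j k f] ijk unfolding f_def by auto
  have f1: "fst (P ! e1) = (par t, t)" using sw[of e1] e1 h ijk unfolding f_def by simp
  have f2: "fst (P ! e2) = (t, par t)" using sw[of e2] e2 ijk unfolding f_def by simp
  have f3: "fst (P ! e3) = (par t, t)" using sw[of e3] e3 ijk unfolding f_def by simp
  have el: "e1 < length P" "e2 < length P" "e3 < length P" using e1 e2 e3 ijk by linarith+
  have ne: "P ! e1 \<noteq> P ! e3" using c(1) el e1 e2 e3 unfolding cyc_def by (simp add: nth_eq_iff_index_eq)
  have e3f: "P ! e3 = flip (P ! e1)" using flag_fst[of "P ! e3" "P ! e1"] f1 f3 ne by auto
  have "fst (P ! e2) = fst (R (P ! e1))" using f1 f2 by (simp add: rv_def fst_opp)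
  from flag_fst[OF this] have "P ! e2 = R (P ! e1) \<or> P ! e2 = R (P ! e3)" unfolding e3f by (simp add: rv_def opp_flip)
  then have "P ! e2 \<in> R ` orb x" using PX(2)[OF el(1)] PX(2)[OF el(3)] by (metis imageI)
  then show False using orb_R_disjoint[OF c(3), THEN equals0D, of "P ! e2"] PX(2)[OF el(2)] by (simp only: Int_iff simp_thms)
qed

lemma filter_segment:
  assumes "\<And>i j k. i < j \<Longrightarrow> j < k \<Longrightarrow> k < length P \<Longrightarrow> d (P ! i) \<Longrightarrow> \<not> d (P ! j) \<Longrightarrow> d (P ! k) \<Longrightarrow> False"
  shows "\<exists>u v w. P = u @ v @ w \<and> set v = {x \<in> set P. d x}"
proof -
  define u Q where "u = takeWhile (Not \<circ> d) P" and "Q = dropWhile (Not \<circ> d) P"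
  define v w where "v = takeWhile d Q" and "w = dropWhile d Q"
  have P: "P = u @ v @ w" unfolding u_def v_def w_def Q_def by simp
  have u: "\<not> d x" if "x \<in> set u" for x using set_takeWhileD[of x "Not \<circ> d" P] that unfolding u_def by simp
  have v: "d x" if "x \<in> set v" for x using set_takeWhileD[of x d Q] that unfolding v_def by simp
  have w: "\<not> d x" if xw: "x \<in> set w" for x
  proof
    assume dx: "d x"
    have wne: "w \<noteq> []" using xw by auto
    have hw: "\<not> d (hd w)" using hd_dropWhile[of d Q] wne unfolding w_def by simp
    have Qne: "Q \<noteq> []" using wne unfolding w_def by auto
    have hQ: "d (hd Q)" using hd_dropWhile[of "Not \<circ> d" P] Qne unfolding Q_def by simp
    have vne: "v \<noteq> []" using Qne hQ unfolding v_def by (cases Q) auto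
    obtain m where m: "m < length w" "w ! m = x" using xw by (auto simp: in_set_conv_nth)
    have "m \<noteq> 0" using m hw dx wne by (metis hd_conv_nth)
    show False
    proof (rule assms[of "length u" "length u + length v" "length u + length v + m"])
      show "length u < length u + length v" using vne by simp
      show "length u + length v < length u + length v + m" using \<open>m \<noteq> 0\<close> by simp
      show "length u + length v + m < length P" using m unfolding P by simp
      show "d (P ! length u)" unfolding P using vne v by (simp add: nth_append)
      show "\<not> d (P ! (length u + length v))" unfolding P using wne hw by (simp add: nth_append hd_conv_nth)
      show "d (P ! (length u + length v + m))" unfolding P using m dx by (simp add: nth_append)
    qed
  qed
  have "set v = {x \<in> set P. d x}" using u v w unfolding P by auto
  then show ?thesis using P by blast
qed

text \<open>From each component with an edge one of the two mirrored facial walks is taken, starting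
  at the root, and these walks are concatenated. One of the two suffices, since a walk and its
  mirror image visit the same vertices.\<close>

lemma contour_list:
  "\<exists>L. distinct L \<and> nc ch L \<and>
    (\<forall>t. t \<notin> Z \<longrightarrow> (\<exists>u v w. L = u @ v @ w \<and> set v = {i \<in> set L. \<exists>n. (par ^^ n) (ftail i) = t})) \<and>
    (\<forall>t. t \<notin> Z \<longrightarrow> t \<in> ftail ` set L) \<and>
    (\<forall>u v. u \<notin> Z \<longrightarrow> v \<notin> Z \<longrightarrow> (u, v) \<in> E \<longrightarrow> par u = v \<or> par v = u \<or>
      (\<exists>i\<in>set L. \<exists>j\<in>set L. ftail i = u \<and> ftail j = v \<and> ch i j))"
proof -
  have "\<forall>r\<in>NI. \<exists>P. cyc F P \<and> set P = orb (start r) \<and> P ! 0 = start r \<and> nc ch P"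
  proof
    fix r assume r: "r \<in> NI"
    obtain P where P: "cyc F P" "set P = orb (start r)" "start r \<in> set P" "nc ch P" using orb_list[OF start(1)[OF r]] by (elim exE conjE)
    obtain a b where ab: "P = a @ start r # b" using P(3) by (meson split_list)
    have "cyc F (start r # b @ a)" using cyc_rotate[of F a "start r # b"] P ab by simp
    moreover have "nc ch (start r # b @ a)" using nc_rotate[of ch a "start r # b"] chord_sym P ab by auto
    moreover have "set (start r # b @ a) = set P" unfolding ab by (simp add: Un_commute)
    ultimately show "\<exists>P. cyc F P \<and> set P = orb (start r) \<and> P ! 0 = start r \<and> nc ch P"
      using P(2) by (intro exI[of _ "start r # b @ a"]) simp
  qed
  from bchoice[OF this] obtain P where
    P0: "\<forall>r\<in>NI. cyc F (P r) \<and> set (P r) = orb (start r) \<and> P r ! 0 = start r \<and> nc ch (P r)"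
    by (elim exE)
  note P = bspec[OF P0]
  have rtP: "rt (ftail x) = r" "x \<in> X" if "r \<in> NI" "x \<in> set (P r)" for x r
  proof -
    have x: "x \<in> orb (start r)" using P[OF that(1)] that(2) by simp
    have r: "r \<in> Rt" using that(1) unfolding NI_def by simp
    show "rt (ftail x) = r" using orb_rt[OF start(1)[OF that(1)] x] start(2)[OF that(1)] rt_Rt[OF r] by simp
    show "x \<in> X" using orb_sub[OF start(1)[OF that(1)]] x by (meson subsetD)
  qed
  obtain rs where rs: "set rs = NI" "distinct rs" using finNI finite_distinct_list by blast
  have ch_rt: "rt (ftail x) = rt (ftail y)" if "ch x y" for x y
  proof -
    from that obtain z where z: "z \<in> (E - A) \<times> UNIV" "x = \<kappa> z" "y = \<kappa> (opp \<sigma> z)" unfolding chord_def by (elim bexE conjE)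
    then have z0: "z \<in> X0" unfolding mem_Times_iff by simp
    have "(ftail z, fhead z) \<in> E" using z0 by (simp add: mem_Times_iff)
    from rt_E[OF this] show ?thesis using kappa_tail[OF z0] kappa_tail[OF opp_in0[OF z0]] z(2,3) by simp
  qed
  have cat: "distinct (concat (map P qs)) \<and> nc ch (concat (map P qs))" if "set qs \<subseteq> NI" "distinct qs" for qs
    using that
  proof (induction qs)
    case Nil
    then show ?case by (simp add: nc_def)
  next
    case (Cons q qs)
    have q: "q \<in> NI" using Cons.prems by simp
    have sep: "rt (ftail y) \<noteq> q" if yy: "y \<in> set (concat (map P qs))" for y
    proof -
      obtain r where r: "r \<in> set qs" "y \<in> set (P r)" using yy by auto
      have "r \<in> NI" using r(1) Cons.prems by auto
      then show ?thesis using rtP(1)[of r y] r Cons.prems by auto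
    qed
    have "set (P q) \<inter> set (concat (map P qs)) = {}"
    proof (rule equals0I, erule IntE)
      fix y assume "y \<in> set (P q)" "y \<in> set (concat (map P qs))"
      then show False using rtP(1)[OF q, of y] sep[of y] by simp
    qed
    moreover have "distinct (P q)" using P[OF q] unfolding cyc_def by simp
    moreover have "nc ch (P q @ concat (map P qs))"
    proof (rule nc_append)
      show "nc ch (P q)" using P[OF q] by simp
      show "nc ch (concat (map P qs))" using Cons by simp
      fix x y assume "x \<in> set (P q)" "y \<in> set (concat (map P qs))"
      then show "\<not> ch x y" using rtP(1)[OF q, of x] sep[of y] ch_rt[of x y] by metis
    qed
    ultimately show ?case using Cons by simp
  qed
  define L where "L = concat (map P rs)"
  have L: "distinct L" "nc ch L" using cat[of rs] rs unfolding L_def by simp_all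
  have PL: "x \<in> set L" if "r \<in> NI" "x \<in> orb (start r)" for r x
    unfolding L_def using that P[OF that(1)] rs(1) by auto
  have LP: "\<exists>r\<in>NI. x \<in> set (P r)" if "x \<in> set L" for x
    using that rs(1) unfolding L_def by auto
  have flag: "\<exists>w\<in>X. fst w = (t, par t)" if "t \<notin> Z" for t
  proof
    have "t \<in> V" "t \<notin> Rt" using that unfolding Z_def by simp_all
    then have "(t, par t) \<in> A" using T_par T_A by (meson subsetD)
    then show "((t, par t), True) \<in> X" by simp
  qed simp
  show ?thesis
  proof (rule exI[of _ L], intro conjI allI impI)
    show "distinct L" "nc ch L" by (fact L)+
  next
    fix t assume t: "t \<notin> Z"
    have tV: "t \<in> V" "t \<notin> Rt" using t unfolding Z_def by simp_all
    obtain w where w: "w \<in> X" "fst w = (t, par t)" using flag[OF t] by (elim bexE)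
    define r where "r = rt t"
    have r: "r \<in> NI" using cls_root[OF w(1)] w(2) unfolding r_def by simp
    then obtain qa qb where q: "rs = qa @ r # qb" using rs(1) by (metis split_list)
    have "\<exists>u v w. P r = u @ v @ w \<and> set v = {x \<in> set (P r). desc t (ftail x)}"
    proof (rule filter_segment)
      fix i j k assume ijk: "i < j" "j < k" "k < length (P r)" "desc t (ftail (P r ! i))" "\<not> desc t (ftail (P r ! j))" "desc t (ftail (P r ! k))"
      have rR: "r \<in> Rt" using r unfolding NI_def by simp
      \<comment> \<open>The walk starts at a root, outside the subtree of \<open>t\<close>, so the
        corners below \<open>t\<close> are not split between its end and its beginning.\<close>
      have "\<not> desc t (ftail (P r ! 0))" using P[OF r] start(2)[OF r] anc_Rt[OF rR] tV rR unfolding desc_def by auto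
      then show False using no_reentry[OF t _ _ start(1)[OF r] _ ijk] P[OF r] by simp
    qed
    then obtain u v w' where uvw: "P r = u @ v @ w'" "set v = {x \<in> set (P r). desc t (ftail x)}" by (elim exE conjE)
    have "x \<in> set (P r)" if x: "x \<in> set L" "desc t (ftail x)" for x
    proof -
      obtain r' where r': "r' \<in> NI" "x \<in> set (P r')" using LP[OF x(1)] by (elim bexE)
      have "rt (ftail x) = rt t" using x(2) anc_rt[OF ends(2)[OF rtP(2)[OF r']]] unfolding desc_def by auto
      then show ?thesis using rtP(1)[OF r'] r'(2) unfolding r_def by simp
    qed
    then have "set v = {i \<in> set L. desc t (ftail i)}" using uvw(2) PL[OF r] P[OF r] by auto
    moreover have "L = (concat (map P qa) @ u) @ v @ (w' @ concat (map P qb))" unfolding L_def q using uvw(1) by simp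
    ultimately show "\<exists>u v w. L = u @ v @ w \<and> set v = {i \<in> set L. \<exists>n. (par ^^ n) (ftail i) = t}" unfolding desc_def by blast
  next
    fix t assume t: "t \<notin> Z"
    obtain w where w: "w \<in> X" "fst w = (t, par t)" using flag[OF t] by (elim bexE)
    have r: "rt t \<in> NI" using cls_root[OF w(1)] w(2) by simp
    from orb_root[OF w(1)] show "t \<in> ftail ` set L"
    proof
      assume "orb w = orb (start (rt (ftail w)))"
      then have "w \<in> set L" using PL[OF r, of w] orb_self[OF w(1)] w(2) by simp
      then show ?thesis using w(2) by (metis fst_conv image_eqI)
    next
      assume o: "orb w = R ` orb (start (rt (ftail w)))"
      \<comment> \<open>If \<open>w\<close> is on the mirror image, the selected walk contains
        \<open>R w\<close>, which arrives at \<open>t\<close>, and its successor starts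
        there.\<close>
      have "orb (R w) = R ` R ` orb (start (rt t))" using orb_R[OF w(1)] o w(2) by simp
      then have "orb (F (R w)) = orb (start (rt t))" using orb_RR[OF start(1)[OF r]] orb_F[OF R_in[OF w(1)]] by simp
      then have "F (R w) \<in> set L" using PL[OF r, of "F (R w)"] orb_self[OF F_in[OF R_in[OF w(1)]]] by simp
      moreover have "ftail (F (R w)) = t" using F_tail[OF R_in[OF w(1)]] R_tail(2)[of w] w(2) by simp
      ultimately show ?thesis by (metis image_eqI)
    qed
  next
    fix u v assume u: "u \<notin> Z" and v: "v \<notin> Z" and uv: "(u, v) \<in> E"
    show "par u = v \<or> par v = u \<or> (\<exists>i\<in>set L. \<exists>j\<in>set L. ftail i = u \<and> ftail j = v \<and> ch i j)"
    proof (cases "(u, v) \<in> A")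
      case True
      have "(u, v) \<in> T"
      proof (rule ccontr)
        assume "(u, v) \<notin> T"
        then have "u \<in> fst ` (A - T)" using True by force
        moreover have "(par ^^ 0) u = u" by simp
        ultimately show False using u unfolding Z_def by blast
      qed
      then show ?thesis using T_cases[of u v] by auto
    next
      case False
      have key: "\<exists>i\<in>set L. \<exists>j\<in>set L. ftail i = u \<and> ftail j = v \<and> ch i j"
        if z: "z \<in> (E - A) \<times> UNIV" "fst z = (u, v)" "orb (\<kappa> z) = orb (start (rt u))" for z
      proof -
        have z0: "z \<in> X0" using z(1) unfolding mem_Times_iff by simp
        have k: "\<kappa> z \<in> X" "\<kappa> (opp \<sigma> z) \<in> X" by (rule kappa_in[OF z0], rule kappa_in[OF opp_in0[OF z0]])
        have t: "ftail (\<kappa> z) = u" "ftail (\<kappa> (opp \<sigma> z)) = v"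
          using kappa_tail[OF z0] kappa_tail[OF opp_in0[OF z0]] z(2) by simp_all
        have r: "rt u \<in> NI" using cls_root[OF k(1)] t by simp
        have "\<kappa> z \<in> set L" using PL[OF r, of "\<kappa> z"] orb_self[OF k(1)] z(3) by simp
        moreover have "\<kappa> (opp \<sigma> z) \<in> set L" using PL[OF r, of "\<kappa> (opp \<sigma> z)"] orb_self[OF k(2)] z(3) kappa_opp[OF z(1)] by simp
        moreover have "ch (\<kappa> z) (\<kappa> (opp \<sigma> z))" unfolding chord_def using z(1) by (intro bexI[of _ z]) simp_all
        ultimately show ?thesis using t by (intro bexI[of _ "\<kappa> z"] bexI[of _ "\<kappa> (opp \<sigma> z)"] conjI)
      qed
      \<comment> \<open>The chord of the deleted edge may lie on the mirror image; then the flipped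
        flag has its chord on the selected walk.\<close>
      define z :: "'v flag" where "z = ((u, v), True)"
      have z: "z \<in> (E - A) \<times> UNIV" "fst z = (u, v)" unfolding z_def using uv False by simp_all
      have fz: "flip z \<in> (E - A) \<times> UNIV" "fst (flip z) = (u, v)" using z by (simp_all add: mem_Times_iff)
      have z0: "z \<in> X0" using z(1) unfolding mem_Times_iff by simp
      have k: "\<kappa> z \<in> X" "ftail (\<kappa> z) = u" using kappa_in[OF z0] kappa_tail[OF z0] z(2) by simp_all
      have r: "rt u \<in> NI" using cls_root[OF k(1)] k(2) by simp
      from orb_root[OF k(1)] show ?thesis
      proof
        assume "orb (\<kappa> z) = orb (start (rt (ftail (\<kappa> z))))"
        then show ?thesis using key[OF z] unfolding k(2) by (simp only: simp_thms)
      next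
        assume "orb (\<kappa> z) = R ` orb (start (rt (ftail (\<kappa> z))))"
        then have "orb (\<kappa> (flip z)) = orb (start (rt u))" using kappa_flip[OF z(1)] orb_RR[OF start(1)[OF r]] unfolding k(2) by simp
        then show ?thesis using key[OF fz] by (simp only: simp_thms)
      qed
    qed
  qed
qed

end

section \<open>Embedding schemes\<close>

lemma bfs_exists:
  fixes E :: "('v \<times> 'v) set"
  assumes fin: "finite V" and EV: "E \<subseteq> V \<times> V" and sym: "sym E"
  shows "\<exists>par lev Rt rt. bfs_forest V E par lev Rt rt \<and> (\<forall>u v. (u, v) \<in> E\<^sup>* \<longrightarrow> rt u = rt v)"
proof -
  \<comment> \<open>\<open>SOME\<close> depends only on the set of reachable vertices, so connected
    vertices get the same representative.\<close>
  define rt where "rt v = (SOME u. (v, u) \<in> E\<^sup>*)" for v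
  define lev where "lev v = (LEAST n. (rt v, v) \<in> E ^^ n)" for v
  define Rt where "Rt = rt ` V"
  define par where "par v = (if v \<in> V - Rt then SOME u. (u, v) \<in> E \<and> lev v = Suc (lev u) else v)" for v
  have symR: "(v, u) \<in> E\<^sup>*" if "(u, v) \<in> E\<^sup>*" for u v using sym_rtrancl[OF sym] that by (meson symD)
  have rt1: "(v, rt v) \<in> E\<^sup>*" for v unfolding rt_def by (rule someI[of _ v]) simp
  have rt2: "rt u = rt v" if "(u, v) \<in> E\<^sup>*" for u v
  proof -
    have "(u, w) \<in> E\<^sup>* \<longleftrightarrow> (v, w) \<in> E\<^sup>*" for w using that symR[OF that] by (meson rtrancl_trans)
    then show ?thesis unfolding rt_def by simp
  qed
  have rtV: "rt v \<in> V" if "v \<in> V" for v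
    using rt1[of v] that by (induction rule: rtrancl_induct) (use EV in auto)
  have rtrt: "rt (rt v) = rt v" for v using rt2[OF rt1[of v]] by simp
  have levE: "(rt v, v) \<in> E ^^ lev v" for v
  proof -
    have "\<exists>n. (rt v, v) \<in> E ^^ n" using symR[OF rt1[of v]] by (rule rtrancl_imp_relpow)
    then show ?thesis unfolding lev_def by (rule LeastI_ex)
  qed
  have lev_le: "lev v \<le> Suc (lev u)" if "(u, v) \<in> E" for u v
  proof -
    have "rt u = rt v" using rt2 that by blast
    then have "(rt v, v) \<in> E ^^ Suc (lev u)" using levE[of u] that by auto
    then show ?thesis unfolding lev_def[of v] by (rule Least_le)
  qed
  have par: "(par v, v) \<in> E \<and> lev v = Suc (lev (par v))" if v: "v \<in> V" "v \<notin> Rt" for v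
  proof -
    have "\<exists>u. (u, v) \<in> E \<and> lev v = Suc (lev u)"
    proof (cases "lev v")
      case 0
      then have "rt v = v" using levE[of v] by simp
      then show ?thesis using v unfolding Rt_def by (metis imageI)
    next
      case (Suc n)
      then obtain u where u: "(rt v, u) \<in> E ^^ n" "(u, v) \<in> E" using levE[of v] by auto
      have "rt u = rt v" using rt2 u(2) by blast
      then have "lev u \<le> n" unfolding lev_def[of u] using u(1) by (intro Least_le) simp
      then show ?thesis using lev_le[OF u(2)] Suc u(2) by (intro exI[of _ u]) simp
    qed
    from someI_ex[OF this] show ?thesis using v unfolding par_def by simp
  qed
  have "bfs_forest V E par lev Rt rt"
  proof
    fix r assume "r \<in> Rt"
    then have r: "rt r = r" unfolding Rt_def using rtrt by auto
    then show "rt r = r" .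
    have "lev r \<le> 0" unfolding lev_def using r by (intro Least_le) simp
    then show "lev r = 0" by simp
  next
    fix v assume "v \<in> V" "v \<notin> Rt"
    from par[OF this] show "(v, par v) \<in> E" "lev v = Suc (lev (par v))" using sym by (auto dest: symD)
  next
    show "rt u = rt v" if "(u, v) \<in> E" for u v using rt2 that by blast
  qed (use fin EV sym rtV lev_le in \<open>auto dest: symD simp: par_def Rt_def\<close>)
  then show ?thesis using rt2 by blast
qed

lemma cyclic_exists:
  assumes "finite S" shows "\<exists>f. f permutes S \<and> (S \<noteq> {} \<longrightarrow> cyclic_on f S)"
proof (cases "S = {}")
  case True
  then show ?thesis by (intro exI[of _ id]) (simp add: permutes_id)
next
  case False
  define n where "n = card S"
  obtain b where b: "bij_betw b {..<n} S" using ex_bij_betw_nat_finite[OF assms] unfolding n_def lessThan_atLeast0 by blast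
  have n: "n > 0" using False assms unfolding n_def by (simp add: card_gt_0_iff)
  define f where "f x = (if x \<in> S then b (Suc (inv_into {..<n} b x) mod n) else x)" for x
  have inv: "inv_into {..<n} b (b i) = i" if "i < n" for i
    using bij_betw_inv_into_left[OF b] that by simp
  have bS: "b i \<in> S" if "i < n" for i using b that unfolding bij_betw_def by auto
  have fb: "f (b i) = b (Suc i mod n)" if "i < n" for i unfolding f_def using inv[OF that] bS[OF that] by simp
  have Sb: "\<exists>i<n. x = b i" if "x \<in> S" for x using b that unfolding bij_betw_def by auto
  have orb: "b i \<in> orbit f (b 0)" if "i < n" for i
  proof -
    have pos: "b i \<in> orbit f (b 0)" if "i < n" "i > 0" for i
      using that
    proof (induction i)
      case (Suc i)
      have e: "f (b i) = b (Suc i)" using fb[of i] Suc by simp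
      show ?case
      proof (cases i)
        case 0 then show ?thesis using e orbit.base[of f "b 0"] by simp
      next
        case (Suc j) then show ?thesis using e orbit.step[of "b i" f "b 0"] Suc.IH Suc.prems by simp
      qed
    qed simp
    show ?thesis
    proof (cases "i = 0")
      case True
      have e: "f (b (n - 1)) = b 0" using fb[of "n - 1"] n by simp
      show ?thesis
      proof (cases "n = 1")
        case 1: True then show ?thesis using e orbit.base[of f "b 0"] True by simp
      next
        case False
        then have "b (n - 1) \<in> orbit f (b 0)" using pos[of "n - 1"] n by simp
        then show ?thesis using e orbit.step[of "b (n - 1)" f "b 0"] True by simp
      qed
    qed (use pos that in simp)
  qed
  have fS: "f x \<in> S" if "x \<in> S" for x
    unfolding f_def using that bS n by simp
  have sub: "orbit f (b 0) \<subseteq> S"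
  proof
    fix x assume "x \<in> orbit f (b 0)"
    then show "x \<in> S" by (induction rule: orbit.induct) (use fS bS n in auto)
  qed
  have cyc: "cyclic_on f S"
  proof (rule cyclic_on_singleI)
    show "b 0 \<in> S" using bS n by simp
    have "S \<subseteq> orbit f (b 0)"
    proof
      fix x assume "x \<in> S"
      then obtain i where "i < n" "x = b i" using Sb by blast
      then show "x \<in> orbit f (b 0)" using orb by simp
    qed
    then show "S = orbit f (b 0)" using sub by blast
  qed
  have "f ` S = S"
  proof
    show "f ` S \<subseteq> S" using fS by auto
    show "S \<subseteq> f ` S"
    proof
      fix x assume "x \<in> S"
      then obtain i where i: "i < n" "x = b i" using Sb by auto
      have "f (b ((i + n - 1) mod n)) = b (Suc ((i + n - 1) mod n) mod n)" using fb n by simp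
      also have "Suc ((i + n - 1) mod n) mod n = i" using i n by (simp add: mod_Suc_eq)
      finally have "x = f (b ((i + n - 1) mod n))" using i by simp
      then show "x \<in> f ` S" using bS n by simp
    qed
  qed
  then have "bij_betw f S S" using assms by (simp add: bij_betw_def eq_card_imp_inj_on)
  then have "f permutes S" by (rule bij_imp_permutes) (simp add: f_def)
  then show ?thesis using cyc by blast
qed

definition rot :: "('v \<times> 'v \<Rightarrow> 'v \<times> 'v) \<Rightarrow> 'v flag \<Rightarrow> 'v flag" where
  "rot \<pi> w = (if snd w then \<pi> (fst w) else inv \<pi> (fst w), snd w)"

lemma face_step_rot: "face_step \<pi> \<sigma> = rot \<pi> \<circ> opp \<sigma>"
proof
  fix x :: "('a \<times> 'a) \<times> bool"
  obtain u v s where x: "x = ((u, v), s)" by (metis surj_pair)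
  show "face_step \<pi> \<sigma> x = (rot \<pi> \<circ> opp \<sigma>) x" unfolding x rot_def by (simp add: Let_def)
qed

section \<open>The flag system of an embedding scheme\<close>

context pair_graph
begin

lemma arcs_sym: "(u, v) \<in> parcs G \<Longrightarrow> (v, u) \<in> parcs G"
  using sym_arcs by (auto simp: symmetric_def dest: symD)

lemma out_arcs_eq: "out_arcs (with_proj G) v = {e \<in> parcs G. fst e = v}"
  unfolding out_arcs_def by simp

text \<open>Ensures that the least value in \<open>euler_genus\<close> is attained by some
  scheme.\<close>

lemma scheme_exists: "\<exists>\<pi> \<sigma>. embedding_scheme G \<pi> \<sigma>"
proof -
  let ?S = "\<lambda>v. out_arcs (with_proj G) v"
  have fin: "finite (?S v)" for v unfolding out_arcs_eq using pair_finite_arcs by simp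
  have "\<forall>v. \<exists>f. f permutes ?S v \<and> (?S v \<noteq> {} \<longrightarrow> cyclic_on f (?S v))" using cyclic_exists[OF fin] by blast
  from choice[OF this] obtain f where f: "\<forall>v. f v permutes ?S v \<and> (?S v \<noteq> {} \<longrightarrow> cyclic_on (f v) (?S v))" by (elim exE)
  define \<pi> where "\<pi> e = f (fst e) e" for e
  have in_S: "e \<in> ?S (fst e)" if "e \<in> parcs G" for e using that unfolding out_arcs_eq by simp
  have step: "f v e \<in> parcs G \<and> fst (f v e) = v" if "e \<in> ?S v" for v e
    using permutes_in_image[of "f v" "?S v" e] f that unfolding out_arcs_eq by auto
  have inj: "inj_on \<pi> (parcs G)"
  proof (rule inj_onI)
    fix x y assume xy: "x \<in> parcs G" "y \<in> parcs G" "\<pi> x = \<pi> y"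
    then have e: "fst x = fst y" using step[OF in_S[of x]] step[OF in_S[of y]] unfolding \<pi>_def by metis
    have "f (fst x) x = f (fst x) y" using xy(3) e unfolding \<pi>_def by simp
    then show "x = y" using permutes_inj[of "f (fst x)"] f by (metis injD)
  qed
  have "\<pi> ` parcs G \<subseteq> parcs G" using step[OF in_S] unfolding \<pi>_def by blast
  from endo_inj_surj[OF pair_finite_arcs this inj] have "bij_betw \<pi> (parcs G) (parcs G)" using inj unfolding bij_betw_def by blast
  then have p: "\<pi> permutes parcs G"
  proof (rule bij_imp_permutes)
    fix x assume "x \<notin> parcs G"
    then have "x \<notin> ?S (fst x)" unfolding out_arcs_eq by simp
    then show "\<pi> x = x" unfolding \<pi>_def using f by (metis permutes_not_in)
  qed
  have "cyclic_on \<pi> (?S v)" if "?S v \<noteq> {}" for v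
  proof -
    have "cyclic_on \<pi> (?S v) = cyclic_on (f v) (?S v)" by (rule cyclic_cong) (auto simp: \<pi>_def out_arcs_eq)
    then show ?thesis using f that by blast
  qed
  then have "embedding_scheme G \<pi> (\<lambda>_. True)" unfolding embedding_scheme_def using p by auto
  then show ?thesis by blast
qed

lemma initial_state:
  assumes s: "embedding_scheme G \<pi> \<sigma>"
  shows "flag_state \<sigma> (parcs G) (parcs G) (rot \<pi>) (\<lambda>w. w)"
proof -
  let ?A = "parcs G" and ?r = "rot \<pi>"
  have p: "\<pi> permutes ?A" and cyc: "\<And>v. v \<in> pverts G \<Longrightarrow> out_arcs (with_proj G) v \<noteq> {} \<Longrightarrow> cyclic_on \<pi> (out_arcs (with_proj G) v)"
    and sg: "\<And>u v. (u, v) \<in> ?A \<Longrightarrow> \<sigma> (v, u) = \<sigma> (u, v)"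
    using s unfolding embedding_scheme_def by auto
  note pinv = permutes_inverses[OF p]
  have iin: "inv \<pi> e \<in> ?A" "\<pi> e \<in> ?A" if "e \<in> ?A" for e
    using permutes_in_image[OF p] permutes_in_image[OF permutes_inv[OF p]] that by auto
  have cycS: "cyclic_on \<pi> {e \<in> ?A. fst e = fst x}" if "x \<in> ?A" for x
  proof -
    have "fst x \<in> pverts G" using arc_fst_in_verts[OF that] .
    then show ?thesis using cyc[of "fst x"] that unfolding out_arcs_eq by blast
  qed
  have tail1: "fst (\<pi> e) = fst e" if "e \<in> ?A" for e
    using cyclic_on_inI[OF cycS[OF that], of e] that by simp
  have tail2: "fst (inv \<pi> e) = fst e" if "e \<in> ?A" for e
    using tail1[OF iin(1)[OF that]] pinv(1)[of e] by simp
  have r_in: "?r w \<in> ?A \<times> UNIV" if "w \<in> ?A \<times> UNIV" for w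
    using that iin unfolding rot_def mem_Times_iff by simp
  have r_inj: "inj_on ?r (?A \<times> UNIV)"
  proof (rule inj_onI)
    fix x y assume xy: "?r x = ?r y"
    then have s: "snd x = snd y" unfolding rot_def by simp
    have "fst x = fst y"
    proof (cases "snd x")
      case True
      then have "\<pi> (fst x) = \<pi> (fst y)" using xy s unfolding rot_def by simp
      then show ?thesis by (rule injD[OF permutes_inj[OF p]])
    next
      case False
      then have "inv \<pi> (fst x) = inv \<pi> (fst y)" using xy s unfolding rot_def by simp
      then show ?thesis by (rule injD[OF permutes_inj[OF permutes_inv[OF p]]])
    qed
    then show "x = y" using s by (rule prod_eqI)
  qed
  have F_inj: "inj_on (?r \<circ> opp \<sigma>) (?A \<times> UNIV)" and F_in: "\<And>x. x \<in> ?A \<times> UNIV \<Longrightarrow> (?r \<circ> opp \<sigma>) x \<in> ?A \<times> UNIV"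
  proof -
    have oin: "opp \<sigma> x \<in> ?A \<times> UNIV" if "x \<in> ?A \<times> UNIV" for x
      using that arcs_sym[of "ftail x" "fhead x"] by (simp add: mem_Times_iff fst_opp)
    then show "\<And>x. x \<in> ?A \<times> UNIV \<Longrightarrow> (?r \<circ> opp \<sigma>) x \<in> ?A \<times> UNIV" using r_in by simp
    have oo: "opp \<sigma> (opp \<sigma> x) = x" if "x \<in> ?A \<times> UNIV" for x
      using that sg by (cases x; cases "fst x") auto
    have "inj_on (opp \<sigma>) (?A \<times> UNIV)" by (rule inj_on_inverseI[of _ "opp \<sigma>"]) (rule oo)
    moreover have "inj_on ?r (opp \<sigma> ` (?A \<times> UNIV))" by (rule inj_on_subset[OF r_inj]) (use oin in blast)
    ultimately show "inj_on (?r \<circ> opp \<sigma>) (?A \<times> UNIV)" by (rule comp_inj_on)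
  qed
  show ?thesis
  proof
    show "finite ?A" by (rule pair_finite_arcs)
    show "u \<noteq> v" if "(u, v) \<in> ?A" for u v using pair_no_loops[OF that] by simp
    show "ftail (?r w) = ftail w" "snd (?r w) = snd w" if "w \<in> ?A \<times> UNIV" for w
      using that tail1 tail2 unfolding rot_def mem_Times_iff by simp_all
    show "?r (flip (?r w)) = flip w" for w unfolding rot_def flip_def using pinv by simp
    show "B = {w \<in> ?A \<times> UNIV. ftail w = v \<and> snd w = s}"
      if B: "B \<noteq> {}" "B \<subseteq> {w \<in> ?A \<times> UNIV. ftail w = v \<and> snd w = s}" "?r ` B \<subseteq> B" for B v s
    proof -
      let ?S = "{e \<in> ?A. fst e = v}"
      have Bm: "fst w \<in> ?S" "snd w = s" if "w \<in> B" for w using B(2) that by (auto simp: mem_Times_iff)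
      have BS: "fst ` B \<subseteq> ?S" using Bm(1) by (rule image_subsetI)
      have mem: "w \<in> B" if wf: "fst w \<in> fst ` B" and ws: "snd w = s" for w
      proof -
        obtain w' where w': "w' \<in> B" "fst w = fst w'" using wf by (elim imageE)
        then have "w = w'" using Bm(2)[OF w'(1)] ws by (intro prod_eqI) simp_all
        then show ?thesis using w'(1) by simp
      qed
      have fin: "finite (fst ` B)" using finite_subset[OF BS] pair_finite_arcs by simp
      have rB: "?r w \<in> B" if "w \<in> B" for w using B(3) that by blast
      have closed: "\<pi> e \<in> fst ` B" if e: "e \<in> fst ` B" for e
      proof (cases s)
        case True
        obtain w where w: "w \<in> B" "e = fst w" using e by (elim imageE)
        have "fst (?r w) = \<pi> e" using w Bm(2)[OF w(1)] True unfolding rot_def by simp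
        then show ?thesis using rB[OF w(1)] by (metis imageI)
      next
        case False
        \<comment> \<open>In the anticlockwise sense \<open>B\<close> is closed under the inverse
          rotation; being finite, it is then closed under \<open>\<pi>\<close> as well.\<close>
        have "inv \<pi> ` fst ` B \<subseteq> fst ` B"
        proof (rule image_subsetI, elim imageE)
          fix e w assume w: "e = fst w" "w \<in> B"
          have "fst (?r w) = inv \<pi> e" using w Bm(2)[OF w(2)] False unfolding rot_def by simp
          then show "inv \<pi> e \<in> fst ` B" using rB[OF w(2)] by (metis imageI)
        qed
        then have "inv \<pi> ` fst ` B = fst ` B"
          using fin permutes_inj[OF permutes_inv[OF p]] by (intro endo_inj_surj) (auto intro: inj_on_subset)
        then obtain e' where "e' \<in> fst ` B" "e = inv \<pi> e'" using e by blast
        then show ?thesis using pinv(1) by simp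
      qed
      obtain b where b: "b \<in> B" using B(1) by blast
      have cS: "cyclic_on \<pi> ?S" using cycS[of "fst b"] Bm(1)[OF b] by simp
      have "?S \<subseteq> fst ` B"
      proof
        fix e assume "e \<in> ?S"
        then have "e \<in> orbit \<pi> (fst b)" using orbit_cyclic_eq3[OF cS Bm(1)[OF b]] by simp
        then show "e \<in> fst ` B" by (induction rule: orbit.induct) (use closed b in auto)
      qed
      then have "w \<in> B" if "w \<in> ?A \<times> UNIV" "ftail w = v" "snd w = s" for w
        using mem[of w] that by (auto simp: mem_Times_iff)
      then show ?thesis using B(2) by (intro subset_antisym) (simp_all add: subset_iff)
    qed
    show "\<exists>P. cyc (?r \<circ> opp \<sigma>) P \<and> x \<in> set P \<and> nc (chord \<sigma> ?A ?A (\<lambda>w. w)) P" if "x \<in> ?A \<times> UNIV" for x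
    proof -
      have "finite (?A \<times> (UNIV :: bool set))" using pair_finite_arcs by simp
      from cyc_exists[OF this F_inj F_in that] obtain P where "cyc (?r \<circ> opp \<sigma>) P" "x \<in> set P" by blast
      moreover have "nc (chord \<sigma> ?A ?A (\<lambda>w. w)) P" unfolding nc_def chord_def by simp
      ultimately show ?thesis by blast
    qed
    show "(v, u) \<in> ?A" if "(u, v) \<in> ?A" for u v by (rule arcs_sym[OF that])
    show "\<sigma> (v, u) = \<sigma> (u, v)" if "(u, v) \<in> ?A" for u v by (rule sg[OF that])
    show "?r w \<in> ?A \<times> UNIV" if "w \<in> ?A \<times> UNIV" for w by (rule r_in[OF that])
    show "inj_on ?r (?A \<times> UNIV)" by (rule r_inj)
  qed simp_all
qed

end

text \<open>Among all systems that keep the forest and satisfy the count, one with the fewest arcs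
  is taken. A non-forest edge between two different faces could still be deleted, by
  \<open>deleted_state\<close> and \<open>orbit_count\<close>.\<close>

lemma minimal_exists:
  fixes \<rho>0 :: "'v flag \<Rightarrow> 'v flag"
  assumes st: "flag_state \<sigma> E E \<rho>0 \<kappa>0" and f: "bfs_forest V E par lev Rt rt"
  shows "\<exists>A \<rho> \<kappa>. minimal_state \<sigma> E A \<rho> \<kappa> V par lev Rt rt \<and>
    card (orbit (\<rho>0 \<circ> opp \<sigma>) ` (E \<times> UNIV)) + card A \<le> card (orbit (\<rho> \<circ> opp \<sigma>) ` (A \<times> UNIV)) + card E"
proof -
  interpret bfs_forest V E par lev Rt rt by (rule f)
  define ok where "ok A \<rho> \<kappa> \<longleftrightarrow> flag_state \<sigma> E A \<rho> \<kappa> \<and> T \<subseteq> A \<and>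
    card (orbit (\<rho>0 \<circ> opp \<sigma>) ` (E \<times> UNIV)) + card A \<le> card (orbit (\<rho> \<circ> opp \<sigma>) ` (A \<times> UNIV)) + card E" for A \<rho> \<kappa>
  have "ok E \<rho>0 \<kappa>0" unfolding ok_def using st T_E by simp
  then have ex: "\<exists>n A \<rho> \<kappa>. ok A \<rho> \<kappa> \<and> card A = n" by blast
  define n where "n = (LEAST n. \<exists>A \<rho> \<kappa>. ok A \<rho> \<kappa> \<and> card A = n)"
  obtain A \<rho> \<kappa> where okA: "ok A \<rho> \<kappa>" "card A = n" using LeastI_ex[OF ex] unfolding n_def by (elim exE conjE)
  have least: "n \<le> card A'" if "ok A' \<rho>' \<kappa>'" for A' \<rho>' \<kappa>'
    unfolding n_def by (rule Least_le, intro exI conjI, rule that, rule refl)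
  have fs: "flag_state \<sigma> E A \<rho> \<kappa>" and TA: "T \<subseteq> A"
    and cnt: "card (orbit (\<rho>0 \<circ> opp \<sigma>) ` (E \<times> UNIV)) + card A \<le> card (orbit (\<rho> \<circ> opp \<sigma>) ` (A \<times> UNIV)) + card E"
    using okA(1) unfolding ok_def by simp_all
  interpret flag_state \<sigma> E A \<rho> \<kappa> by (rule fs)
  have "orb (opp \<sigma> z) = orb z \<or> orb (opp \<sigma> z) = R ` orb z" if z: "z \<in> X" "fst z \<notin> T" for z
  proof (rule ccontr)
    assume n: "\<not> ?thesis"
    interpret D: flag_delete \<sigma> E A \<rho> \<kappa> z
      by unfold_locales (use z n in \<open>simp_all only: de_Morgan_disj simp_thms\<close>)
    have "fst (opp \<sigma> z) \<notin> T" using z(2) T_sym[of "fhead z" "ftail z"] unfolding fst_opp by auto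
    then have "T \<subseteq> D.A'" unfolding D.A'_def using TA z(2) by blast
    then have "ok D.A' D.\<rho>' D.\<kappa>'" unfolding ok_def using D.deleted_state D.orbit_count D.card_A' cnt by simp
    from least[OF this] show False using okA(2) D.card_A' by simp
  qed
  then have "minimal_state \<sigma> E A \<rho> \<kappa> V par lev Rt rt" using TA by unfold_locales
  then show ?thesis using cnt by blast
qed

theorem genus_words:
  assumes G: "pair_graph G" and g: "euler_genus G \<le> g"
  shows "\<exists>par lev Rt rt Q. \<exists>h :: 'a \<Rightarrow> nat list. bfs_forest (pverts G) (parcs G) par lev Rt rt \<and> finite Q \<and> Q \<subseteq> pverts G \<and> card Q \<le> 2 * g + 1 \<and>
    (let Z = - pverts G \<union> Rt \<union> {v. \<exists>u\<in>Q. \<exists>n. (par ^^ n) u = v} in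
     (\<forall>u. u \<notin> Z \<longrightarrow> set (h u) \<subseteq> {0, 1, 2}) \<and>
     (\<forall>u v. u \<notin> Z \<and> v \<notin> Z \<and> (u, v) \<in> parcs G \<longrightarrow> wadj (h u) (h v)) \<and>
     (\<forall>\<omega>. \<exists>x :: nat \<Rightarrow> 'a. \<forall>u. u \<notin> Z \<and> h u = \<omega> \<longrightarrow> (\<exists>j<3. \<exists>n. (par ^^ n) (x j) = u)))"
proof -
  interpret pair_graph G by (rule G)
  have "\<exists>g \<pi> \<sigma>. embedding_scheme G \<pi> \<sigma> \<and> scheme_euler_genus G \<pi> \<sigma> \<le> int g"
  proof -
    obtain \<pi> \<sigma> where "embedding_scheme G \<pi> \<sigma>" using scheme_exists by blast
    then show ?thesis by (intro exI[of _ "nat (scheme_euler_genus G \<pi> \<sigma>)"] exI[of _ \<pi>] exI[of _ \<sigma>]) simp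
  qed
  from LeastI_ex[OF this] obtain \<pi> \<sigma> where s: "embedding_scheme G \<pi> \<sigma>" "scheme_euler_genus G \<pi> \<sigma> \<le> int (euler_genus G)"
    unfolding euler_genus_def by blast
  let ?V = "pverts G" and ?E = "parcs G"
  have EV: "?E \<subseteq> ?V \<times> ?V" 
  proof
    fix e assume "e \<in> ?E"
    then show "e \<in> ?V \<times> ?V" using arc_fst_in_verts[of e] arc_snd_in_verts[of e] by (simp add: mem_Times_iff)
  qed
  have symE: "sym ?E" using arcs_sym by (rule symI)
  from bfs_exists[OF pair_finite_verts EV symE] obtain par lev Rt rt where
    f: "bfs_forest ?V ?E par lev Rt rt" and rts: "\<forall>u v. (u, v) \<in> ?E\<^sup>* \<longrightarrow> rt u = rt v" by (elim exE conjE)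
  from minimal_exists[OF initial_state[OF s(1)] f] obtain A \<rho> \<kappa> where
    m: "minimal_state \<sigma> ?E A \<rho> \<kappa> ?V par lev Rt rt" and
    cnt: "card (orbit (rot \<pi> \<circ> opp \<sigma>) ` (?E \<times> UNIV)) + card A \<le> card (orbit (\<rho> \<circ> opp \<sigma>) ` (A \<times> UNIV)) + card ?E" by (elim exE conjE)
  interpret minimal_state \<sigma> ?E A \<rho> \<kappa> ?V par lev Rt rt by (rule m)
  define Q where "Q = fst ` (A - T)"
  have finA: "finite A" using finite_subset[OF A_sub pair_finite_arcs] .
  have Q: "finite Q" "Q \<subseteq> ?V" unfolding Q_def using finA A_sub EV by auto
  \<comment> \<open>Mutually reachable vertices have the same \<open>rt\<close>, so distinct roots
    are in distinct components.\<close>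
  have roots: "card Rt \<le> card sccs_verts"
  proof -
    have inj: "inj_on scc_of Rt"
    proof (rule inj_onI)
      fix r r' assume r: "r \<in> Rt" "r' \<in> Rt" "scc_of r = scc_of r'"
      have "r' \<in> scc_of r'" using in_scc_of_self[of r'] r(2) Rt_V by auto
      then have "r \<rightarrow>\<^sup>*\<^bsub>with_proj G\<^esub> r'" using r(3) unfolding scc_of_def by auto
      then have "(r, r') \<in> ?E\<^sup>*" unfolding reachable_def by (auto dest: rtrancl_on_rtranclI)
      then have "rt r = rt r'" using rts by blast
      then show "r = r'" using rt_Rt r by simp
    qed
    have "scc_of ` Rt \<subseteq> sccs_verts" using scc_of_in_sccs_verts Rt_V by auto
    then show ?thesis using card_inj_on_le[OF inj _ finite_sccs_verts] by blast
  qed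
  define Iso where "Iso = {v \<in> ?V. out_arcs (with_proj G) v = {}}"
  have finRt: "finite Rt" using finite_subset[OF Rt_V finV] .
  have "NI \<inter> Iso = {}"
  proof (rule equals0I, erule IntE)
    fix r assume "r \<in> NI" "r \<in> Iso"
    then obtain w where w: "w \<in> X" "ftail w = r" unfolding NI_def by blast
    have "(r, fhead w) \<in> ?E" using ends(1)[OF w(1)] w(2) by simp
    then show False using \<open>r \<in> Iso\<close> unfolding Iso_def out_arcs_eq by auto
  qed
  moreover have "NI \<union> Iso \<subseteq> Rt"
    using par_E unfolding NI_def Iso_def out_arcs_eq by (auto simp: prod_eq_iff)
  ultimately have NI: "card NI + card Iso \<le> card Rt"
    using card_mono[OF finRt] card_Un_disjoint[of NI Iso] finite_subset[OF _ finRt] by (metis Un_subset_iff)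
  have RtV: "card Rt \<le> card ?V" using card_mono[OF finV Rt_V] .
  have cT: "card T = 2 * (card ?V - card Rt)" using card_T card_Diff_subset[OF finRt Rt_V] by simp
  have cA: "card A = card T + card (A - T)"
    using card_Diff_subset[of T A] card_mono[OF finA T_A] finite_subset[OF T_A finA] T_A by simp
  define orb0 where "orb0 = card (orbit (rot \<pi> \<circ> opp \<sigma>) ` (?E \<times> UNIV))"
  have "scheme_euler_genus G \<pi> \<sigma> = 2 * int (card sccs_verts) - (int (card ?V) - int (card ?E div 2) + int (orb0 div 2 + card Iso))"
    unfolding scheme_euler_genus_def num_faces_def face_step_rot orb0_def Iso_def ..
  then have "2 * int (card sccs_verts) - (int (card ?V) - int (card ?E div 2) + int (orb0 div 2 + card Iso)) \<le> int g"
    using s(2) g by linarith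
  moreover have "orb0 + card A \<le> 2 * card NI + card ?E" using cnt card_orbits unfolding orb0_def by linarith
  moreover have "2 * (orb0 div 2) \<le> orb0" "card ?E \<le> 2 * (card ?E div 2) + 1" by linarith+
  \<comment> \<open>Euler's formula: a minimal system has at most two orbits for each component with
    an edge, and the forest has \<open>2 * (card ?V - card Rt)\<close> arcs. The additional 1 covers
    the rounding in \<open>card ?E div 2\<close>.\<close>
  ultimately have "card (A - T) \<le> 2 * g + 1" using roots NI RtV cT cA by linarith
  then have cQ: "card Q \<le> 2 * g + 1" unfolding Q_def using card_image_le[of "A - T" fst] finA by simp
  obtain L where L: "distinct L" "nc ch L"
    "\<forall>t. t \<notin> Z \<longrightarrow> (\<exists>u v w. L = u @ v @ w \<and> set v = {i \<in> set L. \<exists>n. (par ^^ n) (ftail i) = t})"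
    "\<forall>t. t \<notin> Z \<longrightarrow> t \<in> ftail ` set L"
    "\<forall>u v. u \<notin> Z \<longrightarrow> v \<notin> Z \<longrightarrow> (u, v) \<in> ?E \<longrightarrow> par u = v \<or> par v = u \<or>
      (\<exists>i\<in>set L. \<exists>j\<in>set L. ftail i = u \<and> ftail j = v \<and> ch i j)"
    using contour_list by (elim exE conjE)
  interpret C: contour par Z "\<lambda>u v. (u, v) \<in> ?E" L ftail ch
  proof
    show "distinct L" "nc ch L" by (fact L)+
    show "\<exists>u v w. L = u @ v @ w \<and> set v = {i \<in> set L. \<exists>n. (par ^^ n) (ftail i) = t}" if "t \<notin> Z" for t
      by (rule L(3)[rule_format, OF that])
    show "t \<in> ftail ` set L" if "t \<notin> Z" for t by (rule L(4)[rule_format, OF that])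
    show "par u = v \<or> par v = u \<or> (\<exists>i\<in>set L. \<exists>j\<in>set L. ftail i = u \<and> ftail j = v \<and> ch i j)"
      if "u \<notin> Z" "v \<notin> Z" "(u, v) \<in> ?E" for u v by (rule L(5)[rule_format, OF that])
    show "(v, u) \<in> ?E" if "(u, v) \<in> ?E" for u v by (rule arcs_sym[OF that])
    show "par v \<in> Z" if "v \<in> Z" for v by (rule Z_up[OF that])
    show "ch y x" if "ch x y" for x y by (rule chord_sym[OF that])
  qed
  from C.contour_words obtain h :: "'a \<Rightarrow> nat list" where h: "(\<forall>u. u \<notin> Z \<longrightarrow> set (h u) \<subseteq> {0, 1, 2}) \<and>
     (\<forall>u v. u \<notin> Z \<and> v \<notin> Z \<and> (u, v) \<in> ?E \<longrightarrow> wadj (h u) (h v)) \<and>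
     (\<forall>\<omega>. \<exists>x::nat \<Rightarrow> 'a. \<forall>u. u \<notin> Z \<and> h u = \<omega> \<longrightarrow> (\<exists>j<3. \<exists>n. (par ^^ n) (x j) = u))" by (elim exE)
  show ?thesis unfolding Let_def
    by (rule exI[of _ par], rule exI[of _ lev], rule exI[of _ Rt], rule exI[of _ rt], rule exI[of _ Q], rule exI[of _ h])
      (rule conjI[OF f conjI[OF Q(1) conjI[OF Q(2) conjI[OF cQ h[unfolded Z_def Q_def[symmetric]]]]]])
qed

section \<open>The colouring\<close>

lemma successively_vwalk_arcs: "set (vwalk_arcs p) \<subseteq> E \<Longrightarrow> successively (\<lambda>u v. (u, v) \<in> E) p"
  by (induction p rule: vwalk_arcs.induct) auto

lemma mod_eq_near:
  fixes a b l :: nat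
  assumes "a mod (l + 1) = b mod (l + 1)" "a \<le> b + l" "b \<le> a + l"
  shows "a = b"
proof -
  have le: "a = b" if e: "a mod (l + 1) = b mod (l + 1)" and ab: "b \<le> a" "a \<le> b + l" for a b :: nat
  proof -
    have "l + 1 dvd a - b" using e ab(1) by (metis mod_eq_dvd_iff_nat)
    then have "l + 1 \<le> a - b" if "0 < a - b" using that by (rule dvd_imp_le)
    then show ?thesis using ab by linarith
  qed
  show ?thesis using le[OF assms(1) _ assms(2)] le[OF assms(1)[symmetric] _ assms(3)] by (metis linear)
qed

lemma mult_add_inj:
  fixes a b m n k :: nat
  assumes "a * k + m = b * k + n" "m < k" "n < k" shows "a = b" "m = n"
proof -
  have "(a * k + m) div k = a" "(b * k + n) div k = b" using assms(2,3) by simp_all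
  then show "a = b" using assms(1) by simp
  then show "m = n" using assms(1) by simp
qed

lemma mult_add_less:
  fixes a b m k :: nat assumes "a < b" "m < k" shows "a * k + m < b * k"
proof -
  have "Suc a * k \<le> b * k" using assms(1) by (intro mult_right_mono) simp_all
  then show ?thesis using assms(2) by simp
qed

context bfs_forest
begin

lemma walk_lev:
  "successively (\<lambda>u v. (u, v) \<in> E) p \<Longrightarrow> p \<noteq> [] \<Longrightarrow>
    lev (last p) \<le> lev (hd p) + (length p - 1) \<and> lev (hd p) \<le> lev (last p) + (length p - 1) \<and> rt (hd p) = rt (last p)"
proof (induction p rule: induct_list012)
  case (3 x y zs)
  then have xy: "(x, y) \<in> E" by simp
  show ?case using 3 lev_E[OF xy] lev_E[OF E_sym[OF xy]] rt_E[OF xy] by auto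
qed auto

lemma anc_start_in: "(par ^^ n) x \<in> V \<Longrightarrow> x \<in> V"
proof (rule ccontr)
  assume a: "(par ^^ n) x \<in> V" "x \<notin> V"
  have "(par ^^ n) x = x" by (induction n) (use par_out[OF a(2)] in auto)
  then show False using a by simp
qed

end

text \<open>Outside \<open>Z\<close> colours are triples of word colour, depth modulo
  \<open>l + 1\<close> and leg in lexicographic order. Above them come one colour for all roots, and
  then pairs of path and depth for the rest of \<open>Z\<close>. Equal colours at distance at most
  \<open>l\<close> mean the same vertical path and the same depth, unless the words differ, and then
  the walk of words contains a larger colour. The roots can share a colour because a path stays in
  one component.\<close>

theorem ranking_bound:
  assumes G: "pair_graph G" and g: "euler_genus G \<le> g" and d: "1 \<le> d1" "1 \<le> d2"
    and q: "card (pverts G) < d1 ^ q1" "d1 \<le> d2 ^ q2"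
    and k: "k = q1 * (l + 2) * (q2 * (l + 2) * (l + 2) + (2 * l + 1) * d2 * 2 + 1) + (2 * l + 1) * d1 * 3 + 1"
  shows "ranking_number l G \<le> k * (l + 1) * 3 + (2 * g + 1) * (l + 1) + 1"
proof -
  let ?V = "pverts G" and ?E = "parcs G"
  obtain par lev Rt rt Q and h :: "'a \<Rightarrow> nat list" where f: "bfs_forest ?V ?E par lev Rt rt"
    and Q: "finite Q" "Q \<subseteq> ?V" "card Q \<le> 2 * g + 1"
    and H: "let Z = - ?V \<union> Rt \<union> {v. \<exists>u\<in>Q. \<exists>n. (par ^^ n) u = v} in
     (\<forall>u. u \<notin> Z \<longrightarrow> set (h u) \<subseteq> {0, 1, 2}) \<and>
     (\<forall>u v. u \<notin> Z \<and> v \<notin> Z \<and> (u, v) \<in> ?E \<longrightarrow> wadj (h u) (h v)) \<and>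
     (\<forall>\<omega>. \<exists>x :: nat \<Rightarrow> 'a. \<forall>u. u \<notin> Z \<and> h u = \<omega> \<longrightarrow> (\<exists>j<3. \<exists>n. (par ^^ n) (x j) = u))"
    using genus_words[OF G g] by (elim exE conjE)
  interpret bfs_forest ?V ?E par lev Rt rt by (rule f)
  define Z where "Z = - ?V \<union> Rt \<union> {v. \<exists>u\<in>Q. \<exists>n. (par ^^ n) u = v}"
  have h3: "set (h u) \<subseteq> {0, 1, 2}" if "u \<notin> Z" for u using H that unfolding Let_def Z_def[symmetric] by blast
  have hadj: "wadj (h u) (h v)" if "u \<notin> Z" "v \<notin> Z" "(u, v) \<in> ?E" for u v
    using H that unfolding Let_def Z_def[symmetric] by blast
  have "\<forall>\<omega>. \<exists>x :: nat \<Rightarrow> 'a. \<forall>u. u \<notin> Z \<and> h u = \<omega> \<longrightarrow> (\<exists>j<3. \<exists>n. (par ^^ n) (x j) = u)"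
    using H unfolding Let_def Z_def[symmetric] by (elim conjE)
  from choice[OF this] obtain x :: "nat list \<Rightarrow> nat \<Rightarrow> 'a"
    where x: "\<forall>\<omega> u. u \<notin> Z \<and> h u = \<omega> \<longrightarrow> (\<exists>j<3. \<exists>n. (par ^^ n) (x \<omega> j) = u)" by (elim exE)
  define leg where "leg u = (SOME j. j < 3 \<and> (\<exists>n. (par ^^ n) (x (h u) j) = u))" for u
  have leg: "leg u < 3" "\<exists>n. (par ^^ n) (x (h u) (leg u)) = u" if u: "u \<notin> Z" for u
  proof -
    have "\<exists>j. j < 3 \<and> (\<exists>n. (par ^^ n) (x (h u) j) = u)" using x u by blast
    from someI_ex[OF this] show "leg u < 3" "\<exists>n. (par ^^ n) (x (h u) (leg u)) = u" unfolding leg_def by simp_all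
  qed
  have ZV: "u \<in> ?V" if "u \<notin> Z" for u using that unfolding Z_def by simp
  define U where "U = h ` (- Z)"
  have UV: "U \<subseteq> h ` ?V" unfolding U_def using ZV by auto
  have finU: "finite U" using finite_subset[OF UV] finV by simp
  have "card U \<le> card ?V" using card_mono[OF _ UV] card_image_le[OF finV, of h] finV by simp
  then have "card U < d1 ^ q1" using q(1) by simp
  moreover have "U \<subseteq> {s. card (set s) \<le> 3}"
  proof
    fix s assume "s \<in> U"
    then have "set s \<subseteq> {0, 1, 2}" unfolding U_def using h3 by auto
    then have "card (set s) \<le> card {0, 1, 2 :: nat}" by (intro card_mono) simp_all
    then show "s \<in> {s. card (set s) \<le> 3}" by simp
  qed
  ultimately have "\<exists>\<phi>. (\<forall>x. \<phi> x < k) \<and> W.ranks l U U \<phi>" unfolding k using words_ranking finU d q(2) by blast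
  then obtain \<phi> where \<phi>: "\<And>s. \<phi> s < k" "W.ranks l U U \<phi>" by blast
  obtain e where e: "bij_betw e Q {0..<card Q}" using ex_bij_betw_finite_nat[OF Q(1)] by blast
  define top where "top v = (SOME q. q \<in> Q \<and> (\<exists>n. (par ^^ n) q = v))" for v
  have top: "top v \<in> Q" "\<exists>n. (par ^^ n) (top v) = v" if v: "v \<in> Z" "v \<in> ?V" "v \<notin> Rt" for v
  proof -
    have "\<exists>q. q \<in> Q \<and> (\<exists>n. (par ^^ n) q = v)" using v unfolding Z_def by blast
    from someI_ex[OF this] show "top v \<in> Q" "\<exists>n. (par ^^ n) (top v) = v" unfolding top_def by simp_all
  qed
  have eQ: "e q < 2 * g + 1" if "q \<in> Q" for q using bij_betw_apply[OF e that] Q(3) by simp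
  define m where "m v = lev v mod (l + 1)" for v
  have m: "m v < l + 1" for v unfolding m_def by simp
  define lo where "lo v = (\<phi> (h v) * (l + 1) + m v) * 3 + leg v" for v
  define hi where "hi v = e (top v) * (l + 1) + m v" for v
  define K where "K = k * (l + 1) * 3"
  \<comment> \<open>The shifts by 1 and 2 make the colours start at 1 and leave \<open>K + 1\<close>
    to the roots.\<close>
  define c where "c v = (if v \<notin> Z then lo v + 1 else if v \<in> ?V - Rt then K + hi v + 2 else K + 1)" for v
  have lo: "lo v < K" if "v \<notin> Z" for v
    unfolding lo_def K_def using mult_add_less[OF mult_add_less[OF \<phi>(1) m] leg(1)[OF that]] .
  have hi: "hi v < (2 * g + 1) * (l + 1)" if "v \<in> Z" "v \<in> ?V" "v \<notin> Rt" for v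
    unfolding hi_def using mult_add_less[OF eQ[OF top(1)[OF that]] m] .
  have cZ: "K < c v" if "v \<in> Z" for v using that unfolding c_def by simp
  have cnZ: "c v = lo v + 1" "c v \<le> K" if "v \<notin> Z" for v using that lo[OF that] unfolding c_def by simp_all
  have bound: "c ` ?V \<subseteq> {1..K + (2 * g + 1) * (l + 1) + 1}"
  proof (rule image_subsetI)
    fix v assume "v \<in> ?V"
    then show "c v \<in> {1..K + (2 * g + 1) * (l + 1) + 1}" using lo[of v] hi[of v] unfolding c_def by auto
  qed
  have "is_ranking l G c"
    unfolding is_ranking_def
  proof (intro allI impI)
    fix p assume p: "vpath p (with_proj G) \<and> 1 \<le> vwalk_length p \<and> vwalk_length p \<le> l"
    then have pV: "set p \<subseteq> ?V" "p \<noteq> []" "distinct p" and suc: "successively (\<lambda>u v. (u, v) \<in> ?E) p"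
      and len: "1 \<le> length p - 1" "length p - 1 \<le> l"
      unfolding vpath_def vwalk_def by (simp_all add: successively_vwalk_arcs)
    define u v where "u = hd p" and "v = last p"
    have uv: "u \<in> set p" "v \<in> set p" "u \<in> ?V" "v \<in> ?V" using pV unfolding u_def v_def by auto
    have ne: "u \<noteq> v"
    proof -
      obtain a b p' where "p = a # b # p'" using len(1) by (cases p; cases "tl p") auto
      then show ?thesis using pV(3) unfolding u_def v_def by auto
    qed
    have lv: "lev v \<le> lev u + l" "lev u \<le> lev v + l" and rtuv: "rt u = rt v"
      using walk_lev[OF suc pV(2)] len unfolding u_def v_def by auto
    \<comment> \<open>On one vertical path the depth determines the vertex, and the depths of the
      ends differ by at most \<open>l\<close>.\<close>
    have same: "u = v" if "(par ^^ i) y = u" "(par ^^ j) y = v" "m u = m v" for i j y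
    proof -
      have "lev u = lev v" using mod_eq_near[of "lev u" l "lev v"] lv that(3) unfolding m_def by simp
      moreover have "y \<in> ?V" using anc_start_in[of i y] that(1) uv(3) by simp
      ultimately show ?thesis using anc_unique[of y i j] that(1,2) by simp
    qed
    have "c u < Max (c ` set p)" if eq: "c u = c v"
    proof (rule ccontr)
      assume "\<not> ?thesis"
      moreover have "c w \<le> Max (c ` set p)" if "w \<in> set p" for w using that by simp
      ultimately have max: "c w \<le> c u" if "w \<in> set p" for w using that by (meson le_less_trans not_le)
      show False
      proof (cases "u \<in> Z")
        case True
        then have vZ: "v \<in> Z" using cZ[of u] cnZ(2)[of v] eq by fastforce
        show False
        proof (cases "u \<in> Rt")
          case True: True
          then have "c u = K + 1" using \<open>u \<in> Z\<close> unfolding c_def by simp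
          then have "v \<in> Rt" using eq vZ uv(4) unfolding c_def by (auto split: if_splits)
          then show False using True rt_Rt rtuv ne by metis
        next
          case False
          then have cu: "c u = K + hi u + 2" using \<open>u \<in> Z\<close> uv(3) unfolding c_def by simp
          then have vR: "v \<notin> Rt" using eq vZ unfolding c_def by (auto split: if_splits)
          then have "c v = K + hi v + 2" using vZ uv(4) unfolding c_def by simp
          then have h: "e (top u) * (l + 1) + m u = e (top v) * (l + 1) + m v" using cu eq unfolding hi_def by simp
          note t = top[OF \<open>u \<in> Z\<close> uv(3) False] top[OF vZ uv(4) vR]
          have "top u = top v"
            using mult_add_inj(1)[OF h m m] e t(1,3) unfolding bij_betw_def by (meson inj_onD)
          then show False using t(2,4) same mult_add_inj(2)[OF h m m] ne by metis
        qed
      next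
        case False
        \<comment> \<open>A vertex of \<open>Z\<close> on the path would have a colour above
          \<open>K\<close> and thus above that of \<open>u\<close>.\<close>
        have nZ: "w \<notin> Z" if "w \<in> set p" for w using max[OF that] cZ[of w] cnZ(2)[OF False] by fastforce
        note vZ = nZ[OF uv(2)]
        have lo_eq: "lo u = lo v" using eq cnZ(1)[OF False] cnZ(1)[OF vZ] by simp
        note d1 = mult_add_inj[OF lo_eq[unfolded lo_def] leg(1)[OF False] leg(1)[OF vZ]]
        note d2 = mult_add_inj[OF d1(1) m m]
        show False
        proof (cases "h u = h v")
          case True
          obtain i where "(par ^^ i) (x (h u) (leg u)) = u" using leg(2)[OF False] by (elim exE)
          moreover obtain j where "(par ^^ j) (x (h u) (leg u)) = v" using leg(2)[OF vZ] True d1(2) by auto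
          ultimately show False using same d2(2) ne by metis
        next
          case hne: False
          have "successively (\<lambda>a b. wadj (h a) (h b)) p"
            using suc by (rule successively_mono) (use nZ hadj in blast)
          then have "W.walk U (map h p)" unfolding W.walk_def using pV(2) nZ
            by (auto simp: successively_map U_def)
          moreover have "length (map h p) \<le> Suc l" using len by simp
          moreover have "hd (map h p) = h u" "last (map h p) = h v" unfolding u_def v_def using pV(2) by (simp_all add: hd_map last_map)
          moreover have "h u \<in> U" "h v \<in> U" unfolding U_def using False vZ by auto
          ultimately obtain s where s: "s \<in> set (map h p)" "\<phi> (h u) < \<phi> s"
            using \<phi>(2) d2(1) hne unfolding W.ranks_def by metis
          then obtain w where w: "w \<in> set p" "s = h w" by auto
          have "\<phi> (h u) * (l + 1) + m u < \<phi> (h w) * (l + 1) + m w"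
            using mult_add_less[OF s(2) m, of u] unfolding w(2) by (rule trans_less_add1)
          from mult_add_less[OF this leg(1)[OF False]] have "lo u < lo w" unfolding lo_def by linarith
          then show False using max[OF w(1)] cnZ(1)[OF False] cnZ(1)[OF nZ[OF w(1)]] by simp
        qed
      qed
    qed
    then show "c (hd p) \<noteq> c (last p) \<or> c (hd p) < Max (c ` set p)" unfolding u_def v_def by blast
  qed
  then show ?thesis unfolding ranking_number_def K_def[symmetric] using bound by (intro Least_le exI[of _ c]) simp
qed

theorem theorem4:
  fixes l :: nat
  assumes "l \<ge> 2"
  shows "\<exists>C::real. C > 0 \<and> (\<exists>N::nat. \<forall>(g::nat) (n::nat) (G :: 'a pair_pre_digraph).
    pair_graph G \<and> card (pverts G) = n \<and> n \<ge> N \<and> euler_genus G \<le> g \<longrightarrow>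
      real (ranking_number l G) \<le> C * (real g + 1) * ln (real n) / iter_log 3 (real n))"
proof -
  obtain C0 where C0: "C0 > 0" and ev: "eventually (\<lambda>n::nat. \<exists>d1 q1 d2 q2. 1 \<le> d1 \<and> 1 \<le> d2 \<and> n < d1 ^ q1 \<and> d1 \<le> d2 ^ q2 \<and>
     real (q1 * (l + 2) * (q2 * (l + 2) * (l + 2) + (2 * l + 1) * d2 * 2 + 1) + (2 * l + 1) * d1 * 3 + 1)
       \<le> C0 * ln n / ln (ln (ln n))) sequentially" using pick_three_letter[of l] by blast
  have "eventually (\<lambda>n::nat. 1 \<le> ln (real n) / ln (ln (ln (real n)))) sequentially" by real_asymp
  from eventually_conj[OF ev this] obtain N where N: "\<And>n. n \<ge> N \<Longrightarrow> (\<exists>d1 q1 d2 q2. 1 \<le> d1 \<and> 1 \<le> d2 \<and> n < d1 ^ q1 \<and> d1 \<le> d2 ^ q2 \<and>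
     real (q1 * (l + 2) * (q2 * (l + 2) * (l + 2) + (2 * l + 1) * d2 * 2 + 1) + (2 * l + 1) * d1 * 3 + 1)
       \<le> C0 * ln n / ln (ln (ln n))) \<and> 1 \<le> ln (real n) / ln (ln (ln (real n)))"
    unfolding eventually_sequentially by blast
  \<comment> \<open>The colours for \<open>Z\<close> number
    \<open>(2 * g + 1) * (l + 1) + 1\<close>, at most \<open>(2 * l + 3) * (g + 1)\<close>; this is
    the second summand, which \<open>1 \<le> r\<close> turns into a multiple of
    \<open>r\<close>.\<close>
  define C where "C = C0 * (l + 1) * 3 + (2 * l + 3)"
  have "C > 0" unfolding C_def using C0 by (simp add: add_nonneg_pos)
  moreover have "real (ranking_number l G) \<le> C * (real g + 1) * ln (real n) / iter_log 3 (real n)"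
    if G: "pair_graph G" "card (pverts G) = n" "n \<ge> N" "euler_genus G \<le> g" for g n and G :: "'a pair_pre_digraph"
  proof -
    define r where "r = ln (real n) / ln (ln (ln (real n)))"
    obtain d1 q1 d2 q2 where d: "1 \<le> d1" "1 \<le> d2" "n < d1 ^ q1" "d1 \<le> d2 ^ q2"
      and kr0: "real (q1 * (l + 2) * (q2 * (l + 2) * (l + 2) + (2 * l + 1) * d2 * 2 + 1) + (2 * l + 1) * d1 * 3 + 1)
       \<le> C0 * ln n / ln (ln (ln n))" and r: "1 \<le> r" using N[OF G(3)] unfolding r_def by (elim exE conjE)
    define k where k: "k = q1 * (l + 2) * (q2 * (l + 2) * (l + 2) + (2 * l + 1) * d2 * 2 + 1) + (2 * l + 1) * d1 * 3 + 1"
    have kr: "real k \<le> C0 * r" using kr0 unfolding k[symmetric] r_def by simp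
    have "ranking_number l G \<le> k * (l + 1) * 3 + (2 * g + 1) * (l + 1) + 1"
      by (rule ranking_bound[OF G(1,4) d(1,2) _ d(4) k]) (use d(3) G(2) in simp)
    also have "\<dots> \<le> k * ((l + 1) * 3) + (2 * l + 3) * (g + 1)" by (simp add: algebra_simps)
    finally have "real (ranking_number l G) \<le> real (k * ((l + 1) * 3) + (2 * l + 3) * (g + 1))" by (rule of_nat_mono)
    also have "\<dots> = real k * real ((l + 1) * 3) + real ((2 * l + 3) * (g + 1))" by simp
    also have "\<dots> \<le> (C0 * r) * real ((l + 1) * 3) * (real g + 1) + real ((2 * l + 3) * (g + 1)) * r"
    proof (rule add_mono)
      have "real k * real ((l + 1) * 3) \<le> (C0 * r) * real ((l + 1) * 3)" using kr by (rule mult_right_mono) simp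
      also have "\<dots> \<le> (C0 * r) * real ((l + 1) * 3) * (real g + 1)"
        using mult_left_mono[of 1 "real g + 1" "(C0 * r) * real ((l + 1) * 3)"] C0 r by simp
      finally show "real k * real ((l + 1) * 3) \<le> (C0 * r) * real ((l + 1) * 3) * (real g + 1)" .
      show "real ((2 * l + 3) * (g + 1)) \<le> real ((2 * l + 3) * (g + 1)) * r" using mult_left_mono[OF r, of "real ((2 * l + 3) * (g + 1))"] by simp
    qed
    also have "\<dots> = C * (real g + 1) * r" unfolding C_def by (simp add: algebra_simps)
    finally show ?thesis unfolding r_def iter_log_def by (simp add: numeral_3_eq_3)
  qed
  ultimately show ?thesis by blast
qed

end
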